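(* Let $P(x,D)=\sum_{|\alpha|\le m}c_\alpha(x)D^\alpha$ be a differential operator with coefficients $c_\alpha\in\mathcal{G}_\infty(\mathbb{R}^n)$. Assume that there exist $a\in\mathbb{R}$, $0\le m'\le m$, $R>0$ and a representative $(P_\varepsilon)_\varepsilon$ of $P$ such that: (i) $|P_\varepsilon|^{(m)}_{\alpha,\beta}=O(\varepsilon^a)$ for all $\alpha,\beta\in\mathbb{N}^n$; (ii) there exists $c>0$ such that $|P_\varepsilon(x,\xi)|\ge c\,\varepsilon^{a}\langle\xi\rangle^{m'}$ for all $x\in\mathbb{R}^n$, $|\xi|\ge R$ and $\varepsilon\in(0,1]$; (iii) for all $\alpha,\beta\in\mathbb{N}^n$ there exists a net $(c_{\alpha,\beta,\varepsilon})_\varepsilon$ with $c_{\alpha,\beta,\varepsilon}=O(1)$ such that $|\partial^\alpha_\xi\partial^\beta_xP_\varepsilon(x,\xi)|\le c_{\alpha,\beta,\varepsilon}|P_\varepsilon(x,\xi)|\langle\xi\rangle^{-|\alpha|}$ for all $x\in\mathbb{R}^n$, $|\xi|\ge R$ and $\varepsilon\in(0,1]$. Then for all $x_0\in\mathbb{R}^n$ there exist a neighborhood $\Omega$ of $x_0$ and a cut-off function $\phi\in\mathcal{C}^\infty_c(\Omega)$, identically $1$ near $x_0$, such that: - for every $f\in\mathcal{G}(\mathbb{R}^n)$ there exists $u\in\mathcal{G}(\Omega)$ with $P(x,D)u=\phi f$ on $\Omega$; and - for every $f\in\mathcal{G}^\infty(\mathbb{R}^n)$ there exists $u\in\mathcal{G}^\infty(\Omega)$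 with $P(x,D)u=\phi f$ on $\Omega$.
   Context: All nets are indexed by $\varepsilon\in(0,1]$ and $O(\cdot)$ refers to $\varepsilon\to0$. For a locally convex space $E$ with seminorms $\{p_i\}$: $\mathcal{M}_E$ is the set of nets $(u_\varepsilon)_\varepsilon\in E^{(0,1]}$ such that for every $i$ there is $N\in\mathbb{N}$ with $p_i(u_\varepsilon)=O(\varepsilon^{-N})$; $\mathcal{N}_E$ is the set of nets with $p_i(u_\varepsilon)=O(\varepsilon^q)$ for all $i$ and all $q\in\mathbb{N}$; $\mathcal{G}_E=\mathcal{M}_E/\mathcal{N}_E$. $\mathcal{G}(\Omega)=\mathcal{G}_{\mathcal{C}^\infty(\Omega)}$ for $\Omega\subseteq\mathbb{R}^n$ open; $\mathcal{G}^\infty(\Omega)$ is the subalgebra of those $u\in\mathcal{G}(\Omega)$ having a representative $(u_\varepsilon)_\varepsilon$ such that for all $K\Subset\Omega$ there is $N\in\mathbb{N}$ such that for all $\alpha\in\mathbb{N}^n$, $\sup_{x\in K}|\partial^\alpha u_\varepsilon(x)|=O(\varepsilon^{-N})$. $\mathcal{G}_\infty(\mathbb{R}^n)=\mathcal{G}_E$ with $E=\bigcap_sW^{s,\infty}(\mathbb{R}^n)$. Operations on generalized functions are defined componentwise on representatives. A representative of $P$ is a net $P_\varepsilon(x,\xi)=\sum_{|\alpha|\le m}c_{\alpha,\varepsilon}(x)\xi^\alpha$ with $(c_{\alpha,\varepsilon})_\varepsilon$ a representative of $c_\alpha$; $D=-i\partial$; $|a|^{(m)}_{\alpha,\beta}=\sup_{(x,\xi)\in\mathbb{R}^{2n}}\langle\xi\rangle^{-m+|\alpha|}|\partial_\xi^\alpha\partial_x^\beta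 a(x,\xi)|$, $\langle\xi\rangle=(1+|\xi|^2)^{1/2}$. *)

theory Defs
  imports
    "HOL-Analysis.Analysis"
    "HOL-Probability.Essential_Supremum"
    "HOL-Library.Landau_Symbols"
begin

type_synonym 'n multi_index = "'n \<Rightarrow> nat"
type_synonym 'n cfun = "real ^ 'n \<Rightarrow> complex"
type_synonym 'v net = "real \<Rightarrow> 'v"

subsection \<open>Partial derivatives and smooth functions\<close>

definition mi_order :: "'n::finite multi_index \<Rightarrow> nat" where
  "mi_order \<alpha> = (\<Sum>i\<in>UNIV. \<alpha> i)"

definition mi_power :: "real ^ 'n::finite \<Rightarrow> 'n multi_index \<Rightarrow> real" where
  "mi_power \<xi> \<alpha> = (\<Prod>i\<in>UNIV. (\<xi> $ i) ^ \<alpha> i)"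

definition partial :: "'n::finite \<Rightarrow> 'n cfun \<Rightarrow> 'n cfun" where
  "partial i f x = frechet_derivative f (at x) (axis i 1)"

text \<open>
  The coordinates carry no canonical order, so the iterated derivative is taken along some
  fixed enumeration of them; on smooth functions the choice is immaterial.
\<close>

definition mpartial :: "'n::finite multi_index \<Rightarrow> 'n cfun \<Rightarrow> 'n cfun" where
  "mpartial \<alpha> f =
     foldr (\<lambda>i. partial i ^^ \<alpha> i) (SOME is. distinct is \<and> set is = UNIV) f"

definition Dop :: "'n::finite multi_index \<Rightarrow> 'n cfun \<Rightarrow> 'n cfun" where
  "Dop \<alpha> f x = (- \<i>) ^ mi_order \<alpha> * mpartial \<alpha> f x"

text \<open>Only used for open sets.\<close>

fun Ck_on :: "nat \<Rightarrow> (real ^ 'n::finite) set \<Rightarrow> 'n cfun \<Rightarrow> bool" where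
  "Ck_on 0 \<Omega> f \<longleftrightarrow> continuous_on \<Omega> f"
| "Ck_on (Suc k) \<Omega> f \<longleftrightarrow> f differentiable_on \<Omega> \<and> (\<forall>i. Ck_on k \<Omega> (partial i f))"

definition smooth_on :: "(real ^ 'n::finite) set \<Rightarrow> 'n cfun set" where
  "smooth_on \<Omega> = {f. \<forall>k. Ck_on k \<Omega> f}"

definition test_functions :: "(real ^ 'n::finite) set \<Rightarrow> 'n cfun set" where
  "test_functions \<Omega> =
     {\<phi> \<in> smooth_on UNIV. compact (closure {x. \<phi> x \<noteq> 0}) \<and> closure {x. \<phi> x \<noteq> 0} \<subseteq> \<Omega>}"

subsection \<open>Sobolev spaces of bounded type\<close>

definition Linf_norm :: "'n::finite cfun \<Rightarrow> ennreal" where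
  "Linf_norm f = esssup lborel (\<lambda>x. ennreal (norm (f x)))"

definition Linf :: "'n::finite cfun set" where
  "Linf = {f \<in> borel_measurable lborel. Linf_norm f < \<infinity>}"

definition is_weak_deriv :: "'n::finite multi_index \<Rightarrow> 'n cfun \<Rightarrow> 'n cfun \<Rightarrow> bool" where
  "is_weak_deriv \<alpha> f g \<longleftrightarrow>
     (\<forall>\<phi>\<in>test_functions UNIV.
        (LINT x|lborel. f x * mpartial \<alpha> \<phi> x) =
        (- 1) ^ mi_order \<alpha> * (LINT x|lborel. g x * \<phi> x))"

definition sobolev_inf :: "nat \<Rightarrow> 'n::finite cfun set" where
  "sobolev_inf s =
     {f \<in> Linf. \<forall>\<alpha>. mi_order \<alpha> \<le> s \<longrightarrow> (\<exists>g\<in>Linf. is_weak_deriv \<alpha> f g)}"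

text \<open>The choice picks a version of the weak derivative, which is unique almost everywhere.\<close>

definition sobolev_inf_norm :: "nat \<Rightarrow> 'n::finite cfun \<Rightarrow> ennreal" where
  "sobolev_inf_norm s f =
     (SUP \<alpha>\<in>{\<alpha>. mi_order \<alpha> \<le> s}. Linf_norm (SOME g. g \<in> Linf \<and> is_weak_deriv \<alpha> f g))"

subsection \<open>Colombeau spaces over a locally convex space\<close>

text \<open>
  Nets are indexed by \<open>(0,1]\<close>; their values at other reals are unconstrained and are
  identified by the quotient.  The same holds for the values outside \<open>\<Omega>\<close> of functions
  representing elements of the space of smooth functions on \<open>\<Omega>\<close>.  Seminorms are valued
  in \<open>[0,\<infinity>]\<close>, so that suprema need no side condition.
\<close>

definition bigO_eps :: "ennreal net \<Rightarrow> real \<Rightarrow> bool" where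
  "bigO_eps p b \<longleftrightarrow> (\<exists>C. \<forall>\<^sub>F \<epsilon> in at_right 0. p \<epsilon> \<le> ennreal (C * \<epsilon> powr b))"

definition moderate_nets :: "'v set \<Rightarrow> ('v \<Rightarrow> ennreal) set \<Rightarrow> 'v net set" where
  "moderate_nets E S =
     {u. (\<forall>\<epsilon>\<in>{0<..1}. u \<epsilon> \<in> E) \<and> (\<forall>p\<in>S. \<exists>N::nat. bigO_eps (\<lambda>\<epsilon>. p (u \<epsilon>)) (- real N))}"

definition negligible_nets :: "'v set \<Rightarrow> ('v \<Rightarrow> ennreal) set \<Rightarrow> 'v net set" where
  "negligible_nets E S =
     {u. (\<forall>\<epsilon>\<in>{0<..1}. u \<epsilon> \<in> E) \<and> (\<forall>p\<in>S. \<forall>q::nat. bigO_eps (\<lambda>\<epsilon>. p (u \<epsilon>)) (real q))}"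

definition colombeau_rel ::
    "'v::minus set \<Rightarrow> ('v \<Rightarrow> ennreal) set \<Rightarrow> ('v net \<times> 'v net) set" where
  "colombeau_rel E S =
     {(u, v). u \<in> moderate_nets E S \<and> v \<in> moderate_nets E S \<and> (\<lambda>\<epsilon>. u \<epsilon> - v \<epsilon>) \<in> negligible_nets E S}"

definition colombeau :: "'v::minus set \<Rightarrow> ('v \<Rightarrow> ennreal) set \<Rightarrow> 'v net set set" where
  "colombeau E S = moderate_nets E S // colombeau_rel E S"

definition smooth_seminorm ::
    "(real ^ 'n::finite) set \<Rightarrow> 'n multi_index \<Rightarrow> 'n cfun \<Rightarrow> ennreal" where
  "smooth_seminorm K \<alpha> f = (SUP x\<in>K. ennreal (norm (mpartial \<alpha> f x)))"

definition smooth_seminorms :: "(real ^ 'n::finite) set \<Rightarrow> ('n cfun \<Rightarrow> ennreal) set" where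
  "smooth_seminorms \<Omega> = {smooth_seminorm K \<alpha> | K \<alpha>. compact K \<and> K \<subseteq> \<Omega>}"

definition G :: "(real ^ 'n::finite) set \<Rightarrow> 'n cfun net set set" where
  "G \<Omega> = colombeau (smooth_on \<Omega>) (smooth_seminorms \<Omega>)"

definition G_class :: "(real ^ 'n::finite) set \<Rightarrow> 'n cfun net \<Rightarrow> 'n cfun net set" where
  "G_class \<Omega> u = colombeau_rel (smooth_on \<Omega>) (smooth_seminorms \<Omega>) `` {u}"

definition G_regular :: "(real ^ 'n::finite) set \<Rightarrow> 'n cfun net set set" where
  "G_regular \<Omega> =
     {U \<in> G \<Omega>. \<exists>u\<in>U. \<forall>K. compact K \<and> K \<subseteq> \<Omega> \<longrightarrow>
        (\<exists>N::nat. \<forall>\<alpha>. bigO_eps (\<lambda>\<epsilon>. smooth_seminorm K \<alpha> (u \<epsilon>)) (- real N))}"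

text \<open>
  By Sobolev embedding, every element of the intersection of all \<open>W\<^bsup>s,\<infinity>\<^esup>\<close>
  has exactly one smooth version, by which it is represented here.
\<close>

definition sobolev_inf_all :: "'n::finite cfun set" where
  "sobolev_inf_all = smooth_on UNIV \<inter> (\<Inter>s. sobolev_inf s)"

definition G_inf :: "'n::finite cfun net set set" where
  "G_inf = colombeau sobolev_inf_all (range sobolev_inf_norm)"

subsection \<open>Operations on generalized functions\<close>

text \<open>
  Operations act on representatives.  The results for all choices of representatives are
  collected, which is a single class since the operations are well defined.
\<close>

definition G_mult_smooth ::
    "(real ^ 'n::finite) set \<Rightarrow> 'n cfun \<Rightarrow> 'n cfun net set \<Rightarrow> 'n cfun net set" where
  "G_mult_smooth \<Omega> \<phi> F = (\<Union>f\<in>F. G_class \<Omega> (\<lambda>\<epsilon> x. \<phi> x * f \<epsilon> x))"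

definition coeff_representatives ::
    "nat \<Rightarrow> ('n::finite multi_index \<Rightarrow> 'n cfun net set) \<Rightarrow> ('n multi_index \<Rightarrow> 'n cfun net) set" where
  "coeff_representatives m c = {r. \<forall>\<alpha>. mi_order \<alpha> \<le> m \<longrightarrow> r \<alpha> \<in> c \<alpha>}"

definition G_diff_op ::
    "(real ^ 'n::finite) set \<Rightarrow> nat \<Rightarrow> ('n multi_index \<Rightarrow> 'n cfun net set) \<Rightarrow>
     'n cfun net set \<Rightarrow> 'n cfun net set" where
  "G_diff_op \<Omega> m c U =
     (\<Union>r\<in>coeff_representatives m c. \<Union>u\<in>U.
        G_class \<Omega> (\<lambda>\<epsilon> x. \<Sum>\<alpha> | mi_order \<alpha> \<le> m. r \<alpha> \<epsilon> x * Dop \<alpha> (u \<epsilon>) x))"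

subsection \<open>Symbols\<close>

type_synonym 'n symbol = "real ^ 'n \<Rightarrow> real ^ 'n \<Rightarrow> complex"

definition japanese_bracket :: "real ^ 'n::finite \<Rightarrow> real" where
  "japanese_bracket \<xi> = sqrt (1 + (norm \<xi>)\<^sup>2)"

definition symbol_deriv ::
    "'n::finite multi_index \<Rightarrow> 'n multi_index \<Rightarrow> 'n symbol \<Rightarrow> 'n symbol" where
  "symbol_deriv \<alpha> \<beta> p x \<xi> = mpartial \<alpha> (\<lambda>\<eta>. mpartial \<beta> (\<lambda>y. p y \<eta>) x) \<xi>"

definition symbol_seminorm ::
    "real \<Rightarrow> 'n::finite multi_index \<Rightarrow> 'n multi_index \<Rightarrow> 'n symbol \<Rightarrow> ennreal" where
  "symbol_seminorm m \<alpha> \<beta> p =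
     (SUP (x, \<xi>)\<in>UNIV.
        ennreal (japanese_bracket \<xi> powr (- m + real (mi_order \<alpha>)) * norm (symbol_deriv \<alpha> \<beta> p x \<xi>)))"

definition symbol_representative ::
    "nat \<Rightarrow> ('n::finite multi_index \<Rightarrow> 'n cfun net set) \<Rightarrow> 'n symbol net \<Rightarrow> bool" where
  "symbol_representative m c P \<longleftrightarrow>
     (\<exists>r\<in>coeff_representatives m c. \<forall>\<epsilon>\<in>{0<..1}. \<forall>x \<xi>.
        P \<epsilon> x \<xi> = (\<Sum>\<alpha> | mi_order \<alpha> \<le> m. r \<alpha> \<epsilon> x * of_real (mi_power \<xi> \<alpha>)))"

end

theory Submission
  imports Defs "HOL-Computational_Algebra.Polynomial"
begin

text \<open>
  Fix \<open>x\<^sub>0\<close> and a large \<open>L\<close>, and let \<open>\<xi>\<^sub>k = L (k + 1/2)\<close> for \<open>k \<in> \<int>\<^sup>n\<close>, so that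
  \<open>|\<xi>\<^sub>k| \<ge> L/2\<close> for all \<open>k\<close>, and \<open>e\<^sub>k(x) = exp (i \<xi>\<^sub>k \<cdot> (x - x\<^sub>0))\<close>.  By the Leibniz rule
  \<open>P\<^sub>\<epsilon>(x,D)(e\<^sub>k / P\<^sub>\<epsilon>(\<cdot>,\<xi>\<^sub>k)) = e\<^sub>k (1 + \<rho>\<^sub>k)\<close>, where (iii) bounds each \<open>x\<close>-derivative of \<open>\<rho>\<^sub>k\<close> by
  \<open>O(1) / |\<xi>\<^sub>k|\<close>; thus no pseudodifferential calculus is needed.  After a cut-off
  at scale \<open>1/L\<close> the functions \<open>\<rho>\<^sub>k\<close> and \<open>\<phi> f\<^sub>\<epsilon>\<close> have Fourier series, and
  \<open>u\<^sub>\<epsilon> = \<Sum> c\<^sub>k e\<^sub>k / P\<^sub>\<epsilon>(\<cdot>,\<xi>\<^sub>k)\<close> solves the equation near \<open>x\<^sub>0\<close> as soon as the coefficients solve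
  \<open>c + M c = b\<close>, where \<open>b\<close> are the Fourier coefficients of \<open>\<phi> f\<^sub>\<epsilon>\<close> and \<open>M\<close> has norm \<open>O(1/L)\<close> uniformly
  in \<open>\<epsilon>\<close>.  Moreover \<open>M\<close> gains one power of the frequency, so the decay of \<open>b\<close> is inherited by \<open>c\<close>
  with constants \<open>O(1)\<close>.  By (ii) the derivatives of \<open>u\<^sub>\<epsilon>\<close> are then bounded by \<open>O(\<epsilon>\<^sup>-\<^sup>a)\<close> times finitely many
  derivatives of \<open>f\<^sub>\<epsilon>\<close>, which gives both moderateness and regularity.
\<close>

subsection \<open>Calculus of iterated partial derivatives\<close>

text \<open>The obstacle is uniformity: \<Omega> and \<phi> must not depend on \<epsilon>, while P
  may degenerate like a power of \<epsilon>. Condition (iii) measures derivatives of P relative to P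
  itself. In \<rho> the factor P from the \<xi>-derivative therefore cancels against 1/P, and only
  O(1) constants remain. Hence one L makes the Neumann series for 1 + M converge for all small
  \<epsilon>; for the other \<epsilon> the solution is set to 0, which the classes do not see. The
  half-integer shift removes the low frequencies, so 1/P exists at every lattice point and no
  finite-dimensional exceptional space has to be treated. Smallness is used only once, in the sup
  norm; faster decay of c follows by bootstrapping, so L does not depend on the number of
  derivatives. The loss \<open>\<epsilon> powr (- a)\<close> enters once, through 1/P, and not once
  per derivative: this is what preserves regularity. All constants are explicit expressions in the
  bounds of (iii), so their boundedness as \<epsilon> tends to 0 can be read off from sums and
  products.\<close>

lemma partial_eq:
  assumes "(f has_derivative f') (at x)"
  shows "partial i f x = f' (axis i 1)"
  using frechet_derivative_at[OF assms] by (simp add: partial_def)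

lemma has_derivative_partial:
  fixes f :: "'n::finite cfun"
  assumes "f differentiable (at x)"
  shows "(f has_derivative (\<lambda>h. \<Sum>i\<in>UNIV. h $ i *\<^sub>R partial i f x)) (at x)"
proof -
  obtain f' where f': "(f has_derivative f') (at x)"
    using assms by (auto simp: differentiable_def)
  then interpret bounded_linear f' by (rule has_derivative_bounded_linear)
  have "f' h = (\<Sum>i\<in>UNIV. h $ i *\<^sub>R partial i f x)" for h
  proof -
    have "f' h = f' (\<Sum>i\<in>UNIV. h $ i *\<^sub>R axis i 1)"
      by (simp only: basis_expansion scalar_mult_eq_scaleR[symmetric])
    also have "\<dots> = (\<Sum>i\<in>UNIV. h $ i *\<^sub>R f' (axis i 1))"
      by (simp add: sum scaleR)
    finally show ?thesis by (simp add: partial_eq[OF f'])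
  qed
  then have "f' = (\<lambda>h. \<Sum>i\<in>UNIV. h $ i *\<^sub>R partial i f x)" by (rule ext)
  then show ?thesis using f' by simp
qed

lemma has_vector_derivative_along_axis:
  fixes f :: "'n::finite cfun"
  assumes "f differentiable (at (x + s *\<^sub>R axis i 1))"
  shows "((\<lambda>s. f (x + s *\<^sub>R axis i 1)) has_vector_derivative partial i f (x + s *\<^sub>R axis i 1)) (at s within S)"
proof -
  obtain f' where f': "(f has_derivative f') (at (x + s *\<^sub>R axis i 1))"
    using assms by (auto simp: differentiable_def)
  interpret bounded_linear f' using f' by (rule has_derivative_bounded_linear)
  have "((\<lambda>s. f (x + s *\<^sub>R axis i 1)) has_derivative (\<lambda>h. f' (h *\<^sub>R axis i 1))) (at s)"
    by (rule has_derivative_compose[where g = f and g' = f' and f = "\<lambda>s. x + s *\<^sub>R axis i 1", OF _ f'])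
      (auto intro!: derivative_eq_intros)
  then have "((\<lambda>s. f (x + s *\<^sub>R axis i 1)) has_vector_derivative partial i f (x + s *\<^sub>R axis i 1)) (at s)"
    by (simp add: has_vector_derivative_def partial_eq[OF f'] scaleR)
  then show ?thesis by (rule has_vector_derivative_at_within)
qed

text \<open>\<open>frechet_derivative\<close> is a choice among the derivatives at \<open>x\<close>,
  and functions that agree near \<open>x\<close> have the same derivatives there. This makes every
  notion below insensitive to values outside \<Omega>.\<close>

lemma partial_cong:
  assumes "open \<Omega>" "x \<in> \<Omega>" "\<And>y. y \<in> \<Omega> \<Longrightarrow> f y = g y"
  shows "partial i f x = partial i g x"
proof -
  have "(f has_derivative F) (at x) \<longleftrightarrow> (g has_derivative F) (at x)" for F
    using assms has_derivative_transform_within_open[of f F x UNIV \<Omega> g]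
      has_derivative_transform_within_open[of g F x UNIV \<Omega> f] by auto
  then show ?thesis by (simp add: partial_def frechet_derivative_def)
qed

lemma differentiable_cong_open:
  assumes "open \<Omega>" "\<And>y. y \<in> \<Omega> \<Longrightarrow> f y = g y" "f differentiable_on \<Omega>"
  shows "g differentiable_on \<Omega>"
  using assms unfolding differentiable_on_def differentiable_def
  by (metis has_derivative_transform)

lemma Ck_on_cong:
  assumes "open \<Omega>" "\<And>y. y \<in> \<Omega> \<Longrightarrow> f y = g y" "Ck_on k \<Omega> f"
  shows "Ck_on k \<Omega> g"
  using assms
proof (induction k arbitrary: f g)
  case 0
  then show ?case by (simp cong: continuous_on_cong)
next
  case (Suc k)
  have "Ck_on k \<Omega> (partial i g)" for i
    by (rule Suc.IH[of "partial i f"]) (use Suc.prems partial_cong[of \<Omega> _ f g i] in auto)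
  then show ?case using Suc.prems differentiable_cong_open[of \<Omega> f g] by auto
qed

lemma Ck_on_Suc: "Ck_on (Suc k) \<Omega> f \<Longrightarrow> Ck_on k \<Omega> f"
proof (induction k arbitrary: f)
  case 0
  then show ?case by (simp add: differentiable_imp_continuous_on)
next
  case (Suc k)
  then show ?case by (metis Ck_on.simps(2))
qed

lemma Ck_on_subset: "Ck_on k \<Omega> f \<Longrightarrow> \<Omega>' \<subseteq> \<Omega> \<Longrightarrow> Ck_on k \<Omega>' f"
  by (induction k arbitrary: f) (auto intro: continuous_on_subset differentiable_on_subset)

lemma smooth_on_subset: "f \<in> smooth_on \<Omega> \<Longrightarrow> \<Omega>' \<subseteq> \<Omega> \<Longrightarrow> f \<in> smooth_on \<Omega>'"
  by (auto simp: smooth_on_def intro: Ck_on_subset)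

lemma smooth_on_differentiable_on: "f \<in> smooth_on \<Omega> \<Longrightarrow> f differentiable_on \<Omega>"
  unfolding smooth_on_def using Ck_on.simps(2) by blast

lemma smooth_on_differentiable: "f \<in> smooth_on \<Omega> \<Longrightarrow> open \<Omega> \<Longrightarrow> x \<in> \<Omega> \<Longrightarrow> f differentiable (at x)"
  using smooth_on_differentiable_on[of f \<Omega>] differentiable_on_eq_differentiable_at by blast

lemma smooth_on_continuous_on: "f \<in> smooth_on \<Omega> \<Longrightarrow> continuous_on \<Omega> f"
  unfolding smooth_on_def using Ck_on.simps(1) by blast

lemma smooth_on_partial: "f \<in> smooth_on \<Omega> \<Longrightarrow> partial i f \<in> smooth_on \<Omega>"
  unfolding smooth_on_def using Ck_on.simps(2) by blast

text \<open>A class of differentiable functions that is closed under partial derivatives, up to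
  equality on \<Omega>, consists of smooth functions. Affine substitutions, Fourier projections and
  infinite sums are treated by exhibiting such a class.\<close>

lemma smooth_on_coinduct:
  assumes "open \<Omega>" "f \<in> X"
    and "\<And>f. f \<in> X \<Longrightarrow> f differentiable_on \<Omega>"
    and "\<And>f i. f \<in> X \<Longrightarrow> \<exists>g\<in>X. \<forall>x\<in>\<Omega>. partial i f x = g x"
  shows "f \<in> smooth_on \<Omega>"
proof -
  have "Ck_on k \<Omega> f" if "f \<in> X" for k f
    using that
  proof (induction k arbitrary: f)
    case 0
    then show ?case by (simp add: assms(3) differentiable_imp_continuous_on)
  next
    case (Suc k)
    have "Ck_on k \<Omega> (partial i f)" for i
    proof -
      obtain g where "g \<in> X" "\<forall>x\<in>\<Omega>. partial i f x = g x" using assms(4) Suc.prems by blast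
      then show ?thesis using Suc.IH[of g] Ck_on_cong[OF assms(1), of g "partial i f"] by simp
    qed
    then show ?case using assms(3) Suc.prems by simp
  qed
  then show ?thesis using assms(2) by (simp add: smooth_on_def)
qed

section \<open>Rules for partial derivatives and closure properties of smooth functions\<close>

lemma partial_const [simp]: "partial i (\<lambda>_. c) = (\<lambda>_. 0)"
  by (rule ext, subst partial_eq[of _ "\<lambda>_. 0"]) auto

lemma partial_add:
  assumes "f differentiable (at x)" "g differentiable (at x)"
  shows "partial i (\<lambda>x. f x + g x) x = partial i f x + partial i g x"
  using assms unfolding differentiable_def
  by (auto intro!: partial_eq[THEN trans] derivative_eq_intros simp: partial_eq)

lemma partial_mult:
  assumes "f differentiable (at x)" "g differentiable (at x)"
  shows "partial i (\<lambda>x. f x * g x) x = partial i f x * g x + f x * partial i g x"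
  using assms unfolding differentiable_def
  by (auto intro!: partial_eq[THEN trans] derivative_eq_intros simp: partial_eq)

lemma partial_cmult:
  assumes "f differentiable (at x)"
  shows "partial i (\<lambda>x. c * f x) x = c * partial i f x"
  using partial_mult[of "\<lambda>_. c" x f i] assms by simp

lemma partial_inverse:
  assumes "f differentiable (at x)" "f x \<noteq> 0"
  shows "partial i (\<lambda>x. inverse (f x)) x = - (partial i f x * (inverse (f x) * inverse (f x)))"
proof -
  obtain f' where f': "(f has_derivative f') (at x)" using assms by (auto simp: differentiable_def)
  have "((\<lambda>x. inverse (f x)) has_derivative (\<lambda>h. - (inverse (f x) * f' h * inverse (f x)))) (at x)"
    by (rule Deriv.has_derivative_inverse[OF assms(2) f'])
  from partial_eq[OF this] show ?thesis by (simp add: partial_eq[OF f'] mult_ac)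
qed

lemma smooth_on_const [simp, intro]: "(\<lambda>_. c) \<in> smooth_on \<Omega>"
proof -
  have "Ck_on k \<Omega> (\<lambda>_. c)" for k by (induction k arbitrary: c) auto
  then show ?thesis by (simp add: smooth_on_def)
qed

lemma Ck_on_add:
  assumes "open \<Omega>" "Ck_on k \<Omega> f" "Ck_on k \<Omega> g"
  shows "Ck_on k \<Omega> (\<lambda>x. f x + g x)"
  using assms(2,3)
proof (induction k arbitrary: f g)
  case 0 then show ?case by (auto intro: continuous_intros)
next
  case (Suc k)
  have d: "f differentiable (at x)" "g differentiable (at x)" if "x \<in> \<Omega>" for x
    using Suc.prems that assms(1) by (auto simp: differentiable_on_eq_differentiable_at)
  have "Ck_on k \<Omega> (partial i (\<lambda>x. f x + g x))" for i
    by (rule Ck_on_cong[of _ "\<lambda>x. partial i f x + partial i g x"])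
      (use Suc assms(1) d in \<open>auto simp: partial_add\<close>)
  then show ?case using Suc.prems by (auto intro: differentiable_on_add)
qed

lemma Ck_on_mult:
  assumes "open \<Omega>" "Ck_on k \<Omega> f" "Ck_on k \<Omega> g"
  shows "Ck_on k \<Omega> (\<lambda>x. f x * g x)"
  using assms(2,3)
proof (induction k arbitrary: f g)
  case 0 then show ?case by (auto intro: continuous_intros)
next
  case (Suc k)
  have d: "f differentiable (at x)" "g differentiable (at x)" if "x \<in> \<Omega>" for x
    using Suc.prems that assms(1) by (auto simp: differentiable_on_eq_differentiable_at)
  have "Ck_on k \<Omega> (\<lambda>x. partial i f x * g x + f x * partial i g x)" for i
    using Suc.prems(1)[THEN Ck_on_Suc] Suc.prems(2)[THEN Ck_on_Suc] Suc.prems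
    by (intro Ck_on_add[OF assms(1)] Suc.IH) auto
  then have "Ck_on k \<Omega> (partial i (\<lambda>x. f x * g x))" for i
    by (rule Ck_on_cong[OF assms(1), rotated]) (use d in \<open>auto simp: partial_mult\<close>)
  moreover have "(\<lambda>x. f x * g x) differentiable_on \<Omega>"
    using d by (auto simp: differentiable_on_eq_differentiable_at[OF assms(1)] intro: differentiable_mult)
  ultimately show ?case by simp
qed

text \<open>The derivative of 1/f is a product of a derivative of f and two copies of 1/f, so the
  induction hypothesis for 1/f itself suffices.\<close>

lemma Ck_on_inverse:
  assumes "open \<Omega>" "Ck_on k \<Omega> f" "\<And>x. x \<in> \<Omega> \<Longrightarrow> f x \<noteq> 0"
  shows "Ck_on k \<Omega> (\<lambda>x. inverse (f x))"
  using assms(2)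
proof (induction k)
  case 0 then show ?case using assms(3) by (auto intro!: continuous_intros)
next
  case (Suc k)
  have d: "f differentiable (at x)" if "x \<in> \<Omega>" for x
    using Suc.prems that assms(1) by (auto simp: differentiable_on_eq_differentiable_at)
  have c: "Ck_on k \<Omega> (\<lambda>_. - 1)"
    using smooth_on_const[of "-1" \<Omega>] by (auto simp: smooth_on_def)
  have "Ck_on k \<Omega> (\<lambda>x. (-1) * (partial i f x * (inverse (f x) * inverse (f x))))" for i
    using Suc.prems Suc.prems[THEN Ck_on_Suc] by (intro Ck_on_mult[OF assms(1)] c Suc.IH) auto
  then have "Ck_on k \<Omega> (partial i (\<lambda>x. inverse (f x)))" for i
    by (rule Ck_on_cong[OF assms(1), rotated]) (use d assms(3) in \<open>auto simp: partial_inverse\<close>)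
  moreover have "(\<lambda>x. inverse (f x)) differentiable_on \<Omega>"
    using d assms(3) by (auto simp: differentiable_on_eq_differentiable_at[OF assms(1)] intro: differentiable_inverse)
  ultimately show ?case by simp
qed

lemma smooth_on_add: "open \<Omega> \<Longrightarrow> f \<in> smooth_on \<Omega> \<Longrightarrow> g \<in> smooth_on \<Omega> \<Longrightarrow> (\<lambda>x. f x + g x) \<in> smooth_on \<Omega>"
  by (simp add: smooth_on_def Ck_on_add)

lemma smooth_on_mult: "open \<Omega> \<Longrightarrow> f \<in> smooth_on \<Omega> \<Longrightarrow> g \<in> smooth_on \<Omega> \<Longrightarrow> (\<lambda>x. f x * g x) \<in> smooth_on \<Omega>"
  by (simp add: smooth_on_def Ck_on_mult)

lemma smooth_on_inverse:
  "open \<Omega> \<Longrightarrow> f \<in> smooth_on \<Omega> \<Longrightarrow> (\<And>x. x \<in> \<Omega> \<Longrightarrow> f x \<noteq> 0) \<Longrightarrow> (\<lambda>x. inverse (f x)) \<in> smooth_on \<Omega>"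
  by (simp add: smooth_on_def Ck_on_inverse)

lemma smooth_on_cmult: "open \<Omega> \<Longrightarrow> f \<in> smooth_on \<Omega> \<Longrightarrow> (\<lambda>x. c * f x) \<in> smooth_on \<Omega>"
  using smooth_on_mult[of \<Omega> "\<lambda>_. c" f] by simp

lemma smooth_on_diff: "open \<Omega> \<Longrightarrow> f \<in> smooth_on \<Omega> \<Longrightarrow> g \<in> smooth_on \<Omega> \<Longrightarrow> (\<lambda>x. f x - g x) \<in> smooth_on \<Omega>"
  using smooth_on_add[of \<Omega> f "\<lambda>x. (-1) * g x"] smooth_on_cmult[of \<Omega> g "-1"] by simp

lemma smooth_on_sum:
  assumes "open \<Omega>" "\<And>a. a \<in> A \<Longrightarrow> f a \<in> smooth_on \<Omega>"
  shows "(\<lambda>x. \<Sum>a\<in>A. f a x) \<in> smooth_on \<Omega>"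
  using assms(2) by (induction A rule: infinite_finite_induct) (auto intro: smooth_on_add[OF assms(1)])

lemma partial_sum:
  assumes "finite A" "\<And>a. a \<in> A \<Longrightarrow> f a differentiable (at x)"
  shows "partial i (\<lambda>x. \<Sum>a\<in>A. f a x) x = (\<Sum>a\<in>A. partial i (f a) x)"
  using assms
proof (induction A rule: finite_induct)
  case (insert a A)
  then have "partial i (\<lambda>x. f a x + (\<Sum>a\<in>A. f a x)) x = partial i (f a) x + partial i (\<lambda>x. \<Sum>a\<in>A. f a x) x"
    by (intro partial_add differentiable_sum) auto
  with insert show ?case by simp
qed simp

text \<open>Both iterated derivatives are recovered by differentiating
  \<open>f (x + s e\<^sub>i + t e\<^sub>j) - f (x + s e\<^sub>i) = \<integral>\<^sub>0\<^sup>t partial j f (x + s e\<^sub>i + \<tau> e\<^sub>j) d\<tau>\<close> in \<open>s\<close> under the integral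
  and then in \<open>t\<close>.\<close>

lemma partial_commute:
  fixes f :: "'n::finite cfun"
  assumes \<Omega>: "open \<Omega>" and f: "f \<in> smooth_on \<Omega>" and x: "x \<in> \<Omega>"
  shows "partial i (partial j f) x = partial j (partial i f) x"
proof -
  obtain r where r: "r > 0" "ball x r \<subseteq> \<Omega>" using \<Omega> x by (meson openE)
  \<comment> \<open>Displacements of size at most \<open>d\<close> in each of the two directions add
    up to at most 2r/3 and stay in the ball.\<close>
  define d where "d = r / 3"
  have d: "d > 0" using r by (simp add: d_def)
  define F where "F s t = x + t *\<^sub>R axis j 1 + s *\<^sub>R axis i (1::real)" for s t
  have F: "F s t \<in> \<Omega>" if "s \<in> {-d..d}" "t \<in> {-d..d}" for s t
  proof -
    have "norm (t *\<^sub>R axis j (1::real) + s *\<^sub>R axis i 1) \<le> \<bar>t\<bar> + \<bar>s\<bar>"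
      by (rule norm_triangle_le) simp
    also have "\<dots> < r" using that r by (auto simp: d_def)
    finally have "F s t \<in> ball x r" by (simp add: F_def dist_norm norm_minus_commute ac_simps)
    then show ?thesis using r by blast
  qed
  have F': "F s t = x + s *\<^sub>R axis i (1::real) + t *\<^sub>R axis j 1" for s t
    by (simp add: F_def)
  have df: "f differentiable (at (F s t))" "partial i f differentiable (at (F s t))"
     "partial j f differentiable (at (F s t))" if "s \<in> {-d..d}" "t \<in> {-d..d}" for s t
    using F[OF that] smooth_on_differentiable[OF _ \<Omega>] f smooth_on_partial by blast+
  have contF: "continuous_on ({-d..d} \<times> {-d..d}) (\<lambda>(s, t). g (F s t))"
    if "g \<in> smooth_on \<Omega>" for g
  proof -
    have "continuous_on ({-d..d} \<times> {-d..d}) (\<lambda>p. F (fst p) (snd p))"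
      unfolding F_def by (intro continuous_intros)
    then show ?thesis
      unfolding case_prod_unfold
      by (rule continuous_on_compose2[OF smooth_on_continuous_on[OF that]]) (use F in auto)
  qed
  have contt: "continuous_on {-d..d} (\<lambda>t. g (F s t))" if "g \<in> smooth_on \<Omega>" "s \<in> {-d..d}" for g s
  proof -
    have "continuous_on {-d..d} (\<lambda>t. (s, t))" by (intro continuous_intros)
    from continuous_on_compose2[OF contF[OF that(1)] this] show ?thesis using that(2) by force
  qed
  have ftc: "((\<lambda>\<tau>. partial j f (F s \<tau>)) has_integral f (F s t) - f (F s 0)) {0..t}"
    if "s \<in> {-d..d}" "t \<in> {0..d}" for s t
  proof (rule fundamental_theorem_of_calculus)
    fix \<tau> assume "\<tau> \<in> {0..t}"
    then show "((\<lambda>\<tau>. f (F s \<tau>)) has_vector_derivative partial j f (F s \<tau>)) (at \<tau> within {0..t})"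
      unfolding F' using that df(1)[of s \<tau>] by (intro has_vector_derivative_along_axis) (auto simp: F')
  qed (use that in auto)
  have step: "integral {0..t} (\<lambda>\<tau>. partial i (partial j f) (F 0 \<tau>)) = partial i f (F 0 t) - partial i f (F 0 0)"
    if t: "t \<in> {0..d}" for t
  proof -
    have "((\<lambda>s. integral (cbox 0 t) (\<lambda>\<tau>. partial j f (F s \<tau>))) has_vector_derivative
        integral (cbox 0 t) (\<lambda>\<tau>. partial i (partial j f) (F 0 \<tau>))) (at 0 within {-d..d})"
    proof (rule leibniz_rule_vector_derivative)
      fix s \<tau> assume "s \<in> {-d..d}" "\<tau> \<in> cbox 0 t"
      then show "((\<lambda>s. partial j f (F s \<tau>)) has_vector_derivative partial i (partial j f) (F s \<tau>)) (at s within {-d..d})"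
        unfolding F_def using t df(3)[of s \<tau>] by (intro has_vector_derivative_along_axis) (auto simp: F_def)
    next
      fix s assume "s \<in> {-d..d}"
      then show "(\<lambda>\<tau>. partial j f (F s \<tau>)) integrable_on cbox 0 t"
        using ftc[OF _ t] by (auto simp: has_integral_integrable_integral)
    next
      show "continuous_on ({-d..d} \<times> cbox 0 t) (\<lambda>(s, t). partial i (partial j f) (F s t))"
        by (rule continuous_on_subset[OF contF]) (use t f in \<open>auto intro: smooth_on_partial\<close>)
    qed (use d in auto)
    moreover have "((\<lambda>s. integral (cbox 0 t) (\<lambda>\<tau>. partial j f (F s \<tau>))) has_vector_derivative
        partial i f (F 0 t) - partial i f (F 0 0)) (at 0 within {-d..d})"
    proof -
      have "((\<lambda>s. f (F s t)) has_vector_derivative partial i f (F 0 t)) (at 0 within {-d..d})"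
        "((\<lambda>s. f (F s 0)) has_vector_derivative partial i f (F 0 0)) (at 0 within {-d..d})"
        unfolding F_def using t d df(1)[of 0 t] df(1)[of 0 0]
        by (intro has_vector_derivative_along_axis; auto simp: F_def)+
      then have "((\<lambda>s. f (F s t) - f (F s 0)) has_vector_derivative partial i f (F 0 t) - partial i f (F 0 0)) (at 0 within {-d..d})"
        by (rule has_vector_derivative_diff)
      then show ?thesis
        by (rule has_vector_derivative_transform[rotated 2]) (use d ftc[OF _ t] in \<open>auto simp: integral_unique\<close>)
    qed
    moreover have "at 0 within {-d..d} \<noteq> bot" 
      using d by (simp add: trivial_limit_within islimpt_Icc)
    ultimately show ?thesis
      using vector_derivative_unique_within[of 0 "{-d..d}"] by simp
  qed
  \<comment> \<open>The outer differentiation is one-sided at 0, since the integral runs over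
    \<open>{0..t}\<close>; 0 is a limit point of \<open>{0..d}\<close>, which is enough for the
    derivative to be unique.\<close>
  have "((\<lambda>t. integral {0..t} (\<lambda>\<tau>. partial i (partial j f) (F 0 \<tau>))) has_vector_derivative
      partial i (partial j f) (F 0 0)) (at 0 within {0..d})"
    by (rule integral_has_vector_derivative)
      (use d f in \<open>auto intro!: continuous_on_subset[OF contt] smooth_on_partial\<close>)
  moreover have "((\<lambda>t. integral {0..t} (\<lambda>\<tau>. partial i (partial j f) (F 0 \<tau>))) has_vector_derivative
      partial j (partial i f) (F 0 0)) (at 0 within {0..d})"
  proof -
    have "((\<lambda>t. partial i f (F 0 t) - partial i f (F 0 0)) has_vector_derivative partial j (partial i f) (F 0 0) - 0) (at 0 within {0..d})"
      using has_vector_derivative_along_axis[of "partial i f" "x + 0 *\<^sub>R axis i 1" 0 j] df(2)[of 0 0] d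
      by (intro has_vector_derivative_diff) (auto simp: F' intro: derivative_eq_intros)
    then show ?thesis
      by (rule has_vector_derivative_transform[rotated 2, THEN has_vector_derivative_eq_rhs]) (use d step in auto)
  qed
  moreover have "at 0 within {0..d} \<noteq> bot" 
    using d by (simp add: trivial_limit_within islimpt_Icc)
  ultimately have "partial i (partial j f) (F 0 0) = partial j (partial i f) (F 0 0)"
    by (rule vector_derivative_unique_within[rotated])
  then show ?thesis by (simp add: F_def)
qed

section \<open>Iterated derivatives and multi-indices\<close>

lemma funpow_partial_smooth: "f \<in> smooth_on \<Omega> \<Longrightarrow> (partial i ^^ k) f \<in> smooth_on \<Omega>"
  by (induction k) (auto intro: smooth_on_partial)

lemma foldr_partial_smooth:
  "f \<in> smooth_on \<Omega> \<Longrightarrow> foldr (\<lambda>i. partial i ^^ \<alpha> i) js f \<in> smooth_on \<Omega>"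
  by (induction js) (auto intro: funpow_partial_smooth)

lemma mpartial_smooth: "f \<in> smooth_on \<Omega> \<Longrightarrow> mpartial \<alpha> f \<in> smooth_on \<Omega>"
  by (simp add: mpartial_def foldr_partial_smooth)

lemma funpow_partial_cong:
  assumes "open \<Omega>" "\<And>y. y \<in> \<Omega> \<Longrightarrow> f y = g y" "x \<in> \<Omega>"
  shows "(partial i ^^ k) f x = (partial i ^^ k) g x"
  using assms(3)
  by (induction k arbitrary: x) (use assms(1,2) in \<open>auto intro: partial_cong\<close>)

lemma foldr_partial_cong:
  assumes "open \<Omega>" "\<And>y. y \<in> \<Omega> \<Longrightarrow> f y = g y" "x \<in> \<Omega>"
  shows "foldr (\<lambda>i. partial i ^^ \<alpha> i) js f x = foldr (\<lambda>i. partial i ^^ \<alpha> i) js g x"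
  using assms(3)
proof (induction js arbitrary: x)
  case (Cons j js)
  then show ?case using funpow_partial_cong[OF assms(1) Cons.IH Cons.prems] by simp
qed (simp add: assms(2))

lemma funpow_partial_commute:
  assumes "open \<Omega>" "f \<in> smooth_on \<Omega>" "x \<in> \<Omega>"
  shows "(partial j ^^ k) (partial i f) x = partial i ((partial j ^^ k) f) x"
  using assms(3)
proof (induction k arbitrary: x)
  case (Suc k)
  have "(partial j ^^ Suc k) (partial i f) x = partial j (partial i ((partial j ^^ k) f)) x"
    using partial_cong[OF assms(1) Suc.prems Suc.IH] by simp
  also have "\<dots> = partial i ((partial j ^^ Suc k) f) x"
    using partial_commute[OF assms(1) funpow_partial_smooth[OF assms(2)] Suc.prems] by simp
  finally show ?case .
qed simp

lemma foldr_partial_commute: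
  assumes "open \<Omega>" "f \<in> smooth_on \<Omega>" "x \<in> \<Omega>"
  shows "foldr (\<lambda>j. partial j ^^ \<alpha> j) js (partial i f) x = partial i (foldr (\<lambda>j. partial j ^^ \<alpha> j) js f) x"
  using assms(3)
proof (induction js arbitrary: x)
  case (Cons j js)
  show ?case
    using funpow_partial_cong[OF assms(1) Cons.IH Cons.prems]
      funpow_partial_commute[OF assms(1) foldr_partial_smooth[OF assms(2)] Cons.prems]
    by simp
qed simp

lemma distinct_coordinates:
  "distinct (SOME is. distinct is \<and> set is = (UNIV :: 'n::finite set))"
  "set (SOME is. distinct is \<and> set is = (UNIV :: 'n::finite set)) = UNIV"
proof -
  have "\<exists>is. distinct is \<and> set is = (UNIV :: 'n set)"
    using finite_distinct_list[OF finite, of "UNIV :: 'n set"] by blast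
  from someI_ex[OF this]
  show "distinct (SOME is. distinct is \<and> set is = (UNIV :: 'n set))"
    "set (SOME is. distinct is \<and> set is = (UNIV :: 'n set)) = UNIV" by blast+
qed

text \<open>The additional derivative is innermost; it commutes outwards past the coordinates that
  follow \<open>i\<close> in the enumeration until it meets the block of \<open>i\<close>.
  Distinctness guarantees that there is exactly one such block.\<close>

lemma mpartial_partial:
  fixes f :: "'n::finite cfun"
  assumes "open \<Omega>" "f \<in> smooth_on \<Omega>" "x \<in> \<Omega>"
  shows "mpartial \<alpha> (partial i f) x = mpartial (\<alpha>(i := Suc (\<alpha> i))) f x"
proof -
  have "foldr (\<lambda>j. partial j ^^ \<alpha> j) js (partial i f) x
      = foldr (\<lambda>j. partial j ^^ (\<alpha>(i := Suc (\<alpha> i))) j) js f x"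
    if "distinct js" "i \<in> set js" "x \<in> \<Omega>" for js x
    using that
  proof (induction js arbitrary: x)
    case (Cons j js)
    show ?case
    proof (cases "i = j")
      case True
      have *: "foldr (\<lambda>j. partial j ^^ (\<alpha>(i := Suc (\<alpha> i))) j) js = foldr (\<lambda>j. partial j ^^ \<alpha> j) js"
        using Cons.prems True by (intro ext foldr_cong) auto
      show ?thesis
        using True * funpow_partial_cong[OF assms(1) foldr_partial_commute[OF assms(1,2)] Cons.prems(3)]
        by (simp add: funpow_swap1)
    next
      case False
      then show ?thesis
        using Cons.prems funpow_partial_cong[OF assms(1) Cons.IH] by simp
    qed
  qed simp
  from this[OF distinct_coordinates(1) _ assms(3)] show ?thesis
    by (simp add: mpartial_def distinct_coordinates)
qed

lemma mi_order_upd_Suc: "mi_order (\<alpha>(i := Suc (\<alpha> i))) = Suc (mi_order \<alpha>)"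
proof -
  have "(\<Sum>j\<in>UNIV. (\<alpha>(i := Suc (\<alpha> i))) j) = (\<Sum>j\<in>UNIV. \<alpha> j + (if j = i then 1 else 0))"
    by (intro sum.cong) auto
  then show ?thesis by (simp add: mi_order_def sum.distrib)
qed

lemma mpartial_zero [simp]: "mpartial (\<lambda>_. 0) f = f"
proof -
  have "foldr (\<lambda>i. partial i ^^ 0) js f = f" for js by (induction js) auto
  then show ?thesis by (simp add: mpartial_def)
qed

lemma mi_order_zero [simp]: "mi_order (\<lambda>_. 0) = 0"
  by (simp add: mi_order_def)

lemma mi_order_eq_0_iff: "mi_order \<alpha> = 0 \<longleftrightarrow> \<alpha> = (\<lambda>_. 0)"
  by (auto simp: mi_order_def)

lemma finite_mi_order_le: "finite {\<alpha> :: 'n::finite multi_index. mi_order \<alpha> \<le> m}"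
proof (rule finite_subset)
  show "{\<alpha> :: 'n multi_index. mi_order \<alpha> \<le> m} \<subseteq> PiE UNIV (\<lambda>_. {..m})"
  proof
    fix \<alpha> :: "'n multi_index" assume "\<alpha> \<in> {\<alpha>. mi_order \<alpha> \<le> m}"
    moreover have "\<alpha> i \<le> mi_order \<alpha>" for i
      unfolding mi_order_def by (rule member_le_sum) auto
    ultimately show "\<alpha> \<in> PiE UNIV (\<lambda>_. {..m})" using le_trans by fastforce
  qed
qed (auto intro: finite_PiE)

subsection \<open>Jets\<close>

text \<open>The sum of the norms of all derivatives along words of at most \<open>k\<close>
  coordinates; a mixed derivative is counted once for each word that produces it. Unlike a maximum
  over multi-indices this has a one-step recursion, so products, inverses and series are estimated
  by plain induction on \<open>k\<close>, without a general Leibniz formula.\<close>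

fun jet :: "nat \<Rightarrow> 'n::finite cfun \<Rightarrow> real ^ 'n \<Rightarrow> real" where
  "jet 0 f x = norm (f x)"
| "jet (Suc k) f x = norm (f x) + (\<Sum>i\<in>UNIV. jet k (partial i f) x)"

lemma jet_nonneg [simp]: "jet k f x \<ge> 0"
  by (induction k arbitrary: f) (auto intro!: add_nonneg_nonneg sum_nonneg)

lemma norm_le_jet: "norm (f x) \<le> jet k f x"
  by (cases k) (auto intro!: sum_nonneg)

lemma jet_Suc_mono: "jet k f x \<le> jet (Suc k) f x"
proof (induction k arbitrary: f)
  case 0
  then show ?case by (auto intro!: sum_nonneg)
next
  case (Suc k)
  have "(\<Sum>i\<in>UNIV. jet k (partial i f) x) \<le> (\<Sum>i\<in>UNIV. jet (Suc k) (partial i f) x)"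
    by (intro sum_mono Suc.IH)
  then show ?case by simp
qed

lemma jet_mono: "k \<le> l \<Longrightarrow> jet k f x \<le> jet l f x"
  by (rule lift_Suc_mono_le[of "\<lambda>k. jet k f x"]) (rule jet_Suc_mono)

lemma jet_partial: "jet k (partial i f) x \<le> jet (Suc k) f x"
  using member_le_sum[of i UNIV "\<lambda>i. jet k (partial i f) x"] by (simp add: add_increasing)

lemma jet_cong:
  assumes "open \<Omega>" "\<And>y. y \<in> \<Omega> \<Longrightarrow> f y = g y" "x \<in> \<Omega>"
  shows "jet k f x = jet k g x"
  using assms(2)
proof (induction k arbitrary: f g)
  case 0
  then show ?case using assms(3) by simp
next
  case (Suc k)
  have "jet k (partial i f) x = jet k (partial i g) x" for i
    by (rule Suc.IH) (use Suc.prems partial_cong[OF assms(1), of _ f g] in auto)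
  then show ?case using Suc.prems assms(3) by simp
qed

lemma jet_zero [simp]: "jet k (\<lambda>_. 0) x = 0"
  by (induction k) auto

lemma jet_add:
  assumes "open \<Omega>" "x \<in> \<Omega>" "f \<in> smooth_on \<Omega>" "g \<in> smooth_on \<Omega>"
  shows "jet k (\<lambda>x. f x + g x) x \<le> jet k f x + jet k g x"
  using assms(3,4)
proof (induction k arbitrary: f g)
  case 0
  then show ?case by (simp add: norm_triangle_ineq)
next
  case (Suc k)
  have "jet k (partial i (\<lambda>x. f x + g x)) x \<le> jet k (partial i f) x + jet k (partial i g) x" for i
  proof -
    have "jet k (partial i (\<lambda>x. f x + g x)) x = jet k (\<lambda>x. partial i f x + partial i g x) x"
      by (rule jet_cong[OF assms(1)])
        (use Suc.prems assms smooth_on_differentiable in \<open>auto intro!: partial_add\<close>)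
    also have "\<dots> \<le> jet k (partial i f) x + jet k (partial i g) x"
      using Suc by (auto intro: smooth_on_partial)
    finally show ?thesis .
  qed
  then have "(\<Sum>i\<in>UNIV. jet k (partial i (\<lambda>x. f x + g x)) x) \<le> (\<Sum>i\<in>UNIV. jet k (partial i f) x + jet k (partial i g) x)"
    by (intro sum_mono)
  then show ?case using norm_triangle_ineq[of "f x" "g x"] by (simp add: sum.distrib)
qed

text \<open>Each order applies the product rule once and thereby doubles the constant.\<close>

lemma jet_mult:
  assumes "open \<Omega>" "x \<in> \<Omega>" "f \<in> smooth_on \<Omega>" "g \<in> smooth_on \<Omega>"
  shows "jet k (\<lambda>x. f x * g x) x \<le> 2 ^ k * jet k f x * jet k g x"
  using assms(3,4)
proof (induction k arbitrary: f g)
  case 0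
  then show ?case by (simp add: norm_mult)
next
  case (Suc k)
  let ?F = "jet (Suc k) f x" and ?G = "jet (Suc k) g x"
  have le: "jet k (partial i (\<lambda>x. f x * g x)) x \<le> 2 ^ k * (jet k (partial i f) x * ?G) + 2 ^ k * (?F * jet k (partial i g) x)" for i
  proof -
    have "jet k (partial i (\<lambda>x. f x * g x)) x = jet k (\<lambda>x. partial i f x * g x + f x * partial i g x) x"
      by (rule jet_cong[OF assms(1)])
        (use Suc.prems assms smooth_on_differentiable in \<open>auto intro!: partial_mult\<close>)
    also have "\<dots> \<le> jet k (\<lambda>x. partial i f x * g x) x + jet k (\<lambda>x. f x * partial i g x) x"
      using Suc.prems assms by (intro jet_add[OF assms(1)] smooth_on_mult smooth_on_partial) auto
    also have "\<dots> \<le> 2 ^ k * jet k (partial i f) x * jet k g x + 2 ^ k * jet k f x * jet k (partial i g) x"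
      using Suc by (intro add_mono) (auto intro: smooth_on_partial)
    also have "\<dots> \<le> 2 ^ k * jet k (partial i f) x * ?G + 2 ^ k * ?F * jet k (partial i g) x"
      by (intro add_mono mult_left_mono mult_right_mono jet_Suc_mono mult_nonneg_nonneg jet_nonneg) auto
    finally show ?thesis by (simp add: mult_ac)
  qed
  let ?SF = "\<Sum>i\<in>UNIV. jet k (partial i f) x" and ?SG = "\<Sum>i\<in>UNIV. jet k (partial i g) x"
  have "jet (Suc k) (\<lambda>x. f x * g x) x \<le> norm (f x) * norm (g x) +
      (\<Sum>i\<in>UNIV. 2 ^ k * (jet k (partial i f) x * ?G) + 2 ^ k * (?F * jet k (partial i g) x))"
    using le by (auto simp: norm_mult intro!: sum_mono)
  also have "\<dots> = norm (f x) * norm (g x) + 2 ^ k * (?SF * ?G + ?F * ?SG)"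
    by (simp only: sum.distrib sum_distrib_left[symmetric] sum_distrib_right[symmetric] distrib_left)
  \<comment> \<open>The zeroth-order term is enlarged to precisely the two products that complete
    the sums over derivatives to full jets of \<open>f\<close> and of \<open>g\<close>.\<close>
  also have "\<dots> \<le> 2 ^ k * (norm (f x) * ?G + ?F * norm (g x)) + 2 ^ k * (?SF * ?G + ?F * ?SG)"
  proof -
    have "norm (f x) * norm (g x) \<le> norm (f x) * ?G" by (intro mult_left_mono norm_le_jet) auto
    also have "\<dots> \<le> norm (f x) * ?G + ?F * norm (g x)" by (simp only: le_add_same_cancel1) (intro mult_nonneg_nonneg jet_nonneg norm_ge_zero)
    also have "\<dots> \<le> 2 ^ k * \<dots>"
      using mult_right_mono[of 1 "2^k" "norm (f x) * ?G + ?F * norm (g x)"]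
      by (simp del: jet.simps add: add_nonneg_nonneg mult_nonneg_nonneg)
    finally show ?thesis by simp
  qed
  also have "\<dots> = 2 ^ k * ((norm (f x) + ?SF) * ?G + ?F * (norm (g x) + ?SG))"
    by (simp only: distrib_left distrib_right ac_simps)
  also have "\<dots> = 2 ^ Suc k * ?F * ?G" by simp
  finally show ?case .
qed

lemma jet_cmult:
  assumes "open \<Omega>" "x \<in> \<Omega>" "f \<in> smooth_on \<Omega>"
  shows "jet k (\<lambda>x. c * f x) x = norm c * jet k f x"
  using assms(3)
proof (induction k arbitrary: f)
  case (Suc k)
  have "jet k (partial i (\<lambda>x. c * f x)) x = norm c * jet k (partial i f) x" for i
    using jet_cong[OF assms(1) partial_cmult[OF smooth_on_differentiable[OF Suc.prems assms(1)]] assms(2)]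
      Suc.IH[OF smooth_on_partial[OF Suc.prems]]
    by simp
  then show ?case by (simp add: norm_mult sum_distrib_left distrib_left)
qed (simp add: norm_mult)

lemma jet_sum:
  assumes "open \<Omega>" "x \<in> \<Omega>" "finite A" "\<And>a. a \<in> A \<Longrightarrow> f a \<in> smooth_on \<Omega>"
  shows "jet k (\<lambda>x. \<Sum>a\<in>A. f a x) x \<le> (\<Sum>a\<in>A. jet k (f a) x)"
  using assms(3,4)
proof (induction A rule: finite_induct)
  case (insert a A)
  have "jet k (\<lambda>x. f a x + (\<Sum>a\<in>A. f a x)) x \<le> jet k (f a) x + jet k (\<lambda>x. \<Sum>a\<in>A. f a x) x"
    using insert.prems by (intro jet_add[OF assms(1,2)] smooth_on_sum[OF assms(1)]) auto
  with insert show ?case by simp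
qed simp

lemma jet_funpow_partial: "jet k ((partial i ^^ n) f) x \<le> jet (k + n) f x"
proof (induction n arbitrary: k)
  case (Suc n)
  have "jet k ((partial i ^^ Suc n) f) x \<le> jet (Suc k) ((partial i ^^ n) f) x"
    using jet_partial by simp
  also have "\<dots> \<le> jet (Suc k + n) f x" by (rule Suc.IH)
  finally show ?case by simp
qed simp

lemma jet_mpartial:
  fixes f :: "'n::finite cfun"
  shows "jet k (mpartial \<alpha> f) x \<le> jet (k + mi_order \<alpha>) f x"
proof -
  have "jet k (foldr (\<lambda>i. partial i ^^ \<alpha> i) js f) x \<le> jet (k + (\<Sum>i\<leftarrow>js. \<alpha> i)) f x" for js
  proof (induction js arbitrary: k)
    case (Cons j js)
    have "jet k (foldr (\<lambda>i. partial i ^^ \<alpha> i) (j # js) f) x \<le> jet (k + \<alpha> j) (foldr (\<lambda>i. partial i ^^ \<alpha> i) js f) x"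
      by (simp add: jet_funpow_partial)
    also have "\<dots> \<le> jet (k + \<alpha> j + (\<Sum>i\<leftarrow>js. \<alpha> i)) f x" by (rule Cons.IH)
    finally show ?case by (simp add: add.assoc)
  qed simp
  from this[of "SOME is. distinct is \<and> set is = UNIV"]
  have "jet k (mpartial \<alpha> f) x \<le> jet (k + (\<Sum>i\<leftarrow>(SOME is. distinct is \<and> set is = UNIV). \<alpha> i)) f x"
    by (simp add: mpartial_def)
  also have "(\<Sum>i\<leftarrow>(SOME is. distinct is \<and> set is = (UNIV :: 'n set)). \<alpha> i) = mi_order \<alpha>"
    using distinct_coordinates[where 'n = 'n] by (subst sum_list_distinct_conv_sum_set) (simp_all add: mi_order_def)
  finally show ?thesis .
qed

lemma norm_mpartial_le_jet: "norm (mpartial \<alpha> f x) \<le> jet (mi_order \<alpha>) f x"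
  using jet_mpartial[of 0 \<alpha> f x] by simp

text \<open>Smoothness sorts every word into a multi-index, and (n + 1)^k bounds the number of words
  of length at most k over n letters.\<close>

lemma jet_le_mpartial:
  fixes f :: "'n::finite cfun"
  assumes "open \<Omega>" "x \<in> \<Omega>" "f \<in> smooth_on \<Omega>"
    and "\<And>\<alpha>. mi_order \<alpha> \<le> k \<Longrightarrow> norm (mpartial \<alpha> f x) \<le> A"
  shows "jet k f x \<le> (real CARD('n) + 1) ^ k * A"
  using assms(3,4)
proof (induction k arbitrary: f)
  case 0
  then show ?case using 0(2)[of "\<lambda>_. 0"] by simp
next
  case (Suc k)
  have fx: "norm (f x) \<le> A" using Suc.prems(2)[of "\<lambda>_. 0"] by simp
  then have A: "A \<ge> 0" using norm_ge_zero order_trans by blast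
  have "jet k (partial i f) x \<le> (real CARD('n) + 1) ^ k * A" for i
  proof (rule Suc.IH[OF smooth_on_partial[OF Suc.prems(1)]])
    fix \<alpha> :: "'n multi_index" assume "mi_order \<alpha> \<le> k"
    then have "mi_order (\<alpha>(i := Suc (\<alpha> i))) \<le> Suc k" by (simp only: mi_order_upd_Suc Suc_le_mono)
    from Suc.prems(2)[OF this] show "norm (mpartial \<alpha> (partial i f) x) \<le> A"
      by (simp only: mpartial_partial[OF assms(1) Suc.prems(1) assms(2)])
  qed
  then have "(\<Sum>i\<in>UNIV. jet k (partial i f) x) \<le> (\<Sum>i\<in>(UNIV :: 'n set). (real CARD('n) + 1) ^ k * A)"
    by (intro sum_mono)
  moreover have "A \<le> (real CARD('n) + 1) ^ k * A"
    using mult_right_mono[OF one_le_power A, of "real CARD('n) + 1" k] by simp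
  ultimately show ?case using fx by (simp add: algebra_simps)
qed

text \<open>The recursion follows the derivative -p'/p^2 of 1/p: the factor \<open>4 ^ k\<close>
  comes from two applications of \<open>jet_mult\<close>, the square from the two copies of 1/p, and
  \<open>A\<close> from p' measured against p.\<close>

fun inverse_jet_const :: "nat \<Rightarrow> real \<Rightarrow> real" where
  "inverse_jet_const 0 A = 1"
| "inverse_jet_const (Suc k) A = inverse_jet_const k A + 4 ^ k * A * (inverse_jet_const k A)\<^sup>2"

lemma inverse_jet_const_ge_1: "A \<ge> 0 \<Longrightarrow> inverse_jet_const k A \<ge> 1"
  by (induction k) (auto intro!: add_increasing2)

text \<open>Both the assumption on \<open>p\<close> and the conclusion are invariant under scaling
  of \<open>p\<close>. The size of the symbol, and with it the power of \<epsilon>, therefore never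
  enters the constant.\<close>

lemma jet_inverse:
  fixes p :: "'n::finite cfun"
  assumes "open \<Omega>" "x \<in> \<Omega>" "p \<in> smooth_on \<Omega>" "\<And>y. y \<in> \<Omega> \<Longrightarrow> p y \<noteq> 0"
    and A: "jet k p x \<le> A * norm (p x)"
  shows "jet k (\<lambda>x. inverse (p x)) x \<le> inverse_jet_const k A / norm (p x)"
  using A
proof (induction k)
  case 0
  then show ?case by (simp add: norm_inverse divide_inverse)
next
  case (Suc k)
  let ?q = "\<lambda>x. inverse (p x)" and ?C = "inverse_jet_const k A"
  have p0: "norm (p x) > 0" using assms by simp
  have A0: "A \<ge> 0" using Suc.prems jet_nonneg[of "Suc k" p x] p0
    by (metis mult_less_0_iff not_le order_trans)
  have C: "?C \<ge> 1" by (rule inverse_jet_const_ge_1[OF A0])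
  have q: "?q \<in> smooth_on \<Omega>" using assms by (intro smooth_on_inverse) auto
  have IH: "jet k ?q x \<le> ?C / norm (p x)"
    by (rule Suc.IH) (use Suc.prems jet_Suc_mono[of k p x] in linarith)
  have pi: "partial i p \<in> smooth_on \<Omega>" for i using assms by (intro smooth_on_partial)
  have "jet k (partial i ?q) x \<le> 4 ^ k * ((?C / norm (p x)) * (?C / norm (p x))) * jet k (partial i p) x" for i
  proof -
    have "jet k (partial i ?q) x = jet k (\<lambda>x. (-1) * (partial i p x * (?q x * ?q x))) x"
      by (rule jet_cong[OF assms(1) _ assms(2)])
        (use assms(4) smooth_on_differentiable[OF assms(3,1)] in \<open>simp add: partial_inverse\<close>)
    also have "\<dots> = jet k (\<lambda>x. partial i p x * (?q x * ?q x)) x"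
      by (subst jet_cmult[OF assms(1,2)]) (auto intro!: smooth_on_mult assms(1) pi q)
    also have "\<dots> \<le> 2 ^ k * jet k (partial i p) x * jet k (\<lambda>x. ?q x * ?q x) x"
      by (intro jet_mult[OF assms(1,2)] smooth_on_mult assms(1) pi q)
    also have "\<dots> \<le> 2 ^ k * jet k (partial i p) x * (2 ^ k * jet k ?q x * jet k ?q x)"
      by (intro mult_left_mono jet_mult[OF assms(1,2)] q) auto
    also have "\<dots> \<le> 2 ^ k * jet k (partial i p) x * (2 ^ k * (?C / norm (p x)) * (?C / norm (p x)))"
      using C by (intro mult_left_mono mult_mono IH) auto
    also have "\<dots> = 4 ^ k * ((?C / norm (p x)) * (?C / norm (p x))) * jet k (partial i p) x"
      using power_mult_distrib[of "2::real" 2 k] by simp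
    finally show ?thesis .
  qed
  then have "(\<Sum>i\<in>UNIV. jet k (partial i ?q) x)
      \<le> (\<Sum>i\<in>UNIV. 4 ^ k * ((?C / norm (p x)) * (?C / norm (p x))) * jet k (partial i p) x)"
    by (intro sum_mono)
  also have "\<dots> \<le> 4 ^ k * ((?C / norm (p x)) * (?C / norm (p x))) * (A * norm (p x))"
    unfolding sum_distrib_left[symmetric]
    using Suc.prems norm_ge_zero[of "p x"] by (intro mult_left_mono) (unfold jet.simps, linarith, simp)
  also have "\<dots> = 4 ^ k * A * ?C\<^sup>2 / norm (p x)"
    using p0 by (simp add: field_simps power2_eq_square)
  finally have "(\<Sum>i\<in>UNIV. jet k (partial i ?q) x) \<le> 4 ^ k * A * ?C\<^sup>2 / norm (p x)" .
  moreover have "norm (?q x) \<le> ?C / norm (p x)"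
    using C p0 by (simp add: norm_inverse divide_inverse mult_right_mono)
  ultimately show ?case by (simp add: add_divide_distrib)
qed

subsection \<open>Fourier series in one variable\<close>

lemma has_vector_derivative_cis_linear:
  "((\<lambda>t. cis (c * t)) has_vector_derivative \<i> * of_real c * cis (c * t)) (at t within S)"
  by (auto intro!: derivative_eq_intros simp: has_vector_derivative_def scaleR_conv_of_real algebra_simps)

lemma has_vector_derivative_tendsto_quotient:
  assumes "(f has_vector_derivative D) (at x)"
  shows "((\<lambda>t. (f t - f x) /\<^sub>R (t - x)) \<longlongrightarrow> D) (at x)"
proof -
  have "((\<lambda>t. norm (f t - f x - (t - x) *\<^sub>R D) / norm (t - x)) \<longlongrightarrow> 0) (at x)"
    using assms by (simp add: has_vector_derivative_def has_derivative_iff_norm)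
  moreover have "norm (f t - f x - (t - x) *\<^sub>R D) / norm (t - x) = norm ((f t - f x) /\<^sub>R (t - x) - D)" if "t \<noteq> x" for t
  proof -
    have "(f t - f x) /\<^sub>R (t - x) - D = (f t - f x - (t - x) *\<^sub>R D) /\<^sub>R (t - x)"
      using that by (simp add: scaleR_diff_right)
    then show ?thesis by (simp add: divide_inverse)
  qed
  then have "\<forall>\<^sub>F t in at x. norm (f t - f x - (t - x) *\<^sub>R D) / norm (t - x) = norm ((f t - f x) /\<^sub>R (t - x) - D)"
    by (auto simp: eventually_at intro!: exI[of _ 1])
  ultimately have "((\<lambda>t. norm ((f t - f x) /\<^sub>R (t - x) - D)) \<longlongrightarrow> 0) (at x)"
    by (rule Lim_transform_eventually)
  then show ?thesis by (simp add: tendsto_norm_zero_iff LIM_zero_iff)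
qed

lemma integral_cis_int:
  "integral {-pi..pi} (\<lambda>t. cis (of_int k * t)) = (if k = 0 then 2 * of_real pi else 0)"
proof (cases "k = 0")
  case False
  have "((\<lambda>t. cis (of_int k * t)) has_integral
      cis (of_int k * pi) / (\<i> * of_int k) - cis (of_int k * (-pi)) / (\<i> * of_int k)) {-pi..pi}"
  proof (rule fundamental_theorem_of_calculus)
    fix t assume "t \<in> {-pi..pi}"
    show "((\<lambda>t. cis (of_int k * t) / (\<i> * of_int k)) has_vector_derivative cis (of_int k * t)) (at t within {-pi..pi})"
      using has_vector_derivative_divide[OF has_vector_derivative_cis_linear[of "of_int k" t "{-pi..pi}"], of "\<i> * of_int k"] False
      by simp
  qed simp
  moreover have "cis (of_int k * pi) = cis (of_int k * (-pi))"
  proof -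
    have "cis (of_int k * pi) = cis (of_int k * (-pi)) * cis (2 * pi * of_int k)"
      by (simp add: cis_mult algebra_simps)
    then show ?thesis by simp
  qed
  ultimately show ?thesis using False by (simp add: integral_unique)
qed (simp add: scaleR_conv_of_real)

text \<open>Polynomials are uniformly dense in the continuous functions, and for a polynomial one
  integration by parts gives decay of order 1/|k|.\<close>

lemma riemann_lebesgue:
  fixes h :: "real \<Rightarrow> complex"
  assumes h: "continuous_on {-pi..pi} h" and e: "e > 0"
  shows "\<exists>N. \<forall>k::int. real_of_int \<bar>k\<bar> \<ge> N \<longrightarrow> norm (integral {-pi..pi} (\<lambda>t. h t * cis (- of_int k * t))) < e"
proof -
  obtain g where g: "polynomial_function g" "\<And>t. t \<in> {-pi..pi} \<Longrightarrow> norm (h t - g t) < e / (4 * pi)"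
    using Stone_Weierstrass_polynomial_function[of "{-pi..pi}" h "e / (4 * pi)"] h e by auto
  obtain g' where g': "polynomial_function g'" "\<And>t. (g has_vector_derivative g' t) (at t)"
    using has_vector_derivative_polynomial_function[OF g(1)] by blast
  have cg: "continuous_on S g" "continuous_on S g'" for S
    using g(1) g'(1) continuous_on_polymonial_function by blast+
  have "bounded (g ` {-pi..pi})" "bounded (g' ` {-pi..pi})"
    by (intro compact_imp_bounded compact_continuous_image cg compact_Icc)+
  then obtain A B where A: "\<And>t. t \<in> {-pi..pi} \<Longrightarrow> norm (g t) \<le> A" and B: "\<And>t. t \<in> {-pi..pi} \<Longrightarrow> norm (g' t) \<le> B"
    by (metis bounded_iff imageI)
  define C where "C = 2 * A + 2 * pi * B"
  have gk: "norm (integral {-pi..pi} (\<lambda>t. g t * cis (- of_int k * t))) \<le> C / real_of_int \<bar>k\<bar>" if k: "k \<noteq> 0" for k :: int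
  proof -
    let ?F = "\<lambda>t. g t * (cis (- of_int k * t) / (- \<i> * of_int k))"
    let ?G = "\<lambda>t. g' t * (cis (- of_int k * t) / (- \<i> * of_int k))"
    have "((\<lambda>t. g t * cis (- of_int k * t) + ?G t) has_integral (?F pi - ?F (-pi))) {-pi..pi}"
    proof (rule fundamental_theorem_of_calculus)
      fix t assume "t \<in> {-pi..pi}"
      have c: "((\<lambda>t. cis (- of_int k * t) / (- \<i> * of_int k)) has_vector_derivative cis (- of_int k * t)) (at t within {-pi..pi})"
        using has_vector_derivative_divide[OF has_vector_derivative_cis_linear[of "- of_int k" t "{-pi..pi}"], of "- \<i> * of_int k"] k
        by simp
      show "(?F has_vector_derivative (g t * cis (- of_int k * t) + ?G t)) (at t within {-pi..pi})"
        by (rule has_vector_derivative_mult[OF has_vector_derivative_at_within[OF g'(2)] c])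
    qed simp
    moreover have G: "?G integrable_on {-pi..pi}"
      by (intro integrable_continuous_real continuous_intros cg) (use k in auto)
    ultimately have "((\<lambda>t. g t * cis (- of_int k * t)) has_integral (?F pi - ?F (-pi)) - integral {-pi..pi} ?G) {-pi..pi}"
      using has_integral_diff[of _ _ "{-pi..pi}" ?G, OF _ integrable_integral[OF G]] by fastforce
    then have "integral {-pi..pi} (\<lambda>t. g t * cis (- of_int k * t)) = (?F pi - ?F (-pi)) - integral {-pi..pi} ?G"
      by (rule integral_unique)
    also have "norm \<dots> \<le> (norm (?F pi) + norm (?F (-pi))) + norm (integral {-pi..pi} ?G)"
      by (intro norm_triangle_le_diff add_mono norm_triangle_ineq4) auto
    also have "\<dots> \<le> (A / \<bar>k\<bar> + A / \<bar>k\<bar>) + B / \<bar>k\<bar> * (pi - (-pi))"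
    proof (intro add_mono)
      show "norm (integral {-pi..pi} ?G) \<le> B / \<bar>k\<bar> * (pi - (-pi))"
      proof (rule integral_bound)
        show "continuous_on {-pi..pi} ?G" by (intro continuous_intros cg) (use k in auto)
        show "norm (?G t) \<le> B / \<bar>k\<bar>" if "t \<in> {-pi..pi}" for t
          using B[OF that] k by (simp add: norm_mult norm_divide divide_right_mono)
      qed simp
    qed (use A[of pi] A[of "-pi"] k in \<open>auto simp: norm_mult norm_divide divide_right_mono\<close>)
    also have "\<dots> = C / \<bar>k\<bar>" by (simp add: C_def add_divide_distrib)
    finally show ?thesis .
  qed
  show ?thesis
  proof (intro exI allI impI)
    \<comment> \<open>The maximum with 1 excludes k = 0, and the second entry makes C/|k| less than
      e/2. The approximation error e/(4 pi), integrated over an interval of length 2 pi, contributes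
      the other half.\<close>
    fix k :: int assume k: "real_of_int \<bar>k\<bar> \<ge> max 1 (2 * C / e + 1)"
    then have k0: "k \<noteq> 0" by auto
    have "integral {-pi..pi} (\<lambda>t. h t * cis (- of_int k * t))
        = integral {-pi..pi} (\<lambda>t. (h t - g t) * cis (- of_int k * t)) + integral {-pi..pi} (\<lambda>t. g t * cis (- of_int k * t))"
      by (subst integral_add[symmetric])
        (auto intro!: integrable_continuous_real continuous_intros cg h simp: left_diff_distrib)
    also have "norm \<dots> \<le> e / (4 * pi) * (pi - (-pi)) + C / \<bar>k\<bar>"
    proof (intro norm_triangle_le add_mono gk k0)
      show "norm (integral {-pi..pi} (\<lambda>t. (h t - g t) * cis (- of_int k * t))) \<le> e / (4 * pi) * (pi - (-pi))"
        by (rule integral_bound) (use g(2) in \<open>auto intro!: continuous_intros cg h simp: norm_mult less_imp_le\<close>)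
    qed
    also have "\<dots> < e"
    proof -
      have "2 * C < e * \<bar>k\<bar>" using k e by (auto simp: field_simps)
      then have "C / \<bar>k\<bar> < e / 2" using k0 by (simp add: field_simps)
      moreover have "e / (4 * pi) * (pi - (-pi)) = e / 2" by simp
      ultimately show ?thesis by linarith
    qed
    finally show "norm (integral {-pi..pi} (\<lambda>t. h t * cis (- of_int k * t))) < e" .
  qed
qed

lemma cis_eq_1_small: "cis s = 1 \<Longrightarrow> \<bar>s\<bar> < 2 * pi \<Longrightarrow> s = 0"
proof -
  assume "cis s = 1" "\<bar>s\<bar> < 2 * pi"
  then have "cos s = 1" by (metis cis.sel(1) one_complex.sel(1))
  then obtain n :: int where "s = n * 2 * pi" by (auto simp: cos_one_2pi_int)
  with \<open>\<bar>s\<bar> < 2 * pi\<close> have "\<bar>real_of_int n\<bar> < 1" by (auto simp: abs_mult)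
  then show "s = 0" using \<open>s = n * 2 * pi\<close> by auto
qed

definition fourier_coeff :: "(real \<Rightarrow> complex) \<Rightarrow> int \<Rightarrow> complex" where
  "fourier_coeff f k = integral {-pi..pi} (\<lambda>t. f t * cis (- of_int k * t)) / (2 * of_real pi)"

text \<open>With \<open>f t - f x = h t * (cis (t - x) - 1)\<close>, the symmetric partial sums of the Fourier series of
  \<open>f - f x\<close> at \<open>x\<close> telescope to two Fourier coefficients of the continuous function \<open>h\<close>.\<close>

lemma fourier_series_has_sum:
  assumes f: "continuous_on {-pi..pi} f" and f': "(f has_vector_derivative f') (at x)" and x: "\<bar>x\<bar> < pi"
    and sm: "(\<lambda>k. norm (fourier_coeff f k)) summable_on UNIV"
  shows "((\<lambda>k. fourier_coeff f k * cis (of_int k * x)) has_sum f x) UNIV"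
proof -
  \<comment> \<open>The value at \<open>x\<close> makes \<open>h\<close> continuous: divided by t -
    x, the numerator tends to \<open>f'\<close> and cis (t - x) - 1 tends to \<i>.\<close>
  define h where "h t = (if t = x then f' / \<i> else (f t - f x) / (cis (t - x) - 1))" for t
  have nz: "cis (t - x) \<noteq> 1" if "t \<in> {-pi..pi}" "t \<noteq> x" for t
  proof -
    have "\<bar>t - x\<bar> < 2 * pi" using that x by (simp add: abs_less_iff)
    then show ?thesis using cis_eq_1_small[of "t - x"] that by auto
  qed
  have fh: "f t - f x = h t * (cis (t - x) - 1)" if "t \<in> {-pi..pi}" for t
    using nz[OF that] by (auto simp: h_def)
  have conth: "continuous_on {-pi..pi} h"
    unfolding continuous_on_eq_continuous_within
  proof -
    show "\<forall>t\<in>{-pi..pi}. continuous (at t within {-pi..pi}) h"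
    proof
      fix t assume t: "t \<in> {-pi..pi}"
      show "continuous (at t within {-pi..pi}) h"
      proof (cases "t = x")
        case True
        have 1: "((\<lambda>t. (f t - f x) /\<^sub>R (t - x)) \<longlongrightarrow> f') (at x)"
          by (rule has_vector_derivative_tendsto_quotient[OF f'])
        have "((\<lambda>t. cis (t - x)) has_vector_derivative \<i>) (at x)"
          by (auto intro!: derivative_eq_intros simp: has_vector_derivative_def)
        then have 2: "((\<lambda>t. (cis (t - x) - 1) /\<^sub>R (t - x)) \<longlongrightarrow> \<i>) (at x)"
          using has_vector_derivative_tendsto_quotient[of "\<lambda>t. cis (t - x)" \<i> x] by simp
        have "((\<lambda>t. ((f t - f x) /\<^sub>R (t - x)) / ((cis (t - x) - 1) /\<^sub>R (t - x))) \<longlongrightarrow> f' / \<i>) (at x)"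
          by (intro tendsto_divide 1 2) simp
        then have "(h \<longlongrightarrow> f' / \<i>) (at x)"
          by (rule Lim_transform_eventually)
            (auto simp: eventually_at h_def scaleR_conv_of_real intro!: exI[of _ 1])
        then have "(h \<longlongrightarrow> h x) (at x)" by (simp add: h_def)
        then show ?thesis using True by (auto simp: continuous_within intro: tendsto_within_subset[OF _ subset_UNIV])
      next
        case False
        have "((\<lambda>t. (f t - f x) / (cis (t - x) - 1)) \<longlongrightarrow> (f t - f x) / (cis (t - x) - 1)) (at t within {-pi..pi})"
          using f t nz[OF t False] by (intro tendsto_intros) (auto simp: continuous_on_def)
        moreover have "\<forall>\<^sub>F s in at t within {-pi..pi}. (f s - f x) / (cis (s - x) - 1) = h s"
          using False by (auto simp: eventually_at h_def dist_real_def intro!: exI[of _ "\<bar>t - x\<bar>"])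
        ultimately have "(h \<longlongrightarrow> (f t - f x) / (cis (t - x) - 1)) (at t within {-pi..pi})"
          by (rule Lim_transform_eventually)
        then show ?thesis using False by (simp add: continuous_within h_def)
      qed
    qed
  qed
  define H where "H k = integral {-pi..pi} (\<lambda>t. h t * cis (- of_int k * t))" for k :: int
  \<comment> \<open>Multiplication by cis (t - x) shifts the index of a Fourier coefficient by one
    and turns it by the phase cis (-x). The factor cis (k x) absorbs this phase, so that differences
    of \<open>T\<close> appear.\<close>
  define T where "T k = cis (of_int k * x) * H k" for k :: int
  let ?c = "\<lambda>k. fourier_coeff f k * cis (of_int k * x)"
  have tele: "2 * of_real pi * ?c k = (if k = 0 then 2 * of_real pi * f x else 0) + (T (k - 1) - T k)" for k
  proof -
    have "integral {-pi..pi} (\<lambda>t. (f t - f x) * cis (- of_int k * t))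
        = integral {-pi..pi} (\<lambda>t. cis (- x) * (h t * cis (- of_int (k - 1) * t)) - h t * cis (- of_int k * t))"
    proof (rule integral_cong)
      fix t assume "t \<in> {-pi..pi}"
      have "cis (t - x) * cis (- of_int k * t) = cis (- x) * cis (- of_int (k - 1) * t)"
        by (simp add: cis_mult algebra_simps)
      then show "(f t - f x) * cis (- of_int k * t) = cis (- x) * (h t * cis (- of_int (k - 1) * t)) - h t * cis (- of_int k * t)"
        unfolding fh[OF \<open>t \<in> _\<close>] by (simp add: algebra_simps)
    qed
    also have "\<dots> = cis (- x) * H (k - 1) - H k"
      unfolding H_def
      by (subst integral_diff) (auto intro!: integrable_continuous_real continuous_intros conth)
    finally have 1: "integral {-pi..pi} (\<lambda>t. (f t - f x) * cis (- of_int k * t)) = cis (- x) * H (k - 1) - H k" .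
    have "integral {-pi..pi} (\<lambda>t. (f t - f x) * cis (- of_int k * t))
        = integral {-pi..pi} (\<lambda>t. f t * cis (- of_int k * t)) - f x * integral {-pi..pi} (\<lambda>t. cis (of_int (- k) * t))"
      unfolding left_diff_distrib
      by (subst integral_diff) (auto intro!: integrable_continuous_real continuous_intros f)
    also have "integral {-pi..pi} (\<lambda>t. cis (of_int (- k) * t)) = (if k = 0 then 2 * of_real pi else 0)"
      using integral_cis_int[of "- k"] by simp
    also have "integral {-pi..pi} (\<lambda>t. f t * cis (- of_int k * t)) = 2 * of_real pi * fourier_coeff f k"
      by (simp add: fourier_coeff_def)
    finally have 2: "integral {-pi..pi} (\<lambda>t. (f t - f x) * cis (- of_int k * t))
        = 2 * of_real pi * fourier_coeff f k - f x * (if k = 0 then 2 * of_real pi else 0)" .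
    have "2 * of_real pi * fourier_coeff f k = f x * (if k = 0 then 2 * of_real pi else 0) + (cis (- x) * H (k - 1) - H k)"
      unfolding 1[symmetric] 2 by simp
    then have "2 * of_real pi * ?c k = (f x * (if k = 0 then 2 * of_real pi else 0) + (cis (- x) * H (k - 1) - H k)) * cis (of_int k * x)"
      by (metis mult.assoc)
    moreover have "cis (- x) * cis (of_int k * x) = cis (of_int (k - 1) * x)"
      by (simp add: cis_mult algebra_simps)
    ultimately show ?thesis by (auto simp: T_def algebra_simps)
  qed
  have sums: "2 * of_real pi * (\<Sum>k = - int n..int n. ?c k) = 2 * of_real pi * f x + (T (- int n - 1) - T (int n))" for n
  proof (induction n)
    case 0
    then show ?case using tele[of 0] by simp
  next
    case (Suc n)
    have "{- int (Suc n)..int (Suc n)} = insert (- int n - 1) (insert (int n + 1) {- int n..int n})" by auto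
    then have "(\<Sum>k = - int (Suc n)..int (Suc n). ?c k) = ?c (- int n - 1) + (?c (int n + 1) + (\<Sum>k = - int n..int n. ?c k))"
      by simp
    then have "2 * of_real pi * (\<Sum>k = - int (Suc n)..int (Suc n). ?c k)
      = 2 * of_real pi * ?c (- int n - 1) + (2 * of_real pi * ?c (int n + 1) + 2 * of_real pi * (\<Sum>k = - int n..int n. ?c k))"
      by (simp only: distrib_left)
    also have "\<dots> = 2 * of_real pi * f x + (T (- int (Suc n) - 1) - T (int (Suc n)))"
      unfolding Suc.IH tele by (auto simp: algebra_simps)
    finally show ?case .
  qed
  obtain S where S: "(?c has_sum S) UNIV"
  proof -
    have "(\<lambda>k. norm (?c k)) summable_on UNIV" using sm by (simp add: norm_mult)
    then show ?thesis using that[OF has_sum_infsum[OF abs_summable_summable]] by simp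
  qed
  \<comment> \<open>Absolute summability provides an unordered sum \<open>S\<close>, and the
    symmetric intervals are cofinal among the finite sets of integers. It only remains to identify
    \<open>S\<close> along them.\<close>
  have lim: "(\<lambda>n. \<Sum>k = - int n..int n. ?c k) \<longlonglongrightarrow> S"
  proof -
    have "filterlim (\<lambda>n. {- int n..int n}) (finite_subsets_at_top UNIV) sequentially"
      unfolding filterlim_finite_subsets_at_top
    proof (intro allI impI)
      fix X :: "int set" assume X: "finite X \<and> X \<subseteq> UNIV"
      then have "\<forall>\<^sub>F n in sequentially. X \<subseteq> {- int n..int n}"
      proof (intro eventually_sequentiallyI)
        fix n assume n: "nat (Max (insert 0 (abs ` X))) \<le> n"
        show "X \<subseteq> {- int n..int n}"
        proof
          fix k assume "k \<in> X"
          then have "\<bar>k\<bar> \<le> Max (insert 0 (abs ` X))" using X by (intro Max_ge) auto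
          then show "k \<in> {- int n..int n}" using n by auto
        qed
      qed
      then show "\<forall>\<^sub>F n in sequentially. finite {- int n..int n} \<and> X \<subseteq> {- int n..int n} \<and> {- int n..int n} \<subseteq> UNIV"
        by simp
    qed
    then show ?thesis using S unfolding has_sum_def by (rule filterlim_compose[rotated])
  qed
  have Tlim: "(\<lambda>n. T (- int n - 1)) \<longlonglongrightarrow> 0" "(\<lambda>n. T (int n)) \<longlonglongrightarrow> 0"
  proof -
    have "\<exists>N. \<forall>n\<ge>N. norm (T (- int n - 1)) < e \<and> norm (T (int n)) < e" if e: "e > 0" for e
    proof -
      obtain N where N: "\<And>k::int. real_of_int \<bar>k\<bar> \<ge> N \<Longrightarrow> norm (H k) < e"
        using riemann_lebesgue[OF conth e] unfolding H_def by auto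
      have "norm (T (- int n - 1)) < e \<and> norm (T (int n)) < e" if "n \<ge> nat \<lceil>N\<rceil>" for n
        using N[of "- int n - 1"] N[of "int n"] that by (auto simp: T_def norm_mult)
      then show ?thesis by blast
    qed
    then show "(\<lambda>n. T (- int n - 1)) \<longlonglongrightarrow> 0" "(\<lambda>n. T (int n)) \<longlonglongrightarrow> 0"
      by (auto simp: LIMSEQ_iff) blast+
  qed
  have "(\<lambda>n. 2 * of_real pi * (\<Sum>k = - int n..int n. ?c k)) \<longlonglongrightarrow> 2 * of_real pi * f x + (0 - 0)"
    unfolding sums by (intro tendsto_intros Tlim)
  moreover have "(\<lambda>n. 2 * of_real pi * (\<Sum>k = - int n..int n. ?c k)) \<longlonglongrightarrow> 2 * of_real pi * S"
    by (intro tendsto_intros lim)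
  ultimately have "2 * of_real pi * f x + (0 - 0) = 2 * of_real pi * S"
    by (rule LIMSEQ_unique)
  then show ?thesis using S by simp
qed

subsection \<open>Fourier projections\<close>

text \<open>Differentiation under the integral with a vector parameter. The derivative has to depend
  continuously on the parameter as a bounded linear map, and in finite dimension this may be checked
  on single vectors.\<close>

lemma has_derivative_integral_param:
  fixes F :: "real ^ 'n::finite \<Rightarrow> real \<Rightarrow> complex"
  assumes d: "\<And>y t. t \<in> {a..b} \<Longrightarrow> ((\<lambda>y. F y t) has_derivative (\<lambda>h. \<Sum>j\<in>UNIV. h $ j *\<^sub>R F' j y t)) (at y)"
    and c: "\<And>y. continuous_on {a..b} (F y)"
    and c': "\<And>j. continuous_on (UNIV \<times> {a..b}) (\<lambda>(y, t). F' j y t)"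
  shows "((\<lambda>y. integral {a..b} (F y)) has_derivative (\<lambda>h. \<Sum>j\<in>UNIV. h $ j *\<^sub>R integral {a..b} (F' j y))) (at y)"
proof -
  define B where "B y t = Blinfun (\<lambda>h. \<Sum>j\<in>UNIV. h $ j *\<^sub>R F' j y t)" for y t
  have B: "blinfun_apply (B y t) = (\<lambda>h. \<Sum>j\<in>UNIV. h $ j *\<^sub>R F' j y t)" for y t
    unfolding B_def
    by (rule bounded_linear_Blinfun_apply)
      (intro bounded_linear_sum bounded_linear_compose[OF bounded_linear_scaleR_left bounded_linear_vec_nth])
  have cB: "continuous_on (UNIV \<times> {a..b}) (\<lambda>(y, t). B y t)"
  proof (rule continuous_on_blinfun_componentwise)
    fix h :: "real ^ 'n"
    have "continuous_on (UNIV \<times> {a..b}) (\<lambda>p. \<Sum>j\<in>UNIV. h $ j *\<^sub>R (case p of (y, t) \<Rightarrow> F' j y t))"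
      by (intro continuous_intros c')
    then show "continuous_on (UNIV \<times> {a..b}) (\<lambda>x. blinfun_apply (case x of (y, t) \<Rightarrow> B y t) h)"
      by (simp add: case_prod_unfold B)
  qed
  have slice: "continuous_on {a..b} (\<lambda>t. G (y, t))" if "continuous_on (UNIV \<times> {a..b}) G" for G :: "(real ^ 'n) \<times> real \<Rightarrow> 'c::topological_space" and y
    by (rule continuous_on_compose2[OF that]) (auto intro!: continuous_intros)
  have iB: "B y integrable_on {a..b}" for y
    using slice[OF cB, of y] by (intro integrable_continuous_real) simp
  have "((\<lambda>y. integral (cbox a b) (F y)) has_derivative integral (cbox a b) (B y)) (at y within UNIV)"
  proof (rule leibniz_rule)
    show "((\<lambda>y. F y t) has_derivative blinfun_apply (B y t)) (at y within UNIV)" if "t \<in> cbox a b" for y t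
      using d[of t y] that by (simp add: B)
    show "F y integrable_on cbox a b" for y using c[of y] by (auto intro: integrable_continuous_real)
    show "continuous_on (UNIV \<times> cbox a b) (\<lambda>(y, t). B y t)" using cB by simp
  qed auto
  moreover have "blinfun_apply (integral (cbox a b) (B y)) h = (\<Sum>j\<in>UNIV. h $ j *\<^sub>R integral {a..b} (F' j y))" for h
  proof -
    have "blinfun_apply (integral (cbox a b) (B y)) h = integral (cbox a b) (\<lambda>t. blinfun_apply (B y t) h)"
      by (rule blinfun_apply_integral) (use iB in simp)
    also have "\<dots> = integral {a..b} (\<lambda>t. \<Sum>j\<in>UNIV. h $ j *\<^sub>R F' j y t)" by (simp add: B)
    also have "\<dots> = (\<Sum>j\<in>UNIV. integral {a..b} (\<lambda>t. h $ j *\<^sub>R F' j y t))"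
    proof (rule integral_sum)
      fix j
      show "(\<lambda>t. h $ j *\<^sub>R F' j y t) integrable_on {a..b}"
        using slice[OF c'[of j], of y] by (intro integrable_continuous_real continuous_intros) simp
    qed auto
    finally show ?thesis by simp
  qed
  then have "blinfun_apply (integral (cbox a b) (B y)) = (\<lambda>h. \<Sum>j\<in>UNIV. h $ j *\<^sub>R integral {a..b} (F' j y))"
    by (rule ext)
  ultimately show ?thesis by simp
qed

definition upd :: "real ^ 'n \<Rightarrow> 'n \<Rightarrow> real \<Rightarrow> real ^ 'n" where
  "upd y i t = (\<chi> j. if j = i then t else y $ j)"

lemma upd_nth [simp]: "upd y i t $ j = (if j = i then t else y $ j)"
  by (simp add: upd_def)

lemma upd_same [simp]: "upd y i (y $ i) = y"
  by (simp add: vec_eq_iff)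

lemma upd_upd [simp]: "upd (upd y i s) i t = upd y i t"
  by (simp add: vec_eq_iff)

lemma upd_commute: "i \<noteq> j \<Longrightarrow> upd (upd y i s) j t = upd (upd y j t) i s"
  by (simp add: vec_eq_iff)

lemma upd_eq_axis: "upd y i t = upd y i 0 + t *\<^sub>R axis i 1"
  by (auto simp: vec_eq_iff axis_def)

lemma continuous_on_upd [continuous_intros]:
  fixes f :: "'a::topological_space \<Rightarrow> real ^ 'n::finite"
  assumes "continuous_on S f" "continuous_on S g"
  shows "continuous_on S (\<lambda>x. upd (f x) i (g x))"
proof -
  have "continuous_on S (\<lambda>x. if j = i then g x else f x $ j)" for j
    using assms by (cases "j = i") (auto intro: continuous_intros)
  then show ?thesis unfolding upd_def by (rule continuous_on_vec_lambda)
qed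

lemma has_derivative_upd: "((\<lambda>y. upd y i t) has_derivative (\<lambda>h. upd h i 0)) (at (y :: real ^ 'n::finite))"
proof -
  have *: "upd y i t = (y - y $ i *\<^sub>R axis i 1) + t *\<^sub>R axis i 1" for y :: "real ^ 'n" and t
    by (auto simp: vec_eq_iff axis_def)
  have "((\<lambda>y. (y - y $ i *\<^sub>R axis i 1) + t *\<^sub>R axis i 1) has_derivative (\<lambda>h. (h - h $ i *\<^sub>R axis i 1) + 0)) (at y)"
    by (intro has_derivative_add has_derivative_diff has_derivative_ident has_derivative_const
        bounded_linear_imp_has_derivative bounded_linear_compose[OF bounded_linear_scaleR_left bounded_linear_vec_nth])
  then show ?thesis unfolding *[abs_def] by simp
qed

text \<open>The k-th Fourier mode in the i-th variable, kept as a function on the whole space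
  instead of a coefficient: projections in several variables then compose, and jets apply to every
  intermediate stage.\<close>

definition fproj :: "'n::finite \<Rightarrow> int \<Rightarrow> 'n cfun \<Rightarrow> 'n cfun" where
  "fproj i k g y = integral {-pi..pi} (\<lambda>t. g (upd y i t) * cis (of_int k * (y $ i - t))) / (2 * of_real pi)"

text \<open>The bound 3 lies below pi: the function vanishes near the ends of the period, so
  integration by parts over the period has no boundary terms.\<close>

definition vanishes_beyond :: "'n::finite \<Rightarrow> 'n cfun \<Rightarrow> bool" where
  "vanishes_beyond i g \<longleftrightarrow> (\<forall>y. \<bar>y $ i\<bar> > 3 \<longrightarrow> g y = 0)"

lemma fproj_eq_fourier_coeff:
  "fproj i k g y = fourier_coeff (\<lambda>t. g (upd y i t)) k * cis (of_int k * y $ i)"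
proof -
  have "g (upd y i t) * cis (of_int k * (y $ i - t)) = g (upd y i t) * cis (- of_int k * t) * cis (of_int k * y $ i)" for t
    by (simp add: mult.assoc cis_mult algebra_simps)
  then have "integral {-pi..pi} (\<lambda>t. g (upd y i t) * cis (of_int k * (y $ i - t)))
      = integral {-pi..pi} (\<lambda>t. g (upd y i t) * cis (- of_int k * t)) * cis (of_int k * y $ i)"
    by (simp only: integral_mult_left)
  then show ?thesis by (simp add: fproj_def fourier_coeff_def)
qed

lemma fproj_homogeneous: "fproj i k g y = cis (of_int k * (y $ i - t)) * fproj i k g (upd y i t)"
  by (simp add: fproj_eq_fourier_coeff cis_mult algebra_simps)

lemma continuous_upd_smooth:
  assumes "g \<in> smooth_on UNIV"
  shows "continuous_on S (\<lambda>t. g (upd y i t))" "continuous_on (UNIV \<times> T) (\<lambda>(y, t). g (upd y i t))"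
proof -
  show "continuous_on S (\<lambda>t. g (upd y i t))"
    by (rule continuous_on_compose2[OF smooth_on_continuous_on[OF assms]]) (auto intro!: continuous_intros)
  show "continuous_on (UNIV \<times> T) (\<lambda>(y, t). g (upd y i t))"
    unfolding case_prod_unfold
    by (rule continuous_on_compose2[OF smooth_on_continuous_on[OF assms]]) (auto intro!: continuous_intros)
qed

lemma vanishes_beyond_partial:
  assumes "vanishes_beyond i g"
  shows "vanishes_beyond i (partial j g)"
  unfolding vanishes_beyond_def
proof (intro allI impI)
  fix y :: "real ^ 'a" assume y: "\<bar>y $ i\<bar> > 3"
  have "open {y :: real ^ 'a. \<bar>y $ i\<bar> > 3}"
    by (intro open_Collect_less continuous_intros)
  then have "partial j g y = partial j (\<lambda>_. 0) y"
    by (rule partial_cong) (use y assms in \<open>auto simp: vanishes_beyond_def\<close>)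
  then show "partial j g y = 0" by simp
qed

text \<open>Integration by parts in the i-th variable; the boundary terms at -pi and pi vanish
  because 3 < pi.\<close>

lemma fproj_partial_self:
  fixes g :: "'n::finite cfun"
  assumes g: "g \<in> smooth_on UNIV" and v: "vanishes_beyond i g"
  shows "fproj i k (partial i g) y = \<i> * of_int k * fproj i k g y"
proof -
  let ?F = "\<lambda>t. g (upd y i t) * cis (of_int k * (y $ i - t))"
  let ?e = "\<lambda>t. cis (of_int k * (y $ i - t))"
  have "((\<lambda>t. g (upd y i t) * (- \<i> * of_int k * ?e t) + partial i g (upd y i t) * ?e t) has_integral (?F pi - ?F (-pi))) {-pi..pi}"
  proof (rule fundamental_theorem_of_calculus)
    fix t assume "t \<in> {-pi..pi}"
    have "((\<lambda>t. g (upd y i 0 + t *\<^sub>R axis i 1)) has_vector_derivative partial i g (upd y i 0 + t *\<^sub>R axis i 1)) (at t within {-pi..pi})"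
      by (rule has_vector_derivative_along_axis) (use g smooth_on_differentiable in blast)
    then have 1: "((\<lambda>t. g (upd y i t)) has_vector_derivative partial i g (upd y i t)) (at t within {-pi..pi})"
      by (simp add: upd_eq_axis[symmetric])
    have 2: "(?e has_vector_derivative (- \<i> * of_int k * ?e t)) (at t within {-pi..pi})"
      by (auto intro!: derivative_eq_intros simp: has_vector_derivative_def scaleR_conv_of_real algebra_simps)
    show "(?F has_vector_derivative (g (upd y i t) * (- \<i> * of_int k * ?e t) + partial i g (upd y i t) * ?e t)) (at t within {-pi..pi})"
      by (rule has_vector_derivative_mult[OF 1 2])
  qed simp
  moreover have "?F pi - ?F (-pi) = 0"
    using v pi_gt3 by (simp add: vanishes_beyond_def)
  ultimately have "integral {-pi..pi} (\<lambda>t. g (upd y i t) * (- \<i> * of_int k * ?e t) + partial i g (upd y i t) * ?e t) = 0"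
    by (simp add: integral_unique)
  moreover have "integral {-pi..pi} (\<lambda>t. (- \<i> * of_int k) * ?F t + partial i g (upd y i t) * ?e t)
      = (- \<i> * of_int k) * integral {-pi..pi} ?F + integral {-pi..pi} (\<lambda>t. partial i g (upd y i t) * ?e t)"
    by (subst integral_add)
      (auto intro!: integrable_continuous_real continuous_intros continuous_upd_smooth smooth_on_partial g)
  ultimately have "(- \<i> * of_int k) * integral {-pi..pi} ?F + integral {-pi..pi} (\<lambda>t. partial i g (upd y i t) * ?e t) = 0"
    by (simp add: mult_ac)
  then have "integral {-pi..pi} (\<lambda>t. partial i g (upd y i t) * ?e t) = \<i> * of_int k * integral {-pi..pi} ?F"
    by (simp add: algebra_simps)
  then show ?thesis by (simp add: fproj_def)
qed

lemma has_derivative_fproj: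
  fixes g :: "'n::finite cfun"
  assumes g: "g \<in> smooth_on UNIV" and v: "vanishes_beyond i g"
  shows "(fproj i k g has_derivative (\<lambda>h. \<Sum>j\<in>UNIV. h $ j *\<^sub>R fproj i k (partial j g) y)) (at y)"
proof -
  let ?e = "\<lambda>y t. cis (of_int k * (y $ i - t))"
  \<comment> \<open>In direction \<open>i\<close> only the exponential depends on \<open>y\<close>,
    since \<open>upd\<close> overwrites that coordinate of the argument of \<open>g\<close>.
    \<open>fproj_partial_self\<close> later brings this case into the same form as the other
    directions.\<close>
  define F' where "F' j y t = (if j = i then \<i> * of_int k * g (upd y i t) * ?e y t else partial j g (upd y i t) * ?e y t)" for j y t
  have "((\<lambda>y. integral {-pi..pi} (\<lambda>t. g (upd y i t) * ?e y t)) has_derivative (\<lambda>h. \<Sum>j\<in>UNIV. h $ j *\<^sub>R integral {-pi..pi} (F' j y))) (at y)"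
  proof (rule has_derivative_integral_param)
    fix y :: "real ^ 'n" and t :: real
    have "(g has_derivative (\<lambda>h. \<Sum>j\<in>UNIV. h $ j *\<^sub>R partial j g (upd y i t))) (at (upd y i t))"
      by (rule has_derivative_partial) (use g smooth_on_differentiable in blast)
    from has_derivative_compose[OF has_derivative_upd this]
    have 1: "((\<lambda>y. g (upd y i t)) has_derivative (\<lambda>h. \<Sum>j\<in>UNIV. upd h i 0 $ j *\<^sub>R partial j g (upd y i t))) (at y)" .
    have 2: "((\<lambda>y. ?e y t) has_derivative (\<lambda>h. (of_int k * h $ i) *\<^sub>R (\<i> * ?e y t))) (at y)"
      by (auto intro!: derivative_eq_intros bounded_linear_imp_has_derivative[OF bounded_linear_vec_nth])
    have "(\<lambda>h. g (upd y i t) * ((of_int k * h $ i) *\<^sub>R (\<i> * ?e y t)) + (\<Sum>j\<in>UNIV. upd h i 0 $ j *\<^sub>R partial j g (upd y i t)) * ?e y t)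
        = (\<lambda>h. \<Sum>j\<in>UNIV. h $ j *\<^sub>R F' j y t)"
    proof
      fix h :: "real ^ 'n"
      have "(\<Sum>j\<in>UNIV. h $ j *\<^sub>R F' j y t) = h $ i *\<^sub>R F' i y t + (\<Sum>j\<in>UNIV - {i}. h $ j *\<^sub>R F' j y t)"
        by (rule sum.remove) auto
      also have "(\<Sum>j\<in>UNIV - {i}. h $ j *\<^sub>R F' j y t) = (\<Sum>j\<in>UNIV - {i}. upd h i 0 $ j *\<^sub>R partial j g (upd y i t) * ?e y t)"
        by (intro sum.cong) (auto simp: F'_def)
      also have "\<dots> = (\<Sum>j\<in>UNIV. upd h i 0 $ j *\<^sub>R partial j g (upd y i t) * ?e y t)"
        by (subst (2) sum.remove[of _ i]) auto
      finally show "g (upd y i t) * ((of_int k * h $ i) *\<^sub>R (\<i> * ?e y t)) + (\<Sum>j\<in>UNIV. upd h i 0 $ j *\<^sub>R partial j g (upd y i t)) * ?e y t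
          = (\<Sum>j\<in>UNIV. h $ j *\<^sub>R F' j y t)"
        by (simp only: sum_distrib_right[symmetric]) (simp add: F'_def scaleR_conv_of_real mult_ac)
    qed
    with has_derivative_mult[OF 1 2]
    show "((\<lambda>y. g (upd y i t) * ?e y t) has_derivative (\<lambda>h. \<Sum>j\<in>UNIV. h $ j *\<^sub>R F' j y t)) (at y)"
      by simp
  next
    fix y :: "real ^ 'n"
    show "continuous_on {-pi..pi} (\<lambda>t. g (upd y i t) * ?e y t)"
      by (intro continuous_intros continuous_upd_smooth g)
  next
    fix j
    show "continuous_on (UNIV \<times> {-pi..pi}) (\<lambda>(y, t). F' j y t)"
      using continuous_upd_smooth(2)[OF g, of "{-pi..pi}" i]
        continuous_upd_smooth(2)[OF smooth_on_partial[OF g], of "{-pi..pi}" j i]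
      by (cases "j = i") (auto simp: F'_def case_prod_unfold intro!: continuous_intros)
  qed
  then have "((\<lambda>y. integral {-pi..pi} (\<lambda>t. g (upd y i t) * ?e y t) * (1 / (2 * of_real pi))) has_derivative
      (\<lambda>h. (\<Sum>j\<in>UNIV. h $ j *\<^sub>R integral {-pi..pi} (F' j y)) * (1 / (2 * of_real pi)))) (at y)"
    by (rule has_derivative_mult_left)
  moreover have "integral {-pi..pi} (F' j y) * (1 / (2 * of_real pi)) = fproj i k (partial j g) y" for j
  proof (cases "j = i")
    case True
    have "F' i y = (\<lambda>t. \<i> * of_int k * (g (upd y i t) * ?e y t))" by (simp add: F'_def fun_eq_iff)
    then show ?thesis using fproj_partial_self[OF g v, of k y] True
      by (simp add: fproj_def)
  next
    case False
    then have "F' j y = (\<lambda>t. partial j g (upd y i t) * ?e y t)" by (simp add: F'_def fun_eq_iff)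
    then show ?thesis by (simp add: fproj_def)
  qed
  then have "(\<lambda>h. (\<Sum>j\<in>UNIV. h $ j *\<^sub>R integral {-pi..pi} (F' j y)) * (1 / (2 * of_real pi))) = (\<lambda>h. \<Sum>j\<in>UNIV. h $ j *\<^sub>R fproj i k (partial j g) y)"
    by (intro ext) (simp only: sum_distrib_right mult_scaleR_left)
  moreover have "(\<lambda>y. integral {-pi..pi} (\<lambda>t. g (upd y i t) * ?e y t) * (1 / (2 * of_real pi))) = fproj i k g"
    by (simp add: fproj_def fun_eq_iff)
  ultimately show ?thesis by simp
qed

lemma partial_fproj:
  assumes g: "g \<in> smooth_on UNIV" and v: "vanishes_beyond i g"
  shows "partial j (fproj i k g) = fproj i k (partial j g)"
proof
  fix y
  have "partial j (fproj i k g) y = (\<Sum>l\<in>UNIV. axis j 1 $ l *\<^sub>R fproj i k (partial l g) y)"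
    by (rule partial_eq[OF has_derivative_fproj[OF assms]])
  also have "\<dots> = (\<Sum>l\<in>UNIV. if l = j then fproj i k (partial l g) y else 0)"
    by (intro sum.cong) (auto simp: axis_def)
  finally show "partial j (fproj i k g) y = fproj i k (partial j g) y" by simp
qed

lemma fproj_smooth:
  assumes "g \<in> smooth_on UNIV" "vanishes_beyond i g"
  shows "fproj i k g \<in> smooth_on UNIV"
proof (rule smooth_on_coinduct[of UNIV _ "{fproj i k g |g. g \<in> smooth_on UNIV \<and> vanishes_beyond i g}"])
  fix f assume "f \<in> {fproj i k g |g. g \<in> smooth_on UNIV \<and> vanishes_beyond i g}"
  then obtain g where g: "f = fproj i k g" "g \<in> smooth_on UNIV" "vanishes_beyond i g" by blast
  show "f differentiable_on UNIV"
    using has_derivative_fproj[OF g(2,3)] g(1) by (auto simp: differentiable_on_def differentiable_def)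
  show "\<exists>g\<in>{fproj i k g |g. g \<in> smooth_on UNIV \<and> vanishes_beyond i g}. \<forall>x\<in>UNIV. partial j f x = g x" for j
    using partial_fproj[OF g(2,3), of j k] g smooth_on_partial vanishes_beyond_partial by fastforce
qed (use assms in auto)

lemma jet_continuous_on: "f \<in> smooth_on \<Omega> \<Longrightarrow> continuous_on \<Omega> (jet k f)"
proof (induction k arbitrary: f)
  case 0
  then show ?case by (auto intro!: continuous_intros dest: smooth_on_continuous_on)
next
  case (Suc k)
  have "continuous_on \<Omega> (\<lambda>x. norm (f x) + (\<Sum>i\<in>UNIV. jet k (partial i f) x))"
    by (intro continuous_intros Suc.IH smooth_on_partial Suc.prems smooth_on_continuous_on)
  then show ?case by (simp cong: continuous_on_cong)
qed

lemma jet_upd_integrable: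
  assumes "g \<in> smooth_on UNIV"
  shows "(\<lambda>t. jet N g (upd y i t)) integrable_on {a..b::real}"
  by (intro integrable_continuous_real continuous_on_compose2[OF jet_continuous_on[OF assms]])
    (auto intro!: continuous_intros)

text \<open>Partial derivatives pass through the projection, which is an average over a line against
  a factor of modulus 1.\<close>

lemma jet_fproj_le_integral:
  fixes g :: "'n::finite cfun"
  assumes "g \<in> smooth_on UNIV" "vanishes_beyond i g"
  shows "jet N (fproj i k g) y \<le> integral {-pi..pi} (\<lambda>t. jet N g (upd y i t)) / (2 * pi)"
  using assms
proof (induction N arbitrary: g)
  case 0
  have "norm (integral {-pi..pi} (\<lambda>t. g (upd y i t) * cis (of_int k * (y $ i - t)))) \<le> integral {-pi..pi} (\<lambda>t. norm (g (upd y i t)))"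
    by (rule integral_norm_bound_integral)
      (auto intro!: integrable_continuous_real continuous_intros continuous_upd_smooth 0 simp: norm_mult)
  then show ?case by (simp add: fproj_def norm_divide divide_right_mono)
next
  case (Suc N)
  have 0: "norm (integral {-pi..pi} (\<lambda>t. g (upd y i t) * cis (of_int k * (y $ i - t)))) \<le> integral {-pi..pi} (\<lambda>t. norm (g (upd y i t)))"
    by (rule integral_norm_bound_integral)
      (auto intro!: integrable_continuous_real continuous_intros continuous_upd_smooth Suc.prems simp: norm_mult)
  have "jet (Suc N) (fproj i k g) y = norm (fproj i k g y) + (\<Sum>j\<in>UNIV. jet N (fproj i k (partial j g)) y)"
    by (simp add: partial_fproj[OF Suc.prems])
  also have "\<dots> \<le> integral {-pi..pi} (\<lambda>t. norm (g (upd y i t))) / (2 * pi)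
      + (\<Sum>j\<in>UNIV. integral {-pi..pi} (\<lambda>t. jet N (partial j g) (upd y i t)) / (2 * pi))"
    by (intro add_mono sum_mono Suc.IH smooth_on_partial vanishes_beyond_partial Suc.prems)
      (use 0 in \<open>simp add: fproj_def norm_divide divide_right_mono\<close>)
  also have "\<dots> = integral {-pi..pi} (\<lambda>t. norm (g (upd y i t)) + (\<Sum>j\<in>UNIV. jet N (partial j g) (upd y i t))) / (2 * pi)"
  proof -
    have "(\<lambda>t. norm (g (upd y i t))) integrable_on {-pi..pi}"
      using jet_upd_integrable[OF Suc.prems(1), of 0] by simp
    moreover have J: "(\<lambda>t. jet N (partial j g) (upd y i t)) integrable_on {-pi..pi}" for j
      by (rule jet_upd_integrable[OF smooth_on_partial[OF Suc.prems(1)]])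
    ultimately show ?thesis
      by (simp add: integral_add integral_sum integrable_sum add_divide_distrib sum_divide_distrib)
  qed
  finally show ?case by simp
qed

lemma jet_fproj_le:
  assumes "g \<in> smooth_on UNIV" "vanishes_beyond i g" "\<And>y. jet N g y \<le> A"
  shows "jet N (fproj i k g) y \<le> A"
proof -
  have "integral {-pi..pi} (\<lambda>t. jet N g (upd y i t)) \<le> integral {-pi..pi} (\<lambda>t. A)"
    by (rule integral_le) (use assms jet_upd_integrable in auto)
  then have "integral {-pi..pi} (\<lambda>t. jet N g (upd y i t)) / (2 * pi) \<le> A"
    by (simp add: divide_le_eq mult.commute)
  then show ?thesis
    using jet_fproj_le_integral[OF assms(1,2), of N k y] by linarith
qed

text \<open>Each derivative in direction \<open>i\<close> multiplies the mode by \<i> k, so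
  \<open>s\<close> derivatives buy \<open>s\<close> powers of |k|. Away from k = 0 one has 1 + |k|
  \<le> 2 |k|, whence the factor \<open>2 ^ s\<close>.\<close>

lemma jet_fproj_decay:
  fixes g :: "'n::finite cfun"
  assumes "g \<in> smooth_on UNIV" "vanishes_beyond i g" "\<And>y. jet (N + s) g y \<le> A"
  shows "jet N (fproj i k g) y * (1 + \<bar>of_int k\<bar>) ^ s \<le> 2 ^ s * A"
proof (cases "k = 0")
  case True
  have "jet N (fproj i k g) y \<le> A"
    by (rule jet_fproj_le[OF assms(1,2)]) (use assms(3) jet_mono[of N "N + s" g] order_trans in fastforce)
  moreover have "A \<ge> 0" using assms(3)[of 0] jet_nonneg[of "N + s" g 0] by linarith
  ultimately show ?thesis using True mult_mono[of 1 "2 ^ s" "jet N (fproj i k g) y" A] by simp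
next
  case False
  have v: "vanishes_beyond i ((partial i ^^ s) g)" for s
    using assms(2) by (induction s) (auto intro: vanishes_beyond_partial)
  have sm: "(partial i ^^ s) g \<in> smooth_on UNIV" for s
    by (rule funpow_partial_smooth[OF assms(1)])
  have eq: "fproj i k ((partial i ^^ s) g) = (\<lambda>y. (\<i> * of_int k) ^ s * fproj i k g y)" for s
    by (induction s) (auto simp: fproj_partial_self[OF sm v] fun_eq_iff mult.assoc)
  have "\<bar>of_int k\<bar> ^ s * jet N (fproj i k g) y = jet N (fproj i k ((partial i ^^ s) g)) y"
    unfolding eq using jet_cmult[OF open_UNIV UNIV_I fproj_smooth[OF assms(1,2)], of N "(\<i> * of_int k) ^ s" k y]
    by (simp add: norm_power norm_mult)
  also have "\<dots> \<le> A"
    by (rule jet_fproj_le[OF sm v]) (use assms(3) jet_funpow_partial[where k = N and i = i and n = s and f = g] order_trans in fastforce)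
  finally have *: "\<bar>of_int k\<bar> ^ s * jet N (fproj i k g) y \<le> A" .
  have "(1 + \<bar>of_int k\<bar>) ^ s \<le> (2 * \<bar>real_of_int k\<bar>) ^ s"
    using False by (intro power_mono) auto
  then have "jet N (fproj i k g) y * (1 + \<bar>of_int k\<bar>) ^ s \<le> jet N (fproj i k g) y * (2 * \<bar>real_of_int k\<bar>) ^ s"
    by (intro mult_left_mono) auto
  also have "\<dots> = 2 ^ s * (\<bar>of_int k\<bar> ^ s * jet N (fproj i k g) y)"
    by (simp add: power_mult_distrib)
  also have "\<dots> \<le> 2 ^ s * A" using * by (intro mult_left_mono) auto
  finally show ?thesis .
qed

subsection \<open>Fourier expansion of smooth functions supported in a cube\<close>

lemma summable_on_inverse_square_int: "(\<lambda>k::int. 1 / (1 + \<bar>real_of_int k\<bar>) ^ 2) summable_on UNIV"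
proof -
  have "summable (\<lambda>n. 1 / real (Suc n) ^ 2)"
    using inverse_power_summable[of 2, where 'a = real] unfolding summable_Suc_iff[symmetric, of "\<lambda>n. inverse (real n ^ 2)"]
    by (simp add: divide_inverse power_inverse)
  then have 1: "(\<lambda>n. 1 / (1 + real n) ^ 2) summable_on UNIV"
    by (intro summable_nonneg_imp_summable_on) (auto simp: add.commute)
  have 2: "(\<lambda>k::int. 1 / (1 + \<bar>real_of_int k\<bar>) ^ 2) summable_on range int"
    using 1 by (subst summable_on_reindex) (auto simp: o_def)
  have 3: "(\<lambda>k::int. 1 / (1 + \<bar>real_of_int k\<bar>) ^ 2) summable_on (\<lambda>n. - int n) ` {1..}"
  proof (subst summable_on_reindex)
    show "(\<lambda>k::int. 1 / (1 + \<bar>real_of_int k\<bar>) ^ 2) \<circ> (\<lambda>n. - int n) summable_on {1..}"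
      using summable_on_subset_banach[OF 1, of "{1..}"] by (simp add: o_def)
  qed (auto simp: inj_on_def)
  have "range int \<inter> (\<lambda>n. - int n) ` {1..} = {}" by auto
  moreover have "(UNIV :: int set) = range int \<union> (\<lambda>n. - int n) ` {1..}"
  proof -
    have "k \<in> range int \<union> (\<lambda>n. - int n) ` {1..}" for k :: int
    proof (cases "k \<ge> 0")
      case True then show ?thesis by (metis UnI1 nonneg_int_cases rangeI)
    next
      case False
      then have "k = - int (nat (- k))" "nat (- k) \<in> {1..}" by auto
      then show ?thesis by blast
    qed
    then show ?thesis by blast
  qed
  ultimately show ?thesis using summable_on_Un_disjoint[OF 2 3] by simp
qed

text \<open>Zero entries outside \<open>J\<close> give every tuple over \<open>J\<close> exactly one
  representative, so sums over the lattice can be built up one coordinate at a time.\<close>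

definition lattice_on :: "'n set \<Rightarrow> ('n \<Rightarrow> int) set" where
  "lattice_on J = {\<kappa>. \<forall>i. i \<notin> J \<longrightarrow> \<kappa> i = 0}"

lemma bij_betw_lattice_insert:
  assumes "i \<notin> J"
  shows "bij_betw (\<lambda>(\<kappa>, k). \<kappa>(i := k)) (lattice_on J \<times> UNIV) (lattice_on (insert i J))"
proof (rule bij_betwI[where g = "\<lambda>\<kappa>. (\<kappa>(i := 0), \<kappa> i)"])
  show "(\<lambda>(\<kappa>, k). \<kappa>(i := k)) \<in> lattice_on J \<times> UNIV \<rightarrow> lattice_on (insert i J)"
    by (auto simp: lattice_on_def)
qed (use assms in \<open>auto simp: lattice_on_def\<close>)

lemma summable_on_lattice:
  assumes "finite J"
  shows "(\<lambda>\<kappa>. \<Prod>i\<in>J. 1 / (1 + \<bar>real_of_int (\<kappa> i)\<bar>) ^ 2) summable_on lattice_on J"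
  using assms
proof (induction J rule: finite_induct)
  case empty
  have "lattice_on {} = {\<lambda>_::'a. 0}" by (auto simp: lattice_on_def)
  then show ?case by simp
next
  case (insert i J)
  let ?w = "\<lambda>k::int. 1 / (1 + \<bar>real_of_int k\<bar>) ^ 2"
  have "(\<lambda>p. (\<Prod>j\<in>J. ?w (fst p j)) * ?w (snd p)) summable_on (lattice_on J \<times> UNIV)"
  proof (rule summable_on_SigmaI)
    show "((\<lambda>y. (\<Prod>j\<in>J. ?w (fst (\<kappa>, y) j)) * ?w (snd (\<kappa>, y))) has_sum (\<Prod>j\<in>J. ?w (\<kappa> j)) * infsum ?w UNIV) UNIV" for \<kappa>
      unfolding fst_conv snd_conv
      by (intro has_sum_cmult_right has_sum_infsum summable_on_inverse_square_int)
    show "(\<lambda>\<kappa>. (\<Prod>j\<in>J. ?w (\<kappa> j)) * infsum ?w UNIV) summable_on lattice_on J"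
      using insert.IH by (rule summable_on_cmult_left)
  qed (auto intro!: divide_nonneg_nonneg prod_nonneg)
  also have "(\<lambda>p. (\<Prod>j\<in>J. ?w (fst p j)) * ?w (snd p)) = (\<lambda>p. \<Prod>j\<in>insert i J. ?w ((case p of (\<kappa>, k) \<Rightarrow> \<kappa>(i := k)) j))"
  proof
    fix p :: "('a \<Rightarrow> int) \<times> int"
    have "(\<Prod>j\<in>J. ?w (fst p j)) = (\<Prod>j\<in>J. ?w ((case p of (\<kappa>, k) \<Rightarrow> \<kappa>(i := k)) j))"
      using insert.hyps by (intro prod.cong) (auto split: prod.splits)
    then show "(\<Prod>j\<in>J. ?w (fst p j)) * ?w (snd p) = (\<Prod>j\<in>insert i J. ?w ((case p of (\<kappa>, k) \<Rightarrow> \<kappa>(i := k)) j))"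
      using insert.hyps by (auto split: prod.splits)
  qed
  finally show ?case
    by (subst (asm) summable_on_reindex_bij_betw[OF bij_betw_lattice_insert[OF insert.hyps(2)]])
qed

definition fproj_list :: "'n::finite list \<Rightarrow> ('n \<Rightarrow> int) \<Rightarrow> 'n cfun \<Rightarrow> 'n cfun" where
  "fproj_list js \<kappa> g = foldr (\<lambda>i. fproj i (\<kappa> i)) js g"

lemma fproj_list_simps [simp]:
  "fproj_list [] \<kappa> g = g"
  "fproj_list (i # js) \<kappa> g = fproj i (\<kappa> i) (fproj_list js \<kappa> g)"
  by (simp_all add: fproj_list_def)

lemma vanishes_beyond_fproj: "j \<noteq> i \<Longrightarrow> vanishes_beyond j g \<Longrightarrow> vanishes_beyond j (fproj i k g)"
  by (auto simp: vanishes_beyond_def fproj_def)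

text \<open>A projection in direction \<open>i\<close> makes the function periodic there and so
  destroys its vanishing, but only in that direction. Distinctness of the list keeps the next
  projection admissible.\<close>

lemma fproj_list_smooth_vanishes:
  assumes "g \<in> smooth_on UNIV" "\<And>i. vanishes_beyond i g" "distinct js"
  shows "fproj_list js \<kappa> g \<in> smooth_on UNIV \<and> (\<forall>i. i \<notin> set js \<longrightarrow> vanishes_beyond i (fproj_list js \<kappa> g))"
  using assms(3) by (induction js) (use assms in \<open>auto intro: fproj_smooth vanishes_beyond_fproj\<close>)

text \<open>Every coordinate consumes \<open>s\<close> derivatives. The induction varies
  \<open>N\<close>, because the outer projection needs \<open>s\<close> further derivatives of what
  the inner ones produced.\<close>

lemma jet_fproj_list_decay:
  assumes g: "g \<in> smooth_on UNIV" "\<And>i. vanishes_beyond i g" and js: "distinct js"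
    and A: "\<And>y. jet (N + s * length js) g y \<le> A"
  shows "jet N (fproj_list js \<kappa> g) y * (\<Prod>i\<in>set js. (1 + \<bar>real_of_int (\<kappa> i)\<bar>) ^ s) \<le> 2 ^ (s * length js) * A"
  using js A
proof (induction js arbitrary: N y)
  case (Cons i js)
  let ?h = "fproj_list js \<kappa> g" and ?W = "\<Prod>i\<in>set js. (1 + \<bar>real_of_int (\<kappa> i)\<bar>) ^ s"
  have W: "?W > 0" by (intro prod_pos) auto
  have h: "?h \<in> smooth_on UNIV" "vanishes_beyond i ?h"
    using fproj_list_smooth_vanishes[OF g, of js \<kappa>] Cons.prems by auto
  have "jet (N + s) ?h y * ?W \<le> 2 ^ (s * length js) * A" for y
    by (rule Cons.IH) (use Cons.prems in \<open>auto simp: algebra_simps\<close>)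
  then have "jet (N + s) ?h y \<le> 2 ^ (s * length js) * A / ?W" for y
    using W by (simp add: pos_le_divide_eq)
  then have "jet N (fproj i (\<kappa> i) ?h) y * (1 + \<bar>of_int (\<kappa> i)\<bar>) ^ s \<le> 2 ^ s * (2 ^ (s * length js) * A / ?W)"
    by (rule jet_fproj_decay[OF h])
  then have "jet N (fproj i (\<kappa> i) ?h) y * (1 + \<bar>of_int (\<kappa> i)\<bar>) ^ s * ?W \<le> 2 ^ s * (2 ^ (s * length js) * A)"
    using W by (simp add: pos_le_divide_eq)
  then show ?case using Cons.prems by (simp add: power_add mult_ac)
qed simp

lemma bounded_jet:
  fixes g :: "'n::finite cfun"
  assumes g: "g \<in> smooth_on UNIV" "\<And>i. vanishes_beyond i g"
  obtains A where "\<And>y. jet N g y \<le> A"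
proof -
  let ?Q = "cbox (\<chi> i. -3) (\<chi> i. 3) :: (real ^ 'n) set"
  have "bounded (jet N g ` ?Q)"
    by (intro compact_imp_bounded compact_continuous_image compact_cbox continuous_on_subset[OF jet_continuous_on[OF g(1)]]) auto
  then obtain A where A: "\<And>y. y \<in> ?Q \<Longrightarrow> norm (jet N g y) \<le> A" by (auto simp: bounded_iff)
  have "jet N g y \<le> max A 0" for y
  proof (cases "y \<in> ?Q")
    case True then show ?thesis using A[of y] by auto
  next
    case False
    then obtain i where "y $ i < -3 \<or> y $ i > 3" by (auto simp: mem_box_cart not_le)
    then have i: "\<bar>y $ i\<bar> > 3" by auto
    have "open {y :: real ^ 'n. \<bar>y $ i\<bar> > 3}"
      by (intro open_Collect_less continuous_intros)
    then have "jet N g y = jet N (\<lambda>_. 0) y"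
      by (rule jet_cong) (use i g(2) in \<open>auto simp: vanishes_beyond_def\<close>)
    then show ?thesis by simp
  qed
  then show ?thesis by (rule that)
qed

lemma fproj_has_sum:
  fixes h :: "'n::finite cfun"
  assumes h: "h \<in> smooth_on UNIV" "vanishes_beyond i h" and A: "\<And>y. jet 2 h y \<le> A" and y: "\<bar>y $ i\<bar> < pi"
  shows "((\<lambda>k. fproj i k h y) has_sum h y) UNIV"
proof -
  let ?f = "\<lambda>t. h (upd y i t)"
  have "((\<lambda>k. fourier_coeff ?f k * cis (of_int k * y $ i)) has_sum ?f (y $ i)) UNIV"
  proof (rule fourier_series_has_sum[OF _ _ y])
    show "continuous_on {-pi..pi} ?f" by (rule continuous_upd_smooth(1)[OF h(1)])
    have "((\<lambda>t. h (upd y i 0 + t *\<^sub>R axis i 1)) has_vector_derivative partial i h (upd y i 0 + (y $ i) *\<^sub>R axis i 1)) (at (y $ i))"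
      by (rule has_vector_derivative_along_axis) (use h smooth_on_differentiable in blast)
    then show "(?f has_vector_derivative partial i h y) (at (y $ i))"
      by (simp add: upd_eq_axis[symmetric])
    show "(\<lambda>k. norm (fourier_coeff ?f k)) summable_on UNIV"
    proof (rule summable_on_comparison_test)
      show "(\<lambda>k::int. 4 * A * (1 / (1 + \<bar>real_of_int k\<bar>) ^ 2)) summable_on UNIV"
        by (rule summable_on_cmult_right[OF summable_on_inverse_square_int])
      fix k :: int
      have "norm (fourier_coeff ?f k) = jet 0 (fproj i k h) y"
        by (simp add: fproj_eq_fourier_coeff norm_mult)
      moreover have "jet 0 (fproj i k h) y * (1 + \<bar>of_int k\<bar>) ^ 2 \<le> 2 ^ 2 * A"
        using A by (intro jet_fproj_decay[OF h]) (simp only: add_0)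
      ultimately show "norm (fourier_coeff ?f k) \<le> 4 * A * (1 / (1 + \<bar>real_of_int k\<bar>) ^ 2)"
        by (simp add: pos_le_divide_eq add_pos_nonneg)
    qed simp
  qed
  then show ?thesis by (simp add: fproj_eq_fourier_coeff)
qed

lemma fproj_list_cong:
  "(\<And>i. i \<in> set js \<Longrightarrow> \<kappa> i = \<kappa>' i) \<Longrightarrow> fproj_list js \<kappa> g = fproj_list js \<kappa>' g"
  by (induction js) auto

lemma fproj_list_has_sum:
  fixes g :: "'n::finite cfun"
  assumes g: "g \<in> smooth_on UNIV" "\<And>i. vanishes_beyond i g" and y: "\<And>i. \<bar>y $ i\<bar> < pi"
    and js: "distinct js"
  shows "((\<lambda>\<kappa>. fproj_list js \<kappa> g y) has_sum g y) (lattice_on (set js))"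
  using js
proof (induction js)
  case Nil
  have "lattice_on {} = {\<lambda>_::'n. 0}" by (auto simp: lattice_on_def)
  then show ?case by (simp add: has_sum_finiteI)
next
  case (Cons i js)
  let ?u = "\<lambda>p. case p of (\<kappa>, k) \<Rightarrow> \<kappa>(i := k)"
  have i: "i \<notin> set js" "distinct js" using Cons.prems by auto
  have eq: "fproj_list (i # js) (?u (\<kappa>, k)) g y = fproj i k (fproj_list js \<kappa> g) y" for \<kappa> k
  proof -
    have "fproj_list js (\<kappa>(i := k)) g = fproj_list js \<kappa> g" using i by (intro fproj_list_cong) auto
    then show ?thesis by simp
  qed
  have bij: "bij_betw ?u (lattice_on (set js) \<times> UNIV) (lattice_on (set (i # js)))"
    using bij_betw_lattice_insert[OF i(1)] by simp
  have "((\<lambda>p. fproj_list (i # js) (?u p) g y) has_sum g y) (lattice_on (set js) \<times> UNIV)"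
  proof (rule has_sum_SigmaI)
    fix \<kappa> :: "'n \<Rightarrow> int"
    have h: "fproj_list js \<kappa> g \<in> smooth_on UNIV" "vanishes_beyond i (fproj_list js \<kappa> g)"
      using fproj_list_smooth_vanishes[OF g i(2), of \<kappa>] i by auto
    obtain A where A: "\<And>y. jet (2 + 0 * length js) g y \<le> A" using bounded_jet[OF g, of 2] by auto
    have "jet 2 (fproj_list js \<kappa> g) y \<le> A" for y
      using jet_fproj_list_decay[OF g i(2) A, of \<kappa> y] by simp
    from fproj_has_sum[OF h this y]
    show "((\<lambda>k. fproj_list (i # js) (?u (\<kappa>, k)) g y) has_sum fproj_list js \<kappa> g y) UNIV"
      unfolding eq .
  next
    show "((\<lambda>\<kappa>. fproj_list js \<kappa> g y) has_sum g y) (lattice_on (set js))"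
      by (rule Cons.IH[OF i(2)])
  next
    \<comment> \<open>Two derivatives per coordinate give a summable product of inverse squares.
      This joint absolute summability turns the iterated sum into an unordered one.\<close>
    obtain A where A: "\<And>y. jet (0 + 2 * length (i # js)) g y \<le> A" using bounded_jet[OF g] by blast
    have bd: "norm (fproj_list (i # js) \<kappa> g y) \<le> (2 ^ (2 * length (i # js)) * A) * (\<Prod>i\<in>set (i # js). 1 / (1 + \<bar>real_of_int (\<kappa> i)\<bar>) ^ 2)" for \<kappa>
    proof -
      have "norm (fproj_list (i # js) \<kappa> g y) * (\<Prod>i\<in>set (i # js). (1 + \<bar>real_of_int (\<kappa> i)\<bar>) ^ 2) \<le> 2 ^ (2 * length (i # js)) * A"
        using jet_fproj_list_decay[OF g Cons.prems A, of \<kappa> y] by simp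
      moreover have "(\<Prod>i\<in>set (i # js). (1 + \<bar>real_of_int (\<kappa> i)\<bar>) ^ 2) > 0" by (intro prod_pos) auto
      ultimately show ?thesis by (simp add: prod_dividef pos_le_divide_eq del: fproj_list_simps set_simps)
    qed
    have "(\<lambda>\<kappa>. norm (fproj_list (i # js) \<kappa> g y)) summable_on lattice_on (set (i # js))"
      by (rule summable_on_comparison_test[OF summable_on_cmult_right[OF summable_on_lattice[OF finite_set]]])
        (rule bd, simp)
    then have "(\<lambda>\<kappa>. fproj_list (i # js) \<kappa> g y) summable_on lattice_on (set (i # js))"
      by (rule abs_summable_summable)
    then show "(\<lambda>p. fproj_list (i # js) (?u p) g y) summable_on lattice_on (set js) \<times> UNIV"
      by (subst summable_on_reindex_bij_betw[OF bij])
  qed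
  then show ?case by (subst (asm) has_sum_reindex_bij_betw[OF bij])
qed

lemma fproj_list_homogeneous:
  assumes "i \<in> set js"
  shows "fproj_list js \<kappa> g y = cis (of_int (\<kappa> i) * (y $ i - t)) * fproj_list js \<kappa> g (upd y i t)"
  using assms
proof (induction js arbitrary: y)
  case (Cons j js)
  show ?case
  proof (cases "i = j")
    case True
    then show ?thesis using fproj_homogeneous[of j "\<kappa> j" "fproj_list js \<kappa> g" y t] by simp
  next
    case False
    have "fproj_list js \<kappa> g (upd y j s) * cis (of_int (\<kappa> j) * (y $ j - s))
      = cis (of_int (\<kappa> i) * (y $ i - t)) * (fproj_list js \<kappa> g (upd (upd y i t) j s) * cis (of_int (\<kappa> j) * (y $ j - s)))" for s
      using Cons.IH[of "upd y j s"] Cons.prems False upd_commute[OF False, of y t s] by simp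
    then have "fproj j (\<kappa> j) (fproj_list js \<kappa> g) y =
        integral {-pi..pi} (\<lambda>s. cis (of_int (\<kappa> i) * (y $ i - t)) * (fproj_list js \<kappa> g (upd (upd y i t) j s) * cis (of_int (\<kappa> j) * (y $ j - s)))) / (2 * of_real pi)"
      by (simp only: fproj_def)
    then show ?thesis using False by (simp add: fproj_def)
  qed
qed simp

text \<open>Setting the coordinates to zero one after the other splits off one exponential factor
  each time. Thus a function projected in all coordinates is a constant times a character, and the
  constant is its Fourier coefficient.\<close>

lemma cis_character:
  fixes h :: "'n::finite cfun"
  assumes "\<And>y i t. h y = cis (of_int (\<kappa> i) * (y $ i - t)) * h (upd y i t)"
  shows "h y = h 0 * cis (\<Sum>i\<in>UNIV. of_int (\<kappa> i) * y $ i)"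
proof -
  have "h y = cis (\<Sum>i\<in>S. of_int (\<kappa> i) * y $ i) * h (\<chi> j. if j \<in> S then 0 else y $ j)" if "finite S" for S
    using that
  proof (induction S rule: finite_induct)
    case (insert i S)
    let ?z = "\<chi> j. if j \<in> S then 0 else y $ j"
    have "upd ?z i 0 = (\<chi> j. if j \<in> insert i S then 0 else y $ j)" by (simp add: vec_eq_iff)
    with assms[of ?z i 0] insert show ?case by (simp add: cis_mult[symmetric] mult_ac)
  qed simp
  from this[of UNIV] show ?thesis by (simp add: zero_vec_def[symmetric] mult.commute)
qed

text \<open>One family of coefficients serves all decay exponents \<open>s\<close>, with a constant
  that depends on \<open>g\<close> only through its jet bound. This is what permits the
  bootstrapping and the uniformity in \<epsilon> later on.\<close>

theorem fourier_expansion: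
  fixes g :: "'n::finite cfun"
  assumes g: "g \<in> smooth_on UNIV" "\<forall>y i. \<bar>y $ i\<bar> > 3 \<longrightarrow> g y = 0"
  shows "\<exists>a :: ('n \<Rightarrow> int) \<Rightarrow> complex.
    (\<forall>y. (\<forall>i. \<bar>y $ i\<bar> < pi) \<longrightarrow> ((\<lambda>\<kappa>. a \<kappa> * cis (\<Sum>i\<in>UNIV. of_int (\<kappa> i) * y $ i)) has_sum g y) UNIV) \<and>
    (\<forall>s A \<kappa>. (\<forall>y. jet (s * CARD('n)) g y \<le> A) \<longrightarrow>
       norm (a \<kappa>) * (\<Prod>i\<in>UNIV. 1 + \<bar>real_of_int (\<kappa> i)\<bar>) ^ s \<le> 2 ^ (s * CARD('n)) * A)"
proof -
  obtain js where js: "distinct js" "set js = (UNIV :: 'n set)"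
    using finite_distinct_list[of "UNIV :: 'n set"] by auto
  have len: "length js = CARD('n)" using js distinct_card by metis
  have v: "vanishes_beyond i g" for i using g(2) by (auto simp: vanishes_beyond_def)
  define a where "a \<kappa> = fproj_list js \<kappa> g 0" for \<kappa>
  have h: "fproj_list js \<kappa> g y = a \<kappa> * cis (\<Sum>i\<in>UNIV. of_int (\<kappa> i) * y $ i)" for \<kappa> y
    unfolding a_def by (rule cis_character) (use fproj_list_homogeneous[of _ js] js in blast)
  have L: "lattice_on (set js) = UNIV" using js by (auto simp: lattice_on_def)
  show ?thesis
  proof (intro exI[of _ a] conjI allI impI)
    fix y :: "real ^ 'n" assume "\<forall>i. \<bar>y $ i\<bar> < pi"
    from fproj_list_has_sum[OF g(1) v this[rule_format] js(1)]
    show "((\<lambda>\<kappa>. a \<kappa> * cis (\<Sum>i\<in>UNIV. of_int (\<kappa> i) * y $ i)) has_sum g y) UNIV"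
      unfolding h L .
  next
    fix s A \<kappa> assume "\<forall>y. jet (s * CARD('n)) g y \<le> A"
    then have "jet 0 (fproj_list js \<kappa> g) 0 * (\<Prod>i\<in>set js. (1 + \<bar>real_of_int (\<kappa> i)\<bar>) ^ s) \<le> 2 ^ (s * length js) * A"
      by (intro jet_fproj_list_decay[OF g(1) v js(1)]) (simp add: len)
    then show "norm (a \<kappa>) * (\<Prod>i\<in>UNIV. 1 + \<bar>real_of_int (\<kappa> i)\<bar>) ^ s \<le> 2 ^ (s * CARD('n)) * A"
      by (simp add: a_def js(2) len prod_power_distrib)
  qed
qed

subsection \<open>Series of smooth functions\<close>

lemma norm_partial_le_jet: "norm (partial i f x) \<le> jet (Suc 0) f x"
  using jet_partial[of 0 i f x] by simp

text \<open>First-order jets dominate both the terms and all their partial derivatives, so one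
  summable majorant yields convergence and, by the M-test, uniform convergence of the differentiated
  series in each direction.\<close>

lemma has_derivative_suminf_smooth:
  fixes F :: "nat \<Rightarrow> 'n::finite cfun"
  assumes sm: "\<And>n. F n \<in> smooth_on UNIV"
    and M: "summable M" "\<And>n x. jet (Suc 0) (F n) x \<le> M n"
  shows "((\<lambda>x. \<Sum>n. F n x) has_derivative (\<lambda>h. \<Sum>i\<in>UNIV. h $ i *\<^sub>R (\<Sum>n. partial i (F n) x))) (at x)"
proof -
  have u: "uniform_limit UNIV (\<lambda>N x. \<Sum>n<N. partial i (F n) x) (\<lambda>x. \<Sum>n. partial i (F n) x) sequentially" for i
    by (rule Weierstrass_m_test[OF _ M(1)]) (use M(2) norm_partial_le_jet order_trans in blast)
  have s: "(\<lambda>n. F n x) sums (\<Sum>n. F n x)" for x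
    by (intro summable_sums summable_comparison_test'[OF M(1), of 0]) (use M(2) norm_le_jet order_trans in blast)
  have "\<exists>g. \<forall>x\<in>UNIV. (\<lambda>n. F n x) sums g x \<and> (g has_derivative (\<lambda>h. \<Sum>i\<in>UNIV. h $ i *\<^sub>R (\<Sum>n. partial i (F n) x))) (at x within UNIV)"
  proof (rule has_derivative_series[where f = F and f' = "\<lambda>n x h. \<Sum>i\<in>UNIV. h $ i *\<^sub>R partial i (F n) x" and x = 0 and l = "\<Sum>n. F n 0"])
    show "(F n has_derivative (\<lambda>h. \<Sum>i\<in>UNIV. h $ i *\<^sub>R partial i (F n) x)) (at x within UNIV)" for n x
      by (rule has_derivative_partial) (use sm smooth_on_differentiable in blast)
  next
    fix e :: real assume e: "e > 0"
    let ?e = "e / real CARD('n)"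
    have "\<forall>\<^sub>F N in sequentially. \<forall>x\<in>UNIV. dist (\<Sum>n<N. partial i (F n) x) (\<Sum>n. partial i (F n) x) < ?e" for i
      by (rule uniform_limitD[OF u]) (use e in simp)
    then have "\<forall>\<^sub>F N in sequentially. \<forall>i\<in>UNIV. \<forall>x\<in>UNIV. dist (\<Sum>n<N. partial i (F n) x) (\<Sum>n. partial i (F n) x) < ?e"
      by (intro eventually_ball_finite) auto
    then show "\<forall>\<^sub>F N in sequentially. \<forall>x\<in>UNIV. \<forall>h. norm ((\<Sum>n<N. \<Sum>i\<in>UNIV. h $ i *\<^sub>R partial i (F n) x)
        - (\<Sum>i\<in>UNIV. h $ i *\<^sub>R (\<Sum>n. partial i (F n) x))) \<le> e * norm h"
    proof (rule eventually_mono, intro ballI allI)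
      fix N :: nat and x h :: "real ^ 'n"
      assume *: "\<forall>i\<in>UNIV. \<forall>x\<in>UNIV. dist (\<Sum>n<N. partial i (F n) x) (\<Sum>n. partial i (F n) x) < ?e"
      have "(\<Sum>n<N. \<Sum>i\<in>UNIV. h $ i *\<^sub>R partial i (F n) x) - (\<Sum>i\<in>UNIV. h $ i *\<^sub>R (\<Sum>n. partial i (F n) x))
          = (\<Sum>i\<in>UNIV. h $ i *\<^sub>R ((\<Sum>n<N. partial i (F n) x) - (\<Sum>n. partial i (F n) x)))"
        by (subst sum.swap) (simp add: scaleR_sum_right[symmetric] sum_subtractf[symmetric] scaleR_diff_right)
      also have "norm \<dots> \<le> (\<Sum>i\<in>UNIV. \<bar>h $ i\<bar> * norm ((\<Sum>n<N. partial i (F n) x) - (\<Sum>n. partial i (F n) x)))"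
        by (rule order_trans[OF norm_sum]) simp
      also have "\<dots> \<le> (\<Sum>i\<in>(UNIV :: 'n set). norm h * ?e)"
        using * component_le_norm_cart[of h] by (intro sum_mono mult_mono) (auto simp: dist_norm less_imp_le)
      also have "\<dots> = e * norm h" by simp
      finally show "norm ((\<Sum>n<N. \<Sum>i\<in>UNIV. h $ i *\<^sub>R partial i (F n) x) - (\<Sum>i\<in>UNIV. h $ i *\<^sub>R (\<Sum>n. partial i (F n) x))) \<le> e * norm h" .
    qed
  qed (use s in auto)
  then obtain g where g: "\<And>x. (\<lambda>n. F n x) sums g x" "\<And>x. (g has_derivative (\<lambda>h. \<Sum>i\<in>UNIV. h $ i *\<^sub>R (\<Sum>n. partial i (F n) x))) (at x)"
    by auto
  have "g = (\<lambda>x. \<Sum>n. F n x)" using g(1) sums_unique by blast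
  then show ?thesis using g(2) by simp
qed

text \<open>A majorant for every jet order, uniform in \<open>x\<close>, makes the notion stable
  under partial derivatives, as the coinduction for sums requires.\<close>

definition summable_family :: "('k \<Rightarrow> 'n::finite cfun) \<Rightarrow> bool" where
  "summable_family F \<longleftrightarrow> (\<forall>k. F k \<in> smooth_on UNIV) \<and>
     (\<forall>N. \<exists>M. M summable_on UNIV \<and> (\<forall>k x. jet N (F k) x \<le> M k))"

lemma summable_family_partial: "summable_family F \<Longrightarrow> summable_family (\<lambda>k. partial i (F k))"
  unfolding summable_family_def using smooth_on_partial jet_partial order_trans by meson

lemma summable_family_jet:
  assumes "summable_family F"
  shows "(\<lambda>k. jet N (F k) x) summable_on UNIV"
proof -
  obtain M where M: "M summable_on UNIV" "\<And>k x. jet N (F k) x \<le> M k"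
    using assms unfolding summable_family_def by blast
  show ?thesis by (rule summable_on_comparison_test[OF M(1)]) (use M(2) in auto)
qed

lemma summable_family_summable:
  assumes "summable_family F"
  shows "(\<lambda>k. norm (F k x)) summable_on UNIV" "(\<lambda>k. F k x) summable_on UNIV"
proof -
  show "(\<lambda>k. norm (F k x)) summable_on UNIV" using summable_family_jet[OF assms, of 0 x] by simp
  then show "(\<lambda>k. F k x) summable_on UNIV" by (rule abs_summable_summable)
qed

text \<open>A bijection with the natural numbers reduces unordered sums to series; absolute
  convergence makes the choice of enumeration immaterial.\<close>

lemma has_derivative_infsum_smooth:
  fixes F :: "'k \<Rightarrow> 'n::finite cfun"
  assumes k: "countable (UNIV :: 'k set)" "infinite (UNIV :: 'k set)" and F: "summable_family F"
  shows "((\<lambda>x. \<Sum>\<^sub>\<infinity>k. F k x) has_derivative (\<lambda>h. \<Sum>i\<in>UNIV. h $ i *\<^sub>R (\<Sum>\<^sub>\<infinity>k. partial i (F k) x))) (at x)"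
proof -
  obtain f :: "'k \<Rightarrow> nat" where "bij f" using countableE_infinite[OF k] by metis
  define e where "e = inv f"
  have e: "bij e" unfolding e_def using \<open>bij f\<close> by (rule bij_imp_bij_inv)
  have eq: "(\<Sum>\<^sub>\<infinity>k. G k x) = (\<Sum>n. G (e n) x)" if "summable_family G" for G :: "'k \<Rightarrow> 'n cfun" and x
  proof -
    have "((\<lambda>n. G (e n) x) has_sum (\<Sum>\<^sub>\<infinity>k. G k x)) UNIV"
      by (subst has_sum_reindex_bij_betw[OF e, of "\<lambda>k. G k x"]) (rule has_sum_infsum[OF summable_family_summable(2)[OF that]])
    then show ?thesis using has_sum_imp_sums sums_unique by blast
  qed
  obtain M where M: "M summable_on UNIV" "\<And>k x. jet (Suc 0) (F k) x \<le> M k"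
    using F unfolding summable_family_def by blast
  have "((\<lambda>x. \<Sum>n. F (e n) x) has_derivative (\<lambda>h. \<Sum>i\<in>UNIV. h $ i *\<^sub>R (\<Sum>n. partial i (F (e n)) x))) (at x)"
  proof (rule has_derivative_suminf_smooth)
    show "F (e n) \<in> smooth_on UNIV" for n using F by (auto simp: summable_family_def)
    have "(\<lambda>n. M (e n)) summable_on UNIV"
      using M(1) by (subst summable_on_reindex_bij_betw[OF e])
    then show "summable (\<lambda>n. M (e n))" by (rule summable_on_imp_summable)
  qed (use M in auto)
  then show ?thesis
    by (simp only: eq[OF F, symmetric] eq[OF summable_family_partial[OF F], symmetric])
qed

lemma partial_infsum:
  fixes F :: "'k \<Rightarrow> 'n::finite cfun"
  assumes k: "countable (UNIV :: 'k set)" "infinite (UNIV :: 'k set)" and F: "summable_family F"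
  shows "partial i (\<lambda>x. \<Sum>\<^sub>\<infinity>k. F k x) = (\<lambda>x. \<Sum>\<^sub>\<infinity>k. partial i (F k) x)"
proof
  fix x
  have "partial i (\<lambda>x. \<Sum>\<^sub>\<infinity>k. F k x) x = (\<Sum>l\<in>UNIV. axis i 1 $ l *\<^sub>R (\<Sum>\<^sub>\<infinity>k. partial l (F k) x))"
    by (rule partial_eq[OF has_derivative_infsum_smooth[OF assms]])
  also have "\<dots> = (\<Sum>l\<in>UNIV. if l = i then (\<Sum>\<^sub>\<infinity>k. partial l (F k) x) else 0)"
    by (intro sum.cong) (auto simp: axis_def)
  finally show "partial i (\<lambda>x. \<Sum>\<^sub>\<infinity>k. F k x) x = (\<Sum>\<^sub>\<infinity>k. partial i (F k) x)" by simp
qed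

lemma smooth_infsum:
  fixes F :: "'k \<Rightarrow> 'n::finite cfun"
  assumes k: "countable (UNIV :: 'k set)" "infinite (UNIV :: 'k set)" and F: "summable_family F"
  shows "(\<lambda>x. \<Sum>\<^sub>\<infinity>k. F k x) \<in> smooth_on UNIV"
proof (rule smooth_on_coinduct[of UNIV _ "{\<lambda>x. \<Sum>\<^sub>\<infinity>k. F k x |F :: 'k \<Rightarrow> 'n cfun. summable_family F}"])
  fix f assume "f \<in> {\<lambda>x. \<Sum>\<^sub>\<infinity>k. F k x |F :: 'k \<Rightarrow> 'n cfun. summable_family F}"
  then obtain F :: "'k \<Rightarrow> 'n cfun" where f: "f = (\<lambda>x. \<Sum>\<^sub>\<infinity>k. F k x)" "summable_family F" by blast
  show "f differentiable_on UNIV"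
    using has_derivative_infsum_smooth[OF k f(2)] f(1) by (auto simp: differentiable_on_def differentiable_def)
  show "\<exists>g\<in>{\<lambda>x. \<Sum>\<^sub>\<infinity>k. F k x |F :: 'k \<Rightarrow> 'n cfun. summable_family F}. \<forall>x\<in>UNIV. partial i f x = g x" for i
    using partial_infsum[OF k f(2), of i] f(1) summable_family_partial[OF f(2), of i] by auto
qed (use F in auto)

lemma mpartial_infsum:
  fixes F :: "'k \<Rightarrow> 'n::finite cfun"
  assumes k: "countable (UNIV :: 'k set)" "infinite (UNIV :: 'k set)" and F: "summable_family F"
  shows "mpartial \<alpha> (\<lambda>x. \<Sum>\<^sub>\<infinity>k. F k x) = (\<lambda>x. \<Sum>\<^sub>\<infinity>k. mpartial \<alpha> (F k) x)"
    and "summable_family (\<lambda>k. mpartial \<alpha> (F k))"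
proof -
  have pow: "(partial i ^^ n) (\<lambda>x. \<Sum>\<^sub>\<infinity>k. F k x) = (\<lambda>x. \<Sum>\<^sub>\<infinity>k. (partial i ^^ n) (F k) x) \<and> summable_family (\<lambda>k. (partial i ^^ n) (F k))"
    if "summable_family F" for i n and F :: "'k \<Rightarrow> 'n cfun"
    by (induction n) (use that in \<open>auto simp: partial_infsum[OF k] summable_family_partial\<close>)
  have "foldr (\<lambda>i. partial i ^^ \<alpha> i) js (\<lambda>x. \<Sum>\<^sub>\<infinity>k. F k x) = (\<lambda>x. \<Sum>\<^sub>\<infinity>k. foldr (\<lambda>i. partial i ^^ \<alpha> i) js (F k) x) \<and>
      summable_family (\<lambda>k. foldr (\<lambda>i. partial i ^^ \<alpha> i) js (F k))" for js
    by (induction js) (use F pow in auto)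
  then show "mpartial \<alpha> (\<lambda>x. \<Sum>\<^sub>\<infinity>k. F k x) = (\<lambda>x. \<Sum>\<^sub>\<infinity>k. mpartial \<alpha> (F k) x)"
    "summable_family (\<lambda>k. mpartial \<alpha> (F k))"
    by (auto simp: mpartial_def)
qed

lemma has_sum_finite_sum:
  fixes f :: "'a \<Rightarrow> 'k \<Rightarrow> 'b::topological_comm_monoid_add"
  assumes "finite A" "\<And>a. a \<in> A \<Longrightarrow> (f a has_sum s a) S"
  shows "((\<lambda>k. \<Sum>a\<in>A. f a k) has_sum (\<Sum>a\<in>A. s a)) S"
  using assms by (induction A rule: finite_induct) (auto intro: has_sum_add)

lemma jet_infsum_le:
  fixes F :: "'k \<Rightarrow> 'n::finite cfun"
  assumes k: "countable (UNIV :: 'k set)" "infinite (UNIV :: 'k set)" and F: "summable_family F"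
  shows "jet N (\<lambda>x. \<Sum>\<^sub>\<infinity>k. F k x) x \<le> (\<Sum>\<^sub>\<infinity>k. jet N (F k) x)"
  using F
proof (induction N arbitrary: F)
  case 0
  then show ?case using norm_infsum_bound[OF summable_family_summable(1)] by simp
next
  case (Suc N)
  have "jet (Suc N) (\<lambda>x. \<Sum>\<^sub>\<infinity>k. F k x) x = norm (\<Sum>\<^sub>\<infinity>k. F k x) + (\<Sum>i\<in>UNIV. jet N (\<lambda>x. \<Sum>\<^sub>\<infinity>k. partial i (F k) x) x)"
    by (simp add: partial_infsum[OF k Suc.prems])
  also have "\<dots> \<le> (\<Sum>\<^sub>\<infinity>k. norm (F k x)) + (\<Sum>i\<in>UNIV. \<Sum>\<^sub>\<infinity>k. jet N (partial i (F k)) x)"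
    by (intro add_mono sum_mono Suc.IH summable_family_partial Suc.prems norm_infsum_bound summable_family_summable(1))
  also have "\<dots> = (\<Sum>\<^sub>\<infinity>k. norm (F k x) + (\<Sum>i\<in>UNIV. jet N (partial i (F k)) x))"
    by (intro infsumI[symmetric] has_sum_add has_sum_finite_sum has_sum_infsum summable_family_jet
        summable_family_partial Suc.prems summable_family_summable(1)) auto
  finally show ?case by simp
qed

lemma countable_infinite_lattice:
  "countable (UNIV :: ('n::finite \<Rightarrow> int) set)" "infinite (UNIV :: ('n::finite \<Rightarrow> int) set)"
proof -
  show "countable (UNIV :: ('n \<Rightarrow> int) set)" by simp
  have "inj (\<lambda>k. (\<lambda>_::'n. k :: int))" by (auto simp: inj_def fun_eq_iff)
  then show "infinite (UNIV :: ('n \<Rightarrow> int) set)"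
    using infinite_UNIV_int finite_imageD[of "\<lambda>k. (\<lambda>_::'n. k :: int)" UNIV] finite_subset[OF subset_UNIV] by blast
qed

subsection \<open>Symbols and plane waves\<close>

lemma partial_eq_vector_derivative:
  fixes f :: "'n::finite cfun"
  assumes "f differentiable (at x)" "((\<lambda>s. f (x + s *\<^sub>R axis i 1)) has_vector_derivative D) (at 0)"
  shows "partial i f x = D"
  using vector_derivative_unique_at[OF assms(2), of "partial i f (x + 0 *\<^sub>R axis i 1)"]
    has_vector_derivative_along_axis[of f x 0 i UNIV] assms(1) by simp

lemma smooth_coordinate: "(\<lambda>x::real ^ 'n::finite. complex_of_real (x $ i)) \<in> smooth_on UNIV"
proof (rule smooth_on_coinduct[of UNIV _ "insert (\<lambda>x. of_real (x $ i)) (range (\<lambda>c _. c))"])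
  have d: "((\<lambda>x::real ^ 'n. complex_of_real (x $ i)) has_derivative (\<lambda>h. of_real (h $ i))) (at x)" for x
    by (intro bounded_linear_imp_has_derivative bounded_linear_compose[OF bounded_linear_of_real bounded_linear_vec_nth])
  fix f :: "'n cfun" assume f: "f \<in> insert (\<lambda>x. of_real (x $ i)) (range (\<lambda>c _. c))"
  then show "f differentiable_on UNIV" using d by (auto simp: differentiable_on_def differentiable_def intro: has_derivative_const)
  show "\<exists>g\<in>insert (\<lambda>x. of_real (x $ i)) (range (\<lambda>c _. c)). \<forall>x\<in>UNIV. partial j f x = g x" for j
    using f partial_eq[OF d] by auto
qed auto

lemma smooth_on_prod:
  assumes "open \<Omega>" "\<And>a. a \<in> A \<Longrightarrow> f a \<in> smooth_on \<Omega>"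
  shows "(\<lambda>x. \<Prod>a\<in>A. f a x) \<in> smooth_on \<Omega>"
  using assms(2) by (induction A rule: infinite_finite_induct) (auto intro: smooth_on_mult[OF assms(1)])

lemma smooth_on_power:
  assumes "open \<Omega>" "f \<in> smooth_on \<Omega>"
  shows "(\<lambda>x. f x ^ n) \<in> smooth_on \<Omega>"
  by (induction n) (auto intro: smooth_on_mult assms)

text \<open>One constant per coordinate keeps the family closed under \<open>partial\<close>: a
  derivative changes only the factor of its own coordinate.\<close>

definition monom_fun :: "('n::finite \<Rightarrow> real) \<Rightarrow> ('n \<Rightarrow> nat) \<Rightarrow> 'n cfun" where
  "monom_fun c n \<eta> = of_real (\<Prod>i\<in>UNIV. c i * \<eta> $ i ^ n i)"

lemma monom_fun_smooth: "monom_fun c n \<in> smooth_on UNIV"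
proof -
  have "(\<lambda>\<eta>. \<Prod>i\<in>UNIV. of_real (c i) * complex_of_real (\<eta> $ i) ^ n i) \<in> smooth_on UNIV"
    by (intro smooth_on_prod smooth_on_cmult smooth_on_power smooth_coordinate) auto
  then show ?thesis by (simp add: monom_fun_def[abs_def])
qed

lemma partial_monom_fun:
  "partial j (monom_fun c n) = monom_fun (c(j := c j * real (n j))) (n(j := n j - 1))"
proof
  fix x :: "real ^ 'a"
  let ?r = "\<Prod>i\<in>UNIV - {j}. c i * x $ i ^ n i"
  have split: "(\<Prod>i\<in>UNIV. f i) = f j * (\<Prod>i\<in>UNIV - {j}. f i)" for f :: "'a \<Rightarrow> real"
    by (rule prod.remove) auto
  have rest: "(\<Prod>i\<in>UNIV - {j}. c i * (x + s *\<^sub>R axis j 1) $ i ^ n i) = ?r" for s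
    by (intro prod.cong) (auto simp: axis_def)
  have "((\<lambda>s. (c j * (x $ j + s) ^ n j) * ?r) has_real_derivative (c j * (real (n j) * (x $ j + 0) ^ (n j - 1))) * ?r) (at 0)"
    by (auto intro!: derivative_eq_intros)
  then have "((\<lambda>s. complex_of_real ((c j * (x $ j + s) ^ n j) * ?r)) has_vector_derivative of_real ((c j * (real (n j) * (x $ j + 0) ^ (n j - 1))) * ?r)) (at 0)"
    by (intro bounded_linear.has_vector_derivative[OF bounded_linear_of_real]) (simp only: has_real_derivative_iff_has_vector_derivative)
  moreover have "monom_fun c n (x + s *\<^sub>R axis j 1) = complex_of_real ((c j * (x $ j + s) ^ n j) * ?r)" for s
    unfolding monom_fun_def by (subst split) (simp add: rest axis_def)
  moreover have "monom_fun (c(j := c j * real (n j))) (n(j := n j - 1)) x = of_real ((c j * (real (n j) * (x $ j + 0) ^ (n j - 1))) * ?r)"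
  proof -
    have "(\<Prod>i\<in>UNIV - {j}. (c(j := c j * real (n j))) i * x $ i ^ (n(j := n j - 1)) i) = ?r"
      by (intro prod.cong) auto
    then show ?thesis unfolding monom_fun_def by (subst split) (simp add: mult.assoc)
  qed
  ultimately have "((\<lambda>s. monom_fun c n (x + s *\<^sub>R axis j 1)) has_vector_derivative monom_fun (c(j := c j * real (n j))) (n(j := n j - 1)) x) (at 0)"
    by (simp only:)
  then show "partial j (monom_fun c n) x = monom_fun (c(j := c j * real (n j))) (n(j := n j - 1)) x"
    by (rule partial_eq_vector_derivative[OF smooth_on_differentiable[OF monom_fun_smooth open_UNIV UNIV_I]])
qed

lemma funpow_partial_monom_fun:
  "(partial j ^^ k) (monom_fun c n) = monom_fun (c(j := c j * (fact k * real (n j choose k)))) (n(j := n j - k))"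
proof (induction k)
  case (Suc k)
  \<comment> \<open>For k beyond the exponent both sides vanish: the subtraction is truncated on the
    right, and the binomial coefficient is zero on the left.\<close>
  have "real (Suc k) * real (n j choose Suc k) = real (n j - k) * real (n j choose k)"
  proof (cases "k \<le> n j")
    case True
    have "Suc k * (n j choose Suc k) = (n j - k) * (n j choose k)"
      using binomial_absorb_comp[of "n j" k] binomial_absorption[of k "n j"] by simp
    then show ?thesis by (metis of_nat_mult)
  qed simp
  then have "fact (Suc k) * real (n j choose Suc k) = fact k * real (n j choose k) * real (n j - k)"
    by (metis fact_Suc mult.assoc mult.commute of_nat_fact of_nat_mult)
  then have E: "c j * (fact k * real (n j choose k)) * real (n j - k) = c j * (fact (Suc k) * real (n j choose Suc k))"
    by (simp only: mult.assoc)
  have "n j - k - 1 = n j - Suc k" by simp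
  then show ?case
    unfolding funpow.simps o_apply Suc.IH partial_monom_fun by (simp only: fun_upd_same fun_upd_upd E)
qed simp

text \<open>Up to the factorials of \<gamma> this is a binomial coefficient times a monomial. It
  vanishes unless \<gamma> \<le> \<alpha>, since otherwise a binomial coefficient is zero, so the
  truncated exponents do no harm.\<close>

definition monom_deriv_coeff :: "'n::finite multi_index \<Rightarrow> 'n multi_index \<Rightarrow> real ^ 'n \<Rightarrow> real" where
  "monom_deriv_coeff \<alpha> \<gamma> \<xi> = (\<Prod>i\<in>UNIV. fact (\<gamma> i) * real (\<alpha> i choose \<gamma> i) * \<xi> $ i ^ (\<alpha> i - \<gamma> i))"

lemma mpartial_monomial:
  fixes \<alpha> :: "'n::finite multi_index"
  shows "mpartial \<gamma> (\<lambda>\<eta>. of_real (mi_power \<eta> \<alpha>)) \<xi> = of_real (monom_deriv_coeff \<alpha> \<gamma> \<xi>)"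
proof -
  have "foldr (\<lambda>i. partial i ^^ \<gamma> i) js (monom_fun (\<lambda>_. 1) \<alpha>)
      = monom_fun (\<lambda>i. if i \<in> set js then fact (\<gamma> i) * real (\<alpha> i choose \<gamma> i) else 1)
          (\<lambda>i. if i \<in> set js then \<alpha> i - \<gamma> i else \<alpha> i)" if "distinct js" for js
    using that
  proof (induction js)
    case (Cons j js)
    then show ?case
      by (simp add: funpow_partial_monom_fun) (intro arg_cong2[where f = monom_fun] ext; auto)
  qed simp
  from this[OF distinct_coordinates(1)]
  have "mpartial \<gamma> (monom_fun (\<lambda>_. 1) \<alpha>) = monom_fun (\<lambda>i. fact (\<gamma> i) * real (\<alpha> i choose \<gamma> i)) (\<lambda>i. \<alpha> i - \<gamma> i)"
    by (simp add: mpartial_def distinct_coordinates)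
  moreover have "monom_fun (\<lambda>_. 1) \<alpha> = (\<lambda>\<eta>. of_real (mi_power \<eta> \<alpha>))"
    by (simp add: monom_fun_def[abs_def] mi_power_def)
  ultimately show ?thesis by (simp add: monom_fun_def monom_deriv_coeff_def)
qed

lemma partial_lincomb:
  assumes "finite A" "\<And>a. a \<in> A \<Longrightarrow> f a \<in> smooth_on UNIV"
  shows "partial i (\<lambda>x. \<Sum>a\<in>A. c a * f a x) = (\<lambda>x. \<Sum>a\<in>A. c a * partial i (f a) x)"
proof
  fix x
  have d: "f a differentiable (at x)" if "a \<in> A" for a
    using smooth_on_differentiable[OF assms(2)[OF that]] by simp
  have "partial i (\<lambda>x. \<Sum>a\<in>A. c a * f a x) x = (\<Sum>a\<in>A. partial i (\<lambda>x. c a * f a x) x)"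
    by (rule partial_sum[OF assms(1)]) (use d in \<open>auto intro!: differentiable_mult\<close>)
  then show "partial i (\<lambda>x. \<Sum>a\<in>A. c a * f a x) x = (\<Sum>a\<in>A. c a * partial i (f a) x)"
    using partial_cmult[OF d] by simp
qed

lemma funpow_partial_lincomb:
  assumes "finite A" "\<And>a. a \<in> A \<Longrightarrow> f a \<in> smooth_on UNIV"
  shows "(partial i ^^ k) (\<lambda>x. \<Sum>a\<in>A. c a * f a x) = (\<lambda>x. \<Sum>a\<in>A. c a * (partial i ^^ k) (f a) x)"
  by (induction k) (use assms in \<open>auto simp: partial_lincomb funpow_partial_smooth\<close>)

lemma mpartial_lincomb:
  assumes "finite A" "\<And>a. a \<in> A \<Longrightarrow> f a \<in> smooth_on UNIV"
  shows "mpartial \<alpha> (\<lambda>x. \<Sum>a\<in>A. c a * f a x) = (\<lambda>x. \<Sum>a\<in>A. c a * mpartial \<alpha> (f a) x)"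
proof -
  have "foldr (\<lambda>i. partial i ^^ \<alpha> i) js (\<lambda>x. \<Sum>a\<in>A. c a * f a x) = (\<lambda>x. \<Sum>a\<in>A. c a * foldr (\<lambda>i. partial i ^^ \<alpha> i) js (f a) x)" for js
    by (induction js) (use assms in \<open>auto simp: funpow_partial_lincomb foldr_partial_smooth\<close>)
  then show ?thesis by (simp add: mpartial_def)
qed

definition symbol_of :: "nat \<Rightarrow> ('n::finite multi_index \<Rightarrow> 'n cfun) \<Rightarrow> 'n symbol" where
  "symbol_of m r x \<xi> = (\<Sum>\<alpha> | mi_order \<alpha> \<le> m. r \<alpha> x * of_real (mi_power \<xi> \<alpha>))"

text \<open>The \<xi>-derivative of the symbol with \<xi> frozen, as a linear combination of the
  coefficients: a smooth function of \<open>x\<close> to which jets apply.\<close>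

definition symbol_xi_deriv :: "nat \<Rightarrow> ('n::finite multi_index \<Rightarrow> 'n cfun) \<Rightarrow> 'n multi_index \<Rightarrow> real ^ 'n \<Rightarrow> 'n cfun" where
  "symbol_xi_deriv m r \<gamma> \<xi> x = (\<Sum>\<alpha> | mi_order \<alpha> \<le> m. of_real (monom_deriv_coeff \<alpha> \<gamma> \<xi>) * r \<alpha> x)"

lemma symbol_xi_deriv_smooth:
  assumes "\<And>\<alpha>. mi_order \<alpha> \<le> m \<Longrightarrow> r \<alpha> \<in> smooth_on UNIV"
  shows "symbol_xi_deriv m r \<gamma> \<xi> \<in> smooth_on UNIV"
  unfolding symbol_xi_deriv_def[abs_def] by (intro smooth_on_sum smooth_on_cmult) (use assms in auto)

text \<open>The symbol is a finite sum of functions of \<open>x\<close> times monomials in \<xi>, so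
  both differentiations act termwise and their order is irrelevant.\<close>

lemma symbol_deriv_symbol_of:
  fixes r :: "'n::finite multi_index \<Rightarrow> 'n cfun"
  assumes r: "\<And>\<alpha>. mi_order \<alpha> \<le> m \<Longrightarrow> r \<alpha> \<in> smooth_on UNIV"
  shows "symbol_deriv \<gamma> \<beta> (symbol_of m r) x \<xi> = mpartial \<beta> (symbol_xi_deriv m r \<gamma> \<xi>) x"
proof -
  have s: "(\<lambda>\<eta>. complex_of_real (mi_power \<eta> \<alpha>)) \<in> smooth_on UNIV" for \<alpha> :: "'n multi_index"
    using monom_fun_smooth[of "\<lambda>_. 1" \<alpha>] by (simp add: monom_fun_def[abs_def] mi_power_def[abs_def])
  have "mpartial \<beta> (\<lambda>y. symbol_of m r y \<eta>) x = (\<Sum>\<alpha> | mi_order \<alpha> \<le> m. mpartial \<beta> (r \<alpha>) x * of_real (mi_power \<eta> \<alpha>))" for \<eta>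
    using mpartial_lincomb[OF finite_mi_order_le, of m r \<beta> "\<lambda>\<alpha>. of_real (mi_power \<eta> \<alpha>)"] r
    by (simp add: symbol_of_def[abs_def] mult.commute)
  then have "symbol_deriv \<gamma> \<beta> (symbol_of m r) x \<xi>
      = mpartial \<gamma> (\<lambda>\<eta>. \<Sum>\<alpha> | mi_order \<alpha> \<le> m. mpartial \<beta> (r \<alpha>) x * of_real (mi_power \<eta> \<alpha>)) \<xi>"
    by (simp add: symbol_deriv_def)
  also have "\<dots> = (\<Sum>\<alpha> | mi_order \<alpha> \<le> m. of_real (monom_deriv_coeff \<alpha> \<gamma> \<xi>) * mpartial \<beta> (r \<alpha>) x)"
    by (subst mpartial_lincomb[OF finite_mi_order_le s]) (simp add: mpartial_monomial mult.commute)
  also have "\<dots> = mpartial \<beta> (symbol_xi_deriv m r \<gamma> \<xi>) x"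
    using mpartial_lincomb[OF finite_mi_order_le, of m r \<beta> "\<lambda>\<alpha>. of_real (monom_deriv_coeff \<alpha> \<gamma> \<xi>)"] r
    by (simp add: symbol_xi_deriv_def[abs_def])
  finally show ?thesis .
qed

lemma symbol_xi_deriv_zero: "symbol_xi_deriv m r (\<lambda>_. 0) \<xi> x = symbol_of m r x \<xi>"
  by (simp add: symbol_xi_deriv_def symbol_of_def monom_deriv_coeff_def mi_power_def mult.commute)

section \<open>Plane waves and the Leibniz formula\<close>

definition plane_wave :: "real ^ 'n::finite \<Rightarrow> real ^ 'n \<Rightarrow> 'n cfun" where
  "plane_wave x0 \<xi> x = cis (\<xi> \<bullet> (x - x0))"

lemma has_derivative_plane_wave:
  "(plane_wave x0 \<xi> has_derivative (\<lambda>h. (\<xi> \<bullet> h) *\<^sub>R (\<i> * plane_wave x0 \<xi> x))) (at x)"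
  unfolding plane_wave_def[abs_def] by (auto intro!: derivative_eq_intros)

lemma partial_plane_wave: "partial i (plane_wave x0 \<xi>) = (\<lambda>x. (\<i> * of_real (\<xi> $ i)) * plane_wave x0 \<xi> x)"
  by (rule ext, subst partial_eq[OF has_derivative_plane_wave])
    (simp add: inner_axis scaleR_conv_of_real mult_ac)

lemma plane_wave_smooth: "plane_wave x0 \<xi> \<in> smooth_on UNIV"
proof (rule smooth_on_coinduct[of UNIV _ "range (\<lambda>c x. c * plane_wave x0 \<xi> x)"])
  fix f assume "f \<in> range (\<lambda>c x. c * plane_wave x0 \<xi> x)"
  then obtain c where f: "f = (\<lambda>x. c * plane_wave x0 \<xi> x)" by blast
  have d: "plane_wave x0 \<xi> differentiable (at x)" for x
    using has_derivative_plane_wave by (auto simp: differentiable_def)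
  show "f differentiable_on UNIV"
    unfolding f differentiable_on_def using d by (auto intro!: differentiable_mult)
  have "partial i f = (\<lambda>x. (c * (\<i> * of_real (\<xi> $ i))) * plane_wave x0 \<xi> x)" for i
    unfolding f by (rule ext) (simp add: partial_cmult[OF d] partial_plane_wave mult.assoc)
  then show "\<exists>g\<in>range (\<lambda>c x. c * plane_wave x0 \<xi> x). \<forall>x\<in>UNIV. partial i f x = g x" for i by auto
qed (auto intro: image_eqI[of _ _ 1])

lemma norm_plane_wave [simp]: "norm (plane_wave x0 \<xi> x) = 1"
  by (simp add: plane_wave_def)

text \<open>Pascal's rule, in the shape of the induction step for applying the n-th power of z +
  d/dx.\<close>

lemma binomial_shift_sum:
  fixes z :: complex and a :: "nat \<Rightarrow> complex"
  shows "z * (\<Sum>k\<le>n. of_nat (n choose k) * z ^ (n - k) * a k) + (\<Sum>k\<le>n. of_nat (n choose k) * z ^ (n - k) * a (Suc k))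
    = (\<Sum>k\<le>Suc n. of_nat (Suc n choose k) * z ^ (Suc n - k) * a k)"
proof -
  have "(\<Sum>k\<le>Suc n. of_nat (Suc n choose k) * z ^ (Suc n - k) * a k)
      = z ^ Suc n * a 0 + (\<Sum>k\<le>n. of_nat (n choose k) * z ^ (n - k) * a (Suc k) + of_nat (n choose Suc k) * z ^ (n - k) * a (Suc k))"
    by (subst sum.atMost_Suc_shift) (simp add: distrib_right)
  also have "\<dots> = (\<Sum>k\<le>n. of_nat (n choose k) * z ^ (n - k) * a (Suc k)) + (z ^ Suc n * a 0 + (\<Sum>k\<le>n. of_nat (n choose Suc k) * z ^ (n - k) * a (Suc k)))"
    by (simp add: sum.distrib)
  also have "z ^ Suc n * a 0 + (\<Sum>k\<le>n. of_nat (n choose Suc k) * z ^ (n - k) * a (Suc k))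
      = (\<Sum>k\<le>Suc n. of_nat (n choose k) * z ^ (Suc n - k) * a k)"
    by (subst sum.atMost_Suc_shift) simp
  also have "\<dots> = (\<Sum>k\<le>n. of_nat (n choose k) * z ^ (Suc n - k) * a k)" by simp
  also have "\<dots> = z * (\<Sum>k\<le>n. of_nat (n choose k) * z ^ (n - k) * a k)"
    unfolding sum_distrib_left by (intro sum.cong) (auto simp: Suc_diff_le mult_ac)
  finally show ?thesis by simp
qed

text \<open>Conjugation by the plane wave turns the j-th derivative into itself plus \<i> times the
  j-th frequency; the bracket is the binomial expansion of the n-th power of that operator.\<close>

lemma funpow_partial_plane_wave_mult:
  assumes q: "q \<in> smooth_on UNIV"
  shows "(partial j ^^ n) (\<lambda>x. plane_wave x0 \<xi> x * q x) =
    (\<lambda>x. plane_wave x0 \<xi> x * (\<Sum>k\<le>n. of_nat (n choose k) * (\<i> * of_real (\<xi> $ j)) ^ (n - k) * (partial j ^^ k) q x))"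
proof (induction n)
  case (Suc n)
  let ?z = "\<i> * of_real (\<xi> $ j)" and ?e = "plane_wave x0 \<xi>"
  let ?Q = "\<lambda>x. \<Sum>k\<le>n. (of_nat (n choose k) * ?z ^ (n - k)) * (partial j ^^ k) q x"
  have Q: "?Q \<in> smooth_on UNIV"
    by (intro smooth_on_sum smooth_on_cmult funpow_partial_smooth q) auto
  have "partial j (\<lambda>x. ?e x * ?Q x) x = ?e x * (\<Sum>k\<le>Suc n. of_nat (Suc n choose k) * ?z ^ (Suc n - k) * (partial j ^^ k) q x)" for x
  proof -
    have "partial j (\<lambda>x. ?e x * ?Q x) x = partial j ?e x * ?Q x + ?e x * partial j ?Q x"
      by (rule partial_mult) (use plane_wave_smooth Q smooth_on_differentiable in blast)+
    also have "partial j ?Q x = (\<Sum>k\<le>n. of_nat (n choose k) * ?z ^ (n - k) * (partial j ^^ Suc k) q x)"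
      by (subst partial_lincomb) (auto intro: funpow_partial_smooth q)
    also have "partial j ?e x * ?Q x = ?e x * (?z * ?Q x)" by (simp add: partial_plane_wave)
    finally have "partial j (\<lambda>x. ?e x * ?Q x) x = ?e x * (?z * ?Q x + (\<Sum>k\<le>n. of_nat (n choose k) * ?z ^ (n - k) * (partial j ^^ Suc k) q x))"
      by (simp only: distrib_left)
    then show ?thesis by (simp only: binomial_shift_sum[of ?z n "\<lambda>k. (partial j ^^ k) q x"])
  qed
  then have "partial j (\<lambda>x. ?e x * ?Q x) = (\<lambda>x. ?e x * (\<Sum>k\<le>Suc n. of_nat (Suc n choose k) * ?z ^ (Suc n - k) * (partial j ^^ k) q x))"
    by (rule ext)
  then show ?case unfolding funpow.simps o_apply Suc.IH .
qed simp

text \<open>As in \<open>lattice_on\<close>, entries outside \<open>J\<close> are zero so that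
  representatives are unique and the Leibniz sum can grow by one coordinate at a time.\<close>

definition sub_indices :: "'n set \<Rightarrow> ('n \<Rightarrow> nat) \<Rightarrow> ('n \<Rightarrow> nat) set" where
  "sub_indices J \<alpha> = {\<gamma>. \<forall>i. if i \<in> J then \<gamma> i \<le> \<alpha> i else \<gamma> i = 0}"

lemma bij_betw_sub_indices_insert:
  assumes "j \<notin> J"
  shows "bij_betw (\<lambda>(k, \<gamma>). \<gamma>(j := k)) ({..\<alpha> j} \<times> sub_indices J \<alpha>) (sub_indices (insert j J) \<alpha>)"
proof (rule bij_betwI[where g = "\<lambda>\<gamma>. (\<gamma> j, \<gamma>(j := 0))"])
  show "(\<lambda>(k, \<gamma>). \<gamma>(j := k)) \<in> {..\<alpha> j} \<times> sub_indices J \<alpha> \<rightarrow> sub_indices (insert j J) \<alpha>"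
    by (auto simp: sub_indices_def)
  show "(\<lambda>\<gamma>. (\<gamma> j, \<gamma>(j := 0))) \<in> sub_indices (insert j J) \<alpha> \<rightarrow> {..\<alpha> j} \<times> sub_indices J \<alpha>"
    using assms by (auto simp: sub_indices_def)
qed (use assms in \<open>auto simp: sub_indices_def fun_eq_iff\<close>)

lemma finite_sub_indices: "finite J \<Longrightarrow> finite (sub_indices J \<alpha>)"
proof (induction J rule: finite_induct)
  case empty
  have "sub_indices {} \<alpha> = {\<lambda>_. 0}" by (auto simp: sub_indices_def)
  then show ?case by simp
next
  case (insert j J)
  then show ?case using bij_betw_finite[OF bij_betw_sub_indices_insert[of j J \<alpha>]] by simp
qed

lemma foldr_partial_plane_wave_mult:
  fixes q :: "'n::finite cfun"
  assumes q: "q \<in> smooth_on UNIV" and js: "distinct js"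
  shows "foldr (\<lambda>i. partial i ^^ \<alpha> i) js (\<lambda>x. plane_wave x0 \<xi> x * q x) =
    (\<lambda>x. plane_wave x0 \<xi> x * (\<Sum>\<gamma>\<in>sub_indices (set js) \<alpha>.
       (\<Prod>i\<in>set js. of_nat (\<alpha> i choose \<gamma> i) * (\<i> * of_real (\<xi> $ i)) ^ (\<alpha> i - \<gamma> i)) * foldr (\<lambda>i. partial i ^^ \<gamma> i) js q x))"
  using js
proof (induction js)
  case Nil
  have "sub_indices {} \<alpha> = {\<lambda>_. 0}" by (auto simp: sub_indices_def)
  then show ?case by simp
next
  case (Cons j js)
  let ?c = "\<lambda>i k. of_nat (\<alpha> i choose k) * (\<i> * of_real (\<xi> $ i)) ^ (\<alpha> i - k)"
  let ?S = "sub_indices (set js) \<alpha>"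
  let ?f = "\<lambda>\<gamma>. foldr (\<lambda>i. partial i ^^ \<gamma> i) js q"
  let ?Q = "\<lambda>x. \<Sum>\<gamma>\<in>?S. (\<Prod>i\<in>set js. ?c i (\<gamma> i)) * ?f \<gamma> x"
  have j: "j \<notin> set js" "distinct js" using Cons.prems by auto
  have Q: "?Q \<in> smooth_on UNIV"
    by (intro smooth_on_sum smooth_on_cmult foldr_partial_smooth q) auto
  have "foldr (\<lambda>i. partial i ^^ \<alpha> i) (j # js) (\<lambda>x. plane_wave x0 \<xi> x * q x)
      = (partial j ^^ \<alpha> j) (\<lambda>x. plane_wave x0 \<xi> x * ?Q x)"
    using Cons.IH[OF j(2)] by simp
  also have "\<dots> = (\<lambda>x. plane_wave x0 \<xi> x * (\<Sum>k\<le>\<alpha> j. ?c j k * (partial j ^^ k) ?Q x))"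
    by (rule funpow_partial_plane_wave_mult[OF Q])
  also have "\<dots> = (\<lambda>x. plane_wave x0 \<xi> x * (\<Sum>k\<le>\<alpha> j. \<Sum>\<gamma>\<in>?S. ?c j k * ((\<Prod>i\<in>set js. ?c i (\<gamma> i)) * (partial j ^^ k) (?f \<gamma>) x)))"
    by (subst funpow_partial_lincomb) (auto intro: foldr_partial_smooth q finite_sub_indices simp: sum_distrib_left)
  also have "\<dots> = (\<lambda>x. plane_wave x0 \<xi> x * (\<Sum>(k, \<gamma>)\<in>{..\<alpha> j} \<times> ?S. ?c j k * ((\<Prod>i\<in>set js. ?c i (\<gamma> i)) * (partial j ^^ k) (?f \<gamma>) x)))"
    by (simp add: sum.cartesian_product)
  also have "\<dots> = (\<lambda>x. plane_wave x0 \<xi> x * (\<Sum>p\<in>{..\<alpha> j} \<times> ?S.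
      (\<Prod>i\<in>set (j # js). ?c i ((case p of (k, \<gamma>) \<Rightarrow> \<gamma>(j := k)) i)) * foldr (\<lambda>i. partial i ^^ (case p of (k, \<gamma>) \<Rightarrow> \<gamma>(j := k)) i) (j # js) q x))"
  proof (intro ext arg_cong2[where f = "(*)"] refl sum.cong)
    fix x p assume "p \<in> {..\<alpha> j} \<times> ?S"
    obtain k \<gamma> where p: "p = (k, \<gamma>)" by (cases p)
    have "foldr (\<lambda>i. partial i ^^ (\<gamma>(j := k)) i) js q = ?f \<gamma>"
      using j by (intro foldr_cong) auto
    moreover have "(\<Prod>i\<in>set js. ?c i ((\<gamma>(j := k)) i)) = (\<Prod>i\<in>set js. ?c i (\<gamma> i))"
      using j by (intro prod.cong) auto
    ultimately show "(case p of (k, \<gamma>) \<Rightarrow> ?c j k * ((\<Prod>i\<in>set js. ?c i (\<gamma> i)) * (partial j ^^ k) (?f \<gamma>) x))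
      = (\<Prod>i\<in>set (j # js). ?c i ((case p of (k, \<gamma>) \<Rightarrow> \<gamma>(j := k)) i)) * foldr (\<lambda>i. partial i ^^ (case p of (k, \<gamma>) \<Rightarrow> \<gamma>(j := k)) i) (j # js) q x"
      using j by (simp add: p del: fun_upd_apply) (simp add: mult.assoc)
  qed
  also have "\<dots> = (\<lambda>x. plane_wave x0 \<xi> x * (\<Sum>\<gamma>\<in>sub_indices (set (j # js)) \<alpha>.
      (\<Prod>i\<in>set (j # js). ?c i (\<gamma> i)) * foldr (\<lambda>i. partial i ^^ \<gamma> i) (j # js) q x))"
    by (subst sum.reindex_bij_betw[OF bij_betw_sub_indices_insert[OF j(1)]]) simp
  finally show ?case .
qed

text \<open>Conjugation turns D into D + \<xi>. The powers of \<i> from the plane wave cancel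
  against those in the normalization of D, and real coefficients remain.\<close>

lemma Dop_plane_wave_mult:
  fixes q :: "'n::finite cfun"
  assumes q: "q \<in> smooth_on UNIV"
  shows "Dop \<alpha> (\<lambda>x. plane_wave x0 \<xi> x * q x) x = plane_wave x0 \<xi> x *
    (\<Sum>\<gamma>\<in>sub_indices UNIV \<alpha>. of_real (\<Prod>i\<in>UNIV. real (\<alpha> i choose \<gamma> i) * \<xi> $ i ^ (\<alpha> i - \<gamma> i)) * Dop \<gamma> q x)"
proof -
  have "(- \<i>) ^ mi_order \<alpha> * (\<Prod>i\<in>UNIV. of_nat (\<alpha> i choose \<gamma> i) * (\<i> * of_real (\<xi> $ i)) ^ (\<alpha> i - \<gamma> i))
      = of_real (\<Prod>i\<in>UNIV. real (\<alpha> i choose \<gamma> i) * \<xi> $ i ^ (\<alpha> i - \<gamma> i)) * (- \<i>) ^ mi_order \<gamma>"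
    if "\<gamma> \<in> sub_indices UNIV \<alpha>" for \<gamma>
  proof -
    have i: "(- \<i>) ^ n * \<i> ^ n = 1" for n by (simp add: power_mult_distrib[symmetric])
    have le: "\<gamma> i \<le> \<alpha> i" for i using that by (auto simp: sub_indices_def)
    have "(- \<i>) ^ mi_order \<alpha> = (\<Prod>i\<in>UNIV. (- \<i>) ^ \<alpha> i)" "(- \<i>) ^ mi_order \<gamma> = (\<Prod>i\<in>UNIV. (- \<i>) ^ \<gamma> i)"
      by (simp_all add: mi_order_def power_sum)
    moreover have "(- \<i>) ^ \<alpha> i * (of_nat (\<alpha> i choose \<gamma> i) * (\<i> * of_real (\<xi> $ i)) ^ (\<alpha> i - \<gamma> i))
        = of_real (real (\<alpha> i choose \<gamma> i) * \<xi> $ i ^ (\<alpha> i - \<gamma> i)) * (- \<i>) ^ \<gamma> i" for i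
    proof -
      have "(- \<i>) ^ \<alpha> i = (- \<i>) ^ \<gamma> i * (- \<i>) ^ (\<alpha> i - \<gamma> i)" using le[of i] by (simp add: power_add[symmetric])
      then have "(- \<i>) ^ \<alpha> i * (of_nat (\<alpha> i choose \<gamma> i) * (\<i> * of_real (\<xi> $ i)) ^ (\<alpha> i - \<gamma> i))
        = ((- \<i>) ^ (\<alpha> i - \<gamma> i) * \<i> ^ (\<alpha> i - \<gamma> i)) * (of_real (real (\<alpha> i choose \<gamma> i) * \<xi> $ i ^ (\<alpha> i - \<gamma> i)) * (- \<i>) ^ \<gamma> i)"
        by (simp add: power_mult_distrib mult_ac)
      then show ?thesis by (simp only: i mult_1)
    qed
    ultimately show ?thesis
      by (simp only: prod.distrib[symmetric] of_real_prod)
  qed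
  note * = this
  have "Dop \<alpha> (\<lambda>x. plane_wave x0 \<xi> x * q x) x = plane_wave x0 \<xi> x *
      (\<Sum>\<gamma>\<in>sub_indices UNIV \<alpha>. ((- \<i>) ^ mi_order \<alpha> * (\<Prod>i\<in>UNIV. of_nat (\<alpha> i choose \<gamma> i) * (\<i> * of_real (\<xi> $ i)) ^ (\<alpha> i - \<gamma> i))) * mpartial \<gamma> q x)"
    unfolding Dop_def mpartial_def foldr_partial_plane_wave_mult[OF q distinct_coordinates(1)] distinct_coordinates(2)
    by (simp add: sum_distrib_left mult_ac)
  also have "\<dots> = plane_wave x0 \<xi> x * (\<Sum>\<gamma>\<in>sub_indices UNIV \<alpha>.
      (of_real (\<Prod>i\<in>UNIV. real (\<alpha> i choose \<gamma> i) * \<xi> $ i ^ (\<alpha> i - \<gamma> i)) * (- \<i>) ^ mi_order \<gamma>) * mpartial \<gamma> q x)"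
    by (intro arg_cong2[where f = "(*)", OF refl] sum.cong refl) (simp only: *)
  finally show ?thesis by (simp add: Dop_def mult.assoc)
qed

text \<open>Taylor's formula for the symbol at \<xi>, evaluated in D. It is exact because the symbol
  is a polynomial of degree at most m in \<xi>; this replaces the asymptotic composition
  formula.\<close>

theorem diff_op_plane_wave_mult:
  fixes q :: "'n::finite cfun"
  assumes q: "q \<in> smooth_on UNIV"
  shows "(\<Sum>\<alpha> | mi_order \<alpha> \<le> m. r \<alpha> x * Dop \<alpha> (\<lambda>x. plane_wave x0 \<xi> x * q x) x) =
    plane_wave x0 \<xi> x * (\<Sum>\<gamma> | mi_order \<gamma> \<le> m. of_real (1 / (\<Prod>i\<in>UNIV. fact (\<gamma> i))) * (symbol_xi_deriv m r \<gamma> \<xi> x * Dop \<gamma> q x))"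
proof -
  let ?b = "\<lambda>\<alpha> \<gamma>. \<Prod>i\<in>UNIV. real (\<alpha> i choose \<gamma> i) * \<xi> $ i ^ (\<alpha> i - \<gamma> i)"
  \<comment> \<open>The range of \<gamma> is made independent of \<alpha> so that the two sums can
    be interchanged; the terms added contain a vanishing binomial coefficient.\<close>
  have ext: "(\<Sum>\<gamma>\<in>sub_indices UNIV \<alpha>. of_real (?b \<alpha> \<gamma>) * Dop \<gamma> q x) = (\<Sum>\<gamma> | mi_order \<gamma> \<le> m. of_real (?b \<alpha> \<gamma>) * Dop \<gamma> q x)"
    if "mi_order \<alpha> \<le> m" for \<alpha>
  proof (rule sum.mono_neutral_left[OF finite_mi_order_le])
    show "sub_indices UNIV \<alpha> \<subseteq> {\<gamma>. mi_order \<gamma> \<le> m}"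
    proof
      fix \<gamma> assume "\<gamma> \<in> sub_indices UNIV \<alpha>"
      then have "mi_order \<gamma> \<le> mi_order \<alpha>" unfolding mi_order_def by (intro sum_mono) (auto simp: sub_indices_def)
      then show "\<gamma> \<in> {\<gamma>. mi_order \<gamma> \<le> m}" using that by simp
    qed
    show "\<forall>\<gamma>\<in>{\<gamma>. mi_order \<gamma> \<le> m} - sub_indices UNIV \<alpha>. of_real (?b \<alpha> \<gamma>) * Dop \<gamma> q x = 0"
    proof
      fix \<gamma> assume "\<gamma> \<in> {\<gamma>. mi_order \<gamma> \<le> m} - sub_indices UNIV \<alpha>"
      then obtain i where "\<gamma> i > \<alpha> i" by (auto simp: sub_indices_def not_le)
      then have "?b \<alpha> \<gamma> = 0" by (intro prod_zero) (auto intro!: bexI[of _ i])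
      then show "of_real (?b \<alpha> \<gamma>) * Dop \<gamma> q x = 0" by simp
    qed
  qed
  have b: "monom_deriv_coeff \<alpha> \<gamma> \<xi> = (\<Prod>i\<in>UNIV. fact (\<gamma> i)) * ?b \<alpha> \<gamma>" for \<alpha> \<gamma>
    unfolding monom_deriv_coeff_def by (simp add: prod.distrib mult.assoc)
  have nz: "(\<Prod>i\<in>UNIV. fact (\<gamma> i) :: real) \<noteq> 0" for \<gamma> :: "'n multi_index" by simp
  have "(\<Sum>\<alpha> | mi_order \<alpha> \<le> m. r \<alpha> x * Dop \<alpha> (\<lambda>x. plane_wave x0 \<xi> x * q x) x)
      = (\<Sum>\<alpha> | mi_order \<alpha> \<le> m. plane_wave x0 \<xi> x * (\<Sum>\<gamma> | mi_order \<gamma> \<le> m. r \<alpha> x * (of_real (?b \<alpha> \<gamma>) * Dop \<gamma> q x)))"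
  proof (intro sum.cong refl)
    fix \<alpha> :: "'n multi_index" assume "\<alpha> \<in> {\<alpha>. mi_order \<alpha> \<le> m}"
    then have "Dop \<alpha> (\<lambda>x. plane_wave x0 \<xi> x * q x) x = plane_wave x0 \<xi> x * (\<Sum>\<gamma> | mi_order \<gamma> \<le> m. of_real (?b \<alpha> \<gamma>) * Dop \<gamma> q x)"
      using Dop_plane_wave_mult[OF q, of \<alpha> x0 \<xi> x] ext[of \<alpha>] by (simp only: mem_Collect_eq)
    then show "r \<alpha> x * Dop \<alpha> (\<lambda>x. plane_wave x0 \<xi> x * q x) x
        = plane_wave x0 \<xi> x * (\<Sum>\<gamma> | mi_order \<gamma> \<le> m. r \<alpha> x * (of_real (?b \<alpha> \<gamma>) * Dop \<gamma> q x))"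
      by (simp only: sum_distrib_left[symmetric] mult.left_commute)
  qed
  also have "\<dots> = plane_wave x0 \<xi> x * (\<Sum>\<gamma> | mi_order \<gamma> \<le> m. \<Sum>\<alpha> | mi_order \<alpha> \<le> m. r \<alpha> x * (of_real (?b \<alpha> \<gamma>) * Dop \<gamma> q x))"
    by (subst sum.swap) (simp add: sum_distrib_left)
  also have "\<dots> = plane_wave x0 \<xi> x * (\<Sum>\<gamma> | mi_order \<gamma> \<le> m. of_real (1 / (\<Prod>i\<in>UNIV. fact (\<gamma> i))) * (symbol_xi_deriv m r \<gamma> \<xi> x * Dop \<gamma> q x))"
  proof (intro arg_cong2[where f = "(*)"] refl sum.cong)
    fix \<gamma> :: "'n multi_index"
    have "of_real (1 / (\<Prod>i\<in>UNIV. fact (\<gamma> i))) * (symbol_xi_deriv m r \<gamma> \<xi> x * Dop \<gamma> q x)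
        = (\<Sum>\<alpha> | mi_order \<alpha> \<le> m. of_real (1 / (\<Prod>i\<in>UNIV. fact (\<gamma> i)) * monom_deriv_coeff \<alpha> \<gamma> \<xi>) * (r \<alpha> x * Dop \<gamma> q x))"
      by (simp add: symbol_xi_deriv_def sum_distrib_left sum_distrib_right mult_ac)
    also have "\<dots> = (\<Sum>\<alpha> | mi_order \<alpha> \<le> m. of_real (?b \<alpha> \<gamma>) * (r \<alpha> x * Dop \<gamma> q x))"
      unfolding b using nz[of \<gamma>] by simp
    finally show "(\<Sum>\<alpha> | mi_order \<alpha> \<le> m. r \<alpha> x * (of_real (?b \<alpha> \<gamma>) * Dop \<gamma> q x))
        = of_real (1 / (\<Prod>i\<in>UNIV. fact (\<gamma> i))) * (symbol_xi_deriv m r \<gamma> \<xi> x * Dop \<gamma> q x)"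
      by (simp add: mult_ac)
  qed
  finally show ?thesis .
qed

subsection \<open>Lattice equations\<close>

text \<open>Two weights are in play: decay in each coordinate yields this product, whose inverse
  square is summable, while \<open>sum_weight\<close> measures the size of a frequency, in which the
  operator gains. Each is bounded by a power of the other.\<close>

definition prod_weight :: "('n::finite \<Rightarrow> int) \<Rightarrow> real" where
  "prod_weight k = (\<Prod>i\<in>UNIV. 1 + \<bar>real_of_int (k i)\<bar>)"

definition sum_weight :: "('n::finite \<Rightarrow> int) \<Rightarrow> real" where
  "sum_weight k = 1 + (\<Sum>i\<in>UNIV. \<bar>real_of_int (k i)\<bar>)"

abbreviation ldiff :: "('n \<Rightarrow> int) \<Rightarrow> ('n \<Rightarrow> int) \<Rightarrow> 'n \<Rightarrow> int" where
  "ldiff k j \<equiv> \<lambda>i. k i - j i"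

lemma sum_weight_ge_1: "sum_weight k \<ge> 1"
  by (simp add: sum_weight_def sum_nonneg)

lemma prod_weight_ge_1: "prod_weight k \<ge> 1"
  unfolding prod_weight_def by (rule prod_ge_1) auto

lemma sum_weight_le_prod_weight: "sum_weight k \<le> prod_weight k"
proof -
  have "1 + (\<Sum>i\<in>S. \<bar>real_of_int (k i)\<bar>) \<le> (\<Prod>i\<in>S. 1 + \<bar>real_of_int (k i)\<bar>)" if "finite S" for S
    using that
  proof (induction S rule: finite_induct)
    case (insert i S)
    have "1 + (\<Sum>i\<in>insert i S. \<bar>real_of_int (k i)\<bar>) \<le> (1 + \<bar>real_of_int (k i)\<bar>) * (1 + (\<Sum>i\<in>S. \<bar>real_of_int (k i)\<bar>))"
      using insert.hyps by (simp add: algebra_simps sum_nonneg)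
    also have "\<dots> \<le> (1 + \<bar>real_of_int (k i)\<bar>) * (\<Prod>i\<in>S. 1 + \<bar>real_of_int (k i)\<bar>)"
      by (intro mult_left_mono insert.IH) auto
    finally show ?case using insert.hyps by simp
  qed simp
  then show ?thesis by (simp add: sum_weight_def prod_weight_def)
qed

lemma prod_weight_le_sum_weight_power: "prod_weight (k :: 'n::finite \<Rightarrow> int) \<le> sum_weight k ^ CARD('n)"
proof -
  have "prod_weight k \<le> (\<Prod>i\<in>(UNIV :: 'n set). sum_weight k)"
    unfolding prod_weight_def sum_weight_def
    by (intro prod_mono) (auto intro!: member_le_sum)
  then show ?thesis by simp
qed

lemma sum_weight_submult: "sum_weight k \<le> sum_weight (ldiff k j) * sum_weight j"
proof -
  let ?a = "\<Sum>i\<in>UNIV. \<bar>real_of_int (k i - j i)\<bar>" and ?b = "\<Sum>i\<in>UNIV. \<bar>real_of_int (j i)\<bar>"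
  have "(\<Sum>i\<in>UNIV. \<bar>real_of_int (k i)\<bar>) \<le> (\<Sum>i\<in>UNIV. \<bar>real_of_int (k i - j i)\<bar> + \<bar>real_of_int (j i)\<bar>)"
    by (intro sum_mono) auto
  then have "(\<Sum>i\<in>UNIV. \<bar>real_of_int (k i)\<bar>) \<le> ?a + ?b" by (simp add: sum.distrib)
  moreover have "?a * ?b \<ge> 0" by (intro mult_nonneg_nonneg sum_nonneg) auto
  moreover have "(1 + ?a) * (1 + ?b) = 1 + (?a + ?b) + ?a * ?b" by (simp add: algebra_simps)
  ultimately show ?thesis unfolding sum_weight_def by linarith
qed

lemma summable_on_prod_weight: "(\<lambda>k :: 'n::finite \<Rightarrow> int. 1 / prod_weight k ^ 2) summable_on UNIV"
proof -
  have "lattice_on (UNIV :: 'n set) = UNIV" by (auto simp: lattice_on_def)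
  then show ?thesis using summable_on_lattice[of "UNIV :: 'n set"]
    by (simp add: prod_weight_def prod_power_distrib[symmetric] prod_dividef)
qed

text \<open>The argument of type \<open>itself\<close> only fixes the dimension.\<close>

definition weight_sum :: "'n::finite itself \<Rightarrow> real" where
  "weight_sum _ = (\<Sum>\<^sub>\<infinity>k :: 'n \<Rightarrow> int. 1 / prod_weight k ^ 2)"

lemma bij_ldiff: "bij (ldiff k)"
  by (rule bijI') (auto simp: fun_eq_iff intro!: exI[of _ "ldiff k _"])

lemma bij_ldiff2: "bij (\<lambda>k. ldiff k j)"
  by (rule bijI') (auto simp: fun_eq_iff intro!: exI[of _ "\<lambda>i. _ i + j i"])

lemma has_sum_weight_ldiff:
  "((\<lambda>j :: 'n::finite \<Rightarrow> int. 1 / prod_weight (ldiff k j) ^ 2) has_sum weight_sum TYPE('n)) UNIV"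
  unfolding has_sum_reindex_bij_betw[OF bij_ldiff, of "\<lambda>j. 1 / prod_weight j ^ 2"] weight_sum_def
  by (rule has_sum_infsum[OF summable_on_prod_weight])

lemma weight_sum_nonneg: "weight_sum TYPE('n::finite) \<ge> 0"
  unfolding weight_sum_def by (rule infsum_nonneg) simp

text \<open>A row of a matrix whose entries decay away from the diagonal, estimated in the sup norm;
  translating the row by \<open>k\<close> does not change the total weight.\<close>

lemma lattice_sum_bound:
  fixes F :: "('n::finite \<Rightarrow> int) \<Rightarrow> complex"
  assumes "\<And>j. norm (F j) \<le> A * (1 / prod_weight (ldiff k j) ^ 2)"
  shows "(\<lambda>j. norm (F j)) summable_on UNIV" "norm (\<Sum>\<^sub>\<infinity>j. F j) \<le> A * weight_sum TYPE('n)"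
proof -
  have S: "((\<lambda>j. A * (1 / prod_weight (ldiff k j) ^ 2)) has_sum A * weight_sum TYPE('n)) UNIV"
    by (rule has_sum_cmult_right[OF has_sum_weight_ldiff])
  show F: "(\<lambda>j. norm (F j)) summable_on UNIV"
    by (rule summable_on_comparison_test[OF has_sum_imp_summable[OF S]]) (use assms in auto)
  have "norm (\<Sum>\<^sub>\<infinity>j. F j) \<le> (\<Sum>\<^sub>\<infinity>j. norm (F j))" by (rule norm_infsum_bound[OF F])
  also have "\<dots> \<le> A * weight_sum TYPE('n)"
    by (rule has_sum_mono[OF has_sum_infsum[OF F] S]) (rule assms)
  finally show "norm (\<Sum>\<^sub>\<infinity>j. F j) \<le> A * weight_sum TYPE('n)" .
qed

text \<open>The entry at (k, j) is the Fourier coefficient of index k - j belonging to column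
  \<open>j\<close>: with \<open>a j\<close> the coefficients of \<rho> at frequency
  \<open>j\<close>, column \<open>j\<close> describes multiplication of the j-th plane wave by
  \<rho>.\<close>

definition lattice_op :: "(('n \<Rightarrow> int) \<Rightarrow> ('n \<Rightarrow> int) \<Rightarrow> complex) \<Rightarrow> (('n \<Rightarrow> int) \<Rightarrow> complex) \<Rightarrow> ('n \<Rightarrow> int) \<Rightarrow> complex" where
  "lattice_op a c k = (\<Sum>\<^sub>\<infinity>j. a j (ldiff k j) * c j)"

text \<open>Neumann series in the sup norm. The rows of the matrix have absolute sum at most 1/2,
  and the geometric series gives the factor 2.\<close>

lemma lattice_solve:
  fixes a :: "('n::finite \<Rightarrow> int) \<Rightarrow> ('n \<Rightarrow> int) \<Rightarrow> complex"
  assumes a: "\<And>j l. norm (a j l) \<le> \<delta> * (1 / prod_weight l ^ 2)"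
    and \<delta>: "\<delta> * weight_sum TYPE('n) \<le> 1 / 2"
    and b: "\<And>k. norm (b k) \<le> B"
  obtains c where "\<And>k. norm (c k) \<le> 2 * B" "\<And>k. c k + lattice_op a c k = b k"
proof -
  define I where "I n = ((\<lambda>c k. - lattice_op a c k) ^^ n) b" for n
  have I_Suc: "I (Suc n) k = - lattice_op a (I n) k" for n k by (simp add: I_def)
  have B0: "B \<ge> 0" using b[of "\<lambda>_. 0"] norm_ge_zero order_trans by blast
  have "norm (a (\<lambda>_. 0) (\<lambda>_. 0)) \<le> \<delta>" using a[of "\<lambda>_. 0" "\<lambda>_. 0"] by (simp add: prod_weight_def)
  then have \<delta>0: "\<delta> \<ge> 0" using norm_ge_zero order_trans by blast
  have entry: "norm (a j (ldiff k j) * c j) \<le> \<delta> * D * (1 / prod_weight (ldiff k j) ^ 2)" if "\<And>j. norm (c j) \<le> D" for c D j k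
  proof -
    have "norm (a j (ldiff k j) * c j) \<le> (\<delta> * (1 / prod_weight (ldiff k j) ^ 2)) * D"
      unfolding norm_mult using that[of j] \<delta>0 by (intro mult_mono a) auto
    then show ?thesis by (simp add: mult_ac)
  qed
  have In: "norm (I n k) \<le> B * (1 / 2) ^ n" for n k
  proof (induction n arbitrary: k)
    case 0
    then show ?case using b by (simp add: I_def)
  next
    case (Suc n)
    have "norm (lattice_op a (I n) k) \<le> \<delta> * (B * (1 / 2) ^ n) * weight_sum TYPE('n)"
      unfolding lattice_op_def by (rule lattice_sum_bound(2)[OF entry[OF Suc.IH]])
    also have "\<dots> = (\<delta> * weight_sum TYPE('n)) * (B * (1 / 2) ^ n)" by simp
    also have "\<dots> \<le> (1 / 2) * (B * (1 / 2) ^ n)"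
      using \<delta> B0 by (intro mult_right_mono) auto
    finally show ?case by (simp add: I_Suc)
  qed
  have geo: "((\<lambda>n. B * (1 / 2) ^ n) has_sum (2 * B)) UNIV"
  proof -
    have "(\<lambda>n. B * (1 / 2) ^ n) sums (B * (1 / (1 - 1 / 2)))"
      by (intro sums_mult geometric_sums) simp
    then show ?thesis using B0 by (intro sums_nonneg_imp_has_sum) (auto simp: mult.commute)
  qed
  have nI: "(\<lambda>n. norm (I n k)) summable_on UNIV" for k
    by (rule summable_on_comparison_test[OF has_sum_imp_summable[OF geo]]) (use In in auto)
  then have sI: "(\<lambda>n. I n k) summable_on UNIV" for k by (rule abs_summable_summable)
  define c where "c k = (\<Sum>\<^sub>\<infinity>n. I n k)" for k
  show ?thesis
  proof (rule that[of c])
    fix k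
    have "norm (c k) \<le> (\<Sum>\<^sub>\<infinity>n. norm (I n k))" unfolding c_def by (rule norm_infsum_bound[OF nI])
    also have "\<dots> \<le> 2 * B" by (rule has_sum_mono[OF has_sum_infsum[OF nI] geo]) (rule In)
    finally show "norm (c k) \<le> 2 * B" .
    \<comment> \<open>The operator is applied to the Neumann series term by term; interchanging the
      two sums is justified by absolute summability of the double family.\<close>
    have "lattice_op a c k = (\<Sum>\<^sub>\<infinity>j. \<Sum>\<^sub>\<infinity>n. a j (ldiff k j) * I n j)"
      unfolding lattice_op_def c_def by (subst infsum_cmult_right[OF sI]) simp
    also have "\<dots> = (\<Sum>\<^sub>\<infinity>n. \<Sum>\<^sub>\<infinity>j. a j (ldiff k j) * I n j)"
    proof (rule infsum_swap_banach)
      have "(\<lambda>p. \<delta> * (1 / prod_weight (ldiff k (fst p)) ^ 2) * (B * (1 / 2) ^ snd p)) summable_on (UNIV \<times> UNIV)"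
      proof (rule summable_on_SigmaI)
        show "((\<lambda>n. \<delta> * (1 / prod_weight (ldiff k (fst (j, n))) ^ 2) * (B * (1 / 2) ^ snd (j, n))) has_sum
            \<delta> * (1 / prod_weight (ldiff k j) ^ 2) * (2 * B)) UNIV" for j
          unfolding fst_conv snd_conv by (rule has_sum_cmult_right[OF geo])
        show "(\<lambda>j. \<delta> * (1 / prod_weight (ldiff k j) ^ 2) * (2 * B)) summable_on UNIV"
          by (intro summable_on_cmult_left summable_on_cmult_right has_sum_imp_summable[OF has_sum_weight_ldiff])
      qed (use \<delta>0 B0 in auto)
      then have "(\<lambda>p. norm (a (fst p) (ldiff k (fst p)) * I (snd p) (fst p))) summable_on (UNIV \<times> UNIV)"
      proof (rule summable_on_comparison_test)
        fix p
        show "norm (a (fst p) (ldiff k (fst p)) * I (snd p) (fst p)) \<le> \<delta> * (1 / prod_weight (ldiff k (fst p)) ^ 2) * (B * (1 / 2) ^ snd p)"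
          unfolding norm_mult using \<delta>0 by (intro mult_mono a In) auto
      qed simp
      then show "(\<lambda>(j, n). a j (ldiff k j) * I n j) summable_on UNIV \<times> UNIV"
        unfolding case_prod_unfold by (rule abs_summable_summable)
    qed
    also have "\<dots> = (\<Sum>\<^sub>\<infinity>n. - I (Suc n) k)" by (simp add: I_Suc lattice_op_def)
    also have "\<dots> = - (\<Sum>\<^sub>\<infinity>n. I (Suc n) k)" by (rule infsum_uminus)
    finally have 1: "lattice_op a c k = - (\<Sum>\<^sub>\<infinity>n. I (Suc n) k)" .
    have sums: "(\<lambda>n. I n k) sums c k" unfolding c_def by (intro has_sum_imp_sums has_sum_infsum sI)
    have "(\<lambda>n. I (Suc n) k) summable_on UNIV"
    proof -
      have "(\<lambda>n. I n k) summable_on range Suc" by (rule summable_on_subset_banach[OF sI]) simp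
      then show ?thesis by (simp add: summable_on_reindex o_def)
    qed
    then have "(\<lambda>n. I (Suc n) k) sums (\<Sum>\<^sub>\<infinity>n. I (Suc n) k)" by (intro has_sum_imp_sums has_sum_infsum)
    moreover have "(\<lambda>n. I (Suc n) k) sums (c k - I 0 k)"
      using sums sums_Suc_iff[of "\<lambda>n. I n k" "c k - I 0 k"] by simp
    ultimately have "(\<Sum>\<^sub>\<infinity>n. I (Suc n) k) = c k - b k" using sums_unique2 by (auto simp: I_def)
    with 1 show "c k + lattice_op a c k = b k" by simp
  qed
qed

text \<open>Of the s + 3 powers of off-diagonal decay, s + 1 move the weight from \<open>k\<close>
  to \<open>j\<close> by submultiplicativity and 2 make the row summable. Of the s + 1 weights that
  arrive at \<open>j\<close>, \<open>s\<close> are absorbed by the decay of \<open>c\<close> and the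
  last one by \<tau>, which is the gain.\<close>

lemma lattice_op_gain:
  fixes a :: "('n::finite \<Rightarrow> int) \<Rightarrow> ('n \<Rightarrow> int) \<Rightarrow> complex"
  assumes a: "\<And>j l. norm (a j l) * prod_weight l ^ (s + 3) \<le> \<phi> * \<tau> j" and \<tau>: "\<And>j. \<tau> j * sum_weight j \<le> t"
    and c: "\<And>k. sum_weight k ^ s * norm (c k) \<le> D" and \<phi>: "\<phi> \<ge> 0"
  shows "sum_weight k ^ Suc s * norm (lattice_op a c k) \<le> \<phi> * t * D * weight_sum TYPE('n)"
proof -
  have "norm (c (\<lambda>_. 0)) \<le> D" using c[of "\<lambda>_. 0"] by (simp add: sum_weight_def)
  then have D: "D \<ge> 0" using norm_ge_zero order_trans by blast
  have "norm (of_real (sum_weight k ^ Suc s) * (a j (ldiff k j) * c j)) \<le> \<phi> * t * D * (1 / prod_weight (ldiff k j) ^ 2)" for j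
  proof -
    let ?W = "prod_weight (ldiff k j)"
    have W: "?W \<ge> 1" by (rule prod_weight_ge_1)
    have V: "sum_weight j \<ge> 1" "sum_weight k \<ge> 1" by (rule sum_weight_ge_1)+
    have "sum_weight k \<le> ?W * sum_weight j"
      using sum_weight_submult[of k j] mult_right_mono[OF sum_weight_le_prod_weight[of "ldiff k j"], of "sum_weight j"] V by linarith
    then have "sum_weight k ^ Suc s \<le> (?W * sum_weight j) ^ Suc s"
      using V by (intro power_mono) auto
    then have "sum_weight k ^ Suc s * (norm (a j (ldiff k j)) * norm (c j)) \<le> (?W * sum_weight j) ^ Suc s * (norm (a j (ldiff k j)) * norm (c j))"
      by (intro mult_right_mono) auto
    also have "\<dots> = (norm (a j (ldiff k j)) * ?W ^ (s + 3)) * sum_weight j * (sum_weight j ^ s * norm (c j)) * (1 / ?W ^ 2)"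
      using W by (simp add: power_mult_distrib power_add power3_eq_cube power2_eq_square field_simps)
    also have "\<dots> \<le> (\<phi> * \<tau> j) * sum_weight j * D * (1 / ?W ^ 2)"
    proof -
      have *: "0 \<le> norm (a j (ldiff k j)) * ?W ^ (s + 3)" using W by (intro mult_nonneg_nonneg) auto
      then have "0 \<le> \<phi> * \<tau> j" using a[of j "ldiff k j"] by linarith
      then show ?thesis
        using W V D * by (intro mult_right_mono mult_mono a c) (auto intro!: mult_nonneg_nonneg)
    qed
    also have "\<dots> = \<phi> * (\<tau> j * sum_weight j) * D * (1 / ?W ^ 2)" by (simp add: mult_ac)
    also have "\<dots> \<le> \<phi> * t * D * (1 / ?W ^ 2)"
      using \<phi> D by (intro mult_right_mono mult_left_mono \<tau>) auto
    finally show ?thesis using V by (simp add: norm_mult norm_power)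
  qed
  from lattice_sum_bound(2)[OF this]
  have "norm (\<Sum>\<^sub>\<infinity>j. of_real (sum_weight k ^ Suc s) * (a j (ldiff k j) * c j)) \<le> \<phi> * t * D * weight_sum TYPE('n)" .
  moreover have "(\<Sum>\<^sub>\<infinity>j. of_real (sum_weight k ^ Suc s) * (a j (ldiff k j) * c j)) = of_real (sum_weight k ^ Suc s) * lattice_op a c k"
    unfolding lattice_op_def by (rule infsum_cmult_right')
  ultimately show ?thesis using sum_weight_ge_1[of k] by (simp add: norm_mult norm_power)
qed

fun weight_const :: "(nat \<Rightarrow> real) \<Rightarrow> real \<Rightarrow> nat \<Rightarrow> real" where
  "weight_const \<phi> t 0 = 2"
| "weight_const \<phi> t (Suc s) = 1 + \<phi> (s + 3) * t * weight_const \<phi> t s"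

text \<open>Bootstrapping through c = b - M c: each round raises the exponent by one and enlarges
  the constant as recorded in \<open>weight_const\<close>, but demands no further smallness. The
  contraction condition behind the bound for s = 0 therefore serves all \<open>s\<close>.\<close>

lemma lattice_solution_weighted:
  fixes a :: "('n::finite \<Rightarrow> int) \<Rightarrow> ('n \<Rightarrow> int) \<Rightarrow> complex"
  assumes a: "\<And>j l s. norm (a j l) * prod_weight l ^ s \<le> \<phi> s * \<tau> j" and \<tau>: "\<And>j. \<tau> j * sum_weight j \<le> t"
    and \<phi>: "\<And>s. \<phi> s \<ge> 0"
    and c: "\<And>B k. (\<And>k. norm (b k) \<le> B) \<Longrightarrow> norm (c k) \<le> 2 * B" "\<And>k. c k + lattice_op a c k = b k"
    and b: "\<And>k. sum_weight k ^ s * norm (b k) \<le> E"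
  shows "sum_weight k ^ s * norm (c k) \<le> weight_const \<phi> (t * weight_sum TYPE('n)) s * E"
  using b
proof (induction s arbitrary: k)
  case 0
  then show ?case using c(1)[of E k] by simp
next
  case (Suc s)
  let ?Q = "weight_const \<phi> (t * weight_sum TYPE('n)) s"
  have "sum_weight k ^ s * norm (b k) \<le> E" for k
  proof -
    have "sum_weight k ^ s * norm (b k) \<le> sum_weight k ^ Suc s * norm (b k)"
      using sum_weight_ge_1[of k] by (intro mult_right_mono power_increasing) auto
    then show ?thesis using Suc.prems[of k] by linarith
  qed
  then have "sum_weight k ^ s * norm (c k) \<le> ?Q * E" for k by (rule Suc.IH)
  from lattice_op_gain[OF a \<tau> this \<phi>]
  have gain: "sum_weight k ^ Suc s * norm (lattice_op a c k) \<le> \<phi> (s + 3) * t * (?Q * E) * weight_sum TYPE('n)" .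
  have "c k = b k - lattice_op a c k" using c(2)[of k] by (simp add: eq_diff_eq)
  then have "norm (c k) \<le> norm (b k) + norm (lattice_op a c k)" by (simp add: norm_triangle_ineq4)
  then have "sum_weight k ^ Suc s * norm (c k) \<le> sum_weight k ^ Suc s * (norm (b k) + norm (lattice_op a c k))"
    using sum_weight_ge_1[of k] by (intro mult_left_mono) auto
  also have "\<dots> \<le> E + \<phi> (s + 3) * t * (?Q * E) * weight_sum TYPE('n)"
    using Suc.prems[of k] gain by (simp only: distrib_left add_mono)
  finally show ?case by (simp add: algebra_simps)
qed

subsection \<open>The remainder of the approximate inverse\<close>

lemma jet_plane_wave: "jet N (plane_wave x0 \<xi>) x \<le> (1 + (\<Sum>i\<in>UNIV. \<bar>\<xi> $ i\<bar>)) ^ N"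
proof (induction N)
  case (Suc N)
  let ?E = "1 + (\<Sum>i\<in>UNIV. \<bar>\<xi> $ i\<bar>)"
  have E: "?E \<ge> 1" by (simp add: sum_nonneg)
  have "jet (Suc N) (plane_wave x0 \<xi>) x = 1 + (\<Sum>i\<in>UNIV. \<bar>\<xi> $ i\<bar> * jet N (plane_wave x0 \<xi>) x)"
    by (simp add: partial_plane_wave jet_cmult[OF open_UNIV UNIV_I plane_wave_smooth] norm_mult)
  also have "\<dots> \<le> 1 + (\<Sum>i\<in>UNIV. \<bar>\<xi> $ i\<bar> * ?E ^ N)"
    by (intro add_mono sum_mono mult_left_mono Suc.IH) auto
  also have "\<dots> \<le> ?E ^ N + (\<Sum>i\<in>UNIV. \<bar>\<xi> $ i\<bar>) * ?E ^ N"
    using E one_le_power[OF E, of N] by (simp add: sum_distrib_right)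
  finally show ?case by (simp add: distrib_right)
qed simp

lemma affine_differentiable:
  fixes f :: "'n::finite cfun"
  assumes "f \<in> smooth_on UNIV"
  shows "(\<lambda>y. f (z + c *\<^sub>R y)) differentiable (at y)"
proof -
  have "((\<lambda>y. z + c *\<^sub>R y) has_derivative (\<lambda>h. c *\<^sub>R h)) (at y)" by (auto intro!: derivative_eq_intros)
  then show ?thesis
    using has_derivative_compose[of "\<lambda>y. z + c *\<^sub>R y" "\<lambda>h. c *\<^sub>R h" y UNIV f] smooth_on_differentiable[OF assms open_UNIV UNIV_I]
    unfolding differentiable_def by blast
qed

lemma partial_affine:
  fixes f :: "'n::finite cfun"
  assumes f: "f \<in> smooth_on UNIV"
  shows "partial i (\<lambda>y. f (z + c *\<^sub>R y)) = (\<lambda>y. of_real c * partial i f (z + c *\<^sub>R y))"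
proof
  fix y
  have "((\<lambda>y. z + c *\<^sub>R y) has_derivative (\<lambda>h. c *\<^sub>R h)) (at y)" by (auto intro!: derivative_eq_intros)
  from partial_eq[OF has_derivative_compose[OF this has_derivative_partial[OF smooth_on_differentiable[OF f open_UNIV UNIV_I]]], of i]
  have "partial i (\<lambda>y. f (z + c *\<^sub>R y)) y = (\<Sum>j\<in>UNIV. (c *\<^sub>R axis i 1) $ j *\<^sub>R partial j f (z + c *\<^sub>R y))" .
  also have "\<dots> = (\<Sum>j\<in>UNIV. if j = i then c *\<^sub>R partial j f (z + c *\<^sub>R y) else 0)"
    by (intro sum.cong) (auto simp: axis_def)
  finally show "partial i (\<lambda>y. f (z + c *\<^sub>R y)) y = of_real c * partial i f (z + c *\<^sub>R y)"
    by (simp add: scaleR_conv_of_real)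
qed

lemma smooth_affine:
  fixes f :: "'n::finite cfun"
  assumes "f \<in> smooth_on UNIV"
  shows "(\<lambda>y. f (z + c *\<^sub>R y)) \<in> smooth_on UNIV"
proof (rule smooth_on_coinduct[of UNIV _ "{\<lambda>y. f (z + c *\<^sub>R y) |f. f \<in> smooth_on UNIV}"])
  fix g assume "g \<in> {\<lambda>y. f (z + c *\<^sub>R y) |f. f \<in> smooth_on UNIV}"
  then obtain f where f: "g = (\<lambda>y. f (z + c *\<^sub>R y))" "f \<in> smooth_on UNIV" by blast
  show "g differentiable_on UNIV"
    unfolding f(1) using affine_differentiable[OF f(2)] by (simp add: differentiable_on_def)
  have "partial i g = (\<lambda>y. (\<lambda>x. of_real c * partial i f x) (z + c *\<^sub>R y))" for i
    unfolding f(1) by (rule partial_affine[OF f(2)])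
  moreover have "(\<lambda>x. of_real c * partial i f x) \<in> smooth_on UNIV" for i
    by (intro smooth_on_cmult smooth_on_partial f(2)) simp
  ultimately have "partial i g \<in> {\<lambda>y. f (z + c *\<^sub>R y) |f. f \<in> smooth_on UNIV}" for i
    by (intro CollectI exI[of _ "\<lambda>x. of_real c * partial i f x"]) simp
  then show "\<exists>h\<in>{\<lambda>y. f (z + c *\<^sub>R y) |f. f \<in> smooth_on UNIV}. \<forall>x\<in>UNIV. partial i g x = h x" for i
    by blast
qed (use assms in auto)

text \<open>Each derivative brings out one factor \<open>c\<close> of modulus at most 1. Used with c
  = 1/L, so that rescaling to a fixed cube does not spoil bounds on the original functions.\<close>

lemma jet_affine:
  fixes f :: "'n::finite cfun"
  assumes "f \<in> smooth_on UNIV" "\<bar>c\<bar> \<le> 1"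
  shows "jet N (\<lambda>y. f (z + c *\<^sub>R y)) y \<le> jet N f (z + c *\<^sub>R y)"
  using assms(1)
proof (induction N arbitrary: f)
  case (Suc N)
  have "jet N (partial i (\<lambda>y. f (z + c *\<^sub>R y))) y \<le> jet N (partial i f) (z + c *\<^sub>R y)" for i
  proof -
    have "jet N (partial i (\<lambda>y. f (z + c *\<^sub>R y))) y = \<bar>c\<bar> * jet N (\<lambda>y. partial i f (z + c *\<^sub>R y)) y"
      unfolding partial_affine[OF Suc.prems]
      by (simp add: jet_cmult[OF open_UNIV UNIV_I smooth_affine[OF smooth_on_partial[OF Suc.prems]]])
    also have "\<dots> \<le> 1 * jet N (partial i f) (z + c *\<^sub>R y)"
      using assms(2) by (intro mult_mono Suc.IH smooth_on_partial Suc.prems) auto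
    finally show ?thesis by simp
  qed
  then show ?case by (auto intro!: sum_mono)
qed simp

lemma bounded_jet_ball:
  fixes g :: "'n::finite cfun"
  assumes g: "g \<in> smooth_on UNIV" "\<And>x. norm (x - x0) \<ge> \<rho> \<Longrightarrow> g x = 0"
  obtains A where "\<And>x. jet N g x \<le> A"
proof -
  have "bounded (jet N g ` cball x0 \<rho>)"
    by (intro compact_imp_bounded compact_continuous_image compact_cball continuous_on_subset[OF jet_continuous_on[OF g(1)]]) auto
  then obtain A where A: "\<And>x. x \<in> cball x0 \<rho> \<Longrightarrow> norm (jet N g x) \<le> A" by (metis bounded_iff imageI)
  have "jet N g x \<le> max A 0" for x
  proof (cases "x \<in> cball x0 \<rho>")
    case True then show ?thesis using A[of x] by auto
  next
    case False
    then have "jet N g x = jet N (\<lambda>_. 0) x"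
      by (intro jet_cong[of "- cball x0 \<rho>"]) (auto simp: dist_norm norm_minus_commute intro!: g(2))
    then show ?thesis by simp
  qed
  then show ?thesis by (rule that)
qed

lemma japanese_bracket_ge_1: "japanese_bracket \<xi> \<ge> 1"
  by (simp add: japanese_bracket_def)

lemma norm_le_japanese_bracket: "norm \<xi> \<le> japanese_bracket \<xi>"
  unfolding japanese_bracket_def by (rule real_le_rsqrt) simp

lemma Dop_smooth: "f \<in> smooth_on UNIV \<Longrightarrow> Dop \<alpha> f \<in> smooth_on UNIV"
  unfolding Dop_def[abs_def] by (intro smooth_on_cmult mpartial_smooth) auto

lemma jet_Dop: "f \<in> smooth_on UNIV \<Longrightarrow> jet N (Dop \<alpha> f) x \<le> jet (N + mi_order \<alpha>) f x"
  unfolding Dop_def[abs_def]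
  by (subst jet_cmult[OF open_UNIV UNIV_I mpartial_smooth]) (auto simp: norm_power jet_mpartial)

text \<open>The terms \<gamma> \<noteq> 0 of \<open>diff_op_plane_wave_mult\<close> for q = 1/P; the
  term \<gamma> = 0 is exactly 1.\<close>

definition symbol_remainder :: "nat \<Rightarrow> ('n::finite multi_index \<Rightarrow> 'n cfun) \<Rightarrow> real ^ 'n \<Rightarrow> 'n cfun" where
  "symbol_remainder m r \<xi> x = (\<Sum>\<gamma> | mi_order \<gamma> \<le> m \<and> \<gamma> \<noteq> (\<lambda>_. 0).
     of_real (1 / (\<Prod>i\<in>UNIV. fact (\<gamma> i))) * (symbol_xi_deriv m r \<gamma> \<xi> x * Dop \<gamma> (\<lambda>x. inverse (symbol_of m r x \<xi>)) x))"

text \<open>The number of terms times the product of the bounds for their two factors. The constant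
  is an explicit expression in \<open>B\<close> so that its dependence on \<epsilon> can be traced
  afterwards.\<close>

definition remainder_const :: "'n::finite itself \<Rightarrow> nat \<Rightarrow> (nat \<Rightarrow> real) \<Rightarrow> nat \<Rightarrow> real" where
  "remainder_const _ m B N = real (card {\<gamma> :: 'n multi_index. mi_order \<gamma> \<le> m \<and> \<gamma> \<noteq> (\<lambda>_. 0)}) *
     (2 ^ N * B N * inverse_jet_const (N + m) (B (N + m)))"

text \<open>The situation at one fixed \<epsilon>: \<open>d\<close> stands for the lower bound in
  (ii), and \<open>B\<close> collects the relative derivative bounds of (iii). Estimates inside
  depend on the symbol only through \<open>d\<close> and \<open>B\<close>, which is the uniformity
  needed when \<epsilon> varies.\<close>

locale microhypoelliptic_symbol =
  fixes m :: nat and r :: "'n::finite multi_index \<Rightarrow> 'n cfun" and R d :: real and B :: "nat \<Rightarrow> real"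
  assumes r: "\<And>\<alpha>. mi_order \<alpha> \<le> m \<Longrightarrow> r \<alpha> \<in> smooth_on UNIV"
    and d: "d > 0" "\<And>x \<xi>. norm \<xi> \<ge> R \<Longrightarrow> norm (symbol_of m r x \<xi>) \<ge> d"
    and B: "\<And>N. B N \<ge> 0"
      "\<And>N \<gamma> x \<xi>. mi_order \<gamma> \<le> m \<Longrightarrow> norm \<xi> \<ge> R \<Longrightarrow> jet N (symbol_xi_deriv m r \<gamma> \<xi>) x
         \<le> B N * norm (symbol_of m r x \<xi>) * japanese_bracket \<xi> powr (- real (mi_order \<gamma>))"
begin

lemma symbol_nonzero: "norm \<xi> \<ge> R \<Longrightarrow> symbol_of m r x \<xi> \<noteq> 0"
  using d(1) d(2)[of \<xi> x] by auto

lemma symbol_of_smooth: "(\<lambda>x. symbol_of m r x \<xi>) \<in> smooth_on UNIV"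
  using symbol_xi_deriv_smooth[of m r "\<lambda>_. 0" \<xi>] r by (simp add: symbol_xi_deriv_zero[abs_def])

lemma inverse_symbol_smooth:
  "norm \<xi> \<ge> R \<Longrightarrow> (\<lambda>x. inverse (symbol_of m r x \<xi>)) \<in> smooth_on UNIV"
  by (intro smooth_on_inverse symbol_of_smooth) (use symbol_nonzero in auto)

lemma jet_inverse_symbol:
  assumes "norm \<xi> \<ge> R"
  shows "jet N (\<lambda>x. inverse (symbol_of m r x \<xi>)) x \<le> inverse_jet_const N (B N) / norm (symbol_of m r x \<xi>)"
proof (rule jet_inverse[OF open_UNIV UNIV_I symbol_of_smooth])
  have "symbol_xi_deriv m r (\<lambda>_. 0) \<xi> = (\<lambda>x. symbol_of m r x \<xi>)" by (rule ext) (rule symbol_xi_deriv_zero)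
  moreover have "japanese_bracket \<xi> > 0" using japanese_bracket_ge_1[of \<xi>] by linarith
  ultimately show "jet N (\<lambda>x. symbol_of m r x \<xi>) x \<le> B N * norm (symbol_of m r x \<xi>)"
    using B(2)[of "\<lambda>_. 0" \<xi> N x] assms by simp
qed (use symbol_nonzero assms in auto)

lemma symbol_remainder_smooth: "norm \<xi> \<ge> R \<Longrightarrow> symbol_remainder m r \<xi> \<in> smooth_on UNIV"
  unfolding symbol_remainder_def[abs_def]
  by (intro smooth_on_sum smooth_on_cmult smooth_on_mult Dop_smooth inverse_symbol_smooth symbol_xi_deriv_smooth r) auto

lemma diff_op_plane_wave_inverse:
  assumes "norm \<xi> \<ge> R"
  shows "(\<Sum>\<alpha> | mi_order \<alpha> \<le> m. r \<alpha> x * Dop \<alpha> (\<lambda>x. plane_wave x0 \<xi> x * inverse (symbol_of m r x \<xi>)) x) =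
    plane_wave x0 \<xi> x * (1 + symbol_remainder m r \<xi> x)"
proof -
  let ?t = "\<lambda>\<gamma>. of_real (1 / (\<Prod>i\<in>UNIV. fact (\<gamma> i))) * (symbol_xi_deriv m r \<gamma> \<xi> x * Dop \<gamma> (\<lambda>x. inverse (symbol_of m r x \<xi>)) x)"
  have "(\<Sum>\<gamma> | mi_order \<gamma> \<le> m. ?t \<gamma>) = ?t (\<lambda>_. 0) + (\<Sum>\<gamma>\<in>{\<gamma>. mi_order \<gamma> \<le> m} - {\<lambda>_. 0}. ?t \<gamma>)"
    by (rule sum.remove[OF finite_mi_order_le]) simp
  moreover have "{\<gamma>. mi_order \<gamma> \<le> m} - {\<lambda>_. 0} = {\<gamma> :: 'n multi_index. mi_order \<gamma> \<le> m \<and> \<gamma> \<noteq> (\<lambda>_. 0)}" by auto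
  moreover have "?t (\<lambda>_. 0) = 1"
    using symbol_nonzero[OF assms, of x] by (simp add: symbol_xi_deriv_zero Dop_def)
  ultimately have "(\<Sum>\<gamma> | mi_order \<gamma> \<le> m. ?t \<gamma>) = 1 + symbol_remainder m r \<xi> x"
    by (simp add: symbol_remainder_def)
  then show ?thesis
    using diff_op_plane_wave_mult[OF inverse_symbol_smooth[OF assms], of r x x0 \<xi> m] by simp
qed

text \<open>The factor |P| in the bound of the \<xi>-derivative cancels against the bound for 1/P,
  and |\<gamma>| \<ge> 1 leaves at least one inverse power of the bracket. The constant contains
  neither \<open>d\<close> nor \<xi>.\<close>

lemma jet_symbol_remainder:
  assumes "norm \<xi> \<ge> R"
  shows "jet N (symbol_remainder m r \<xi>) x \<le> remainder_const TYPE('n) m B N / japanese_bracket \<xi>"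
proof -
  let ?q = "\<lambda>x. inverse (symbol_of m r x \<xi>)" and ?p = "norm (symbol_of m r x \<xi>)" and ?J = "japanese_bracket \<xi>"
  let ?I = "inverse_jet_const (N + m) (B (N + m))"
  let ?S = "{\<gamma> :: 'n multi_index. mi_order \<gamma> \<le> m \<and> \<gamma> \<noteq> (\<lambda>_. 0)}"
  have J: "?J \<ge> 1" by (rule japanese_bracket_ge_1)
  have p: "?p > 0" using symbol_nonzero[OF assms] by simp
  have I: "?I \<ge> 1" by (rule inverse_jet_const_ge_1[OF B(1)])
  have q: "?q \<in> smooth_on UNIV" by (rule inverse_symbol_smooth[OF assms])
  have fin: "finite ?S" by (rule finite_subset[OF _ finite_mi_order_le[of m]]) auto
  have "jet N (\<lambda>x. of_real (1 / (\<Prod>i\<in>UNIV. fact (\<gamma> i))) * (symbol_xi_deriv m r \<gamma> \<xi> x * Dop \<gamma> ?q x)) x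
      \<le> 2 ^ N * B N * ?I / ?J" if \<gamma>: "\<gamma> \<in> ?S" for \<gamma>
  proof -
    have s: "symbol_xi_deriv m r \<gamma> \<xi> \<in> smooth_on UNIV" by (rule symbol_xi_deriv_smooth[OF r])
    have ord: "mi_order \<gamma> \<ge> 1" "mi_order \<gamma> \<le> m" using \<gamma> mi_order_eq_0_iff[of \<gamma>] by auto
    have f: "norm (complex_of_real (1 / (\<Prod>i\<in>UNIV. fact (\<gamma> i)))) \<le> 1"
    proof -
      have "(\<Prod>i\<in>UNIV. fact (\<gamma> i) :: real) \<ge> 1" by (rule prod_ge_1) (simp add: fact_ge_1)
      then show ?thesis by (simp only: norm_of_real) simp
    qed
    have "jet N (\<lambda>x. of_real (1 / (\<Prod>i\<in>UNIV. fact (\<gamma> i))) * (symbol_xi_deriv m r \<gamma> \<xi> x * Dop \<gamma> ?q x)) x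
        = norm (complex_of_real (1 / (\<Prod>i\<in>UNIV. fact (\<gamma> i)))) * jet N (\<lambda>x. symbol_xi_deriv m r \<gamma> \<xi> x * Dop \<gamma> ?q x) x"
      by (rule jet_cmult[OF open_UNIV UNIV_I]) (intro smooth_on_mult open_UNIV s Dop_smooth q)
    also have "\<dots> \<le> 1 * jet N (\<lambda>x. symbol_xi_deriv m r \<gamma> \<xi> x * Dop \<gamma> ?q x) x"
      by (intro mult_right_mono f) auto
    also have "\<dots> \<le> 2 ^ N * jet N (symbol_xi_deriv m r \<gamma> \<xi>) x * jet N (Dop \<gamma> ?q) x"
      using jet_mult[OF open_UNIV UNIV_I s Dop_smooth[OF q]] by simp
    also have "\<dots> \<le> 2 ^ N * (B N * ?p * (1 / ?J)) * (?I / ?p)"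
    proof (intro mult_mono mult_left_mono)
      have "?J powr (- real (mi_order \<gamma>)) \<le> ?J powr (- 1)"
        using J ord by (intro powr_mono) auto
      also have "\<dots> = 1 / ?J" using J by (simp add: powr_minus_divide)
      finally have "B N * ?p * ?J powr (- real (mi_order \<gamma>)) \<le> B N * ?p * (1 / ?J)"
        using B(1)[of N] p by (intro mult_left_mono) auto
      then show "jet N (symbol_xi_deriv m r \<gamma> \<xi>) x \<le> B N * ?p * (1 / ?J)"
        using B(2)[OF ord(2) assms, of N x] by linarith
      have "jet N (Dop \<gamma> ?q) x \<le> jet (N + mi_order \<gamma>) ?q x" by (rule jet_Dop[OF q])
      also have "\<dots> \<le> jet (N + m) ?q x" using ord by (intro jet_mono) auto
      also have "\<dots> \<le> ?I / ?p" by (rule jet_inverse_symbol[OF assms])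
      finally show "jet N (Dop \<gamma> ?q) x \<le> ?I / ?p" .
    qed (use B(1)[of N] p J in auto)
    also have "\<dots> = 2 ^ N * B N * ?I / ?J" using p by simp
    finally show ?thesis .
  qed
  then have "(\<Sum>\<gamma>\<in>?S. jet N (\<lambda>x. of_real (1 / (\<Prod>i\<in>UNIV. fact (\<gamma> i))) * (symbol_xi_deriv m r \<gamma> \<xi> x * Dop \<gamma> ?q x)) x)
      \<le> real (card ?S) * (2 ^ N * B N * ?I / ?J)"
    by (rule sum_bounded_above)
  moreover have "jet N (symbol_remainder m r \<xi>) x \<le> (\<Sum>\<gamma>\<in>?S. jet N (\<lambda>x. of_real (1 / (\<Prod>i\<in>UNIV. fact (\<gamma> i))) * (symbol_xi_deriv m r \<gamma> \<xi> x * Dop \<gamma> ?q x)) x)"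
    unfolding symbol_remainder_def[abs_def]
    by (intro jet_sum[OF open_UNIV UNIV_I fin] smooth_on_cmult smooth_on_mult open_UNIV Dop_smooth q symbol_xi_deriv_smooth r)
  ultimately show ?thesis by (simp add: remainder_const_def)
qed

end

section \<open>Half-integer frequencies and local Fourier expansions\<close>

definition freq :: "real \<Rightarrow> ('n::finite \<Rightarrow> int) \<Rightarrow> real ^ 'n" where
  "freq L k = (\<chi> i. L * (of_int (k i) + 1 / 2))"

lemma abs_half_integer_ge: "\<bar>real_of_int k + 1 / 2\<bar> \<ge> 1 / 2" "\<bar>real_of_int k\<bar> \<le> 2 * \<bar>real_of_int k + 1 / 2\<bar>"
proof -
  have "k \<ge> 0 \<or> k \<le> -1" by linarith
  then have "real_of_int k \<ge> 0 \<or> real_of_int k \<le> -1" by (metis of_int_0_le_iff of_int_le_iff of_int_minus of_int_1)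
  then show "\<bar>real_of_int k + 1 / 2\<bar> \<ge> 1 / 2" "\<bar>real_of_int k\<bar> \<le> 2 * \<bar>real_of_int k + 1 / 2\<bar>" by auto
qed

lemma norm_freq_ge:
  assumes "L \<ge> 0"
  shows "norm (freq L (k :: 'n::finite \<Rightarrow> int)) \<ge> L / 2"
proof -
  fix i :: 'n
  have "L * (1 / 2) \<le> L * \<bar>of_int (k i) + 1 / 2\<bar>" using assms abs_half_integer_ge by (intro mult_left_mono) auto
  also have "\<dots> = \<bar>freq L k $ i\<bar>" using assms by (simp add: freq_def abs_mult)
  also have "\<dots> \<le> norm (freq L k)" by (rule component_le_norm_cart)
  finally show ?thesis by simp
qed

text \<open>The constant does not involve \<open>L\<close>, so the one power gained by the lattice
  operator is uniform in the scale.\<close>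

lemma sum_weight_le_bracket:
  assumes "L \<ge> 1"
  shows "sum_weight (k :: 'n::finite \<Rightarrow> int) \<le> (1 + 2 * real CARD('n)) * japanese_bracket (freq L k)"
proof -
  let ?J = "japanese_bracket (freq L k)"
  have "\<bar>real_of_int (k i)\<bar> \<le> 2 * ?J" for i
  proof -
    have "\<bar>real_of_int (k i)\<bar> \<le> 2 * (1 * \<bar>of_int (k i) + 1 / 2\<bar>)" using abs_half_integer_ge(2)[of "k i"] by simp
    also have "\<dots> \<le> 2 * (L * \<bar>of_int (k i) + 1 / 2\<bar>)" using assms by (intro mult_left_mono mult_right_mono) auto
    also have "L * \<bar>of_int (k i) + 1 / 2\<bar> = \<bar>freq L k $ i\<bar>" using assms by (simp add: freq_def abs_mult)
    also have "\<dots> \<le> ?J" using component_le_norm_cart[of "freq L k" i] norm_le_japanese_bracket[of "freq L k"] by linarith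
    finally show ?thesis by simp
  qed
  then have "(\<Sum>i\<in>UNIV. \<bar>real_of_int (k i)\<bar>) \<le> (\<Sum>i\<in>(UNIV :: 'n set). 2 * ?J)" by (intro sum_mono)
  then show ?thesis using japanese_bracket_ge_1[of "freq L k"] by (simp add: sum_weight_def algebra_simps)
qed

lemma one_plus_sum_freq_le:
  assumes "L \<ge> 1"
  shows "1 + (\<Sum>i\<in>UNIV. \<bar>freq L k $ i\<bar>) \<le> (L * (1 + real CARD('n))) * sum_weight (k :: 'n::finite \<Rightarrow> int)"
proof -
  let ?s = "\<Sum>i\<in>UNIV. \<bar>real_of_int (k i)\<bar>"
  have "\<bar>freq L k $ i\<bar> \<le> L * (\<bar>real_of_int (k i)\<bar> + 1 / 2)" for i
    using assms by (auto simp: freq_def abs_mult intro!: mult_left_mono)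
  then have "(\<Sum>i\<in>UNIV. \<bar>freq L k $ i\<bar>) \<le> (\<Sum>i\<in>UNIV. L * (\<bar>real_of_int (k i)\<bar> + 1 / 2))" by (intro sum_mono)
  also have "\<dots> = L * (?s + real CARD('n) * (1 / 2))"
    by (simp add: sum_distrib_left[symmetric] sum.distrib)
  finally have "(\<Sum>i\<in>UNIV. \<bar>freq L k $ i\<bar>) \<le> L * (?s + real CARD('n) * (1 / 2))" .
  moreover have "L * (1 + ?s + real CARD('n)) = L + L * (?s + real CARD('n) * (1 / 2)) + L * (real CARD('n) * (1 / 2))"
    by (simp add: algebra_simps)
  moreover have "L * (real CARD('n) * (1 / 2)) \<ge> 0" using assms by simp
  ultimately have "1 + (\<Sum>i\<in>UNIV. \<bar>freq L k $ i\<bar>) \<le> L * (1 + ?s + real CARD('n))"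
    using assms by linarith
  also have "\<dots> \<le> L * ((1 + real CARD('n)) * sum_weight k)"
    using assms by (intro mult_left_mono) (auto simp: sum_weight_def algebra_simps sum_nonneg)
  finally show ?thesis by (simp add: mult.assoc)
qed

lemma plane_wave_freq:
  "plane_wave x0 (freq L k) x = cis (\<Sum>i\<in>UNIV. (of_int (k i) + 1 / 2) * (L *\<^sub>R (x - x0)) $ i)"
  by (simp add: plane_wave_def freq_def inner_vec_def mult_ac)

text \<open>For decay \<open>s\<close>, s derivatives are spent per coordinate: the outer power of 2
  comes from the Fourier coefficients, the inner one from multiplication with the cut-off, whose
  jets are bounded by \<open>X\<close>.\<close>

definition expansion_const :: "'n::finite itself \<Rightarrow> (nat \<Rightarrow> real) \<Rightarrow> nat \<Rightarrow> (nat \<Rightarrow> real) \<Rightarrow> nat \<Rightarrow> real" where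
  "expansion_const T X m B s = 2 ^ (s * CARD('n)) * (2 ^ (s * CARD('n)) * X (s * CARD('n)) * remainder_const T m B (s * CARD('n)))"

text \<open>In order: the product rule, \<open>N\<close> derivatives of a plane wave, the jet of
  1/P, the lattice equation, the Fourier coefficients of the right-hand side, and the final
  summation. In \<open>s\<close>, the part \<open>N\<close> pays for the derivatives of the plane
  wave, and twice the dimension pays for comparing \<open>sum_weight\<close> with the summable
  inverse square of \<open>prod_weight\<close>.\<close>

definition solution_const :: "'n::finite itself \<Rightarrow> real \<Rightarrow> (nat \<Rightarrow> real) \<Rightarrow> nat \<Rightarrow> (nat \<Rightarrow> real) \<Rightarrow> nat \<Rightarrow> real" where
  "solution_const T L X m B N = (let s = N + 2 * CARD('n) in
     2 ^ N * (L * (1 + real CARD('n))) ^ N * inverse_jet_const N (B N) *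
     (weight_const (expansion_const T X m B) ((1 + 2 * real CARD('n)) * weight_sum T) s *
       (2 ^ (s * CARD('n)) * (2 ^ (s * CARD('n)) * (1 + real CARD('n) / 2) ^ (s * CARD('n))))) * weight_sum T)"

text \<open>Half-integer characters are integer characters times one fixed wave. Multiplying by the
  inverse of that wave reduces the claim to \<open>fourier_expansion\<close>; its jets are the
  origin of the powers of 1 + n/2.\<close>

lemma twisted_fourier_expansion:
  fixes g :: "'n::finite cfun"
  assumes g: "g \<in> smooth_on UNIV" "\<And>x. norm (x - x0) \<ge> 1 / L \<Longrightarrow> g x = 0" and L: "L \<ge> 1"
  shows "\<exists>b :: ('n \<Rightarrow> int) \<Rightarrow> complex.
    (\<forall>x. norm (x - x0) < 1 / L \<longrightarrow> ((\<lambda>k. b k * plane_wave x0 (freq L k) x) has_sum g x) UNIV) \<and>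
    (\<forall>s M k. (\<forall>x. jet (s * CARD('n)) g x \<le> M) \<longrightarrow>
       sum_weight k ^ s * norm (b k) \<le> 2 ^ (s * CARD('n)) * (2 ^ (s * CARD('n)) * (1 + real CARD('n) / 2) ^ (s * CARD('n)) * M))"
proof -
  \<comment> \<open>The frequency of the inverse of the fixed wave, in the rescaled variable y = L
    (x - x0).\<close>
  define \<eta> :: "real ^ 'n" where "\<eta> = (\<chi> i. - (1 / 2))"
  define h where "h y = plane_wave 0 \<eta> y * g (x0 + (1 / L) *\<^sub>R y)" for y
  have h: "h \<in> smooth_on UNIV"
    unfolding h_def[abs_def] by (intro smooth_on_mult open_UNIV plane_wave_smooth smooth_affine g(1))
  have jh: "jet N h y \<le> 2 ^ N * (1 + real CARD('n) / 2) ^ N * jet N g (x0 + (1 / L) *\<^sub>R y)" for N y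
  proof -
    have "jet N h y \<le> 2 ^ N * jet N (plane_wave 0 \<eta>) y * jet N (\<lambda>y. g (x0 + (1 / L) *\<^sub>R y)) y"
      unfolding h_def[abs_def] by (intro jet_mult[OF open_UNIV UNIV_I] plane_wave_smooth smooth_affine g(1))
    also have "\<dots> \<le> 2 ^ N * (1 + real CARD('n) / 2) ^ N * jet N g (x0 + (1 / L) *\<^sub>R y)"
    proof (intro mult_mono mult_left_mono)
      show "jet N (plane_wave 0 \<eta>) y \<le> (1 + real CARD('n) / 2) ^ N"
        using jet_plane_wave[of N 0 \<eta> y] by (simp add: \<eta>_def)
      show "jet N (\<lambda>y. g (x0 + (1 / L) *\<^sub>R y)) y \<le> jet N g (x0 + (1 / L) *\<^sub>R y)"
        using L by (intro jet_affine g(1)) auto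
    qed auto
    finally show ?thesis .
  qed
  have "h y = 0" if "\<bar>y $ i\<bar> > 3" for y i
  proof -
    have "norm y > 3" using that component_le_norm_cart[of y i] by linarith
    then have "norm ((x0 + (1 / L) *\<^sub>R y) - x0) \<ge> 1 / L" using L by (simp add: field_simps)
    then show ?thesis unfolding h_def using g(2) by simp
  qed
  then have "\<forall>y i. \<bar>y $ i\<bar> > 3 \<longrightarrow> h y = 0" by blast
  from fourier_expansion[OF h this] obtain b :: "('n \<Rightarrow> int) \<Rightarrow> complex" where
    b: "\<forall>y. (\<forall>i. \<bar>y $ i\<bar> < pi) \<longrightarrow> ((\<lambda>\<kappa>. b \<kappa> * cis (\<Sum>i\<in>UNIV. of_int (\<kappa> i) * y $ i)) has_sum h y) UNIV"
    "\<forall>s A \<kappa>. (\<forall>y. jet (s * CARD('n)) h y \<le> A) \<longrightarrow>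
       norm (b \<kappa>) * (\<Prod>i\<in>UNIV. 1 + \<bar>real_of_int (\<kappa> i)\<bar>) ^ s \<le> 2 ^ (s * CARD('n)) * A"
    by blast
  show ?thesis
  proof (intro exI[of _ b] conjI allI impI)
    fix x assume x: "norm (x - x0) < 1 / L"
    define y where "y = L *\<^sub>R (x - x0)"
    have "norm y = L * norm (x - x0)" using L by (simp add: y_def)
    then have "norm y < 1" using x L by (simp add: field_simps)
    then have "\<bar>y $ i\<bar> < pi" for i using component_le_norm_cart[of y i] pi_gt3 by linarith
    then have "((\<lambda>\<kappa>. cis ((1 / 2) * (\<Sum>i\<in>UNIV. y $ i)) * (b \<kappa> * cis (\<Sum>i\<in>UNIV. of_int (\<kappa> i) * y $ i))) has_sum cis ((1 / 2) * (\<Sum>i\<in>UNIV. y $ i)) * h y) UNIV"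
      by (intro has_sum_cmult_right b(1)[rule_format])
    moreover have "cis ((1 / 2) * (\<Sum>i\<in>UNIV. y $ i)) * (b \<kappa> * cis (\<Sum>i\<in>UNIV. of_int (\<kappa> i) * y $ i)) = b \<kappa> * plane_wave x0 (freq L \<kappa>) x" for \<kappa>
    proof -
      have "cis ((1 / 2) * (\<Sum>i\<in>UNIV. y $ i)) * cis (\<Sum>i\<in>UNIV. of_int (\<kappa> i) * y $ i) = plane_wave x0 (freq L \<kappa>) x"
        unfolding plane_wave_freq y_def[symmetric]
        by (simp add: cis_mult distrib_right sum.distrib sum_distrib_left add.commute)
      then show ?thesis by (simp add: mult.left_commute)
    qed
    moreover have "cis ((1 / 2) * (\<Sum>i\<in>UNIV. y $ i)) * h y = g x"
    proof -
      have "x0 + (1 / L) *\<^sub>R y = x" using L by (simp add: y_def)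
      moreover have "cis ((1 / 2) * (\<Sum>i\<in>UNIV. y $ i)) * plane_wave 0 \<eta> y = 1"
        by (simp add: plane_wave_def \<eta>_def inner_vec_def cis_mult sum_negf sum_divide_distrib[symmetric])
      ultimately show ?thesis by (simp add: h_def mult.assoc[symmetric])
    qed
    ultimately show "((\<lambda>k. b k * plane_wave x0 (freq L k) x) has_sum g x) UNIV" by (simp only:)
  next
    fix s M k assume M: "\<forall>x. jet (s * CARD('n)) g x \<le> M"
    let ?N = "s * CARD('n)"
    have "jet ?N h y \<le> 2 ^ ?N * (1 + real CARD('n) / 2) ^ ?N * M" for y
      by (rule order_trans[OF jh]) (intro mult_left_mono M[rule_format]; simp)
    with b(2) have "norm (b k) * (\<Prod>i\<in>UNIV. 1 + \<bar>real_of_int (k i)\<bar>) ^ s \<le> 2 ^ ?N * (2 ^ ?N * (1 + real CARD('n) / 2) ^ ?N * M)"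
      by blast
    then
    have "norm (b k) * prod_weight k ^ s \<le> 2 ^ ?N * (2 ^ ?N * (1 + real CARD('n) / 2) ^ ?N * M)"
      by (simp add: prod_weight_def)
    moreover have "sum_weight k ^ s * norm (b k) \<le> prod_weight k ^ s * norm (b k)"
      using sum_weight_ge_1[of k] by (intro mult_right_mono power_mono sum_weight_le_prod_weight) auto
    ultimately show "sum_weight k ^ s * norm (b k) \<le> 2 ^ ?N * (2 ^ ?N * (1 + real CARD('n) / 2) ^ ?N * M)"
      by (simp add: mult.commute)
  qed
qed

context microhypoelliptic_symbol
begin

text \<open>\<rho> is not periodic, so it is cut off in the rescaled variable y = L (x - x0): \<psi>
  equals 1 where the expansion is claimed, and its support fits into one period. Since L \<ge> 1,
  the constant does not depend on \<open>L\<close>.\<close>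

lemma remainder_expansion:
  fixes \<psi> :: "'n cfun"
  assumes \<psi>: "\<psi> \<in> smooth_on UNIV" "\<And>y. norm y \<le> 1 \<Longrightarrow> \<psi> y = 1" "\<And>y. norm y \<ge> 2 \<Longrightarrow> \<psi> y = 0"
    and X: "\<And>N y. jet N \<psi> y \<le> X N" and L: "L \<ge> 1" and \<xi>: "norm \<xi> \<ge> R"
  shows "\<exists>a :: ('n \<Rightarrow> int) \<Rightarrow> complex.
    (\<forall>x. norm (x - x0) < 1 / L \<longrightarrow> ((\<lambda>l. a l * cis (\<Sum>i\<in>UNIV. of_int (l i) * (L *\<^sub>R (x - x0)) $ i)) has_sum symbol_remainder m r \<xi> x) UNIV) \<and>
    (\<forall>s l. norm (a l) * prod_weight l ^ s \<le> expansion_const TYPE('n) X m B s * (1 / japanese_bracket \<xi>))"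
proof -
  define h where "h y = \<psi> y * symbol_remainder m r \<xi> (x0 + (1 / L) *\<^sub>R y)" for y
  have \<rho>: "symbol_remainder m r \<xi> \<in> smooth_on UNIV" by (rule symbol_remainder_smooth[OF \<xi>])
  have h: "h \<in> smooth_on UNIV"
    unfolding h_def[abs_def] by (intro smooth_on_mult open_UNIV \<psi>(1) smooth_affine \<rho>)
  have jh: "jet N h y \<le> 2 ^ N * X N * (remainder_const TYPE('n) m B N / japanese_bracket \<xi>)" for N y
  proof -
    have "jet N h y \<le> 2 ^ N * jet N \<psi> y * jet N (\<lambda>y. symbol_remainder m r \<xi> (x0 + (1 / L) *\<^sub>R y)) y"
      unfolding h_def[abs_def] by (intro jet_mult[OF open_UNIV UNIV_I] \<psi>(1) smooth_affine \<rho>)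
    also have "\<dots> \<le> 2 ^ N * X N * (remainder_const TYPE('n) m B N / japanese_bracket \<xi>)"
    proof (intro mult_mono mult_left_mono X)
      have "jet N (\<lambda>y. symbol_remainder m r \<xi> (x0 + (1 / L) *\<^sub>R y)) y \<le> jet N (symbol_remainder m r \<xi>) (x0 + (1 / L) *\<^sub>R y)"
        using L by (intro jet_affine \<rho>) auto
      also have "\<dots> \<le> remainder_const TYPE('n) m B N / japanese_bracket \<xi>" by (rule jet_symbol_remainder[OF \<xi>])
      finally show "jet N (\<lambda>y. symbol_remainder m r \<xi> (x0 + (1 / L) *\<^sub>R y)) y \<le> remainder_const TYPE('n) m B N / japanese_bracket \<xi>" .
      have "0 \<le> X N" using X[of N 0] jet_nonneg[of N \<psi> 0] by linarith
      then show "0 \<le> 2 ^ N * X N" by simp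
    qed auto
    finally show ?thesis .
  qed
  have "h y = 0" if "\<bar>y $ i\<bar> > 3" for y i
    using that component_le_norm_cart[of y i] \<psi>(3)[of y] by (simp add: h_def)
  then have "\<forall>y i. \<bar>y $ i\<bar> > 3 \<longrightarrow> h y = 0" by blast
  from fourier_expansion[OF h this] obtain a :: "('n \<Rightarrow> int) \<Rightarrow> complex" where
    a: "\<forall>y. (\<forall>i. \<bar>y $ i\<bar> < pi) \<longrightarrow> ((\<lambda>\<kappa>. a \<kappa> * cis (\<Sum>i\<in>UNIV. of_int (\<kappa> i) * y $ i)) has_sum h y) UNIV"
    "\<forall>s A \<kappa>. (\<forall>y. jet (s * CARD('n)) h y \<le> A) \<longrightarrow>
       norm (a \<kappa>) * (\<Prod>i\<in>UNIV. 1 + \<bar>real_of_int (\<kappa> i)\<bar>) ^ s \<le> 2 ^ (s * CARD('n)) * A"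
    by blast
  show ?thesis
  proof (intro exI[of _ a] conjI allI impI)
    fix x assume x: "norm (x - x0) < 1 / L"
    define y where "y = L *\<^sub>R (x - x0)"
    have "norm y = L * norm (x - x0)" using L by (simp add: y_def)
    then have y: "norm y < 1" using x L by (simp add: field_simps)
    then have "\<bar>y $ i\<bar> < pi" for i using component_le_norm_cart[of y i] pi_gt3 by linarith
    with a(1) have "((\<lambda>\<kappa>. a \<kappa> * cis (\<Sum>i\<in>UNIV. of_int (\<kappa> i) * y $ i)) has_sum h y) UNIV" by blast
    moreover have "x0 + (1 / L) *\<^sub>R y = x" using L by (simp add: y_def)
    ultimately show "((\<lambda>l. a l * cis (\<Sum>i\<in>UNIV. of_int (l i) * (L *\<^sub>R (x - x0)) $ i)) has_sum symbol_remainder m r \<xi> x) UNIV"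
      using y \<psi>(2)[of y] by (simp only: h_def y_def[symmetric]) simp
  next
    fix s l
    have "norm (a l) * (\<Prod>i\<in>UNIV. 1 + \<bar>real_of_int (l i)\<bar>) ^ s
        \<le> 2 ^ (s * CARD('n)) * (2 ^ (s * CARD('n)) * X (s * CARD('n)) * (remainder_const TYPE('n) m B (s * CARD('n)) / japanese_bracket \<xi>))"
      using a(2) jh[of "s * CARD('n)"] by blast
    then show "norm (a l) * prod_weight l ^ s \<le> expansion_const TYPE('n) X m B s * (1 / japanese_bracket \<xi>)"
      by (simp add: prod_weight_def expansion_const_def)
  qed
qed

end

lemma Dop_cmult: "f \<in> smooth_on UNIV \<Longrightarrow> Dop \<alpha> (\<lambda>x. c * f x) x = c * Dop \<alpha> f x"
  using mpartial_lincomb[of "{()}" "\<lambda>_. f" \<alpha> "\<lambda>_. c"] by (simp add: Dop_def)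

lemma has_sum_minus:
  fixes f g :: "'a \<Rightarrow> complex"
  assumes "(f has_sum a) A" "(g has_sum b) A"
  shows "((\<lambda>x. f x - g x) has_sum (a - b)) A"
  using has_sum_add[OF assms(1), of "\<lambda>x. - g x" "- b"] assms(2) by (simp add: has_sum_uminus)

text \<open>The product weight is at most the n-th power of the sum weight, so 2n additional powers
  of the latter buy a summable factor.\<close>

lemma inverse_prod_weight_le:
  "sum_weight (k :: 'n::finite \<Rightarrow> int) ^ N \<le> sum_weight k ^ (N + 2 * CARD('n)) * (1 / prod_weight k ^ 2)"
proof -
  have W: "prod_weight k \<ge> 1" and V: "sum_weight k \<ge> 1" by (rule prod_weight_ge_1 sum_weight_ge_1)+
  have "prod_weight k ^ 2 \<le> (sum_weight k ^ CARD('n)) ^ 2"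
    using W by (intro power_mono prod_weight_le_sum_weight_power) auto
  then have "sum_weight k ^ N * prod_weight k ^ 2 \<le> sum_weight k ^ N * sum_weight k ^ (2 * CARD('n))"
    using V by (intro mult_left_mono) (auto simp: power_mult[symmetric] mult.commute)
  then show ?thesis using W by (simp add: power_add pos_le_divide_eq)
qed

context microhypoelliptic_symbol
begin

text \<open>The solution is smooth on the whole space, while the equation holds only in the ball on
  which all the \<rho> are represented by their Fourier series. A single \<open>u\<close> satisfies
  the estimates of every order, with one factor 1/d in each of them.\<close>

theorem local_solution:
  fixes \<psi> g :: "'n cfun"
  assumes \<psi>: "\<psi> \<in> smooth_on UNIV" "\<And>y. norm y \<le> 1 \<Longrightarrow> \<psi> y = 1" "\<And>y. norm y \<ge> 2 \<Longrightarrow> \<psi> y = 0"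
    and X: "\<And>N y. jet N \<psi> y \<le> X N" and L: "L \<ge> 1" "L \<ge> 2 * R"
    and contr: "expansion_const TYPE('n) X m B 2 * (2 / L) * weight_sum TYPE('n) \<le> 1 / 2"
    and g: "g \<in> smooth_on UNIV" "\<And>x. norm (x - x0) \<ge> 1 / L \<Longrightarrow> g x = 0"
  shows "\<exists>u\<in>smooth_on UNIV.
    (\<forall>x. norm (x - x0) < 1 / L \<longrightarrow> (\<Sum>\<alpha> | mi_order \<alpha> \<le> m. r \<alpha> x * Dop \<alpha> u x) = g x) \<and>
    (\<forall>N M x. (\<forall>x. jet ((N + 2 * CARD('n)) * CARD('n)) g x \<le> M) \<longrightarrow>
       jet N u x \<le> solution_const TYPE('n) L X m B N * M / d)"
proof -
  let ?n = "CARD('n)" and ?S = "weight_sum TYPE('n)" and ?e = "\<lambda>k :: 'n \<Rightarrow> int. plane_wave x0 (freq L k)"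
  let ?\<phi> = "expansion_const TYPE('n) X m B" and ?J = "\<lambda>k :: 'n \<Rightarrow> int. japanese_bracket (freq L k)"
  define q where "q k x = inverse (symbol_of m r x (freq L k))" for k x
  define \<rho> where "\<rho> k = symbol_remainder m r (freq L k)" for k
  have fr: "norm (freq L k) \<ge> R" for k :: "'n \<Rightarrow> int" using norm_freq_ge[of L k] L by linarith
  have q: "q k \<in> smooth_on UNIV" for k unfolding q_def[abs_def] by (rule inverse_symbol_smooth[OF fr])
  have J: "?J k \<ge> 1" "?J k \<ge> L / 2" for k
    using norm_freq_ge[of L k] norm_le_japanese_bracket[of "freq L k"] japanese_bracket_ge_1[of "freq L k"] L by linarith+
  have X0: "X N \<ge> 0" for N using X[of N 0] jet_nonneg[of N \<psi> 0] by linarith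
  have \<phi>0: "?\<phi> s \<ge> 0" for s
    unfolding expansion_const_def remainder_const_def
    by (intro mult_nonneg_nonneg X0 B(1) order_trans[OF zero_le_one inverse_jet_const_ge_1]) auto
  have "\<forall>k. \<exists>a :: ('n \<Rightarrow> int) \<Rightarrow> complex.
      (\<forall>x. norm (x - x0) < 1 / L \<longrightarrow> ((\<lambda>l. a l * cis (\<Sum>i\<in>UNIV. of_int (l i) * (L *\<^sub>R (x - x0)) $ i)) has_sum \<rho> k x) UNIV) \<and>
      (\<forall>s l. norm (a l) * prod_weight l ^ s \<le> ?\<phi> s * (1 / ?J k))"
    unfolding \<rho>_def by (intro allI remainder_expansion[OF \<psi> X L(1) fr])
  from choice[OF this] obtain a :: "('n \<Rightarrow> int) \<Rightarrow> ('n \<Rightarrow> int) \<Rightarrow> complex" where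
    a: "\<forall>k. (\<forall>x. norm (x - x0) < 1 / L \<longrightarrow> ((\<lambda>l. a k l * cis (\<Sum>i\<in>UNIV. of_int (l i) * (L *\<^sub>R (x - x0)) $ i)) has_sum \<rho> k x) UNIV) \<and>
      (\<forall>s l. norm (a k l) * prod_weight l ^ s \<le> ?\<phi> s * (1 / ?J k))" ..
  have a1: "((\<lambda>l. a k l * cis (\<Sum>i\<in>UNIV. of_int (l i) * (L *\<^sub>R (x - x0)) $ i)) has_sum \<rho> k x) UNIV"
    if "norm (x - x0) < 1 / L" for k x using a that by blast
  have a2: "norm (a k l) * prod_weight l ^ s \<le> ?\<phi> s * (1 / ?J k)" for k s l using a by blast
  from twisted_fourier_expansion[OF g L(1)] obtain b :: "('n \<Rightarrow> int) \<Rightarrow> complex" where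
    b: "(\<forall>x. norm (x - x0) < 1 / L \<longrightarrow> ((\<lambda>k. b k * ?e k x) has_sum g x) UNIV) \<and>
      (\<forall>s M k. (\<forall>x. jet (s * ?n) g x \<le> M) \<longrightarrow>
       sum_weight k ^ s * norm (b k) \<le> 2 ^ (s * ?n) * (2 ^ (s * ?n) * (1 + real ?n / 2) ^ (s * ?n) * M))" ..
  have b1: "((\<lambda>k. b k * ?e k x) has_sum g x) UNIV" if "norm (x - x0) < 1 / L" for x using b that by blast
  have b2: "sum_weight k ^ s * norm (b k) \<le> 2 ^ (s * ?n) * (2 ^ (s * ?n) * (1 + real ?n / 2) ^ (s * ?n) * M)"
    if "\<And>x. jet (s * ?n) g x \<le> M" for s M k using b that by blast
  \<comment> \<open>Decay exponent 2 makes the rows summable, and 2/L bounds the inverse bracket at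
    every lattice frequency; \<open>contr\<close> is thus the contraction condition of
    \<open>lattice_solve\<close>.\<close>
  define \<delta> where "\<delta> = ?\<phi> 2 * (2 / L)"
  have \<delta>0: "\<delta> \<ge> 0" using \<phi>0[of 2] L by (simp add: \<delta>_def)
  have a\<delta>: "norm (a k l) \<le> \<delta> * (1 / prod_weight l ^ 2)" for k l
  proof -
    have W: "prod_weight l ^ 2 > 0" using prod_weight_ge_1[of l] by (intro zero_less_power) linarith
    have "1 / ?J k \<le> 2 / L" using J[of k] L by (simp add: field_simps)
    then have "norm (a k l) * prod_weight l ^ 2 \<le> \<delta>"
      using a2[of k l 2] mult_left_mono[OF _ \<phi>0[of 2], of "1 / ?J k" "2 / L"] by (simp add: \<delta>_def)
    then show ?thesis using W by (simp add: pos_le_divide_eq)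
  qed
  have bnd: "\<exists>E. \<forall>k. sum_weight k ^ s * norm (b k) \<le> E" for s
  proof -
    obtain A where "\<And>x. jet (s * ?n) g x \<le> A" using bounded_jet_ball[OF g] by blast
    from b2[OF this] show ?thesis by blast
  qed
  obtain B0 where B0: "\<And>k. norm (b k) \<le> B0" using bnd[of 0] by auto
  \<comment> \<open>Solving with the least bound of \<open>b\<close> gives one \<open>c\<close> that
    is bounded by twice every bound of \<open>b\<close>, as the start of the bootstrapping
    requires.\<close>
  define Bs where "Bs = (SUP k. norm (b k))"
  have bdd: "bdd_above (range (\<lambda>k. norm (b k)))" using B0 by (intro bdd_aboveI2)
  have "norm (b k) \<le> Bs" for k unfolding Bs_def by (rule cSUP_upper[OF UNIV_I bdd])
  then obtain c where c1: "\<And>k. norm (c k) \<le> 2 * Bs" and c2: "\<And>k. c k + lattice_op a c k = b k"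
    using lattice_solve[of a \<delta> b Bs, OF a\<delta>] contr by (auto simp: \<delta>_def)
  have c1': "norm (c k) \<le> 2 * B'" if "\<And>k. norm (b k) \<le> B'" for B' k
  proof -
    have "Bs \<le> B'" unfolding Bs_def by (rule cSUP_least) (use that in auto)
    then show ?thesis using c1[of k] by linarith
  qed
  have \<tau>: "1 / ?J k * sum_weight k \<le> 1 + 2 * real ?n" for k
    using sum_weight_le_bracket[OF L(1), of k] J(1)[of k] by (simp add: divide_le_eq mult.commute)
  let ?Q = "weight_const ?\<phi> ((1 + 2 * real ?n) * ?S)"
  have cw: "sum_weight k ^ s * norm (c k) \<le> ?Q s * E" if "\<And>k. sum_weight k ^ s * norm (b k) \<le> E" for s E k
    by (rule lattice_solution_weighted[OF a2 \<tau> \<phi>0 c1' c2 that])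
  define F where "F k x = c k * (?e k x * q k x)" for k x
  have F_smooth: "F k \<in> smooth_on UNIV" for k
    unfolding F_def[abs_def] by (intro smooth_on_cmult smooth_on_mult open_UNIV plane_wave_smooth q)
  \<comment> \<open>The only place where the lower bound \<open>d\<close> of the symbol is used
    quantitatively.\<close>
  have jF: "jet N (F k) x \<le> 2 ^ N * (L * (1 + real ?n)) ^ N * inverse_jet_const N (B N) / d * D * (1 / prod_weight k ^ 2)"
    if D: "\<And>k. sum_weight k ^ (N + 2 * ?n) * norm (c k) \<le> D" for N D k x
  proof -
    have d0: "norm (symbol_of m r x (freq L k)) \<ge> d" by (rule d(2)[OF fr])
    have IC: "inverse_jet_const N (B N) \<ge> 1" by (rule inverse_jet_const_ge_1[OF B(1)])
    have V: "sum_weight k \<ge> 1" by (rule sum_weight_ge_1)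
    have "jet N (F k) x = norm (c k) * jet N (\<lambda>x. ?e k x * q k x) x"
      unfolding F_def[abs_def] by (rule jet_cmult[OF open_UNIV UNIV_I]) (intro smooth_on_mult open_UNIV plane_wave_smooth q)
    also have "\<dots> \<le> norm (c k) * (2 ^ N * jet N (?e k) x * jet N (q k) x)"
      by (intro mult_left_mono jet_mult[OF open_UNIV UNIV_I] plane_wave_smooth q) auto
    also have "\<dots> \<le> norm (c k) * (2 ^ N * ((L * (1 + real ?n)) * sum_weight k) ^ N * (inverse_jet_const N (B N) / d))"
    proof (intro mult_left_mono mult_mono)
      show "jet N (?e k) x \<le> ((L * (1 + real ?n)) * sum_weight k) ^ N"
      proof (rule order_trans[OF jet_plane_wave])
        show "(1 + (\<Sum>i\<in>UNIV. \<bar>freq L k $ i\<bar>)) ^ N \<le> ((L * (1 + real ?n)) * sum_weight k) ^ N"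
          by (intro power_mono one_plus_sum_freq_le L) (simp add: sum_nonneg)
      qed
      have "jet N (q k) x \<le> inverse_jet_const N (B N) / norm (symbol_of m r x (freq L k))"
        unfolding q_def[abs_def] by (rule jet_inverse_symbol[OF fr])
      also have "\<dots> \<le> inverse_jet_const N (B N) / d"
        using d(1) d0 IC less_le_trans[OF d(1) d0] by (intro divide_left_mono mult_pos_pos) auto
      finally show "jet N (q k) x \<le> inverse_jet_const N (B N) / d" .
    qed (use L V in auto)
    also have "\<dots> = 2 ^ N * (L * (1 + real ?n)) ^ N * inverse_jet_const N (B N) / d * (sum_weight k ^ N * norm (c k))"
      by (simp add: power_mult_distrib)
    also have "\<dots> \<le> 2 ^ N * (L * (1 + real ?n)) ^ N * inverse_jet_const N (B N) / d * (D * (1 / prod_weight k ^ 2))"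
    proof (intro mult_left_mono)
      have "sum_weight k ^ N * norm (c k) \<le> sum_weight k ^ (N + 2 * ?n) * (1 / prod_weight k ^ 2) * norm (c k)"
        by (intro mult_right_mono inverse_prod_weight_le) auto
      also have "\<dots> = (sum_weight k ^ (N + 2 * ?n) * norm (c k)) * (1 / prod_weight k ^ 2)" by simp
      also have "\<dots> \<le> D * (1 / prod_weight k ^ 2)" by (intro mult_right_mono D) simp
      finally show "sum_weight k ^ N * norm (c k) \<le> D * (1 / prod_weight k ^ 2)" .
      show "0 \<le> 2 ^ N * (L * (1 + real ?n)) ^ N * inverse_jet_const N (B N) / d"
        using L IC d(1) by (intro divide_nonneg_nonneg mult_nonneg_nonneg) auto
    qed
    finally show ?thesis by (simp only: mult.assoc)
  qed
  have cD: "\<exists>D. \<forall>k. sum_weight k ^ s * norm (c k) \<le> D" for s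
    using bnd[of s] cw by blast
  have sF: "summable_family F"
    unfolding summable_family_def
  proof (intro conjI allI F_smooth)
    fix N
    obtain D where D: "\<And>k. sum_weight k ^ (N + 2 * ?n) * norm (c k) \<le> D" using cD by blast
    show "\<exists>M. M summable_on UNIV \<and> (\<forall>k x. jet N (F k) x \<le> M k)"
      by (intro exI[of _ "\<lambda>k. 2 ^ N * (L * (1 + real ?n)) ^ N * inverse_jet_const N (B N) / d * D * (1 / prod_weight k ^ 2)"]
          conjI allI jF[OF D] summable_on_cmult_right[OF summable_on_prod_weight])
  qed
  note ci = countable_infinite_lattice[where 'n = 'n]
  define u where "u x = (\<Sum>\<^sub>\<infinity>k. F k x)" for x
  have u: "u \<in> smooth_on UNIV" unfolding u_def[abs_def] by (rule smooth_infsum[OF ci sF])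
  have est: "jet N u x \<le> solution_const TYPE('n) L X m B N * M / d"
    if M: "\<And>x. jet ((N + 2 * ?n) * ?n) g x \<le> M" for N M x
  proof -
    let ?s = "N + 2 * ?n"
    let ?E = "2 ^ (?s * ?n) * (2 ^ (?s * ?n) * (1 + real ?n / 2) ^ (?s * ?n) * M)"
    let ?K = "2 ^ N * (L * (1 + real ?n)) ^ N * inverse_jet_const N (B N) / d * (?Q ?s * ?E)"
    have jk: "jet N (F k) x \<le> ?K * (1 / prod_weight k ^ 2)" for k
      by (rule jF[OF cw[OF b2[OF M]]])
    have "jet N u x \<le> (\<Sum>\<^sub>\<infinity>k. jet N (F k) x)" unfolding u_def[abs_def] by (rule jet_infsum_le[OF ci sF])
    also have "\<dots> \<le> ?K * ?S"
      by (rule has_sum_mono[OF has_sum_infsum[OF summable_family_jet[OF sF]] _ jk])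
        (unfold weight_sum_def, intro has_sum_cmult_right has_sum_infsum summable_on_prod_weight)
    also have "\<dots> = solution_const TYPE('n) L X m B N * M / d" by (simp add: solution_const_def Let_def)
    finally show ?thesis .
  qed
  have eqn: "(\<Sum>\<alpha> | mi_order \<alpha> \<le> m. r \<alpha> x * Dop \<alpha> u x) = g x" if x: "norm (x - x0) < 1 / L" for x
  proof -
    obtain D where D: "\<And>k. sum_weight k ^ (0 + 2 * ?n) * norm (c k) \<le> D" using cD by blast
    have cD: "norm (c k) \<le> D * (1 / prod_weight k ^ 2)" for k
    proof -
      have "sum_weight k ^ 0 * norm (c k) \<le> sum_weight k ^ (0 + 2 * ?n) * (1 / prod_weight k ^ 2) * norm (c k)"
        by (intro mult_right_mono inverse_prod_weight_le) auto
      also have "\<dots> = (sum_weight k ^ (0 + 2 * ?n) * norm (c k)) * (1 / prod_weight k ^ 2)" by simp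
      also have "\<dots> \<le> D * (1 / prod_weight k ^ 2)" by (intro mult_right_mono D) simp
      finally show ?thesis by simp
    qed
    have D0: "D \<ge> 0"
      using order_trans[OF norm_ge_zero cD[of "\<lambda>_. 0"]] by (simp add: prod_weight_def)
    have wave: "cis (\<Sum>i\<in>UNIV. of_int (l i) * (L *\<^sub>R (x - x0)) $ i) * ?e k x = ?e (\<lambda>i. l i + k i) x" for l k :: "'n \<Rightarrow> int"
      unfolding plane_wave_freq by (simp add: cis_mult sum.distrib[symmetric] distrib_right add.assoc)
    \<comment> \<open>\<rho> is expanded in integer characters, so multiplication by a half-integer
      plane wave stays within the half-integer family and merely translates the index by
      \<open>k\<close>.\<close>
    have \<rho>sum: "((\<lambda>j. a k (ldiff j k) * ?e j x) has_sum \<rho> k x * ?e k x) UNIV" for k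
    proof -
      have "((\<lambda>l. a k l * cis (\<Sum>i\<in>UNIV. of_int (l i) * (L *\<^sub>R (x - x0)) $ i) * ?e k x) has_sum \<rho> k x * ?e k x) UNIV"
        by (rule has_sum_cmult_left[OF a1[OF x]])
      then have "((\<lambda>l. a k l * ?e (\<lambda>i. l i + k i) x) has_sum \<rho> k x * ?e k x) UNIV"
        by (simp only: mult.assoc wave)
      then show ?thesis
        using has_sum_reindex_bij_betw[OF bij_ldiff2[of k], of "\<lambda>l. a k l * ?e (\<lambda>i. l i + k i) x"] by simp
    qed
    \<comment> \<open>A summable majorant on pairs, from the decay of \<open>c\<close> in
      \<open>k\<close> and of \<open>a\<close> in j - k, to allow the order of summation to be
      interchanged.\<close>
    have "(\<lambda>p :: ('n \<Rightarrow> int) \<times> ('n \<Rightarrow> int). D * (1 / prod_weight (fst p) ^ 2) * (\<delta> * (1 / prod_weight (ldiff (snd p) (fst p)) ^ 2))) summable_on (UNIV \<times> UNIV)"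
    proof (rule summable_on_SigmaI)
      show "((\<lambda>j. D * (1 / prod_weight (fst (k, j)) ^ 2) * (\<delta> * (1 / prod_weight (ldiff (snd (k, j)) (fst (k, j))) ^ 2)))
          has_sum D * (1 / prod_weight k ^ 2) * (\<delta> * ?S)) UNIV" for k :: "'n \<Rightarrow> int"
        unfolding fst_conv snd_conv weight_sum_def
        by (intro has_sum_cmult_right)
          (subst has_sum_reindex_bij_betw[OF bij_ldiff2[of k], of "\<lambda>l. 1 / prod_weight l ^ 2"], rule has_sum_infsum[OF summable_on_prod_weight])
      show "(\<lambda>k :: 'n \<Rightarrow> int. D * (1 / prod_weight k ^ 2) * (\<delta> * ?S)) summable_on UNIV"
        by (intro summable_on_cmult_left summable_on_cmult_right summable_on_prod_weight)
    qed (use D0 \<delta>0 in auto)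
    then have "(\<lambda>p. norm (c (fst p) * (a (fst p) (ldiff (snd p) (fst p)) * ?e (snd p) x))) summable_on (UNIV \<times> UNIV)"
    proof (rule summable_on_comparison_test)
      fix p :: "('n \<Rightarrow> int) \<times> ('n \<Rightarrow> int)"
      show "norm (c (fst p) * (a (fst p) (ldiff (snd p) (fst p)) * ?e (snd p) x))
          \<le> D * (1 / prod_weight (fst p) ^ 2) * (\<delta> * (1 / prod_weight (ldiff (snd p) (fst p)) ^ 2))"
        using D0 cD[of "fst p"] a\<delta>[of "fst p" "ldiff (snd p) (fst p)"] by (simp only: norm_mult norm_plane_wave mult_1_right) (intro mult_mono; simp)
    qed simp
    then have "(\<lambda>(k, j). c k * (a k (ldiff j k) * ?e j x)) summable_on (UNIV \<times> UNIV)"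
      unfolding case_prod_unfold by (rule abs_summable_summable)
    note swap = infsum_swap_banach[OF this]
    have "(\<lambda>k. norm (c k * ?e k x)) summable_on UNIV"
      by (rule summable_on_comparison_test[OF summable_on_cmult_right[OF summable_on_prod_weight, of D]])
        (use cD in \<open>auto simp: norm_mult\<close>)
    then have sc: "(\<lambda>k. c k * ?e k x) summable_on UNIV" by (rule abs_summable_summable)
    have b1x: "((\<lambda>k. b k * ?e k x) has_sum g x) UNIV" by (rule b1[OF x])
    have "(\<Sum>\<^sub>\<infinity>k. c k * (\<rho> k x * ?e k x)) = (\<Sum>\<^sub>\<infinity>k. \<Sum>\<^sub>\<infinity>j. c k * (a k (ldiff j k) * ?e j x))"
      by (intro infsum_cong) (simp add: infsumI[OF has_sum_cmult_right[OF \<rho>sum]])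
    also have "\<dots> = (\<Sum>\<^sub>\<infinity>j. \<Sum>\<^sub>\<infinity>k. c k * (a k (ldiff j k) * ?e j x))" by (rule swap)
    also have "\<dots> = (\<Sum>\<^sub>\<infinity>j. b j * ?e j x - c j * ?e j x)"
    proof (intro infsum_cong)
      fix j
      have "(\<Sum>\<^sub>\<infinity>k. c k * (a k (ldiff j k) * ?e j x)) = (\<Sum>\<^sub>\<infinity>k. a k (ldiff j k) * c k * ?e j x)"
        by (intro infsum_cong) (simp add: mult_ac)
      also have "\<dots> = lattice_op a c j * ?e j x" unfolding lattice_op_def by (rule infsum_cmult_left')
      \<comment> \<open>Here the lattice equation enters: the coefficient of the j-th plane wave in
        the remainder series is the defect between the right-hand side and the leading term.\<close>
      also have "lattice_op a c j = b j - c j" using c2[of j] by (simp add: eq_diff_eq add.commute)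
      finally show "(\<Sum>\<^sub>\<infinity>k. c k * (a k (ldiff j k) * ?e j x)) = b j * ?e j x - c j * ?e j x" by (simp add: left_diff_distrib)
    qed
    also have "\<dots> = g x - (\<Sum>\<^sub>\<infinity>j. c j * ?e j x)"
      by (rule infsumI[OF has_sum_minus[OF b1x has_sum_infsum[OF sc]]])
    finally have 1: "(\<Sum>\<^sub>\<infinity>k. c k * (\<rho> k x * ?e k x)) = g x - (\<Sum>\<^sub>\<infinity>j. c j * ?e j x)" .
    have DF: "((\<lambda>k. Dop \<alpha> (F k) x) has_sum Dop \<alpha> u x) UNIV" for \<alpha>
    proof -
      have "((\<lambda>k. mpartial \<alpha> (F k) x) has_sum mpartial \<alpha> u x) UNIV"
        unfolding u_def[abs_def] mpartial_infsum(1)[OF ci sF]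
        by (intro has_sum_infsum summable_family_summable(2) mpartial_infsum(2)[OF ci sF])
      then show ?thesis unfolding Dop_def by (rule has_sum_cmult_right)
    qed
    have "((\<lambda>k. \<Sum>\<alpha> | mi_order \<alpha> \<le> m. r \<alpha> x * Dop \<alpha> (F k) x) has_sum (\<Sum>\<alpha> | mi_order \<alpha> \<le> m. r \<alpha> x * Dop \<alpha> u x)) UNIV"
      by (intro has_sum_finite_sum finite_mi_order_le has_sum_cmult_right DF)
    moreover have "(\<Sum>\<alpha> | mi_order \<alpha> \<le> m. r \<alpha> x * Dop \<alpha> (F k) x) = c k * ?e k x + c k * (\<rho> k x * ?e k x)" for k
    proof -
      have "Dop \<alpha> (F k) x = c k * Dop \<alpha> (\<lambda>x. ?e k x * q k x) x" for \<alpha>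
        unfolding F_def[abs_def] by (intro Dop_cmult smooth_on_mult open_UNIV plane_wave_smooth q)
      then have "(\<Sum>\<alpha> | mi_order \<alpha> \<le> m. r \<alpha> x * Dop \<alpha> (F k) x) = c k * (\<Sum>\<alpha> | mi_order \<alpha> \<le> m. r \<alpha> x * Dop \<alpha> (\<lambda>x. ?e k x * q k x) x)"
        by (simp add: sum_distrib_left mult_ac)
      also have "\<dots> = c k * (?e k x * (1 + \<rho> k x))"
        unfolding q_def[abs_def] \<rho>_def by (subst diff_op_plane_wave_inverse[OF fr]) simp
      finally show ?thesis by (simp add: algebra_simps)
    qed
    ultimately have 2: "((\<lambda>k. c k * ?e k x + c k * (\<rho> k x * ?e k x)) has_sum (\<Sum>\<alpha> | mi_order \<alpha> \<le> m. r \<alpha> x * Dop \<alpha> u x)) UNIV"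
      by simp
    \<comment> \<open>The remainder series is evaluated a second time, now from P applied termwise
      to \<open>u\<close>. Comparison with \<open>1\<close> cancels the series of the c k times the
      plane waves.\<close>
    have "((\<lambda>k. (c k * ?e k x + c k * (\<rho> k x * ?e k x)) - c k * ?e k x) has_sum
        (\<Sum>\<alpha> | mi_order \<alpha> \<le> m. r \<alpha> x * Dop \<alpha> u x) - (\<Sum>\<^sub>\<infinity>j. c j * ?e j x)) UNIV"
      by (rule has_sum_minus[OF 2 has_sum_infsum[OF sc]])
    then have "(\<Sum>\<^sub>\<infinity>k. c k * (\<rho> k x * ?e k x)) = (\<Sum>\<alpha> | mi_order \<alpha> \<le> m. r \<alpha> x * Dop \<alpha> u x) - (\<Sum>\<^sub>\<infinity>j. c j * ?e j x)"
      by (intro infsumI) simp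
    with 1 show ?thesis by simp
  qed
  show ?thesis using u eqn est by blast
qed

end

subsection \<open>Cut-off functions\<close>

text \<open>The polynomial factor makes the family closed under differentiation, so one induction
  over all \<open>p\<close> proves smoothness, including at 0.\<close>

definition flat_fun :: "real poly \<Rightarrow> real \<Rightarrow> real" where
  "flat_fun p t = (if t > 0 then poly p (1 / t) * exp (- (1 / t)) else 0)"

lemma poly_times_exp_minus_tendsto_0: "((\<lambda>x. poly p x * exp (- x)) \<longlongrightarrow> (0::real)) at_top"
proof -
  have "((\<lambda>x. \<Sum>i\<le>degree p. coeff p i * (x ^ i / exp x)) \<longlongrightarrow> (\<Sum>i\<le>degree p. coeff p i * 0)) at_top"
    by (intro tendsto_sum tendsto_mult tendsto_const tendsto_power_div_exp_0)
  then show ?thesis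
    by (simp add: poly_altdef sum_distrib_right exp_minus divide_inverse mult.assoc)
qed

text \<open>With s = 1/t, the derivative in s gives (p' - p) times the exponential and the chain
  rule gives -s^2; their product has the polynomial s^2 (p - p'). At 0 the exponential beats every
  polynomial in s.\<close>

lemma flat_fun_derivative:
  "(flat_fun p has_real_derivative flat_fun ([:0, 0, 1:] * (p - pderiv p)) t) (at t)"
proof (cases t "0 :: real" rule: linorder_cases)
  case less
  have "(flat_fun p has_real_derivative 0) (at t)"
    by (rule DERIV_cong_ev[THEN iffD2, OF refl _ refl, of _ "\<lambda>_. 0"])
      (use less in \<open>auto simp: flat_fun_def eventually_nhds intro!: exI[of _ "{..<0}"]\<close>)
  then show ?thesis using less by (simp add: flat_fun_def)
next
  case equal
  have "((\<lambda>h. (flat_fun p (0 + h) - flat_fun p 0) / h) \<longlongrightarrow> 0) (at 0)"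
  proof (rule filterlim_split_at)
    show "((\<lambda>h. (flat_fun p (0 + h) - flat_fun p 0) / h) \<longlongrightarrow> 0) (at_left 0)"
      by (rule Lim_transform_eventually[OF tendsto_const])
        (auto simp: eventually_at_filter flat_fun_def)
    \<comment> \<open>Dividing by \<open>h\<close> in the difference quotient multiplies the
      polynomial by its variable.\<close>
    have "((\<lambda>h. poly ([:0, 1:] * p) (inverse h) * exp (- inverse h)) \<longlongrightarrow> 0) (at_right 0)"
      by (rule filterlim_compose[OF poly_times_exp_minus_tendsto_0 filterlim_inverse_at_top_right])
    then show "((\<lambda>h. (flat_fun p (0 + h) - flat_fun p 0) / h) \<longlongrightarrow> 0) (at_right 0)"
      by (rule Lim_transform_eventually)
        (auto simp: eventually_at_filter flat_fun_def divide_inverse)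
  qed
  then have "(flat_fun p has_real_derivative 0) (at 0)" by (simp add: DERIV_def)
  then show ?thesis using equal by (simp add: flat_fun_def)
next
  case greater
  have "((\<lambda>t. poly p (1 / t) * exp (- (1 / t))) has_real_derivative
      poly ([:0, 0, 1:] * (p - pderiv p)) (1 / t) * exp (- (1 / t))) (at t)"
    using greater by (auto intro!: derivative_eq_intros simp: field_simps power2_eq_square)
  then have "(flat_fun p has_real_derivative poly ([:0, 0, 1:] * (p - pderiv p)) (1 / t) * exp (- (1 / t))) (at t)"
    by (rule DERIV_cong_ev[THEN iffD2, OF refl _ refl, rotated])
      (use greater in \<open>auto simp: flat_fun_def eventually_nhds intro!: exI[of _ "{0<..}"]\<close>)
  then show ?thesis using greater by (simp add: flat_fun_def)
qed

lemma smooth_flat_fun_compose: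
  fixes g :: "real ^ 'n::finite \<Rightarrow> real"
  assumes g: "(\<lambda>x. complex_of_real (g x)) \<in> smooth_on UNIV"
  shows "(\<lambda>x. complex_of_real (flat_fun p (g x))) \<in> smooth_on UNIV"
proof -
  have "Ck_on k UNIV (\<lambda>x. complex_of_real (flat_fun p (g x)))" for k
  proof (induction k arbitrary: p)
    case 0
    have "continuous_on UNIV (\<lambda>x. Re (complex_of_real (g x)))"
      by (intro continuous_intros smooth_on_continuous_on g)
    then have "continuous_on UNIV g" by simp
    moreover have "continuous_on UNIV (flat_fun p)"
      by (rule DERIV_continuous_on[OF has_field_derivative_at_within[OF flat_fun_derivative]])
    ultimately have "continuous_on UNIV (\<lambda>x. flat_fun p (g x))"
      using continuous_on_compose2[of UNIV "flat_fun p" UNIV g] by simp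
    then show ?case by (simp add: continuous_on_of_real)
  next
    case (Suc k)
    let ?q = "[:0, 0, 1:] * (p - pderiv p)"
    have d: "((\<lambda>x. complex_of_real (flat_fun p (g x))) has_derivative
        (\<lambda>h. complex_of_real (flat_fun ?q (g x)) * (\<Sum>i\<in>UNIV. h $ i *\<^sub>R partial i (\<lambda>x. of_real (g x)) x))) (at x)" for x
    proof -
      let ?G = "\<lambda>h. \<Sum>i\<in>UNIV. h $ i *\<^sub>R partial i (\<lambda>x. complex_of_real (g x)) x"
      have cg: "((\<lambda>x. complex_of_real (g x)) has_derivative ?G) (at x)"
        by (rule has_derivative_partial[OF smooth_on_differentiable[OF g]]) auto
      then have rg: "(g has_derivative (\<lambda>h. Re (?G h))) (at x)"
        using has_derivative_Re[OF cg] by simp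
      have "((\<lambda>x. complex_of_real (g x)) has_derivative (\<lambda>h. complex_of_real (Re (?G h)))) (at x)"
        using has_derivative_of_real[OF rg] .
      from has_derivative_unique[OF this cg]
      \<comment> \<open>The derivative of a real-valued map is real; this permits the real chain
        rule for \<open>flat_fun\<close> although partial derivatives are taken of complex-valued
        functions.\<close>
      have G: "complex_of_real (Re (?G h)) = ?G h" for h by (rule fun_cong)
      have "((\<lambda>x. flat_fun p (g x)) has_derivative (\<lambda>h. flat_fun ?q (g x) * Re (?G h))) (at x)"
        by (rule has_derivative_compose[OF rg flat_fun_derivative[of p "g x", unfolded has_field_derivative_def]])
      from has_derivative_of_real[OF this, where 'a = complex]
      show ?thesis by (simp only: of_real_mult G)
    qed
    have "partial i (\<lambda>x. complex_of_real (flat_fun p (g x))) = (\<lambda>x. complex_of_real (flat_fun ?q (g x)) * partial i (\<lambda>x. of_real (g x)) x)" for i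
    proof
      fix x
      have "partial i (\<lambda>x. complex_of_real (flat_fun p (g x))) x
          = complex_of_real (flat_fun ?q (g x)) * (\<Sum>j\<in>UNIV. axis i 1 $ j *\<^sub>R partial j (\<lambda>x. of_real (g x)) x)"
        by (rule partial_eq[OF d])
      also have "(\<Sum>j\<in>UNIV. axis i 1 $ j *\<^sub>R partial j (\<lambda>x. complex_of_real (g x)) x)
          = (\<Sum>j\<in>UNIV. if j = i then partial j (\<lambda>x. of_real (g x)) x else 0)"
        by (intro sum.cong) (auto simp: axis_def)
      finally show "partial i (\<lambda>x. complex_of_real (flat_fun p (g x))) x = complex_of_real (flat_fun ?q (g x)) * partial i (\<lambda>x. of_real (g x)) x"
        by simp
    qed
    moreover have "Ck_on k UNIV (partial i (\<lambda>x. complex_of_real (g x)))" for i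
      using smooth_on_partial[OF g, of i] by (simp add: smooth_on_def)
    moreover have "(\<lambda>x. complex_of_real (flat_fun p (g x))) differentiable_on UNIV"
      using d by (auto simp: differentiable_on_def differentiable_def)
    ultimately show ?case by (auto intro: Ck_on_mult Suc.IH)
  qed
  then show ?thesis by (simp add: smooth_on_def)
qed

text \<open>It serves twice: as the cut-off at scale 1/L, and as a bump for testing weak
  derivatives, where nonnegativity matters.\<close>

lemma smooth_cutoff:
  obtains w :: "real ^ 'n::finite \<Rightarrow> real" where
    "(\<lambda>y. complex_of_real (w y)) \<in> smooth_on UNIV" "\<And>y. 0 \<le> w y"
    "\<And>y. norm y \<le> 1 \<Longrightarrow> w y = 1" "\<And>y. norm y \<ge> 2 \<Longrightarrow> w y = 0"
proof -
  let ?F = "flat_fun 1"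
  have F: "?F t \<ge> 0" "t > 0 \<Longrightarrow> ?F t > 0" "t \<le> 0 \<Longrightarrow> ?F t = 0" for t by (auto simp: flat_fun_def)
  \<comment> \<open>The arguments 4 - |y|^2 and |y|^2 - 1 are never both nonpositive, so the
    denominator is positive. The second summand vanishes for |y| \<le> 1, the numerator for |y|
    \<ge> 2.\<close>
  define w where "w y = ?F (4 - (norm y)\<^sup>2) / (?F (4 - (norm y)\<^sup>2) + ?F ((norm y)\<^sup>2 - 1))" for y :: "real ^ 'n"
  have den: "?F (4 - (norm y)\<^sup>2) + ?F ((norm y)\<^sup>2 - 1) > 0" for y :: "real ^ 'n"
  proof (cases "(norm y)\<^sup>2 < 4")
    case True
    then show ?thesis using F(2)[of "4 - (norm y)\<^sup>2"] F(1)[of "(norm y)\<^sup>2 - 1"] by simp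
  next
    case False
    then show ?thesis using F(2)[of "(norm y)\<^sup>2 - 1"] F(1)[of "4 - (norm y)\<^sup>2"] by simp
  qed
  have n2: "complex_of_real ((norm y)\<^sup>2) = (\<Sum>i\<in>UNIV. complex_of_real (y $ i) * complex_of_real (y $ i))" for y :: "real ^ 'n"
    by (simp add: power2_norm_eq_inner inner_vec_def)
  have sn: "(\<lambda>y :: real ^ 'n. \<Sum>i\<in>UNIV. complex_of_real (y $ i) * complex_of_real (y $ i)) \<in> smooth_on UNIV"
    by (intro smooth_on_sum smooth_on_mult smooth_coordinate) auto
  have a: "(\<lambda>y :: real ^ 'n. complex_of_real (4 - (norm y)\<^sup>2)) \<in> smooth_on UNIV"
    using smooth_on_diff[OF open_UNIV smooth_on_const sn, of 4] by (simp add: n2 del: of_real_power)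
  have b: "(\<lambda>y :: real ^ 'n. complex_of_real ((norm y)\<^sup>2 - 1)) \<in> smooth_on UNIV"
    using smooth_on_diff[OF open_UNIV sn smooth_on_const, of 1] by (simp add: n2 del: of_real_power)
  have "(\<lambda>y :: real ^ 'n. complex_of_real (?F (4 - (norm y)\<^sup>2)) * inverse (complex_of_real (?F (4 - (norm y)\<^sup>2)) + complex_of_real (?F ((norm y)\<^sup>2 - 1)))) \<in> smooth_on UNIV"
  proof (intro smooth_on_mult smooth_on_inverse smooth_on_add open_UNIV smooth_flat_fun_compose a b)
    fix y :: "real ^ 'n"
    show "complex_of_real (?F (4 - (norm y)\<^sup>2)) + complex_of_real (?F ((norm y)\<^sup>2 - 1)) \<noteq> 0"
      using den[of y] unfolding of_real_add[symmetric] of_real_eq_0_iff by linarith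
  qed
  then have s: "(\<lambda>y. complex_of_real (w y)) \<in> smooth_on UNIV"
    by (simp add: w_def divide_inverse)
  show ?thesis
  proof (rule that[OF s])
    fix y :: "real ^ 'n"
    show "0 \<le> w y" using den[of y] F(1) by (simp add: w_def)
    show "w y = 1" if "norm y \<le> 1"
    proof -
      have "(norm y)\<^sup>2 \<le> 1" using that by (simp add: power_le_one)
      then show ?thesis using den[of y] F(3)[of "(norm y)\<^sup>2 - 1"] by (simp add: w_def)
    qed
    show "w y = 0" if "norm y \<ge> 2"
    proof -
      have "(norm y)\<^sup>2 \<ge> 2\<^sup>2" using that by (intro power_mono) auto
      then show ?thesis using F(3)[of "4 - (norm y)\<^sup>2"] by (simp add: w_def)
    qed
  qed
qed

subsection \<open>Integration by parts and weak derivatives\<close>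

definition supported_in_ball :: "real \<Rightarrow> 'n::finite cfun \<Rightarrow> bool" where
  "supported_in_ball \<rho> h \<longleftrightarrow> (\<forall>x. norm x > \<rho> \<longrightarrow> h x = 0)"

lemma supported_in_ball_partial:
  assumes "supported_in_ball \<rho> h"
  shows "supported_in_ball \<rho> (partial i h)"
  unfolding supported_in_ball_def
proof (intro allI impI)
  fix x :: "real ^ 'a" assume x: "norm x > \<rho>"
  have "open {x :: real ^ 'a. norm x > \<rho>}" by (intro open_Collect_less continuous_intros)
  then have "partial i h x = partial i (\<lambda>_. 0) x"
    by (rule partial_cong) (use x assms in \<open>auto simp: supported_in_ball_def\<close>)
  then show "partial i h x = 0" by simp
qed

lemma integrable_supported:
  fixes h :: "'n::finite cfun"
  assumes "continuous_on UNIV h" "supported_in_ball \<rho> h"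
  shows "integrable lborel h"
proof -
  have "integrable lborel (\<lambda>x. indicator (cball 0 \<rho>) x *\<^sub>R h x)"
    by (intro borel_integrable_compact compact_cball continuous_on_subset[OF assms(1)]) auto
  moreover have "(\<lambda>x. indicator (cball 0 \<rho>) x *\<^sub>R h x) = h"
    using assms(2) by (auto simp: supported_in_ball_def fun_eq_iff indicator_def)
  ultimately show ?thesis by simp
qed

lemma supported_partial_bounded:
  fixes h :: "'n::finite cfun"
  assumes h: "h \<in> smooth_on UNIV" "supported_in_ball \<rho> h"
  obtains C where "C \<ge> 0" "\<And>x. norm (partial i h x) \<le> C"
proof -
  have "bounded (partial i h ` cball 0 \<rho>)"
    by (intro compact_imp_bounded compact_continuous_image compact_cball
        continuous_on_subset[OF smooth_on_continuous_on[OF smooth_on_partial[OF h(1)]]]) auto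
  then obtain C where C: "\<And>x. x \<in> cball 0 \<rho> \<Longrightarrow> norm (partial i h x) \<le> C" by (metis bounded_iff imageI)
  have "norm (partial i h x) \<le> max C 0" for x
    using C[of x] supported_in_ball_partial[OF h(2), of i] by (cases "norm x \<le> \<rho>") (auto simp: supported_in_ball_def)
  then show ?thesis by (rule that[rotated]) simp
qed

lemma norm_diff_along_axis_le:
  fixes h :: "'n::finite cfun"
  assumes h: "h \<in> smooth_on UNIV" and C: "C \<ge> 0" "\<And>x. norm (partial i h x) \<le> C"
  shows "norm (h (x + s *\<^sub>R axis i 1) - h x) \<le> C * \<bar>s\<bar>"
proof -
  have "norm (h (x + s *\<^sub>R axis i 1) - h (x + 0 *\<^sub>R axis i 1)) \<le> C * norm (s - 0)"
  proof (rule differentiable_bound[of UNIV "\<lambda>s. h (x + s *\<^sub>R axis i 1)" "\<lambda>s t. t *\<^sub>R partial i h (x + s *\<^sub>R axis i 1)"])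
    fix s :: real
    show "((\<lambda>s. h (x + s *\<^sub>R axis i 1)) has_derivative (\<lambda>t. t *\<^sub>R partial i h (x + s *\<^sub>R axis i 1))) (at s within UNIV)"
      using has_vector_derivative_along_axis[of h x s i UNIV] smooth_on_differentiable[OF h open_UNIV UNIV_I]
      by (simp add: has_vector_derivative_def)
    show "onorm (\<lambda>t. t *\<^sub>R partial i h (x + s *\<^sub>R axis i 1)) \<le> C"
    proof (rule onorm_bound[OF C(1)])
      fix t :: real
      show "norm (t *\<^sub>R partial i h (x + s *\<^sub>R axis i 1)) \<le> C * norm t"
        using mult_right_mono[OF C(2)[of "x + s *\<^sub>R axis i 1"], of "\<bar>t\<bar>"] by (simp add: mult.commute)
    qed
  qed auto
  then show ?thesis by simp
qed

text \<open>The integral of \<open>h (x + t e\<^sub>i)\<close> over \<open>x\<close> does not depend on \<open>t\<close>.\<close>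

lemma integral_partial_eq_0:
  fixes h :: "'n::finite cfun"
  assumes h: "h \<in> smooth_on UNIV" "supported_in_ball \<rho> h"
  shows "(LINT x|lborel. partial i h x) = 0"
proof -
  obtain C where C: "C \<ge> 0" "\<And>x. norm (partial i h x) \<le> C" using supported_partial_bounded[OF h] by blast
  \<comment> \<open>Step sizes of at most 1 keep the supports of all difference quotients in the
    ball of radius \<rho> + 1, so a constant multiple of its indicator dominates them.\<close>
  define s where "s n = 1 / real (Suc n)" for n
  define D where "D n x = (h (x + s n *\<^sub>R axis i 1) - h x) /\<^sub>R s n" for n x
  have s: "s n > 0" "s n \<le> 1" for n by (auto simp: s_def field_simps)
  have ch: "continuous_on UNIV h" by (rule smooth_on_continuous_on[OF h(1)])
  have ih: "integrable lborel h" by (rule integrable_supported[OF ch h(2)])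
  have ish: "integrable lborel (\<lambda>x. h (x + t))" for t
  proof (rule integrable_supported[of _ "\<rho> + norm t"])
    show "continuous_on UNIV (\<lambda>x. h (x + t))"
      by (rule continuous_on_compose2[OF ch]) (auto intro!: continuous_intros)
    have "norm (x + t) > \<rho>" if "norm x > \<rho> + norm t" for x
      using that norm_triangle_ineq4[of "x + t" t] by simp
    then show "supported_in_ball (\<rho> + norm t) (\<lambda>x. h (x + t))"
      using h(2) by (auto simp: supported_in_ball_def)
  qed
  have tr: "(LINT x|lborel. h (x + t)) = (LINT x|lborel. h x)" for t
  proof -
    have "(LINT x|lborel. h x) = (LINT x|distr lborel borel ((+) t). h x)" by (simp add: lborel_distr_plus)
    also have "\<dots> = (LINT x|lborel. h (t + x))"
      by (rule integral_distr) (use ih in auto)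
    finally show ?thesis by (simp add: add.commute)
  qed
  have D0: "(LINT x|lborel. D n x) = 0" for n
    unfolding D_def using ish[of "s n *\<^sub>R axis i 1"] ih tr[of "s n *\<^sub>R axis i 1"] by simp
  have "(\<lambda>n. LINT x|lborel. D n x) \<longlonglongrightarrow> (LINT x|lborel. partial i h x)"
  proof (rule integral_dominated_convergence[where w = "\<lambda>x. C * indicator (cball 0 (\<rho> + 1)) x"])
    show "partial i h \<in> borel_measurable lborel"
      using smooth_on_continuous_on[OF smooth_on_partial[OF h(1)]] borel_measurable_continuous_onI by auto
    show "D n \<in> borel_measurable lborel" for n
      unfolding D_def using ish[of "s n *\<^sub>R axis i 1"] ih by (auto dest!: borel_measurable_integrable)
    show "integrable lborel (\<lambda>x :: real ^ 'n. C * indicator (cball 0 (\<rho> + 1)) x)"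
      by (intro integrable_mult_right integrable_real_indicator) (auto intro: emeasure_bounded_finite[unfolded infinity_ennreal_def])
    show "AE x in lborel. (\<lambda>n. D n x) \<longlonglongrightarrow> partial i h x"
    proof (rule AE_I2)
      fix x
      have "((\<lambda>s. h (x + s *\<^sub>R axis i 1)) has_vector_derivative partial i h (x + 0 *\<^sub>R axis i 1)) (at 0)"
        by (rule has_vector_derivative_along_axis) (rule smooth_on_differentiable[OF h(1) open_UNIV UNIV_I])
      from has_vector_derivative_tendsto_quotient[OF this]
      have 1: "((\<lambda>s. (h (x + s *\<^sub>R axis i 1) - h x) /\<^sub>R s) \<longlongrightarrow> partial i h x) (at 0)" by simp
      have "s \<longlonglongrightarrow> 0" unfolding s_def using LIMSEQ_inverse_real_of_nat by (simp add: inverse_eq_divide)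
      then have "filterlim s (at 0) sequentially"
        using s(1) by (auto simp: filterlim_at intro!: always_eventually) (metis less_irrefl)
      from filterlim_compose[OF 1 this] show "(\<lambda>n. D n x) \<longlonglongrightarrow> partial i h x" by (simp add: D_def)
    qed
    show "AE x in lborel. norm (D n x) \<le> C * indicator (cball 0 (\<rho> + 1)) x" for n
    proof (rule AE_I2)
      fix x
      show "norm (D n x) \<le> C * indicator (cball 0 (\<rho> + 1)) x"
      proof (cases "norm x \<le> \<rho> + 1")
        case True
        have "norm (D n x) = norm (h (x + s n *\<^sub>R axis i 1) - h x) / s n"
          using s(1)[of n] by (simp add: D_def divide_inverse)
        also have "\<dots> \<le> C" using norm_diff_along_axis_le[OF h(1) C, of x "s n"] s(1)[of n] by (simp add: divide_le_eq)
        finally show ?thesis using True by (simp add: indicator_def)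
      next
        case False
        have "norm x \<le> norm (x + s n *\<^sub>R axis i 1) + norm (s n *\<^sub>R axis i (1::real))"
          using norm_triangle_ineq4[of "x + s n *\<^sub>R axis i 1" "s n *\<^sub>R axis i 1"] by simp
        then have "norm (x + s n *\<^sub>R axis i 1) > \<rho>" using False s[of n] by (simp add: norm_axis_1)
        then show ?thesis using h(2) False by (simp add: supported_in_ball_def D_def)
      qed
    qed
  qed
  then show ?thesis unfolding D0 by (simp add: LIMSEQ_const_iff)
qed

lemma integral_by_parts:
  fixes f h :: "'n::finite cfun"
  assumes f: "f \<in> smooth_on UNIV" and h: "h \<in> smooth_on UNIV" "supported_in_ball \<rho> h"
  shows "(LINT x|lborel. f x * partial i h x) = - (LINT x|lborel. partial i f x * h x)"
proof -
  have int: "integrable lborel (\<lambda>x. a x * b x)" if "a \<in> smooth_on UNIV" "b \<in> smooth_on UNIV" "supported_in_ball \<rho> b" for a b :: "'n cfun"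
    by (rule integrable_supported[of _ \<rho>])
      (use that in \<open>auto intro!: continuous_intros dest: smooth_on_continuous_on simp: supported_in_ball_def\<close>)
  have "(LINT x|lborel. partial i (\<lambda>x. f x * h x) x) = 0"
    by (rule integral_partial_eq_0[of _ \<rho>]) (use f h in \<open>auto intro!: smooth_on_mult simp: supported_in_ball_def\<close>)
  moreover have "partial i (\<lambda>x. f x * h x) = (\<lambda>x. partial i f x * h x + f x * partial i h x)"
    by (rule ext, rule partial_mult) (rule smooth_on_differentiable[OF _ open_UNIV UNIV_I], rule f h)+
  moreover have "(LINT x|lborel. partial i f x * h x + f x * partial i h x) = (LINT x|lborel. partial i f x * h x) + (LINT x|lborel. f x * partial i h x)"
    by (intro Bochner_Integration.integral_add int smooth_on_partial supported_in_ball_partial f h)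
  ultimately show ?thesis by (simp add: add_eq_0_iff2)
qed

lemma integral_by_parts_mpartial:
  fixes f h :: "'n::finite cfun"
  assumes f: "f \<in> smooth_on UNIV" and h: "h \<in> smooth_on UNIV" "supported_in_ball \<rho> h"
  shows "(LINT x|lborel. f x * mpartial \<alpha> h x) = (- 1) ^ mi_order \<alpha> * (LINT x|lborel. mpartial \<alpha> f x * h x)"
proof -
  have pow: "(LINT x|lborel. f x * (partial i ^^ k) h x) = (- 1) ^ k * (LINT x|lborel. (partial i ^^ k) f x * h x)"
    if "f \<in> smooth_on UNIV" "h \<in> smooth_on UNIV" "supported_in_ball \<rho> h" for f h :: "'n cfun" and i k
    using that(1)
  proof (induction k arbitrary: f)
    case (Suc k)
    have sup: "supported_in_ball \<rho> ((partial i ^^ k) h)"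
      using that(3) by (induction k) (auto intro: supported_in_ball_partial)
    have "(LINT x|lborel. f x * (partial i ^^ Suc k) h x) = - (LINT x|lborel. partial i f x * (partial i ^^ k) h x)"
      using integral_by_parts[OF Suc.prems funpow_partial_smooth[OF that(2)] sup, of i] by simp
    also have "\<dots> = - ((- 1) ^ k * (LINT x|lborel. (partial i ^^ k) (partial i f) x * h x))"
      using Suc.IH[OF smooth_on_partial[OF Suc.prems]] by simp
    finally show ?case by (simp add: funpow_swap1)
  qed simp
  \<comment> \<open>The outermost derivative of \<open>h\<close>, moved to \<open>f\<close>, becomes
    innermost there; commuting it outwards restores the order fixed in
    \<open>mpartial\<close>.\<close>
  have com: "foldr (\<lambda>i. partial i ^^ \<alpha> i) js ((partial j ^^ k) f) = (partial j ^^ k) (foldr (\<lambda>i. partial i ^^ \<alpha> i) js f)"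
    if "f \<in> smooth_on UNIV" for js j k and f :: "'n cfun"
  proof (induction k)
    case (Suc k)
    have "foldr (\<lambda>i. partial i ^^ \<alpha> i) js (partial j ((partial j ^^ k) f)) = partial j (foldr (\<lambda>i. partial i ^^ \<alpha> i) js ((partial j ^^ k) f))"
      by (rule ext, rule foldr_partial_commute[OF open_UNIV funpow_partial_smooth[OF that] UNIV_I])
    then show ?case using Suc by simp
  qed simp
  have "(LINT x|lborel. f x * foldr (\<lambda>i. partial i ^^ \<alpha> i) js h x)
      = (- 1) ^ (\<Sum>i\<leftarrow>js. \<alpha> i) * (LINT x|lborel. foldr (\<lambda>i. partial i ^^ \<alpha> i) js f x * h x)" for js
    using f
  proof (induction js arbitrary: f)
    case (Cons j js)
    have sup1: "supported_in_ball \<rho> ((partial i ^^ k) h)" if "supported_in_ball \<rho> h" for i k and h :: "'n cfun"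
      using that by (induction k) (auto intro: supported_in_ball_partial)
    have sup: "supported_in_ball \<rho> (foldr (\<lambda>i. partial i ^^ \<alpha> i) js h)"
      using h(2) by (induction js) (auto intro: sup1)
    have "(LINT x|lborel. f x * foldr (\<lambda>i. partial i ^^ \<alpha> i) (j # js) h x)
        = (- 1) ^ \<alpha> j * (LINT x|lborel. (partial j ^^ \<alpha> j) f x * foldr (\<lambda>i. partial i ^^ \<alpha> i) js h x)"
      using pow[OF Cons.prems foldr_partial_smooth[OF h(1)] sup] by simp
    also have "\<dots> = (- 1) ^ (\<Sum>i\<leftarrow>j # js. \<alpha> i) * (LINT x|lborel. foldr (\<lambda>i. partial i ^^ \<alpha> i) js ((partial j ^^ \<alpha> j) f) x * h x)"
      using Cons.IH[OF funpow_partial_smooth[OF Cons.prems]] by (simp add: power_add)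
    finally show ?case by (simp add: com[OF Cons.prems])
  qed simp
  from this[of "SOME is. distinct is \<and> set is = UNIV"]
  have "(LINT x|lborel. f x * mpartial \<alpha> h x)
      = (- 1) ^ (\<Sum>i\<leftarrow>(SOME is. distinct is \<and> set is = (UNIV :: 'n set)). \<alpha> i) * (LINT x|lborel. mpartial \<alpha> f x * h x)"
    by (simp only: mpartial_def)
  moreover have "(\<Sum>i\<leftarrow>(SOME is. distinct is \<and> set is = (UNIV :: 'n set)). \<alpha> i) = mi_order \<alpha>"
    using distinct_coordinates[where 'n = 'n] by (subst sum_list_distinct_conv_sum_set) (simp_all add: mi_order_def)
  ultimately show ?thesis by simp
qed

text \<open>Testing against a nonnegative bump near \<open>x\<close> turns the weak derivative into
  a bound for an average of the classical one, and continuity lets the bump shrink. The bound holds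
  for every version \<open>g\<close>, hence for the one picked by choice in
  \<open>sobolev_inf_norm\<close>.\<close>

lemma norm_mpartial_le_weak_deriv:
  fixes f g :: "'n::finite cfun"
  assumes f: "f \<in> smooth_on UNIV" and g: "g \<in> Linf" "is_weak_deriv \<alpha> f g"
  shows "ennreal (norm (mpartial \<alpha> f x)) \<le> Linf_norm g"
proof -
  define M where "M = enn2real (Linf_norm g)"
  have gfin: "Linf_norm g < \<infinity>" and gm [measurable]: "g \<in> borel_measurable lborel" using g(1) by (auto simp: Linf_def)
  have M: "ennreal M = Linf_norm g" "M \<ge> 0" using gfin by (auto simp: M_def less_top)
  have "AE y in lborel. ennreal (norm (g y)) \<le> Linf_norm g"
    unfolding Linf_norm_def by (rule esssup_AE) measurable
  then have gM: "AE y in lborel. norm (g y) \<le> M" by eventually_elim (simp add: M(1)[symmetric] M(2))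
  let ?G = "mpartial \<alpha> f"
  have G: "continuous_on UNIV ?G" by (rule smooth_on_continuous_on[OF mpartial_smooth[OF f]])
  obtain w :: "real ^ 'n \<Rightarrow> real" where w: "(\<lambda>y. complex_of_real (w y)) \<in> smooth_on UNIV" "\<And>y. 0 \<le> w y"
    "\<And>y. norm y \<le> 1 \<Longrightarrow> w y = 1" "\<And>y. norm y \<ge> 2 \<Longrightarrow> w y = 0" using smooth_cutoff by blast
  have "norm (?G x) \<le> M + e" if e: "e > 0" for e
  proof -
    obtain \<delta> where \<delta>: "\<delta> > 0" "\<And>y. dist y x < \<delta> \<Longrightarrow> dist (?G y) (?G x) < e"
      using G e unfolding continuous_on_iff by (metis UNIV_I)
    \<comment> \<open>The bump w (k (y - x)) vanishes for |y - x| \<ge> 2/k = \<delta>/2, hence well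
      inside the ball where the derivative varies by less than \<open>e\<close>.\<close>
    define k where "k = 4 / \<delta>"
    have k: "k > 0" using \<delta> by (simp add: k_def)
    define v where "v y = w ((- k *\<^sub>R x) + k *\<^sub>R y)" for y
    define \<phi> where "\<phi> y = complex_of_real (v y)" for y
    have arg: "norm ((- k *\<^sub>R x) + k *\<^sub>R y) = k * norm (y - x)" for y
    proof -
      have "(- k *\<^sub>R x) + k *\<^sub>R y = k *\<^sub>R (y - x)" by (simp add: scaleR_diff_right)
      then show ?thesis using k by simp
    qed
    have \<phi>s: "\<phi> \<in> smooth_on UNIV" unfolding \<phi>_def[abs_def] v_def by (rule smooth_affine[OF w(1)])
    have v0: "v y = 0" if "dist y x \<ge> \<delta>" for y
    proof -
      have "k * norm (y - x) \<ge> 2" using that k \<delta>(1) by (simp add: k_def dist_norm field_simps)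
      then show ?thesis unfolding v_def by (intro w(4)) (simp only: arg)
    qed
    have supp: "supported_in_ball (norm x + \<delta>) \<phi>"
      unfolding supported_in_ball_def
    proof (intro allI impI)
      fix y :: "real ^ 'n" assume "norm y > norm x + \<delta>"
      then have "dist y x \<ge> \<delta>" using norm_triangle_ineq2[of y x] by (simp add: dist_norm)
      then show "\<phi> y = 0" by (simp add: \<phi>_def v0)
    qed
    have test: "\<phi> \<in> test_functions UNIV"
    proof -
      have "{y. \<phi> y \<noteq> 0} \<subseteq> cball 0 (norm x + \<delta>)"
        using supp by (force simp: supported_in_ball_def)
      then have "bounded {y. \<phi> y \<noteq> 0}" by (rule bounded_subset[OF bounded_cball])
      then show ?thesis using \<phi>s by (simp add: test_functions_def compact_closure)
    qed
    have \<phi>int: "integrable lborel \<phi>" by (rule integrable_supported[OF smooth_on_continuous_on[OF \<phi>s] supp])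
    have vint: "integrable lborel v"
      using \<phi>int unfolding \<phi>_def[abs_def] by (simp add: complex_of_real_integrable_eq)
    have vnn: "v y \<ge> 0" for y by (simp add: v_def w(2))
    define I where "I = (LINT y|lborel. v y)"
    have I: "I > 0"
    proof -
      have "0 < measure lborel (ball x (1 / k))" using k by (simp add: content_ball_pos)
      also have "\<dots> = (LINT y|lborel. indicator (ball x (1 / k)) y)" by simp
      also have "\<dots> \<le> I"
        unfolding I_def
      proof (rule integral_mono[OF _ vint])
        show "integrable lborel (indicator (ball x (1 / k)) :: _ \<Rightarrow> real)" by (intro integrable_real_indicator) (auto intro: emeasure_bounded_finite[unfolded infinity_ennreal_def])
        fix y
        show "indicator (ball x (1 / k)) y \<le> v y"
        proof (cases "y \<in> ball x (1 / k)")
          case True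
          then have "k * norm (y - x) \<le> 1" using k by (simp add: dist_norm norm_minus_commute field_simps)
          then have "v y = 1" unfolding v_def by (intro w(3)) (simp only: arg)
          then show ?thesis by simp
        qed (simp add: v_def w(2))
      qed
      finally show ?thesis .
    qed
    have "(LINT y|lborel. f y * mpartial \<alpha> \<phi> y) = (- 1) ^ mi_order \<alpha> * (LINT y|lborel. g y * \<phi> y)"
      using g(2) test by (simp add: is_weak_deriv_def)
    then have eq: "(LINT y|lborel. ?G y * \<phi> y) = (LINT y|lborel. g y * \<phi> y)"
      using integral_by_parts_mpartial[OF f \<phi>s supp, of \<alpha>] by simp
    have Gint: "integrable lborel (\<lambda>y. ?G y * \<phi> y)"
      by (rule integrable_supported[of _ "norm x + \<delta>"])
        (use supp in \<open>auto intro!: continuous_intros G smooth_on_continuous_on[OF \<phi>s] simp: supported_in_ball_def\<close>)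
    have "?G x * of_real I = (LINT y|lborel. ?G x * \<phi> y)"
      unfolding I_def \<phi>_def by simp
    also have "\<dots> = (LINT y|lborel. (?G x - ?G y) * \<phi> y) + (LINT y|lborel. g y * \<phi> y)"
      unfolding eq[symmetric]
      by (subst Bochner_Integration.integral_add[symmetric]) (use Gint \<phi>int in \<open>auto simp: left_diff_distrib\<close>)
    finally have split: "?G x * of_real I = (LINT y|lborel. (?G x - ?G y) * \<phi> y) + (LINT y|lborel. g y * \<phi> y)" .
    have "norm (?G x) * I = norm (?G x * of_real I)" using I by (simp add: norm_mult)
    also have "\<dots> \<le> norm (LINT y|lborel. (?G x - ?G y) * \<phi> y) + norm (LINT y|lborel. g y * \<phi> y)"
      unfolding split by (rule norm_triangle_ineq)
    also have "\<dots> \<le> e * I + M * I"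
    proof (rule add_mono)
      have "norm (LINT y|lborel. (?G x - ?G y) * \<phi> y) \<le> (LINT y|lborel. norm ((?G x - ?G y) * \<phi> y))"
        by (rule integral_norm_bound)
      also have "\<dots> \<le> (LINT y|lborel. e * v y)"
      proof (rule integral_mono_AE')
        show "AE y in lborel. norm ((?G x - ?G y) * \<phi> y) \<le> e * v y"
        proof (rule AE_I2)
          fix y
          show "norm ((?G x - ?G y) * \<phi> y) \<le> e * v y"
          proof (cases "dist y x < \<delta>")
            case True
            then have "norm (?G x - ?G y) \<le> e" using \<delta>(2)[OF True] by (simp add: dist_norm norm_minus_commute)
            moreover have "v y \<ge> 0" by (simp add: v_def w(2))
            ultimately show ?thesis by (simp add: norm_mult \<phi>_def mult_right_mono)
          qed (simp add: \<phi>_def v0)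
        qed
      qed (use vint vnn e M(2) in auto)
      also have "\<dots> = e * I" by (simp add: I_def)
      finally show "norm (LINT y|lborel. (?G x - ?G y) * \<phi> y) \<le> e * I" .
      have "norm (LINT y|lborel. g y * \<phi> y) \<le> (LINT y|lborel. norm (g y * \<phi> y))"
        by (rule integral_norm_bound)
      also have "\<dots> \<le> (LINT y|lborel. M * v y)"
      proof (rule integral_mono_AE')
        show "AE y in lborel. norm (g y * \<phi> y) \<le> M * v y"
          using gM by eventually_elim (simp add: norm_mult \<phi>_def v_def w(2) mult_right_mono)
      qed (use vint vnn e M(2) in auto)
      also have "\<dots> = M * I" by (simp add: I_def)
      finally show "norm (LINT y|lborel. g y * \<phi> y) \<le> M * I" .
    qed
    finally have "norm (?G x) * I \<le> (M + e) * I" by (simp add: algebra_simps)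
    then show ?thesis using I by simp
  qed
  then have "norm (?G x) \<le> M" by (rule field_le_epsilon)
  then show ?thesis unfolding M(1)[symmetric] by (rule ennreal_leI)
qed

lemma smooth_seminorm_le_sobolev_norm:
  fixes f :: "'n::finite cfun"
  assumes "f \<in> sobolev_inf_all"
  shows "smooth_seminorm K \<alpha> f \<le> sobolev_inf_norm (mi_order \<alpha>) f"
proof -
  have f: "f \<in> smooth_on UNIV" "f \<in> sobolev_inf (mi_order \<alpha>)" using assms by (auto simp: sobolev_inf_all_def)
  let ?g = "SOME g. g \<in> Linf \<and> is_weak_deriv \<alpha> f g"
  have "\<exists>g. g \<in> Linf \<and> is_weak_deriv \<alpha> f g" using f(2) by (auto simp: sobolev_inf_def)
  from someI_ex[OF this] have g: "?g \<in> Linf" "is_weak_deriv \<alpha> f ?g" by auto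
  have "smooth_seminorm K \<alpha> f \<le> Linf_norm ?g"
    unfolding smooth_seminorm_def by (rule SUP_least) (rule norm_mpartial_le_weak_deriv[OF f(1) g])
  also have "\<dots> \<le> sobolev_inf_norm (mi_order \<alpha>) f"
    unfolding sobolev_inf_norm_def
    by (rule SUP_upper[of \<alpha> _ "\<lambda>\<alpha>. Linf_norm (SOME g. g \<in> Linf \<and> is_weak_deriv \<alpha> f g)"]) simp
  finally show ?thesis .
qed

subsection \<open>Nets of smooth functions\<close>

lemma eventually_unit_interval: "\<forall>\<^sub>F \<epsilon> in at_right (0::real). \<epsilon> \<in> {0<..1}"
  unfolding eventually_at_right_field by (rule exI[of _ 1]) auto

text \<open>The real-valued counterpart of \<open>bigO_eps\<close> for all derivatives up to order
  \<open>k\<close> at once; a nonnegative constant allows estimates to be multiplied.\<close>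

definition jet_bigO :: "(real ^ 'n::finite) set \<Rightarrow> nat \<Rightarrow> 'n cfun net \<Rightarrow> real \<Rightarrow> bool" where
  "jet_bigO K k u b \<longleftrightarrow> (\<exists>C\<ge>0. \<forall>\<^sub>F \<epsilon> in at_right 0. \<forall>x\<in>K. jet k (u \<epsilon>) x \<le> C * \<epsilon> powr b)"

lemma powr_mono_unit: "\<epsilon> \<in> {0<..1} \<Longrightarrow> b' \<le> b \<Longrightarrow> \<epsilon> powr b \<le> \<epsilon> powr b'" for \<epsilon> :: real
  by (intro powr_mono') auto

lemma jet_bigO_mono:
  assumes "jet_bigO K k u b" "b' \<le> b"
  shows "jet_bigO K k u b'"
proof -
  obtain C where C: "C \<ge> 0" "\<forall>\<^sub>F \<epsilon> in at_right 0. \<forall>x\<in>K. jet k (u \<epsilon>) x \<le> C * \<epsilon> powr b"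
    using assms(1) by (auto simp: jet_bigO_def)
  have "\<forall>\<^sub>F \<epsilon> in at_right 0. \<forall>x\<in>K. jet k (u \<epsilon>) x \<le> C * \<epsilon> powr b'"
    using C(2) eventually_unit_interval
  proof eventually_elim
    case (elim \<epsilon>)
    then show ?case using mult_left_mono[OF powr_mono_unit[OF elim(2) assms(2)] C(1)] by fastforce
  qed
  then show ?thesis using C(1) by (auto simp: jet_bigO_def)
qed

lemma bigO_eps_mono:
  assumes "bigO_eps p b" "b' \<le> b" "\<forall>\<^sub>F \<epsilon> in at_right 0. p' \<epsilon> \<le> p \<epsilon>"
  shows "bigO_eps p' b'"
proof -
  obtain C where C: "\<forall>\<^sub>F \<epsilon> in at_right 0. p \<epsilon> \<le> ennreal (C * \<epsilon> powr b)"
    using assms(1) by (auto simp: bigO_eps_def)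
  have "\<forall>\<^sub>F \<epsilon> in at_right 0. p' \<epsilon> \<le> ennreal (max C 0 * \<epsilon> powr b')"
    using C assms(3) eventually_unit_interval
  proof eventually_elim
    case (elim \<epsilon>)
    \<comment> \<open>The constant may be negative, since \<open>ennreal\<close> truncates; it has
      to be made nonnegative before the power of \<epsilon> is enlarged.\<close>
    have "C * \<epsilon> powr b \<le> max C 0 * \<epsilon> powr b'"
      using elim(3) by (intro mult_mono powr_mono_unit assms(2)) auto
    then show ?case using elim(1,2) ennreal_leI order_trans by meson
  qed
  then show ?thesis by (auto simp: bigO_eps_def)
qed

lemma bigO_eps_seminorm_if_jet_bigO:
  assumes "jet_bigO K (mi_order \<alpha>) u b"
  shows "bigO_eps (\<lambda>\<epsilon>. smooth_seminorm K \<alpha> (u \<epsilon>)) b"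
proof -
  obtain C where C: "\<forall>\<^sub>F \<epsilon> in at_right 0. \<forall>x\<in>K. jet (mi_order \<alpha>) (u \<epsilon>) x \<le> C * \<epsilon> powr b"
    using assms by (auto simp: jet_bigO_def)
  have "\<forall>\<^sub>F \<epsilon> in at_right 0. smooth_seminorm K \<alpha> (u \<epsilon>) \<le> ennreal (C * \<epsilon> powr b)"
    using C by eventually_elim
      (auto simp: smooth_seminorm_def intro!: SUP_least ennreal_leI order_trans[OF norm_mpartial_le_jet])
  then show ?thesis by (auto simp: bigO_eps_def)
qed

lemma jet_bigO_if_seminorms:
  fixes u :: "'n::finite cfun net"
  assumes \<Omega>: "open \<Omega>" "K \<subseteq> \<Omega>" and u: "\<forall>\<epsilon>\<in>{0<..1}. u \<epsilon> \<in> smooth_on \<Omega>"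
    and b: "\<And>\<alpha>. mi_order \<alpha> \<le> k \<Longrightarrow> bigO_eps (\<lambda>\<epsilon>. smooth_seminorm K \<alpha> (u \<epsilon>)) b"
  shows "jet_bigO K k u b"
proof -
  let ?A = "{\<alpha> :: 'n multi_index. mi_order \<alpha> \<le> k}"
  have "\<forall>\<alpha>. \<exists>C. \<alpha> \<in> ?A \<longrightarrow> (\<forall>\<^sub>F \<epsilon> in at_right 0. smooth_seminorm K \<alpha> (u \<epsilon>) \<le> ennreal (C * \<epsilon> powr b))"
    using b by (auto simp: bigO_eps_def)
  from choice[OF this] obtain C where
    "\<forall>\<alpha>. \<alpha> \<in> ?A \<longrightarrow> (\<forall>\<^sub>F \<epsilon> in at_right 0. smooth_seminorm K \<alpha> (u \<epsilon>) \<le> ennreal (C \<alpha> * \<epsilon> powr b))" ..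
  then have "\<forall>\<^sub>F \<epsilon> in at_right 0. \<forall>\<alpha>\<in>?A. smooth_seminorm K \<alpha> (u \<epsilon>) \<le> ennreal (C \<alpha> * \<epsilon> powr b)"
    by (intro eventually_ball_finite finite_mi_order_le) auto
  then have "\<forall>\<^sub>F \<epsilon> in at_right 0. \<forall>x\<in>K. jet k (u \<epsilon>) x \<le> ((real CARD('n) + 1) ^ k * (\<Sum>\<alpha>\<in>?A. \<bar>C \<alpha>\<bar>)) * \<epsilon> powr b"
    using eventually_unit_interval
  proof eventually_elim
    case (elim \<epsilon>)
    show ?case
    proof
      fix x assume x: "x \<in> K"
      have "jet k (u \<epsilon>) x \<le> (real CARD('n) + 1) ^ k * ((\<Sum>\<alpha>\<in>?A. \<bar>C \<alpha>\<bar>) * \<epsilon> powr b)"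
      proof (rule jet_le_mpartial[OF \<Omega>(1)])
        fix \<alpha> :: "'n multi_index" assume \<alpha>: "mi_order \<alpha> \<le> k"
        have "ennreal (norm (mpartial \<alpha> (u \<epsilon>) x)) \<le> smooth_seminorm K \<alpha> (u \<epsilon>)"
          unfolding smooth_seminorm_def by (rule SUP_upper[OF x])
        also have "\<dots> \<le> ennreal (C \<alpha> * \<epsilon> powr b)" using elim(1) \<alpha> by blast
        also have "\<dots> \<le> ennreal ((\<Sum>\<alpha>\<in>?A. \<bar>C \<alpha>\<bar>) * \<epsilon> powr b)"
        proof (intro ennreal_leI mult_right_mono)
          have "C \<alpha> \<le> \<bar>C \<alpha>\<bar>" by simp
          also have "\<dots> \<le> (\<Sum>\<alpha>\<in>?A. \<bar>C \<alpha>\<bar>)" by (rule member_le_sum) (use \<alpha> finite_mi_order_le in auto)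
          finally show "C \<alpha> \<le> (\<Sum>\<alpha>\<in>?A. \<bar>C \<alpha>\<bar>)" .
        qed simp
        finally show "norm (mpartial \<alpha> (u \<epsilon>) x) \<le> (\<Sum>\<alpha>\<in>?A. \<bar>C \<alpha>\<bar>) * \<epsilon> powr b"
          by (subst (asm) ennreal_le_iff) (auto intro!: mult_nonneg_nonneg sum_nonneg)
      qed (use x \<Omega> u elim(2) in auto)
      then show "jet k (u \<epsilon>) x \<le> ((real CARD('n) + 1) ^ k * (\<Sum>\<alpha>\<in>?A. \<bar>C \<alpha>\<bar>)) * \<epsilon> powr b" by (simp add: mult.assoc)
    qed
  qed
  then show ?thesis unfolding jet_bigO_def
    by (intro exI[of _ "(real CARD('n) + 1) ^ k * (\<Sum>\<alpha>\<in>?A. \<bar>C \<alpha>\<bar>)"] conjI) (auto intro!: mult_nonneg_nonneg sum_nonneg)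
qed

definition smooth_net :: "(real ^ 'n::finite) set \<Rightarrow> 'n cfun net \<Rightarrow> bool" where
  "smooth_net \<Omega> u \<longleftrightarrow> (\<forall>\<epsilon>\<in>{0<..1}. u \<epsilon> \<in> smooth_on \<Omega>)"

definition mod_net :: "(real ^ 'n::finite) set \<Rightarrow> 'n cfun net \<Rightarrow> bool" where
  "mod_net \<Omega> u \<longleftrightarrow> smooth_net \<Omega> u \<and> (\<forall>K k. compact K \<and> K \<subseteq> \<Omega> \<longrightarrow> (\<exists>N::nat. jet_bigO K k u (- real N)))"

definition neg_net :: "(real ^ 'n::finite) set \<Rightarrow> 'n cfun net \<Rightarrow> bool" where
  "neg_net \<Omega> u \<longleftrightarrow> smooth_net \<Omega> u \<and> (\<forall>K k. compact K \<and> K \<subseteq> \<Omega> \<longrightarrow> (\<forall>q::nat. jet_bigO K k u (real q)))"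

lemma moderate_nets_iff:
  fixes u :: "'n::finite cfun net"
  assumes "open \<Omega>"
  shows "u \<in> moderate_nets (smooth_on \<Omega>) (smooth_seminorms \<Omega>) \<longleftrightarrow> mod_net \<Omega> u"
proof
  assume u: "u \<in> moderate_nets (smooth_on \<Omega>) (smooth_seminorms \<Omega>)"
  then have s: "\<forall>\<epsilon>\<in>{0<..1}. u \<epsilon> \<in> smooth_on \<Omega>" by (simp add: moderate_nets_def)
  have "\<exists>N::nat. jet_bigO K k u (- real N)" if K: "compact K" "K \<subseteq> \<Omega>" for K k
  proof -
    let ?A = "{\<alpha> :: 'n multi_index. mi_order \<alpha> \<le> k}"
    have "\<forall>\<alpha>. \<exists>N::nat. bigO_eps (\<lambda>\<epsilon>. smooth_seminorm K \<alpha> (u \<epsilon>)) (- real N)"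
      using u K unfolding moderate_nets_def smooth_seminorms_def by blast
    from choice[OF this] obtain N :: "'n multi_index \<Rightarrow> nat" where
      N: "\<forall>\<alpha>. bigO_eps (\<lambda>\<epsilon>. smooth_seminorm K \<alpha> (u \<epsilon>)) (- real (N \<alpha>))" ..
    \<comment> \<open>Finitely many multi-indices are involved, and the sum of their exponents
      serves all of them.\<close>
    have "jet_bigO K k u (- real (\<Sum>\<alpha>\<in>?A. N \<alpha>))"
    proof (rule jet_bigO_if_seminorms[OF assms K(2) s])
      fix \<alpha> :: "'n multi_index" assume "mi_order \<alpha> \<le> k"
      then have "N \<alpha> \<le> (\<Sum>\<alpha>\<in>?A. N \<alpha>)" by (intro member_le_sum finite_mi_order_le) auto
      then have "- real (\<Sum>\<alpha>\<in>?A. N \<alpha>) \<le> - real (N \<alpha>)" by (simp only: neg_le_iff_le of_nat_le_iff)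
      then show "bigO_eps (\<lambda>\<epsilon>. smooth_seminorm K \<alpha> (u \<epsilon>)) (- real (\<Sum>\<alpha>\<in>?A. N \<alpha>))"
        by (rule bigO_eps_mono[OF N[rule_format]]) simp
    qed
    then show ?thesis by blast
  qed
  then show "mod_net \<Omega> u" using s by (auto simp: mod_net_def smooth_net_def)
next
  assume u: "mod_net \<Omega> u"
  show "u \<in> moderate_nets (smooth_on \<Omega>) (smooth_seminorms \<Omega>)"
    unfolding moderate_nets_def
  proof (intro CollectI conjI ballI)
    fix p :: "'n cfun \<Rightarrow> ennreal" assume "p \<in> smooth_seminorms \<Omega>"
    then obtain K \<alpha> where p: "p = smooth_seminorm K \<alpha>" "compact K \<and> K \<subseteq> \<Omega>" by (auto simp: smooth_seminorms_def)
    then obtain N :: nat where "jet_bigO K (mi_order \<alpha>) u (- real N)" using u unfolding mod_net_def by blast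
    from bigO_eps_seminorm_if_jet_bigO[OF this] show "\<exists>N::nat. bigO_eps (\<lambda>\<epsilon>. p (u \<epsilon>)) (- real N)"
      unfolding p(1) by blast
  qed (use u in \<open>auto simp: mod_net_def smooth_net_def\<close>)
qed

lemma negligible_nets_iff:
  fixes u :: "'n::finite cfun net"
  assumes "open \<Omega>"
  shows "u \<in> negligible_nets (smooth_on \<Omega>) (smooth_seminorms \<Omega>) \<longleftrightarrow> neg_net \<Omega> u"
proof
  assume u: "u \<in> negligible_nets (smooth_on \<Omega>) (smooth_seminorms \<Omega>)"
  then have s: "\<forall>\<epsilon>\<in>{0<..1}. u \<epsilon> \<in> smooth_on \<Omega>" by (simp add: negligible_nets_def)
  have "jet_bigO K k u (real q)" if K: "compact K" "K \<subseteq> \<Omega>" for K k and q :: nat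
    by (rule jet_bigO_if_seminorms[OF assms K(2) s])
      (use u K in \<open>unfold negligible_nets_def smooth_seminorms_def, blast\<close>)
  then show "neg_net \<Omega> u" using s by (auto simp: neg_net_def smooth_net_def)
next
  assume u: "neg_net \<Omega> u"
  show "u \<in> negligible_nets (smooth_on \<Omega>) (smooth_seminorms \<Omega>)"
    unfolding negligible_nets_def
  proof (intro CollectI conjI ballI allI)
    fix p :: "'n cfun \<Rightarrow> ennreal" and q :: nat assume "p \<in> smooth_seminorms \<Omega>"
    then obtain K \<alpha> where p: "p = smooth_seminorm K \<alpha>" "compact K \<and> K \<subseteq> \<Omega>" by (auto simp: smooth_seminorms_def)
    then have "jet_bigO K (mi_order \<alpha>) u (real q)" using u unfolding neg_net_def by blast
    from bigO_eps_seminorm_if_jet_bigO[OF this] show "bigO_eps (\<lambda>\<epsilon>. p (u \<epsilon>)) (real q)"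
      unfolding p(1) .
  qed (use u in \<open>auto simp: neg_net_def smooth_net_def\<close>)
qed

lemma jet_bigO_add:
  assumes \<Omega>: "open \<Omega>" "K \<subseteq> \<Omega>" "smooth_net \<Omega> u" "smooth_net \<Omega> v" and "jet_bigO K k u b" "jet_bigO K k v b"
  shows "jet_bigO K k (\<lambda>\<epsilon> x. u \<epsilon> x + v \<epsilon> x) b"
proof -
  obtain C D where C: "C \<ge> 0" "\<forall>\<^sub>F \<epsilon> in at_right 0. \<forall>x\<in>K. jet k (u \<epsilon>) x \<le> C * \<epsilon> powr b"
    and D: "D \<ge> 0" "\<forall>\<^sub>F \<epsilon> in at_right 0. \<forall>x\<in>K. jet k (v \<epsilon>) x \<le> D * \<epsilon> powr b"
    using assms(5,6) by (auto simp: jet_bigO_def)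
  have "\<forall>\<^sub>F \<epsilon> in at_right 0. \<forall>x\<in>K. jet k (\<lambda>x. u \<epsilon> x + v \<epsilon> x) x \<le> (C + D) * \<epsilon> powr b"
    using C(2) D(2) eventually_unit_interval
  proof eventually_elim
    case (elim \<epsilon>)
    show ?case
    proof
      fix x assume x: "x \<in> K"
      have "jet k (\<lambda>x. u \<epsilon> x + v \<epsilon> x) x \<le> jet k (u \<epsilon>) x + jet k (v \<epsilon>) x"
        by (rule jet_add[OF \<Omega>(1)]) (use x \<Omega> elim(3) in \<open>auto simp: smooth_net_def\<close>)
      also have "\<dots> \<le> C * \<epsilon> powr b + D * \<epsilon> powr b" using elim x by (intro add_mono) auto
      finally show "jet k (\<lambda>x. u \<epsilon> x + v \<epsilon> x) x \<le> (C + D) * \<epsilon> powr b" by (simp add: distrib_right)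
    qed
  qed
  then show ?thesis unfolding jet_bigO_def using C(1) D(1) by (intro exI[of _ "C + D"]) auto
qed

lemma jet_bigO_mult:
  assumes \<Omega>: "open \<Omega>" "K \<subseteq> \<Omega>" "smooth_net \<Omega> u" "smooth_net \<Omega> v" and "jet_bigO K k u b" "jet_bigO K k v b'"
  shows "jet_bigO K k (\<lambda>\<epsilon> x. u \<epsilon> x * v \<epsilon> x) (b + b')"
proof -
  obtain C D where C: "C \<ge> 0" "\<forall>\<^sub>F \<epsilon> in at_right 0. \<forall>x\<in>K. jet k (u \<epsilon>) x \<le> C * \<epsilon> powr b"
    and D: "D \<ge> 0" "\<forall>\<^sub>F \<epsilon> in at_right 0. \<forall>x\<in>K. jet k (v \<epsilon>) x \<le> D * \<epsilon> powr b'"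
    using assms(5,6) by (auto simp: jet_bigO_def)
  have "\<forall>\<^sub>F \<epsilon> in at_right 0. \<forall>x\<in>K. jet k (\<lambda>x. u \<epsilon> x * v \<epsilon> x) x \<le> (2 ^ k * C * D) * \<epsilon> powr (b + b')"
    using C(2) D(2) eventually_unit_interval
  proof eventually_elim
    case (elim \<epsilon>)
    show ?case
    proof
      fix x assume x: "x \<in> K"
      have "jet k (\<lambda>x. u \<epsilon> x * v \<epsilon> x) x \<le> 2 ^ k * jet k (u \<epsilon>) x * jet k (v \<epsilon>) x"
        by (rule jet_mult[OF \<Omega>(1)]) (use x \<Omega> elim(3) in \<open>auto simp: smooth_net_def\<close>)
      also have "\<dots> \<le> 2 ^ k * (C * \<epsilon> powr b) * (D * \<epsilon> powr b')"
        using elim x C(1) by (intro mult_mono mult_left_mono) auto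
      finally show "jet k (\<lambda>x. u \<epsilon> x * v \<epsilon> x) x \<le> (2 ^ k * C * D) * \<epsilon> powr (b + b')"
        by (simp add: powr_add mult_ac)
    qed
  qed
  then show ?thesis unfolding jet_bigO_def using C(1) D(1) by (intro exI[of _ "2 ^ k * C * D"]) auto
qed

lemma jet_bigO_Dop:
  fixes u :: "'n::finite cfun net"
  assumes \<Omega>: "open \<Omega>" "K \<subseteq> \<Omega>" "smooth_net \<Omega> u" and "jet_bigO K (k + mi_order \<alpha>) u b"
  shows "jet_bigO K k (\<lambda>\<epsilon>. Dop \<alpha> (u \<epsilon>)) b"
proof -
  obtain C where C: "C \<ge> 0" "\<forall>\<^sub>F \<epsilon> in at_right 0. \<forall>x\<in>K. jet (k + mi_order \<alpha>) (u \<epsilon>) x \<le> C * \<epsilon> powr b"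
    using assms(4) by (auto simp: jet_bigO_def)
  have "\<forall>\<^sub>F \<epsilon> in at_right 0. \<forall>x\<in>K. jet k (Dop \<alpha> (u \<epsilon>)) x \<le> C * \<epsilon> powr b"
    using C(2) eventually_unit_interval
  proof eventually_elim
    case (elim \<epsilon>)
    show ?case
    proof
      fix x assume x: "x \<in> K"
      have "jet k (Dop \<alpha> (u \<epsilon>)) x = norm ((- \<i>) ^ mi_order \<alpha>) * jet k (mpartial \<alpha> (u \<epsilon>)) x"
        unfolding Dop_def[abs_def]
        by (rule jet_cmult[OF \<Omega>(1)]) (use x \<Omega> elim(2) in \<open>auto simp: smooth_net_def intro!: mpartial_smooth\<close>)
      also have "\<dots> \<le> jet (k + mi_order \<alpha>) (u \<epsilon>) x" by (simp add: norm_power jet_mpartial)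
      also have "\<dots> \<le> C * \<epsilon> powr b" using elim x by blast
      finally show "jet k (Dop \<alpha> (u \<epsilon>)) x \<le> C * \<epsilon> powr b" .
    qed
  qed
  then show ?thesis unfolding jet_bigO_def using C(1) by blast
qed

lemma smooth_net_closure:
  assumes "open \<Omega>"
  shows "smooth_net \<Omega> u \<Longrightarrow> smooth_net \<Omega> v \<Longrightarrow> smooth_net \<Omega> (\<lambda>\<epsilon> x. u \<epsilon> x + v \<epsilon> x)"
    "smooth_net \<Omega> u \<Longrightarrow> smooth_net \<Omega> v \<Longrightarrow> smooth_net \<Omega> (\<lambda>\<epsilon> x. u \<epsilon> x * v \<epsilon> x)"
    "smooth_net \<Omega> u \<Longrightarrow> smooth_net \<Omega> (\<lambda>\<epsilon>. Dop \<alpha> (u \<epsilon>))"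
  using assms unfolding smooth_net_def Dop_def[abs_def]
  by (auto intro!: smooth_on_add smooth_on_mult smooth_on_cmult mpartial_smooth)

lemma mod_net_mult:
  assumes "open \<Omega>" "mod_net \<Omega> u" "mod_net \<Omega> v"
  shows "mod_net \<Omega> (\<lambda>\<epsilon> x. u \<epsilon> x * v \<epsilon> x)"
  unfolding mod_net_def
proof (intro conjI allI impI)
  fix K k assume K: "compact K \<and> K \<subseteq> \<Omega>"
  obtain N M :: nat where "jet_bigO K k u (- real N)" "jet_bigO K k v (- real M)"
    using assms(2,3) K unfolding mod_net_def by blast
  then have "jet_bigO K k (\<lambda>\<epsilon> x. u \<epsilon> x * v \<epsilon> x) (- real N + - real M)"
    using assms K by (intro jet_bigO_mult[OF assms(1)]) (auto simp: mod_net_def)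
  then show "\<exists>N::nat. jet_bigO K k (\<lambda>\<epsilon> x. u \<epsilon> x * v \<epsilon> x) (- real N)"
    by (intro exI[of _ "N + M"]) simp
qed (use assms smooth_net_closure in \<open>auto simp: mod_net_def\<close>)

lemma neg_net_mult:
  assumes "open \<Omega>" "mod_net \<Omega> u" "neg_net \<Omega> v"
  shows "neg_net \<Omega> (\<lambda>\<epsilon> x. u \<epsilon> x * v \<epsilon> x)"
  unfolding neg_net_def
proof (intro conjI allI impI)
  fix K k and q :: nat assume K: "compact K \<and> K \<subseteq> \<Omega>"
  obtain N :: nat where "jet_bigO K k u (- real N)" using assms(2) K unfolding mod_net_def by blast
  moreover have "jet_bigO K k v (real (N + q))" using assms(3) K unfolding neg_net_def by blast
  ultimately have "jet_bigO K k (\<lambda>\<epsilon> x. u \<epsilon> x * v \<epsilon> x) (- real N + real (N + q))"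
    using assms K by (intro jet_bigO_mult[OF assms(1)]) (auto simp: mod_net_def neg_net_def)
  then show "jet_bigO K k (\<lambda>\<epsilon> x. u \<epsilon> x * v \<epsilon> x) (real q)" by simp
qed (use assms smooth_net_closure in \<open>auto simp: mod_net_def neg_net_def\<close>)

lemma mod_net_add:
  assumes "open \<Omega>" "mod_net \<Omega> u" "mod_net \<Omega> v"
  shows "mod_net \<Omega> (\<lambda>\<epsilon> x. u \<epsilon> x + v \<epsilon> x)"
  unfolding mod_net_def
proof (intro conjI allI impI)
  fix K k assume K: "compact K \<and> K \<subseteq> \<Omega>"
  obtain N M :: nat where "jet_bigO K k u (- real N)" "jet_bigO K k v (- real M)"
    using assms(2,3) K unfolding mod_net_def by blast
  then have "jet_bigO K k u (- real (N + M))" "jet_bigO K k v (- real (N + M))"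
    by (auto elim!: jet_bigO_mono)
  then have "jet_bigO K k (\<lambda>\<epsilon> x. u \<epsilon> x + v \<epsilon> x) (- real (N + M))"
    using assms K by (intro jet_bigO_add[OF assms(1)]) (auto simp: mod_net_def)
  then show "\<exists>N::nat. jet_bigO K k (\<lambda>\<epsilon> x. u \<epsilon> x + v \<epsilon> x) (- real N)" by blast
qed (use assms smooth_net_closure in \<open>auto simp: mod_net_def\<close>)

lemma neg_net_add:
  assumes "open \<Omega>" "neg_net \<Omega> u" "neg_net \<Omega> v"
  shows "neg_net \<Omega> (\<lambda>\<epsilon> x. u \<epsilon> x + v \<epsilon> x)"
  using assms unfolding neg_net_def
  by (auto intro!: jet_bigO_add[OF assms(1)] smooth_net_closure)

lemma mod_net_Dop:
  assumes "open \<Omega>" "mod_net \<Omega> u"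
  shows "mod_net \<Omega> (\<lambda>\<epsilon>. Dop \<alpha> (u \<epsilon>))"
  unfolding mod_net_def
proof (intro conjI allI impI)
  fix K k assume K: "compact K \<and> K \<subseteq> \<Omega>"
  then obtain N :: nat where "jet_bigO K (k + mi_order \<alpha>) u (- real N)"
    using assms(2) unfolding mod_net_def by blast
  then have "jet_bigO K k (\<lambda>\<epsilon>. Dop \<alpha> (u \<epsilon>)) (- real N)"
    using assms K by (intro jet_bigO_Dop[OF assms(1)]) (auto simp: mod_net_def)
  then show "\<exists>N::nat. jet_bigO K k (\<lambda>\<epsilon>. Dop \<alpha> (u \<epsilon>)) (- real N)" by blast
qed (use assms smooth_net_closure in \<open>auto simp: mod_net_def\<close>)

lemma neg_net_Dop:
  assumes "open \<Omega>" "neg_net \<Omega> u"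
  shows "neg_net \<Omega> (\<lambda>\<epsilon>. Dop \<alpha> (u \<epsilon>))"
  using assms unfolding neg_net_def
  by (auto intro!: jet_bigO_Dop[OF assms(1)] smooth_net_closure)

text \<open>Only small \<epsilon> count. This absorbs both the values of \<epsilon> for which no
  solution is constructed and identities that hold only on (0,1].\<close>

lemma neg_net_eventually_zero:
  assumes "open \<Omega>" "smooth_net \<Omega> u" "\<forall>\<^sub>F \<epsilon> in at_right 0. \<forall>x\<in>\<Omega>. u \<epsilon> x = 0"
  shows "neg_net \<Omega> u"
  unfolding neg_net_def
proof (intro conjI allI impI assms(2))
  fix K k and q :: nat assume K: "compact K \<and> K \<subseteq> \<Omega>"
  have "\<forall>\<^sub>F \<epsilon> in at_right 0. \<forall>x\<in>K. jet k (u \<epsilon>) x \<le> 0 * \<epsilon> powr real q"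
    using assms(3)
  proof eventually_elim
    case (elim \<epsilon>)
    then have "jet k (u \<epsilon>) x = jet k (\<lambda>_. 0) x" if "x \<in> K" for x
      using K that by (intro jet_cong[OF assms(1)]) auto
    then show ?case by simp
  qed
  then show "jet_bigO K k u (real q)" unfolding jet_bigO_def by blast
qed

lemma neg_net_zero: "open \<Omega> \<Longrightarrow> neg_net \<Omega> (\<lambda>\<epsilon> x. 0)"
  by (rule neg_net_eventually_zero) (auto simp: smooth_net_def)

lemma mod_net_const:
  assumes "open \<Omega>" "\<phi> \<in> smooth_on \<Omega>"
  shows "mod_net \<Omega> (\<lambda>\<epsilon>. \<phi>)"
  unfolding mod_net_def
proof (intro conjI allI impI)
  fix K k assume K: "compact K \<and> K \<subseteq> \<Omega>"
  then have "bounded (jet k \<phi> ` K)"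
    by (intro compact_imp_bounded compact_continuous_image continuous_on_subset[OF jet_continuous_on[OF assms(2)]]) auto
  then obtain A where A: "\<And>x. x \<in> K \<Longrightarrow> norm (jet k \<phi> x) \<le> A" by (metis bounded_iff imageI)
  have "\<forall>\<^sub>F \<epsilon> in at_right 0. \<forall>x\<in>K. jet k \<phi> x \<le> max A 0 * \<epsilon> powr (- real 0)"
    using eventually_unit_interval by eventually_elim (use A in \<open>fastforce\<close>)
  then show "\<exists>N::nat. jet_bigO K k (\<lambda>\<epsilon>. \<phi>) (- real N)" unfolding jet_bigO_def
    by (intro exI[of _ 0] exI[of _ "max A 0"] conjI) auto
qed (use assms in \<open>auto simp: smooth_net_def\<close>)

lemma mod_net_sum:
  assumes "open \<Omega>" "finite A" "\<And>a. a \<in> A \<Longrightarrow> mod_net \<Omega> (u a)"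
  shows "mod_net \<Omega> (\<lambda>\<epsilon> x. \<Sum>a\<in>A. u a \<epsilon> x)"
  using assms(2,3)
  by (induction A rule: finite_induct) (auto intro!: mod_net_add[OF assms(1)] mod_net_const[OF assms(1)])

lemma neg_net_sum:
  assumes "open \<Omega>" "finite A" "\<And>a. a \<in> A \<Longrightarrow> neg_net \<Omega> (u a)"
  shows "neg_net \<Omega> (\<lambda>\<epsilon> x. \<Sum>a\<in>A. u a \<epsilon> x)"
  using assms(2,3)
  by (induction A rule: finite_induct) (auto intro!: neg_net_add[OF assms(1)] neg_net_zero[OF assms(1)])

lemma jet_bigO_subset: "jet_bigO K k u b \<Longrightarrow> K' \<subseteq> K \<Longrightarrow> jet_bigO K' k u b"
  unfolding jet_bigO_def by (fastforce elim: eventually_mono)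

lemma mod_net_subset: "mod_net \<Omega> u \<Longrightarrow> \<Omega>' \<subseteq> \<Omega> \<Longrightarrow> mod_net \<Omega>' u"
  unfolding mod_net_def smooth_net_def using smooth_on_subset subset_trans by meson

lemma neg_net_subset: "neg_net \<Omega> u \<Longrightarrow> \<Omega>' \<subseteq> \<Omega> \<Longrightarrow> neg_net \<Omega>' u"
  unfolding neg_net_def smooth_net_def using smooth_on_subset subset_trans by meson

section \<open>Equivalence of nets and its compatibility with the operations\<close>

definition net_equiv :: "(real ^ 'n::finite) set \<Rightarrow> 'n cfun net \<Rightarrow> 'n cfun net \<Rightarrow> bool" where
  "net_equiv \<Omega> u v \<longleftrightarrow> mod_net \<Omega> u \<and> mod_net \<Omega> v \<and> neg_net \<Omega> (\<lambda>\<epsilon> x. u \<epsilon> x - v \<epsilon> x)"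

lemma colombeau_rel_iff:
  "open \<Omega> \<Longrightarrow> (u, v) \<in> colombeau_rel (smooth_on \<Omega>) (smooth_seminorms \<Omega>) \<longleftrightarrow> net_equiv \<Omega> u v"
  by (simp add: colombeau_rel_def net_equiv_def moderate_nets_iff negligible_nets_iff fun_diff_def)

lemma net_equiv_refl: "open \<Omega> \<Longrightarrow> mod_net \<Omega> u \<Longrightarrow> net_equiv \<Omega> u u"
  by (simp add: net_equiv_def neg_net_zero)

lemma net_equiv_sym:
  assumes "open \<Omega>" "net_equiv \<Omega> u v"
  shows "net_equiv \<Omega> v u"
proof -
  have "neg_net \<Omega> (\<lambda>\<epsilon> x. (- 1) * (u \<epsilon> x - v \<epsilon> x))"
    using assms by (intro neg_net_mult mod_net_const) (auto simp: net_equiv_def)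
  then show ?thesis using assms(2) by (simp add: net_equiv_def)
qed

lemma net_equiv_trans:
  assumes "open \<Omega>" "net_equiv \<Omega> u v" "net_equiv \<Omega> v w"
  shows "net_equiv \<Omega> u w"
proof -
  have "neg_net \<Omega> (\<lambda>\<epsilon> x. (u \<epsilon> x - v \<epsilon> x) + (v \<epsilon> x - w \<epsilon> x))"
    using assms by (intro neg_net_add) (auto simp: net_equiv_def)
  then show ?thesis using assms(2,3) by (simp add: net_equiv_def)
qed

lemma net_equiv_subset: "net_equiv \<Omega> u v \<Longrightarrow> \<Omega>' \<subseteq> \<Omega> \<Longrightarrow> net_equiv \<Omega>' u v"
  by (auto simp: net_equiv_def intro: mod_net_subset neg_net_subset)

lemma G_class_eq: "open \<Omega> \<Longrightarrow> G_class \<Omega> u = {v. net_equiv \<Omega> u v}"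
  by (auto simp: G_class_def colombeau_rel_iff)

lemma G_class_cong:
  assumes "open \<Omega>" "net_equiv \<Omega> u v"
  shows "G_class \<Omega> u = G_class \<Omega> v"
  using assms net_equiv_sym net_equiv_trans unfolding G_class_eq[OF assms(1)] by blast

lemma net_equiv_mult:
  assumes "open \<Omega>" "net_equiv \<Omega> r r'" "net_equiv \<Omega> u u'"
  shows "net_equiv \<Omega> (\<lambda>\<epsilon> x. r \<epsilon> x * u \<epsilon> x) (\<lambda>\<epsilon> x. r' \<epsilon> x * u' \<epsilon> x)"
proof -
  \<comment> \<open>The difference of the products telescopes into two terms, each moderate times
    negligible.\<close>
  have "neg_net \<Omega> (\<lambda>\<epsilon> x. u \<epsilon> x * (r \<epsilon> x - r' \<epsilon> x) + r' \<epsilon> x * (u \<epsilon> x - u' \<epsilon> x))"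
    using assms by (intro neg_net_add neg_net_mult) (auto simp: net_equiv_def)
  then show ?thesis using assms by (auto simp: net_equiv_def algebra_simps intro!: mod_net_mult)
qed

lemma mpartial_diff:
  assumes "open \<Omega>" "f \<in> smooth_on \<Omega>" "g \<in> smooth_on \<Omega>" "x \<in> \<Omega>"
  shows "mpartial \<alpha> (\<lambda>x. f x - g x) x = mpartial \<alpha> f x - mpartial \<alpha> g x"
proof -
  have step: "partial i (\<lambda>x. f x - g x) x = partial i f x - partial i g x"
    if "f \<in> smooth_on \<Omega>" "g \<in> smooth_on \<Omega>" "x \<in> \<Omega>" for f g i x
  proof -
    have d: "f differentiable (at x)" "g differentiable (at x)"
      using that smooth_on_differentiable[OF _ assms(1)] by auto
    then have "(\<lambda>x. (- 1) * g x) differentiable (at x)" by (intro differentiable_mult) auto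
    then have "partial i (\<lambda>x. f x + (- 1) * g x) x = partial i f x + (- 1) * partial i g x"
      using d by (simp only: partial_add partial_cmult)
    then show ?thesis by simp
  qed
  have pow: "(partial i ^^ k) (\<lambda>x. f x - g x) x = (partial i ^^ k) f x - (partial i ^^ k) g x"
    if "f \<in> smooth_on \<Omega>" "g \<in> smooth_on \<Omega>" "x \<in> \<Omega>" for f g i k x
    using that(3)
  proof (induction k arbitrary: x)
    case (Suc k)
    then show ?case
      using partial_cong[OF assms(1) Suc.prems Suc.IH] step[OF funpow_partial_smooth[OF that(1)] funpow_partial_smooth[OF that(2)]]
      by simp
  qed simp
  have "foldr (\<lambda>i. partial i ^^ \<alpha> i) js (\<lambda>x. f x - g x) x = foldr (\<lambda>i. partial i ^^ \<alpha> i) js f x - foldr (\<lambda>i. partial i ^^ \<alpha> i) js g x"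
    if "x \<in> \<Omega>" for js x
    using that
  proof (induction js arbitrary: x)
    case (Cons j js)
    then show ?case
      using funpow_partial_cong[OF assms(1) Cons.IH Cons.prems] pow[OF foldr_partial_smooth[OF assms(2)] foldr_partial_smooth[OF assms(3)]]
      by simp
  qed simp
  then show ?thesis using assms(4) by (simp add: mpartial_def)
qed

lemma net_equiv_Dop:
  assumes "open \<Omega>" "net_equiv \<Omega> u v"
  shows "net_equiv \<Omega> (\<lambda>\<epsilon>. Dop \<alpha> (u \<epsilon>)) (\<lambda>\<epsilon>. Dop \<alpha> (v \<epsilon>))"
proof -
  have neg: "neg_net \<Omega> (\<lambda>\<epsilon>. Dop \<alpha> (\<lambda>x. u \<epsilon> x - v \<epsilon> x))"
    using assms by (intro neg_net_Dop) (auto simp: net_equiv_def)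
  have sm: "smooth_net \<Omega> u" "smooth_net \<Omega> v" using assms by (auto simp: net_equiv_def mod_net_def)
  have eq: "Dop \<alpha> (\<lambda>x. u \<epsilon> x - v \<epsilon> x) x = Dop \<alpha> (u \<epsilon>) x - Dop \<alpha> (v \<epsilon>) x" if "\<epsilon> \<in> {0<..1}" "x \<in> \<Omega>" for \<epsilon> x
    using that sm mpartial_diff[OF assms(1), of "u \<epsilon>" "v \<epsilon>" x \<alpha>] by (simp add: Dop_def smooth_net_def right_diff_distrib)
  have "neg_net \<Omega> (\<lambda>\<epsilon> x. Dop \<alpha> (u \<epsilon>) x - Dop \<alpha> (v \<epsilon>) x)"
  proof -
    \<comment> \<open>Linearity of the derivative is available only on \<Omega> and for \<epsilon>
      in (0,1], so the discrepancy is split off as a net that vanishes eventually.\<close>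
    have "neg_net \<Omega> (\<lambda>\<epsilon> x. Dop \<alpha> (\<lambda>x. u \<epsilon> x - v \<epsilon> x) x + (Dop \<alpha> (u \<epsilon>) x - Dop \<alpha> (v \<epsilon>) x - Dop \<alpha> (\<lambda>x. u \<epsilon> x - v \<epsilon> x) x))"
    proof (rule neg_net_add[OF assms(1) neg])
      show "neg_net \<Omega> (\<lambda>\<epsilon> x. Dop \<alpha> (u \<epsilon>) x - Dop \<alpha> (v \<epsilon>) x - Dop \<alpha> (\<lambda>x. u \<epsilon> x - v \<epsilon> x) x)"
      proof (rule neg_net_eventually_zero[OF assms(1)])
        show "smooth_net \<Omega> (\<lambda>\<epsilon> x. Dop \<alpha> (u \<epsilon>) x - Dop \<alpha> (v \<epsilon>) x - Dop \<alpha> (\<lambda>x. u \<epsilon> x - v \<epsilon> x) x)"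
          using sm assms(1) unfolding smooth_net_def Dop_def[abs_def]
          by (auto intro!: smooth_on_diff smooth_on_cmult mpartial_smooth)
        show "\<forall>\<^sub>F \<epsilon> in at_right 0. \<forall>x\<in>\<Omega>. Dop \<alpha> (u \<epsilon>) x - Dop \<alpha> (v \<epsilon>) x - Dop \<alpha> (\<lambda>x. u \<epsilon> x - v \<epsilon> x) x = 0"
          using eventually_unit_interval by eventually_elim (simp add: eq)
      qed
    qed
    then show ?thesis by simp
  qed
  then show ?thesis using assms by (auto simp: net_equiv_def intro!: mod_net_Dop)
qed

lemma net_equiv_sum:
  assumes "open \<Omega>" "finite A" "\<And>a. a \<in> A \<Longrightarrow> net_equiv \<Omega> (u a) (v a)"
  shows "net_equiv \<Omega> (\<lambda>\<epsilon> x. \<Sum>a\<in>A. u a \<epsilon> x) (\<lambda>\<epsilon> x. \<Sum>a\<in>A. v a \<epsilon> x)"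
proof -
  have "neg_net \<Omega> (\<lambda>\<epsilon> x. \<Sum>a\<in>A. u a \<epsilon> x - v a \<epsilon> x)"
    by (rule neg_net_sum[OF assms(1,2)]) (use assms(3) in \<open>auto simp: net_equiv_def\<close>)
  then show ?thesis using assms by (auto simp: net_equiv_def sum_subtractf intro!: mod_net_sum)
qed

subsection \<open>Local solvability\<close>

text \<open>The constants of the fixed-\<epsilon> estimates are built from \<open>B\<close> by sums
  and products; closure under these carries O(1) from the bounds in (iii) to all of them.\<close>

definition ev_bounded :: "(real \<Rightarrow> real) \<Rightarrow> bool" where
  "ev_bounded f \<longleftrightarrow> (\<exists>C. \<forall>\<^sub>F \<epsilon> in at_right 0. \<bar>f \<epsilon>\<bar> \<le> C)"

lemma ev_bounded_const: "ev_bounded (\<lambda>_. c)"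
  by (auto simp: ev_bounded_def)

lemma ev_bounded_add:
  assumes "ev_bounded f" "ev_bounded g"
  shows "ev_bounded (\<lambda>\<epsilon>. f \<epsilon> + g \<epsilon>)"
proof -
  obtain C D where "\<forall>\<^sub>F \<epsilon> in at_right 0. \<bar>f \<epsilon>\<bar> \<le> C" "\<forall>\<^sub>F \<epsilon> in at_right 0. \<bar>g \<epsilon>\<bar> \<le> D"
    using assms by (auto simp: ev_bounded_def)
  then have "\<forall>\<^sub>F \<epsilon> in at_right 0. \<bar>f \<epsilon> + g \<epsilon>\<bar> \<le> C + D" by eventually_elim linarith
  then show ?thesis by (auto simp: ev_bounded_def)
qed

lemma ev_bounded_mult:
  assumes "ev_bounded f" "ev_bounded g"
  shows "ev_bounded (\<lambda>\<epsilon>. f \<epsilon> * g \<epsilon>)"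
proof -
  obtain C D where "\<forall>\<^sub>F \<epsilon> in at_right 0. \<bar>f \<epsilon>\<bar> \<le> C" "\<forall>\<^sub>F \<epsilon> in at_right 0. \<bar>g \<epsilon>\<bar> \<le> D"
    using assms by (auto simp: ev_bounded_def)
  then have "\<forall>\<^sub>F \<epsilon> in at_right 0. \<bar>f \<epsilon> * g \<epsilon>\<bar> \<le> C * D"
    by eventually_elim (simp add: abs_mult mult_mono')
  then show ?thesis by (auto simp: ev_bounded_def)
qed

lemma ev_bounded_sum:
  assumes "finite A" "\<And>a. a \<in> A \<Longrightarrow> ev_bounded (f a)"
  shows "ev_bounded (\<lambda>\<epsilon>. \<Sum>a\<in>A. f a \<epsilon>)"
  using assms by (induction A rule: finite_induct) (auto intro: ev_bounded_const ev_bounded_add)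

lemma ev_bounded_abs_bigo:
  assumes "f \<in> O[at_right 0](\<lambda>_. 1)"
  shows "ev_bounded (\<lambda>\<epsilon>. \<bar>f \<epsilon>\<bar>)"
  using landau_o.bigE[OF assms] unfolding ev_bounded_def by (metis (no_types, lifting) abs_abs eventually_mono mult.right_neutral norm_one real_norm_def)

lemma ev_bounded_inverse_jet_const:
  assumes "ev_bounded A"
  shows "ev_bounded (\<lambda>\<epsilon>. inverse_jet_const k (A \<epsilon>))"
  by (induction k) (auto simp: power2_eq_square intro!: ev_bounded_const ev_bounded_add ev_bounded_mult assms)

lemma ev_bounded_expansion_const:
  assumes "\<And>N. ev_bounded (\<lambda>\<epsilon>. B \<epsilon> N)"
  shows "ev_bounded (\<lambda>\<epsilon>. expansion_const T X m (B \<epsilon>) s)"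
  unfolding expansion_const_def remainder_const_def
  by (intro ev_bounded_mult ev_bounded_const ev_bounded_inverse_jet_const assms)

lemma ev_bounded_solution_const:
  assumes "\<And>N. ev_bounded (\<lambda>\<epsilon>. B \<epsilon> N)"
  shows "ev_bounded (\<lambda>\<epsilon>. solution_const T L X m (B \<epsilon>) N)"
proof -
  have "ev_bounded (\<lambda>\<epsilon>. weight_const (expansion_const T X m (B \<epsilon>)) t s)" for t s
    by (induction s)
      (auto intro!: ev_bounded_add ev_bounded_mult ev_bounded_const ev_bounded_expansion_const assms)
  then show ?thesis
    unfolding solution_const_def Let_def
    by (intro ev_bounded_mult ev_bounded_const ev_bounded_inverse_jet_const assms)
qed

text \<open>The result at the level of representatives. The exponent \<open>b\<close> is arbitrary
  and the loss \<open>a\<close> is the same for every order \<open>N\<close>: reading it with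
  \<open>b\<close> depending on the order gives moderateness, with a common \<open>b\<close>
  regularity.\<close>

lemma solution_net:
  fixes r :: "'n::finite multi_index \<Rightarrow> 'n cfun net" and P :: "'n symbol net" and x0 :: "real ^ 'n"
  assumes r: "\<And>\<alpha> \<epsilon>. mi_order \<alpha> \<le> m \<Longrightarrow> \<epsilon> \<in> {0<..1} \<Longrightarrow> r \<alpha> \<epsilon> \<in> smooth_on UNIV"
    and P: "\<And>\<epsilon> x \<xi>. \<epsilon> \<in> {0<..1} \<Longrightarrow> P \<epsilon> x \<xi> = symbol_of m (\<lambda>\<alpha>. r \<alpha> \<epsilon>) x \<xi>"
    and m': "0 \<le> m'"
    and ii: "\<exists>C>0. \<forall>x \<xi>. \<forall>\<epsilon>\<in>{0<..1}. norm \<xi> \<ge> R \<longrightarrow>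
               norm (P \<epsilon> x \<xi>) \<ge> C * \<epsilon> powr a * japanese_bracket \<xi> powr m'"
    and iii: "\<And>\<alpha> \<beta>. \<exists>C :: real net. C \<in> O[at_right 0](\<lambda>_. 1) \<and>
               (\<forall>x \<xi>. \<forall>\<epsilon>\<in>{0<..1}. norm \<xi> \<ge> R \<longrightarrow>
                  norm (symbol_deriv \<alpha> \<beta> (P \<epsilon>) x \<xi>)
                    \<le> C \<epsilon> * norm (P \<epsilon> x \<xi>) * japanese_bracket \<xi> powr (- real (mi_order \<alpha>)))"
  shows "\<exists>\<Omega> \<phi> K. open \<Omega> \<and> x0 \<in> \<Omega> \<and> compact K \<and> \<phi> \<in> test_functions \<Omega> \<and> (\<forall>\<^sub>F x in nhds x0. \<phi> x = 1) \<and>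
    (\<forall>f. smooth_net UNIV f \<longrightarrow> (\<exists>u. smooth_net UNIV u \<and>
       (\<forall>\<^sub>F \<epsilon> in at_right 0. \<forall>x\<in>\<Omega>. (\<Sum>\<alpha> | mi_order \<alpha> \<le> m. r \<alpha> \<epsilon> x * Dop \<alpha> (u \<epsilon>) x) = \<phi> x * f \<epsilon> x) \<and>
       (\<forall>N b. jet_bigO K ((N + 2 * CARD('n)) * CARD('n)) f b \<longrightarrow> jet_bigO UNIV N u (b - a))))"
proof -
  let ?n = "CARD('n)" and ?S = "weight_sum TYPE('n)"
  obtain C0 where C0: "C0 > 0" "\<And>x \<xi> \<epsilon>. \<epsilon> \<in> {0<..1} \<Longrightarrow> norm \<xi> \<ge> R \<Longrightarrow>
      norm (P \<epsilon> x \<xi>) \<ge> C0 * \<epsilon> powr a * japanese_bracket \<xi> powr m'"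
    using ii by blast
  have "\<forall>p. \<exists>C :: real net. C \<in> O[at_right 0](\<lambda>_. 1) \<and>
      (\<forall>x \<xi>. \<forall>\<epsilon>\<in>{0<..1}. norm \<xi> \<ge> R \<longrightarrow> norm (symbol_deriv (fst p) (snd p) (P \<epsilon>) x \<xi>)
        \<le> C \<epsilon> * norm (P \<epsilon> x \<xi>) * japanese_bracket \<xi> powr (- real (mi_order (fst p))))"
    using iii by blast
  from choice[OF this] obtain Cc :: "('n multi_index \<times> 'n multi_index) \<Rightarrow> real net" where
    Cc: "\<forall>p. Cc p \<in> O[at_right 0](\<lambda>_. 1) \<and>
      (\<forall>x \<xi>. \<forall>\<epsilon>\<in>{0<..1}. norm \<xi> \<ge> R \<longrightarrow> norm (symbol_deriv (fst p) (snd p) (P \<epsilon>) x \<xi>)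
        \<le> Cc p \<epsilon> * norm (P \<epsilon> x \<xi>) * japanese_bracket \<xi> powr (- real (mi_order (fst p))))" ..
  let ?I = "\<lambda>N. {\<gamma> :: 'n multi_index. mi_order \<gamma> \<le> m} \<times> {\<beta> :: 'n multi_index. mi_order \<beta> \<le> N}"
  have finI: "finite (?I N)" for N by (intro finite_cartesian_product finite_mi_order_le)
  \<comment> \<open>The power of n + 1 passes from multi-indices to jets. Only \<xi>-orders up to
    \<open>m\<close> and x-orders up to \<open>N\<close> occur, so finitely many O(1) nets are
    added.\<close>
  define B where "B \<epsilon> N = (real ?n + 1) ^ N * (\<Sum>p\<in>?I N. \<bar>Cc p \<epsilon>\<bar>)" for \<epsilon> N
  have Bev: "ev_bounded (\<lambda>\<epsilon>. B \<epsilon> N)" for N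
    unfolding B_def using Cc by (intro ev_bounded_mult ev_bounded_const ev_bounded_sum finI ev_bounded_abs_bigo) auto
  obtain w :: "real ^ 'n \<Rightarrow> real" where w: "(\<lambda>y. complex_of_real (w y)) \<in> smooth_on UNIV" "\<And>y. 0 \<le> w y"
    "\<And>y. norm y \<le> 1 \<Longrightarrow> w y = 1" "\<And>y. norm y \<ge> 2 \<Longrightarrow> w y = 0" using smooth_cutoff by blast
  define \<psi> where "\<psi> y = complex_of_real (w y)" for y
  have \<psi>: "\<psi> \<in> smooth_on UNIV" "\<And>y. norm y \<le> 1 \<Longrightarrow> \<psi> y = 1" "\<And>y. norm y \<ge> 2 \<Longrightarrow> \<psi> y = 0"
    using w by (auto simp: \<psi>_def[abs_def])
  have "\<forall>N. \<exists>A. \<forall>y. jet N \<psi> y \<le> A"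
  proof
    fix N
    have "\<psi> x = 0" if "norm (x - 0) \<ge> 2" for x using \<psi>(3) that by simp
    from bounded_jet_ball[OF \<psi>(1) this] obtain A where "\<And>y. jet N \<psi> y \<le> A" by blast
    then show "\<exists>A. \<forall>y. jet N \<psi> y \<le> A" by blast
  qed
  from choice[OF this] obtain X where X': "\<forall>N. \<forall>y. jet N \<psi> y \<le> X N" ..
  then have X: "jet N \<psi> y \<le> X N" for N y by blast
  obtain C1 where C1: "\<forall>\<^sub>F \<epsilon> in at_right 0. \<bar>expansion_const TYPE('n) X m (B \<epsilon>) 2\<bar> \<le> C1"
    using ev_bounded_expansion_const[of B "TYPE('n)" X m 2, OF Bev] unfolding ev_bounded_def by blast
  \<comment> \<open>L \<ge> 2R puts all lattice frequencies beyond R, and the last entry makes |C1|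
    (2/L) times the weight sum at most 1/2. Since \<open>C1\<close> is valid for all small
    \<epsilon>, the scale and with it \<Omega> are independent of \<epsilon>.\<close>
  define L where "L = max (max 1 (2 * R)) (4 * \<bar>C1\<bar> * ?S)"
  have L: "L \<ge> 1" "L \<ge> 2 * R" "L \<ge> 4 * \<bar>C1\<bar> * ?S" by (auto simp: L_def)
  define good where "good \<epsilon> \<longleftrightarrow> \<epsilon> \<in> {0<..1} \<and> expansion_const TYPE('n) X m (B \<epsilon>) 2 * (2 / L) * ?S \<le> 1 / 2" for \<epsilon>
  have good_ev: "\<forall>\<^sub>F \<epsilon> in at_right 0. good \<epsilon>"
    using C1 eventually_unit_interval
  proof eventually_elim
    case (elim \<epsilon>)
    have "expansion_const TYPE('n) X m (B \<epsilon>) 2 \<le> \<bar>C1\<bar>" using elim(1) by linarith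
    then have "expansion_const TYPE('n) X m (B \<epsilon>) 2 * (2 / L) * ?S \<le> \<bar>C1\<bar> * (2 / L) * ?S"
      using L(1) weight_sum_nonneg by (intro mult_right_mono) auto
    also have "\<dots> \<le> 1 / 2" using L by (simp add: field_simps)
    finally show ?case using elim(2) by (simp add: good_def)
  qed
  define \<Omega> where "\<Omega> = ball x0 (1 / L)"
  \<comment> \<open>At scale 4L the cut-off is 1 within distance 1/(4L) of x0 and 0 beyond 1/(2L),
    so its support is a compact subset of the ball of radius 1/L.\<close>
  define \<phi> where "\<phi> x = \<psi> (- (4 * L) *\<^sub>R x0 + (4 * L) *\<^sub>R x)" for x
  have arg: "norm (- (4 * L) *\<^sub>R x0 + (4 * L) *\<^sub>R x) = 4 * L * norm (x - x0)" for x
  proof -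
    have "- (4 * L) *\<^sub>R x0 + (4 * L) *\<^sub>R x = (4 * L) *\<^sub>R (x - x0)" by (simp add: scaleR_diff_right)
    then show ?thesis using L(1) by simp
  qed
  have \<phi>s: "\<phi> \<in> smooth_on UNIV" unfolding \<phi>_def[abs_def] by (rule smooth_affine[OF \<psi>(1)])
  have \<phi>0: "\<phi> x = 0" if "norm (x - x0) \<ge> 1 / (2 * L)" for x
  proof -
    have "4 * L * norm (x - x0) \<ge> 2" using that L(1) by (simp add: field_simps)
    then show ?thesis unfolding \<phi>_def by (intro \<psi>(3)) (simp only: arg)
  qed
  have \<phi>1: "\<phi> x = 1" if "norm (x - x0) \<le> 1 / (4 * L)" for x
  proof -
    have "4 * L * norm (x - x0) \<le> 1" using that L(1) by (simp add: field_simps)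
    then show ?thesis unfolding \<phi>_def by (intro \<psi>(2)) (simp only: arg)
  qed
  have test: "\<phi> \<in> test_functions \<Omega>"
  proof -
    have sub: "{x. \<phi> x \<noteq> 0} \<subseteq> cball x0 (1 / (2 * L))"
    proof
      fix x assume "x \<in> {x. \<phi> x \<noteq> 0}"
      then show "x \<in> cball x0 (1 / (2 * L))" using \<phi>0[of x] by (cases "norm (x - x0) \<ge> 1 / (2 * L)") (auto simp: dist_norm norm_minus_commute)
    qed
    then have c: "closure {x. \<phi> x \<noteq> 0} \<subseteq> cball x0 (1 / (2 * L))" by (rule closure_minimal) simp
    also have "\<dots> \<subseteq> \<Omega>" using L(1) by (auto simp: \<Omega>_def field_simps)
    finally have "closure {x. \<phi> x \<noteq> 0} \<subseteq> \<Omega>" .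
    moreover have "compact (closure {x. \<phi> x \<noteq> 0})"
      using bounded_subset[OF bounded_cball sub] by (simp add: compact_closure)
    ultimately show ?thesis using \<phi>s by (simp add: test_functions_def)
  qed
  have near: "\<forall>\<^sub>F x in nhds x0. \<phi> x = 1"
    unfolding eventually_nhds_metric
  proof (intro exI[of _ "1 / (4 * L)"] conjI allI impI)
    show "\<phi> x = 1" if "dist x x0 < 1 / (4 * L)" for x using that by (intro \<phi>1) (simp add: dist_norm)
  qed (use L(1) in simp)
  have sol: "\<exists>u. smooth_net UNIV u \<and>
       (\<forall>\<^sub>F \<epsilon> in at_right 0. \<forall>x\<in>\<Omega>. (\<Sum>\<alpha> | mi_order \<alpha> \<le> m. r \<alpha> \<epsilon> x * Dop \<alpha> (u \<epsilon>) x) = \<phi> x * f \<epsilon> x) \<and>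
       (\<forall>N b. jet_bigO (cball x0 (1 / L)) ((N + 2 * ?n) * ?n) f b \<longrightarrow> jet_bigO UNIV N u (b - a))"
    if f: "smooth_net UNIV f" for f
  proof -
    define g where "g \<epsilon> x = \<phi> x * f \<epsilon> x" for \<epsilon> x
    have gs: "g \<epsilon> \<in> smooth_on UNIV" if "\<epsilon> \<in> {0<..1}" for \<epsilon>
      unfolding g_def[abs_def] using f that by (intro smooth_on_mult \<phi>s) (auto simp: smooth_net_def)
    have g0: "g \<epsilon> x = 0" if "norm (x - x0) \<ge> 1 / L" for \<epsilon> x
    proof -
      have "1 / (2 * L) \<le> 1 / L" using L(1) by (intro divide_left_mono) auto
      then show ?thesis using \<phi>0[of x] that by (simp add: g_def)
    qed
    define spec where "spec \<epsilon> v \<longleftrightarrow> v \<in> smooth_on UNIV \<and>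
      (\<forall>x. norm (x - x0) < 1 / L \<longrightarrow> (\<Sum>\<alpha> | mi_order \<alpha> \<le> m. r \<alpha> \<epsilon> x * Dop \<alpha> v x) = g \<epsilon> x) \<and>
      (\<forall>N M x. (\<forall>x. jet ((N + 2 * ?n) * ?n) (g \<epsilon>) x \<le> M) \<longrightarrow>
         jet N v x \<le> solution_const TYPE('n) L X m (B \<epsilon>) N * M / (C0 * \<epsilon> powr a))" for \<epsilon> v
    have ex: "\<exists>v. spec \<epsilon> v" if g\<epsilon>: "good \<epsilon>" for \<epsilon>
    proof -
      have \<epsilon>: "\<epsilon> \<in> {0<..1}" using g\<epsilon> by (simp add: good_def)
      have Peq: "P \<epsilon> = symbol_of m (\<lambda>\<alpha>. r \<alpha> \<epsilon>)" using P[OF \<epsilon>] by (intro ext)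
      interpret microhypoelliptic_symbol m "\<lambda>\<alpha>. r \<alpha> \<epsilon>" R "C0 * \<epsilon> powr a" "B \<epsilon>"
      proof
        show "r \<alpha> \<epsilon> \<in> smooth_on UNIV" if "mi_order \<alpha> \<le> m" for \<alpha> by (rule r[OF that \<epsilon>])
        show "C0 * \<epsilon> powr a > 0" using C0(1) \<epsilon> by simp
        show "B \<epsilon> N \<ge> 0" for N unfolding B_def by (intro mult_nonneg_nonneg sum_nonneg) auto
        fix x \<xi> :: "real ^ 'n" assume \<xi>: "norm \<xi> \<ge> R"
        \<comment> \<open>With m' \<ge> 0 the power of the bracket is at least 1, leaving a lower
          bound for the symbol that is uniform in \<xi>.\<close>
        have "C0 * \<epsilon> powr a * 1 \<le> C0 * \<epsilon> powr a * japanese_bracket \<xi> powr m'"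
          using C0(1) japanese_bracket_ge_1[of \<xi>] m' by (intro mult_left_mono) (auto simp: ge_one_powr_ge_zero)
        then show "C0 * \<epsilon> powr a \<le> norm (symbol_of m (\<lambda>\<alpha>. r \<alpha> \<epsilon>) x \<xi>)"
          using C0(2)[OF \<epsilon> \<xi>, of x] by (simp add: Peq)
        fix N and \<gamma> :: "'n multi_index" assume \<gamma>: "mi_order \<gamma> \<le> m"
        let ?J = "japanese_bracket \<xi> powr (- real (mi_order \<gamma>))" and ?p = "norm (symbol_of m (\<lambda>\<alpha>. r \<alpha> \<epsilon>) x \<xi>)"
        have "jet N (symbol_xi_deriv m (\<lambda>\<alpha>. r \<alpha> \<epsilon>) \<gamma> \<xi>) x \<le> (real ?n + 1) ^ N * ((\<Sum>p\<in>?I N. \<bar>Cc p \<epsilon>\<bar>) * ?p * ?J)"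
        proof (rule jet_le_mpartial[OF open_UNIV UNIV_I symbol_xi_deriv_smooth])
          show "r \<alpha> \<epsilon> \<in> smooth_on UNIV" if "mi_order \<alpha> \<le> m" for \<alpha> by (rule r[OF that \<epsilon>])
          fix \<beta> :: "'n multi_index" assume \<beta>: "mi_order \<beta> \<le> N"
          have "mpartial \<beta> (symbol_xi_deriv m (\<lambda>\<alpha>. r \<alpha> \<epsilon>) \<gamma> \<xi>) x = symbol_deriv \<gamma> \<beta> (P \<epsilon>) x \<xi>"
            unfolding Peq by (rule symbol_deriv_symbol_of[symmetric]) (rule r[OF _ \<epsilon>])
          also have "norm \<dots> \<le> Cc (\<gamma>, \<beta>) \<epsilon> * ?p * ?J"
            unfolding Peq[symmetric] using Cc[THEN spec, of "(\<gamma>, \<beta>)"] \<epsilon> \<xi> by simp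
          also have "\<dots> \<le> (\<Sum>p\<in>?I N. \<bar>Cc p \<epsilon>\<bar>) * ?p * ?J"
          proof (intro mult_right_mono)
            have "Cc (\<gamma>, \<beta>) \<epsilon> \<le> \<bar>Cc (\<gamma>, \<beta>) \<epsilon>\<bar>" by simp
            also have "\<dots> \<le> (\<Sum>p\<in>?I N. \<bar>Cc p \<epsilon>\<bar>)" by (rule member_le_sum[OF _ _ finI]) (use \<gamma> \<beta> in auto)
            finally show "Cc (\<gamma>, \<beta>) \<epsilon> \<le> (\<Sum>p\<in>?I N. \<bar>Cc p \<epsilon>\<bar>)" .
          qed auto
          finally show "norm (mpartial \<beta> (symbol_xi_deriv m (\<lambda>\<alpha>. r \<alpha> \<epsilon>) \<gamma> \<xi>) x) \<le> (\<Sum>p\<in>?I N. \<bar>Cc p \<epsilon>\<bar>) * ?p * ?J" .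
        qed
        then show "jet N (symbol_xi_deriv m (\<lambda>\<alpha>. r \<alpha> \<epsilon>) \<gamma> \<xi>) x \<le> B \<epsilon> N * ?p * ?J"
          by (simp add: B_def mult.assoc)
      qed
      have "expansion_const TYPE('n) X m (B \<epsilon>) 2 * (2 / L) * ?S \<le> 1 / 2" using g\<epsilon> by (simp add: good_def)
      from local_solution[OF \<psi> X L(1,2) this gs[OF \<epsilon>] g0]
      show ?thesis unfolding spec_def by blast
    qed
    \<comment> \<open>The zero function is a smooth default for those \<epsilon> at which the
      contraction may fail; they do not accumulate at 0.\<close>
    define u where "u \<epsilon> = (if good \<epsilon> then SOME v. spec \<epsilon> v else (\<lambda>_. 0))" for \<epsilon>
    have us: "spec \<epsilon> (u \<epsilon>)" if "good \<epsilon>" for \<epsilon> unfolding u_def using someI_ex[OF ex[OF that]] that by simp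
    have "smooth_net UNIV u"
      unfolding smooth_net_def
    proof
      fix \<epsilon> :: real
      show "u \<epsilon> \<in> smooth_on UNIV" using us[of \<epsilon>] by (cases "good \<epsilon>") (auto simp: spec_def u_def)
    qed
    moreover have "\<forall>\<^sub>F \<epsilon> in at_right 0. \<forall>x\<in>\<Omega>. (\<Sum>\<alpha> | mi_order \<alpha> \<le> m. r \<alpha> \<epsilon> x * Dop \<alpha> (u \<epsilon>) x) = \<phi> x * f \<epsilon> x"
      using good_ev
    proof eventually_elim
      case (elim \<epsilon>)
      then show ?case using us[OF elim] by (auto simp: spec_def g_def \<Omega>_def dist_norm norm_minus_commute)
    qed
    moreover have "jet_bigO UNIV N u (b - a)" if fb: "jet_bigO (cball x0 (1 / L)) ((N + 2 * ?n) * ?n) f b" for N b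
    proof -
      let ?k = "(N + 2 * ?n) * ?n"
      obtain C where C: "C \<ge> 0" "\<forall>\<^sub>F \<epsilon> in at_right 0. \<forall>x\<in>cball x0 (1 / L). jet ?k (f \<epsilon>) x \<le> C * \<epsilon> powr b"
        using fb by (auto simp: jet_bigO_def)
      obtain D where D: "\<And>x. jet ?k \<phi> x \<le> D" using bounded_jet_ball[where N = ?k, OF \<phi>s \<phi>0] by blast
      have D0: "D \<ge> 0" using D[of 0] jet_nonneg[of ?k \<phi> 0] by linarith
      obtain E where E: "\<forall>\<^sub>F \<epsilon> in at_right 0. \<bar>solution_const TYPE('n) L X m (B \<epsilon>) N\<bar> \<le> E"
        using ev_bounded_solution_const[of B "TYPE('n)" L X m N, OF Bev] unfolding ev_bounded_def by blast
      have "\<forall>\<^sub>F \<epsilon> in at_right 0. \<forall>x\<in>UNIV. jet N (u \<epsilon>) x \<le> (\<bar>E\<bar> * (2 ^ ?k * D * C) / C0) * \<epsilon> powr (b - a)"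
        using C(2) E good_ev
      proof eventually_elim
        case (elim \<epsilon>)
        have \<epsilon>: "\<epsilon> \<in> {0<..1}" using elim(3) by (simp add: good_def)
        have fs: "f \<epsilon> \<in> smooth_on UNIV" using f \<epsilon> by (auto simp: smooth_net_def)
        let ?M = "2 ^ ?k * D * (C * \<epsilon> powr b)"
        have gM: "jet ?k (g \<epsilon>) x \<le> ?M" for x
        proof (cases "x \<in> cball x0 (1 / L)")
          case True
          have "jet ?k (g \<epsilon>) x \<le> 2 ^ ?k * jet ?k \<phi> x * jet ?k (f \<epsilon>) x"
            unfolding g_def[abs_def] by (rule jet_mult[OF open_UNIV UNIV_I \<phi>s fs])
          also have "\<dots> \<le> ?M" using True elim(1) D D0 by (intro mult_mono mult_left_mono) auto
          finally show ?thesis .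
        next
          case False
          then have "jet ?k (g \<epsilon>) x = jet ?k (\<lambda>_. 0) x"
            by (intro jet_cong[of "- cball x0 (1 / L)"]) (auto simp: dist_norm norm_minus_commute intro!: g0)
          then show ?thesis using D0 C(1) by simp
        qed
        show ?case
        proof
          fix x
          have "jet N (u \<epsilon>) x \<le> solution_const TYPE('n) L X m (B \<epsilon>) N * ?M / (C0 * \<epsilon> powr a)"
            using us[OF elim(3)] gM unfolding spec_def by blast
          also have "\<dots> \<le> \<bar>E\<bar> * ?M / (C0 * \<epsilon> powr a)"
            using elim(2) C0(1) D0 C(1) by (intro divide_right_mono mult_right_mono) auto
          also have "\<dots> = (\<bar>E\<bar> * (2 ^ ?k * D * C) / C0) * \<epsilon> powr (b - a)"
            by (simp add: powr_diff)
          finally show "jet N (u \<epsilon>) x \<le> (\<bar>E\<bar> * (2 ^ ?k * D * C) / C0) * \<epsilon> powr (b - a)" .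
        qed
      qed
      moreover have "\<bar>E\<bar> * (2 ^ ?k * D * C) / C0 \<ge> 0" using D0 C(1) C0(1) by simp
      ultimately show ?thesis unfolding jet_bigO_def by blast
    qed
    ultimately show ?thesis by blast
  qed
  show ?thesis
    by (rule exI[of _ \<Omega>], rule exI[of _ \<phi>], rule exI[of _ "cball x0 (1 / L)"])
      (use L(1) test near sol in \<open>auto simp: \<Omega>_def\<close>)
qed

section \<open>Classes and their representatives\<close>

lemma mod_net_if_sobolev_moderate:
  fixes u :: "'n::finite cfun net"
  assumes "u \<in> moderate_nets sobolev_inf_all (range sobolev_inf_norm)"
  shows "mod_net UNIV u"
proof -
  have E: "u \<epsilon> \<in> sobolev_inf_all" if "\<epsilon> \<in> {0<..1}" for \<epsilon> using assms that by (simp add: moderate_nets_def)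
  have "u \<in> moderate_nets (smooth_on UNIV) (smooth_seminorms UNIV)"
    unfolding moderate_nets_def
  proof (intro CollectI conjI ballI)
    show "u \<epsilon> \<in> smooth_on UNIV" if "\<epsilon> \<in> {0<..1}" for \<epsilon> using E[OF that] by (simp add: sobolev_inf_all_def)
    fix p :: "'n cfun \<Rightarrow> ennreal" assume "p \<in> smooth_seminorms UNIV"
    then obtain K \<alpha> where p: "p = smooth_seminorm K \<alpha>" by (auto simp: smooth_seminorms_def)
    obtain N :: nat where N: "bigO_eps (\<lambda>\<epsilon>. sobolev_inf_norm (mi_order \<alpha>) (u \<epsilon>)) (- real N)"
      using assms by (auto simp: moderate_nets_def)
    have "bigO_eps (\<lambda>\<epsilon>. p (u \<epsilon>)) (- real N)"
      by (rule bigO_eps_mono[OF N order_refl])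
        (use eventually_unit_interval in eventually_elim, use E smooth_seminorm_le_sobolev_norm in \<open>auto simp: p\<close>)
    then show "\<exists>N::nat. bigO_eps (\<lambda>\<epsilon>. p (u \<epsilon>)) (- real N)" by blast
  qed
  then show ?thesis by (simp add: moderate_nets_iff)
qed

lemma neg_net_if_sobolev_negligible:
  fixes u :: "'n::finite cfun net"
  assumes "u \<in> negligible_nets sobolev_inf_all (range sobolev_inf_norm)"
  shows "neg_net UNIV u"
proof -
  have E: "u \<epsilon> \<in> sobolev_inf_all" if "\<epsilon> \<in> {0<..1}" for \<epsilon> using assms that by (simp add: negligible_nets_def)
  have "u \<in> negligible_nets (smooth_on UNIV) (smooth_seminorms UNIV)"
    unfolding negligible_nets_def
  proof (intro CollectI conjI ballI allI)
    show "u \<epsilon> \<in> smooth_on UNIV" if "\<epsilon> \<in> {0<..1}" for \<epsilon> using E[OF that] by (simp add: sobolev_inf_all_def)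
    fix p :: "'n cfun \<Rightarrow> ennreal" and q :: nat assume "p \<in> smooth_seminorms UNIV"
    then obtain K \<alpha> where p: "p = smooth_seminorm K \<alpha>" by (auto simp: smooth_seminorms_def)
    have q: "bigO_eps (\<lambda>\<epsilon>. sobolev_inf_norm (mi_order \<alpha>) (u \<epsilon>)) (real q)"
      using assms by (auto simp: negligible_nets_def)
    show "bigO_eps (\<lambda>\<epsilon>. p (u \<epsilon>)) (real q)"
      by (rule bigO_eps_mono[OF q order_refl])
        (use eventually_unit_interval in eventually_elim, use E smooth_seminorm_le_sobolev_norm in \<open>auto simp: p\<close>)
  qed
  then show ?thesis by (simp add: negligible_nets_iff)
qed

text \<open>Classes of Sobolev nets are carried into classes of smooth nets, so the choice of
  representatives of the coefficients is immaterial on every \<Omega>. With r = r' it also supplies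
  smoothness and moderateness of a representative.\<close>

lemma G_inf_net_equiv:
  assumes "C \<in> G_inf" "r \<in> C" "r' \<in> C"
  shows "net_equiv UNIV r r'"
proof -
  let ?R = "colombeau_rel sobolev_inf_all (range sobolev_inf_norm) :: ('a cfun net \<times> 'a cfun net) set"
  obtain v where C: "C = ?R `` {v}" using assms(1) unfolding G_inf_def colombeau_def by (auto elim: quotientE)
  have "net_equiv UNIV v s" if "(v, s) \<in> ?R" for s
    using that mod_net_if_sobolev_moderate neg_net_if_sobolev_negligible[of "\<lambda>\<epsilon>. v \<epsilon> - s \<epsilon>"]
    by (auto simp: colombeau_rel_def net_equiv_def fun_diff_def)
  then have "net_equiv UNIV v r" "net_equiv UNIV v r'" using assms(2,3) C by auto
  then show ?thesis using net_equiv_sym net_equiv_trans open_UNIV by blast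
qed

lemma G_net_equiv:
  assumes "F \<in> G \<Omega>" "f \<in> F" "f' \<in> F" "open \<Omega>"
  shows "net_equiv \<Omega> f f'"
proof -
  obtain v where F: "F = G_class \<Omega> v"
    using assms(1) unfolding G_def colombeau_def G_class_def by (auto elim: quotientE)
  then have "net_equiv \<Omega> v f" "net_equiv \<Omega> v f'" using assms by (auto simp: G_class_eq)
  then show ?thesis using net_equiv_sym net_equiv_trans assms(4) by blast
qed

lemma G_nonempty:
  assumes "F \<in> G \<Omega>" "open \<Omega>"
  obtains f where "f \<in> F" "mod_net \<Omega> f"
proof -
  obtain v where F: "F = G_class \<Omega> v" and v: "v \<in> moderate_nets (smooth_on \<Omega>) (smooth_seminorms \<Omega>)"
    using assms(1) unfolding G_def colombeau_def G_class_def by (auto elim: quotientE)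
  have "mod_net \<Omega> v" using v assms(2) by (simp add: moderate_nets_iff)
  then have "v \<in> F" using F assms(2) by (simp add: G_class_eq net_equiv_refl)
  with \<open>mod_net \<Omega> v\<close> show ?thesis by (rule that[rotated])
qed

lemma G_class_in_G: "open \<Omega> \<Longrightarrow> mod_net \<Omega> u \<Longrightarrow> G_class \<Omega> u \<in> G \<Omega>"
  unfolding G_def colombeau_def G_class_def by (rule quotientI) (simp add: moderate_nets_iff)

text \<open>All choices of representatives give equivalent nets, so the union in
  \<open>G_diff_op\<close> collapses to one class and may be computed with the coefficients of the
  given P.\<close>

lemma G_diff_op_eq:
  fixes c :: "'n::finite multi_index \<Rightarrow> 'n cfun net set"
  assumes \<Omega>: "open \<Omega>" and c: "\<And>\<alpha>. mi_order \<alpha> \<le> m \<Longrightarrow> c \<alpha> \<in> G_inf"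
    and r: "r \<in> coeff_representatives m c" and u: "mod_net \<Omega> u"
  shows "G_diff_op \<Omega> m c (G_class \<Omega> u) = G_class \<Omega> (\<lambda>\<epsilon> x. \<Sum>\<alpha> | mi_order \<alpha> \<le> m. r \<alpha> \<epsilon> x * Dop \<alpha> (u \<epsilon>) x)"
    and "mod_net \<Omega> (\<lambda>\<epsilon> x. \<Sum>\<alpha> | mi_order \<alpha> \<le> m. r \<alpha> \<epsilon> x * Dop \<alpha> (u \<epsilon>) x)"
proof -
  let ?T = "\<lambda>r u \<epsilon> x. \<Sum>\<alpha> | mi_order \<alpha> \<le> m. r \<alpha> \<epsilon> x * Dop \<alpha> (u \<epsilon>) x"
  have eqv: "net_equiv \<Omega> (?T r u) (?T r' u')" if "r' \<in> coeff_representatives m c" "net_equiv \<Omega> u u'" for r' u'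
  proof (rule net_equiv_sum[OF \<Omega> finite_mi_order_le])
    fix \<alpha> :: "'n multi_index" assume "\<alpha> \<in> {\<alpha>. mi_order \<alpha> \<le> m}"
    then have "net_equiv UNIV (r \<alpha>) (r' \<alpha>)"
      using c r that(1) by (intro G_inf_net_equiv[of "c \<alpha>"]) (auto simp: coeff_representatives_def)
    then have "net_equiv \<Omega> (r \<alpha>) (r' \<alpha>)" by (rule net_equiv_subset) simp
    then show "net_equiv \<Omega> (\<lambda>\<epsilon> x. r \<alpha> \<epsilon> x * Dop \<alpha> (u \<epsilon>) x) (\<lambda>\<epsilon> x. r' \<alpha> \<epsilon> x * Dop \<alpha> (u' \<epsilon>) x)"
      by (rule net_equiv_mult[OF \<Omega> _ net_equiv_Dop[OF \<Omega> that(2)]])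
  qed
  then show "mod_net \<Omega> (?T r u)" using eqv[OF r net_equiv_refl[OF \<Omega> u]] by (simp add: net_equiv_def)
  have "G_class \<Omega> (?T r' u') = G_class \<Omega> (?T r u)" if "r' \<in> coeff_representatives m c" "u' \<in> G_class \<Omega> u" for r' u'
    using G_class_cong[OF \<Omega> eqv[OF that(1)], of u'] that(2) by (simp add: G_class_eq[OF \<Omega>])
  moreover have "u \<in> G_class \<Omega> u" using u by (simp add: G_class_eq[OF \<Omega>] net_equiv_refl[OF \<Omega>])
  ultimately show "G_diff_op \<Omega> m c (G_class \<Omega> u) = G_class \<Omega> (?T r u)"
    unfolding G_diff_op_def using r by blast
qed

lemma G_mult_smooth_eq:
  assumes \<Omega>: "open \<Omega>" and \<phi>: "\<phi> \<in> smooth_on \<Omega>" and F: "F \<in> G UNIV" and f: "f \<in> F"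
  shows "G_mult_smooth \<Omega> \<phi> F = G_class \<Omega> (\<lambda>\<epsilon> x. \<phi> x * f \<epsilon> x)"
proof -
  have eqv: "net_equiv \<Omega> (\<lambda>\<epsilon> x. \<phi> x * f \<epsilon> x) (\<lambda>\<epsilon> x. \<phi> x * f' \<epsilon> x)" if "f' \<in> F" for f'
    using net_equiv_subset[OF G_net_equiv[OF F f that open_UNIV], of \<Omega>]
      net_equiv_mult[OF \<Omega> net_equiv_refl[OF \<Omega> mod_net_const[OF \<Omega> \<phi>]]] by simp
  have "G_class \<Omega> (\<lambda>\<epsilon> x. \<phi> x * f' \<epsilon> x) = G_class \<Omega> (\<lambda>\<epsilon> x. \<phi> x * f \<epsilon> x)" if "f' \<in> F" for f'
    using G_class_cong[OF \<Omega> eqv[OF that]] by simp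
  then show ?thesis unfolding G_mult_smooth_def using f by blast
qed

theorem proposition2p9:
  fixes m :: nat
    and c :: "'n::finite multi_index \<Rightarrow> 'n cfun net set"
    and a m' R :: real
    and P :: "'n symbol net"
  assumes coeffs: "\<And>\<alpha>. mi_order \<alpha> \<le> m \<Longrightarrow> c \<alpha> \<in> G_inf"
    and m': "0 \<le> m'" "m' \<le> real m"
    and R: "R > 0"
    and P: "symbol_representative m c P"
    and i: "\<And>\<alpha> \<beta>. bigO_eps (\<lambda>\<epsilon>. symbol_seminorm (real m) \<alpha> \<beta> (P \<epsilon>)) a"
    and ii: "\<exists>C>0. \<forall>x \<xi>. \<forall>\<epsilon>\<in>{0<..1}. norm \<xi> \<ge> R \<longrightarrow>
               norm (P \<epsilon> x \<xi>) \<ge> C * \<epsilon> powr a * japanese_bracket \<xi> powr m'"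
    and iii: "\<And>\<alpha> \<beta>. \<exists>C :: real net. C \<in> O[at_right 0](\<lambda>_. 1) \<and>
               (\<forall>x \<xi>. \<forall>\<epsilon>\<in>{0<..1}. norm \<xi> \<ge> R \<longrightarrow>
                  norm (symbol_deriv \<alpha> \<beta> (P \<epsilon>) x \<xi>)
                    \<le> C \<epsilon> * norm (P \<epsilon> x \<xi>) * japanese_bracket \<xi> powr (- real (mi_order \<alpha>)))"
  shows "\<forall>x0 :: real ^ 'n. \<exists>\<Omega> \<phi>.
           open \<Omega> \<and> x0 \<in> \<Omega> \<and>
           \<phi> \<in> test_functions \<Omega> \<and> (\<forall>\<^sub>F x in nhds x0. \<phi> x = 1) \<and>
           (\<forall>f\<in>G UNIV. \<exists>u\<in>G \<Omega>. G_diff_op \<Omega> m c u = G_mult_smooth \<Omega> \<phi> f) \<and>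
           (\<forall>f\<in>G_regular UNIV. \<exists>u\<in>G_regular \<Omega>. G_diff_op \<Omega> m c u = G_mult_smooth \<Omega> \<phi> f)"
proof
  fix x0 :: "real ^ 'n"
  obtain r where r: "r \<in> coeff_representatives m c"
    and Pr: "\<forall>\<epsilon>\<in>{0<..1}. \<forall>x \<xi>. P \<epsilon> x \<xi> = (\<Sum>\<alpha> | mi_order \<alpha> \<le> m. r \<alpha> \<epsilon> x * of_real (mi_power \<xi> \<alpha>))"
    using P unfolding symbol_representative_def by blast
  have rs: "r \<alpha> \<epsilon> \<in> smooth_on UNIV" if "mi_order \<alpha> \<le> m" "\<epsilon> \<in> {0<..1}" for \<alpha> \<epsilon>
    using G_inf_net_equiv[OF coeffs[OF that(1)], of "r \<alpha>" "r \<alpha>"] r that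
    by (auto simp: coeff_representatives_def net_equiv_def mod_net_def smooth_net_def)
  have Ps: "P \<epsilon> x \<xi> = symbol_of m (\<lambda>\<alpha>. r \<alpha> \<epsilon>) x \<xi>" if "\<epsilon> \<in> {0<..1}" for \<epsilon> x \<xi>
    using Pr that by (simp add: symbol_of_def)
  let ?T = "\<lambda>u \<epsilon> x. \<Sum>\<alpha> | mi_order \<alpha> \<le> m. r \<alpha> \<epsilon> x * Dop \<alpha> (u \<epsilon>) x"
  have "\<exists>\<Omega> \<phi> K. open \<Omega> \<and> x0 \<in> \<Omega> \<and> compact K \<and> \<phi> \<in> test_functions \<Omega> \<and> (\<forall>\<^sub>F x in nhds x0. \<phi> x = 1) \<and>
    (\<forall>f. smooth_net UNIV f \<longrightarrow> (\<exists>u. smooth_net UNIV u \<and>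
       (\<forall>\<^sub>F \<epsilon> in at_right 0. \<forall>x\<in>\<Omega>. ?T u \<epsilon> x = \<phi> x * f \<epsilon> x) \<and>
       (\<forall>N b. jet_bigO K ((N + 2 * CARD('n)) * CARD('n)) f b \<longrightarrow> jet_bigO UNIV N u (b - a))))"
    by (rule solution_net[OF rs Ps m'(1) ii iii])
  then obtain \<Omega> \<phi> K where \<Omega>: "open \<Omega>" "x0 \<in> \<Omega>" and K: "compact K"
    and \<phi>: "\<phi> \<in> test_functions \<Omega>" "\<forall>\<^sub>F x in nhds x0. \<phi> x = 1"
    and sol: "\<forall>f. smooth_net UNIV f \<longrightarrow> (\<exists>u. smooth_net UNIV u \<and>
       (\<forall>\<^sub>F \<epsilon> in at_right 0. \<forall>x\<in>\<Omega>. ?T u \<epsilon> x = \<phi> x * f \<epsilon> x) \<and>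
       (\<forall>N b. jet_bigO K ((N + 2 * CARD('n)) * CARD('n)) f b \<longrightarrow> jet_bigO UNIV N u (b - a)))"
    by (elim exE conjE)
  have \<phi>s: "\<phi> \<in> smooth_on \<Omega>"
    using \<phi>(1) smooth_on_subset[of \<phi> UNIV \<Omega>] by (simp add: test_functions_def)
  \<comment> \<open>The real loss \<open>a\<close> is rounded up to a natural exponent that depends
    neither on the compact set nor on the order of derivatives.\<close>
  have bound: "jet_bigO K' N u (- real (M + nat \<lceil>\<bar>a\<bar>\<rceil>))"
    if "\<forall>N b. jet_bigO K ((N + 2 * CARD('n)) * CARD('n)) f b \<longrightarrow> jet_bigO UNIV N u (b - a)"
      "jet_bigO K ((N + 2 * CARD('n)) * CARD('n)) f (- real M)" for f u K' N M
  proof -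
    have "jet_bigO UNIV N u (- real M - a)" using that by blast
    moreover have "- real (M + nat \<lceil>\<bar>a\<bar>\<rceil>) \<le> - real M - a" by linarith
    ultimately have "jet_bigO UNIV N u (- real (M + nat \<lceil>\<bar>a\<bar>\<rceil>))" by (rule jet_bigO_mono)
    then show ?thesis by (rule jet_bigO_subset) simp
  qed
  have main: "\<exists>u. mod_net \<Omega> u \<and> G_diff_op \<Omega> m c (G_class \<Omega> u) = G_mult_smooth \<Omega> \<phi> F \<and>
      (\<forall>N b. jet_bigO K ((N + 2 * CARD('n)) * CARD('n)) f b \<longrightarrow> jet_bigO UNIV N u (b - a))"
    if F: "F \<in> G UNIV" and f: "f \<in> F" for F f
  proof -
    have fm: "mod_net UNIV f" using G_net_equiv[OF F f f open_UNIV] by (simp add: net_equiv_def)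
    then have "smooth_net UNIV f" by (simp add: mod_net_def)
    from sol[THEN spec, THEN mp, OF this]
    obtain u where u: "smooth_net UNIV u" "\<forall>\<^sub>F \<epsilon> in at_right 0. \<forall>x\<in>\<Omega>. ?T u \<epsilon> x = \<phi> x * f \<epsilon> x"
      and ub: "\<forall>N b. jet_bigO K ((N + 2 * CARD('n)) * CARD('n)) f b \<longrightarrow> jet_bigO UNIV N u (b - a)"
      by (elim exE conjE)
    have us: "smooth_net \<Omega> u" using u(1) by (auto simp: smooth_net_def intro: smooth_on_subset[OF _ subset_UNIV])
    have um: "mod_net \<Omega> u"
      unfolding mod_net_def
    proof (intro conjI allI impI us)
      fix K' N
      obtain M :: nat where "jet_bigO K ((N + 2 * CARD('n)) * CARD('n)) f (- real M)"
        using fm K unfolding mod_net_def by blast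
      from bound[OF ub this] show "\<exists>N'::nat. jet_bigO K' N u (- real N')" by blast
    qed
    have op: "G_diff_op \<Omega> m c (G_class \<Omega> u) = G_class \<Omega> (?T u)" "mod_net \<Omega> (?T u)"
      using G_diff_op_eq[OF \<Omega>(1) _ r um] coeffs by blast+
    have \<phi>f: "mod_net \<Omega> (\<lambda>\<epsilon> x. \<phi> x * f \<epsilon> x)"
      by (rule mod_net_mult[OF \<Omega>(1) mod_net_const[OF \<Omega>(1) \<phi>s] mod_net_subset[OF fm]]) simp
    \<comment> \<open>The equation holds exactly for small \<epsilon>, which is more than equality
      of classes requires.\<close>
    have "neg_net \<Omega> (\<lambda>\<epsilon> x. ?T u \<epsilon> x - \<phi> x * f \<epsilon> x)"
    proof (rule neg_net_eventually_zero[OF \<Omega>(1)])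
      show "smooth_net \<Omega> (\<lambda>\<epsilon> x. ?T u \<epsilon> x - \<phi> x * f \<epsilon> x)"
        using op(2) \<phi>f by (auto simp: mod_net_def smooth_net_def intro!: smooth_on_diff \<Omega>(1))
      show "\<forall>\<^sub>F \<epsilon> in at_right 0. \<forall>x\<in>\<Omega>. ?T u \<epsilon> x - \<phi> x * f \<epsilon> x = 0"
        using u(2) by eventually_elim simp
    qed
    then have "net_equiv \<Omega> (?T u) (\<lambda>\<epsilon> x. \<phi> x * f \<epsilon> x)" using op(2) \<phi>f by (simp add: net_equiv_def)
    then have "G_diff_op \<Omega> m c (G_class \<Omega> u) = G_mult_smooth \<Omega> \<phi> F"
      unfolding op(1) G_mult_smooth_eq[OF \<Omega>(1) \<phi>s F f] by (rule G_class_cong[OF \<Omega>(1)])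
    then show ?thesis using um ub by blast
  qed
  show "\<exists>\<Omega> \<phi>. open \<Omega> \<and> x0 \<in> \<Omega> \<and> \<phi> \<in> test_functions \<Omega> \<and> (\<forall>\<^sub>F x in nhds x0. \<phi> x = 1) \<and>
      (\<forall>f\<in>G UNIV. \<exists>u\<in>G \<Omega>. G_diff_op \<Omega> m c u = G_mult_smooth \<Omega> \<phi> f) \<and>
      (\<forall>f\<in>G_regular UNIV. \<exists>u\<in>G_regular \<Omega>. G_diff_op \<Omega> m c u = G_mult_smooth \<Omega> \<phi> f)"
  proof (intro exI[of _ \<Omega>] exI[of _ \<phi>] conjI \<Omega> \<phi> ballI)
    fix F :: "'n cfun net set" assume F: "F \<in> G UNIV"
    obtain f where "f \<in> F" using G_nonempty[OF F open_UNIV] by blast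
    with main[OF F] obtain u where "mod_net \<Omega> u" "G_diff_op \<Omega> m c (G_class \<Omega> u) = G_mult_smooth \<Omega> \<phi> F" by blast
    then show "\<exists>u\<in>G \<Omega>. G_diff_op \<Omega> m c u = G_mult_smooth \<Omega> \<phi> F" using G_class_in_G[OF \<Omega>(1)] by blast
  next
    fix F :: "'n cfun net set" assume "F \<in> G_regular UNIV"
    \<comment> \<open>The solution is built from the representative with uniform exponents, since an
      arbitrary one need not display the regularity.\<close>
    then obtain f where F: "F \<in> G UNIV" and f: "f \<in> F"
      and reg: "\<forall>K. compact K \<and> K \<subseteq> UNIV \<longrightarrow> (\<exists>N::nat. \<forall>\<alpha>. bigO_eps (\<lambda>\<epsilon>. smooth_seminorm K \<alpha> (f \<epsilon>)) (- real N))"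
      unfolding G_regular_def by blast
    obtain u where um: "mod_net \<Omega> u" and eq: "G_diff_op \<Omega> m c (G_class \<Omega> u) = G_mult_smooth \<Omega> \<phi> F"
      and ub: "\<forall>N b. jet_bigO K ((N + 2 * CARD('n)) * CARD('n)) f b \<longrightarrow> jet_bigO UNIV N u (b - a)"
      using main[OF F f] by blast
    obtain M :: nat where M: "\<forall>\<alpha>. bigO_eps (\<lambda>\<epsilon>. smooth_seminorm K \<alpha> (f \<epsilon>)) (- real M)" using reg K by blast
    have "mod_net UNIV f" using G_net_equiv[OF F f f open_UNIV] by (simp add: net_equiv_def)
    then have "jet_bigO K k f (- real M)" for k
      using M by (intro jet_bigO_if_seminorms[OF open_UNIV subset_UNIV]) (auto simp: mod_net_def smooth_net_def)
    \<comment> \<open>\<open>M\<close> was fixed for the single compact set \<open>K\<close> and all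
      orders, so one exponent now bounds every derivative of \<open>u\<close> on every compact
      set.\<close>
    then have "jet_bigO K' N u (- real (M + nat \<lceil>\<bar>a\<bar>\<rceil>))" for K' N by (rule bound[OF ub])
    then have "\<forall>\<alpha>. bigO_eps (\<lambda>\<epsilon>. smooth_seminorm K' \<alpha> (u \<epsilon>)) (- real (M + nat \<lceil>\<bar>a\<bar>\<rceil>))" for K'
      using bigO_eps_seminorm_if_jet_bigO by blast
    moreover have "u \<in> G_class \<Omega> u" using um \<Omega>(1) by (simp add: G_class_eq net_equiv_refl)
    ultimately have "G_class \<Omega> u \<in> G_regular \<Omega>"
      using G_class_in_G[OF \<Omega>(1) um] unfolding G_regular_def by blast
    then show "\<exists>u\<in>G_regular \<Omega>. G_diff_op \<Omega> m c u = G_mult_smooth \<Omega> \<phi> F" using eq by blast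
  qed
qed

end
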